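(* Let $R$ be a one-dimensional Cohen-Macaulay ring with $R=S/(f)$ for some local ring $(S,\mathfrak{n})$ and some $f\in\mathfrak{n}^2$ that is a non zero-divisor on $S$. Let $M$ be a finitely generated $R$-module that has rank. If $M$ is not free, $M$ is torsion-free, and $\operatorname{pd}_S(M)<\infty$, then $M\otimes_R M^{\ast}$ has torsion. In particular, if $M=\operatorname{coker}(\alpha)$, where $(\alpha,\beta)$ is a reduced matrix factorization of $f$ over $S$, then $M\otimes_R M^{\ast}$ has torsion.
   Context: All rings are commutative Noetherian local rings, and $M^{\ast}=\operatorname{Hom}_R(M,R)$. A finitely generated $R$-module $M$ has rank if there is an integer $r$ such that $M_{\mathfrak p}\cong R_{\mathfrak p}^{\oplus r}$ for all $\mathfrak p\in\operatorname{Ass}(R)$. The torsion submodule of a finitely generated $R$-module $X$ is the kernel of $X\to Q(R)\otimes_R X$, where $Q(R)$ is the total quotient ring of $R$; $X$ is torsion-free if this kernel is zero and has torsion if it is nonzero. A matrix factorization of $f$ over $S$ is a pair $(\alpha,\beta)$ of square matrices of the same size $m\ge 1$ over $S$ with $\alpha\beta=\beta\alpha=f\cdot I_m$; it is reduced if all entries of $\alpha$ and $\beta$ lie in $\mathfrak n$. The cokernel of $\alpha: S^{\oplus m}\to S^{\oplus m}$ is annihilated by $f$ and so is an $R$-module. *)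

theory Defs
  imports "HOL-Algebra.Algebra" "HOL-Library.Extended_Nat"
begin

section \<open>Local rings, dimension and depth\<close>

definition noetherian_local_ring :: "('a, 'x) ring_scheme \<Rightarrow> 'a set \<Rightarrow> bool" where
  "noetherian_local_ring R \<mm> \<longleftrightarrow>
     cring R \<and> noetherian_ring R \<and> maximalideal \<mm> R \<and> (\<forall>J. maximalideal J R \<longrightarrow> J = \<mm>)"

definition nonzerodivisors :: "('a, 'x) ring_scheme \<Rightarrow> 'a set" where
  "nonzerodivisors R =
     {a \<in> carrier R. \<forall>b \<in> carrier R. a \<otimes>\<^bsub>R\<^esub> b = \<zero>\<^bsub>R\<^esub> \<longrightarrow> b = \<zero>\<^bsub>R\<^esub>}"

definition krull_dim :: "('a, 'x) ring_scheme \<Rightarrow> enat" where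
  "krull_dim R = Sup {enat n | n. \<exists>P :: nat \<Rightarrow> 'a set.
     (\<forall>i\<le>n. primeideal (P i) R) \<and> (\<forall>i<n. P i \<subset> P (Suc i))}"

definition regular_sequence :: "('a, 'x) ring_scheme \<Rightarrow> 'a list \<Rightarrow> bool" where
  "regular_sequence R xs \<longleftrightarrow>
     set xs \<subseteq> carrier R \<and> Idl\<^bsub>R\<^esub> (set xs) \<noteq> carrier R \<and>
     (\<forall>i<length xs. \<forall>a \<in> carrier R.
        xs ! i \<otimes>\<^bsub>R\<^esub> a \<in> Idl\<^bsub>R\<^esub> (set (take i xs)) \<longrightarrow> a \<in> Idl\<^bsub>R\<^esub> (set (take i xs)))"

definition depth :: "('a, 'x) ring_scheme \<Rightarrow> 'a set \<Rightarrow> enat" where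
  "depth R \<mm> = Sup {enat (length xs) | xs. regular_sequence R xs \<and> set xs \<subseteq> \<mm>}"

definition cohen_macaulay_local_ring :: "('a, 'x) ring_scheme \<Rightarrow> bool" where
  "cohen_macaulay_local_ring R \<longleftrightarrow>
     (\<exists>\<mm>. noetherian_local_ring R \<mm> \<and> depth R \<mm> = krull_dim R)"

definition associated_primes :: "('a, 'x) ring_scheme \<Rightarrow> 'a set set" where
  "associated_primes R =
     {P. primeideal P R \<and> (\<exists>x \<in> carrier R. P = {a \<in> carrier R. a \<otimes>\<^bsub>R\<^esub> x = \<zero>\<^bsub>R\<^esub>})}"


section \<open>Constructions with modules\<close>

text \<open>The library's type of modules extends the type of rings, so every module below also
  has fields \<open>mult\<close> and \<open>one\<close>. The locale \<open>module\<close> ignores them, and so does everything here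
  except \<open>self_module\<close>; in newly built modules they are left \<open>undefined\<close>.\<close>

definition self_module :: "('a, 'x) ring_scheme \<Rightarrow> ('a, 'a) module" where
  "self_module R = \<lparr>carrier = carrier R, monoid.mult = monoid.mult R, one = \<one>\<^bsub>R\<^esub>,
     ring.zero = \<zero>\<^bsub>R\<^esub>, add = add R, smult = monoid.mult R\<rparr>"

definition restrict_scalars :: "('a \<Rightarrow> 'b) \<Rightarrow> ('b, 'm, 'x) module_scheme \<Rightarrow> ('a, 'm) module" where
  "restrict_scalars \<phi> M = \<lparr>carrier = carrier M, monoid.mult = monoid.mult M, one = \<one>\<^bsub>M\<^esub>,
     ring.zero = \<zero>\<^bsub>M\<^esub>, add = add M, smult = (\<lambda>a. smult M (\<phi> a))\<rparr>"

text \<open>For an \<open>S\<close>-module \<open>M\<close> annihilated by an ideal \<open>I\<close>, the induced \<open>S Quot I\<close>-module: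
  the set of all \<open>s \<odot> x\<close> with \<open>s\<close> in a fixed coset of \<open>I\<close> is then a singleton.\<close>

definition descend_scalars :: "('a, 'm, 'x) module_scheme \<Rightarrow> ('a set, 'm) module" where
  "descend_scalars M = \<lparr>carrier = carrier M, monoid.mult = monoid.mult M, one = \<one>\<^bsub>M\<^esub>,
     ring.zero = \<zero>\<^bsub>M\<^esub>, add = add M, smult = (\<lambda>C x. the_elem ((\<lambda>s. s \<odot>\<^bsub>M\<^esub> x) ` C))\<rparr>"

definition module_hom ::
  "('a, 'x) ring_scheme \<Rightarrow> ('a, 'm, 'y) module_scheme \<Rightarrow> ('a, 'n, 'z) module_scheme \<Rightarrow> ('m \<Rightarrow> 'n) set"
  where
  "module_hom R M N = {h \<in> carrier M \<rightarrow> carrier N.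
     (\<forall>x \<in> carrier M. \<forall>y \<in> carrier M. h (x \<oplus>\<^bsub>M\<^esub> y) = h x \<oplus>\<^bsub>N\<^esub> h y) \<and>
     (\<forall>a \<in> carrier R. \<forall>x \<in> carrier M. h (a \<odot>\<^bsub>M\<^esub> x) = a \<odot>\<^bsub>N\<^esub> h x)}"

definition module_isomorphic ::
  "('a, 'x) ring_scheme \<Rightarrow> ('a, 'm, 'y) module_scheme \<Rightarrow> ('a, 'n, 'z) module_scheme \<Rightarrow> bool" where
  "module_isomorphic R M N \<longleftrightarrow> (\<exists>h \<in> module_hom R M N. bij_betw h (carrier M) (carrier N))"

definition submodule_generated ::
  "('a, 'x) ring_scheme \<Rightarrow> ('a, 'm, 'y) module_scheme \<Rightarrow> 'm set \<Rightarrow> 'm set" where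
  "submodule_generated R M A = \<Inter> {N. submodule N R M \<and> A \<subseteq> N}"

definition finitely_generated_module ::
  "('a, 'x) ring_scheme \<Rightarrow> ('a, 'm, 'y) module_scheme \<Rightarrow> bool" where
  "finitely_generated_module R M \<longleftrightarrow>
     (\<exists>A \<subseteq> carrier M. finite A \<and> submodule_generated R M A = carrier M)"

definition quotient_module :: "('a, 'm, 'y) module_scheme \<Rightarrow> 'm set \<Rightarrow> ('a, 'm set) module" where
  "quotient_module M N = \<lparr>carrier = a_rcosets\<^bsub>M\<^esub> N, monoid.mult = undefined, one = undefined,
     ring.zero = N, add = set_add M, smult = (\<lambda>a C. \<Union>x\<in>C. N +>\<^bsub>M\<^esub> (a \<odot>\<^bsub>M\<^esub> x))\<rparr>"

text \<open>The free module on a set \<open>B\<close>: finitely supported functions on \<open>B\<close>, extended by zero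
  outside \<open>B\<close>. In particular \<open>free_module R {..<n}\<close> is the module of vectors of length \<open>n\<close>.\<close>

definition free_module :: "('a, 'x) ring_scheme \<Rightarrow> 'i set \<Rightarrow> ('a, 'i \<Rightarrow> 'a) module" where
  "free_module R B =
     \<lparr>carrier = {v. (\<forall>i. v i \<in> carrier R) \<and> finite {i. v i \<noteq> \<zero>\<^bsub>R\<^esub>} \<and> {i. v i \<noteq> \<zero>\<^bsub>R\<^esub>} \<subseteq> B},
      monoid.mult = undefined, one = undefined,
      ring.zero = (\<lambda>i. \<zero>\<^bsub>R\<^esub>), add = (\<lambda>v w i. v i \<oplus>\<^bsub>R\<^esub> w i), smult = (\<lambda>a v i. a \<otimes>\<^bsub>R\<^esub> v i)\<rparr>"

text \<open>Basis sets in the type of the module suffice, since a basis is a subset of the module.\<close>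

definition is_free_module :: "('a, 'x) ring_scheme \<Rightarrow> ('a, 'm, 'y) module_scheme \<Rightarrow> bool" where
  "is_free_module R M \<longleftrightarrow> (\<exists>B :: 'm set. module_isomorphic R M (free_module R B))"

definition hom_module ::
  "('a, 'x) ring_scheme \<Rightarrow> ('a, 'm, 'y) module_scheme \<Rightarrow> ('a, 'n, 'z) module_scheme
     \<Rightarrow> ('a, 'm \<Rightarrow> 'n) module" where
  "hom_module R M N =
     \<lparr>carrier = module_hom R M N \<inter> extensional (carrier M), monoid.mult = undefined, one = undefined,
      ring.zero = (\<lambda>x\<in>carrier M. \<zero>\<^bsub>N\<^esub>), add = (\<lambda>g h. \<lambda>x\<in>carrier M. g x \<oplus>\<^bsub>N\<^esub> h x),
      smult = (\<lambda>a h. \<lambda>x\<in>carrier M. a \<odot>\<^bsub>N\<^esub> h x)\<rparr>"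

definition dual_module ::
  "('a, 'x) ring_scheme \<Rightarrow> ('a, 'm, 'y) module_scheme \<Rightarrow> ('a, 'm \<Rightarrow> 'a) module" where
  "dual_module R M = hom_module R M (self_module R)"


section \<open>Tensor products\<close>

definition basis_vector :: "('a, 'x) ring_scheme \<Rightarrow> 'i \<Rightarrow> 'i \<Rightarrow> 'a" where
  "basis_vector R p = (\<lambda>q. if q = p then \<one>\<^bsub>R\<^esub> else \<zero>\<^bsub>R\<^esub>)"

definition bilinearity_relations ::
  "('a, 'x) ring_scheme \<Rightarrow> ('a, 'm, 'y) module_scheme \<Rightarrow> ('a, 'n, 'z) module_scheme
     \<Rightarrow> ('m \<times> 'n \<Rightarrow> 'a) set" where
  "bilinearity_relations R M N =
    (let F = free_module R (carrier M \<times> carrier N); e = (\<lambda>x y. basis_vector R (x, y)) in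
       {e (x \<oplus>\<^bsub>M\<^esub> x') y \<ominus>\<^bsub>F\<^esub> (e x y \<oplus>\<^bsub>F\<^esub> e x' y) | x x' y.
          x \<in> carrier M \<and> x' \<in> carrier M \<and> y \<in> carrier N} \<union>
       {e x (y \<oplus>\<^bsub>N\<^esub> y') \<ominus>\<^bsub>F\<^esub> (e x y \<oplus>\<^bsub>F\<^esub> e x y') | x y y'.
          x \<in> carrier M \<and> y \<in> carrier N \<and> y' \<in> carrier N} \<union>
       {e (a \<odot>\<^bsub>M\<^esub> x) y \<ominus>\<^bsub>F\<^esub> a \<odot>\<^bsub>F\<^esub> e x y | a x y.
          a \<in> carrier R \<and> x \<in> carrier M \<and> y \<in> carrier N} \<union>
       {e x (a \<odot>\<^bsub>N\<^esub> y) \<ominus>\<^bsub>F\<^esub> a \<odot>\<^bsub>F\<^esub> e x y | a x y.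
          a \<in> carrier R \<and> x \<in> carrier M \<and> y \<in> carrier N})"

definition tensor_relations ::
  "('a, 'x) ring_scheme \<Rightarrow> ('a, 'm, 'y) module_scheme \<Rightarrow> ('a, 'n, 'z) module_scheme
     \<Rightarrow> ('m \<times> 'n \<Rightarrow> 'a) set" where
  "tensor_relations R M N =
     submodule_generated R (free_module R (carrier M \<times> carrier N)) (bilinearity_relations R M N)"

definition tensor_module ::
  "('a, 'x) ring_scheme \<Rightarrow> ('a, 'm, 'y) module_scheme \<Rightarrow> ('a, 'n, 'z) module_scheme
     \<Rightarrow> ('a, ('m \<times> 'n \<Rightarrow> 'a) set) module" where
  "tensor_module R M N =
     quotient_module (free_module R (carrier M \<times> carrier N)) (tensor_relations R M N)"

definition pure_tensor ::
  "('a, 'x) ring_scheme \<Rightarrow> ('a, 'm, 'y) module_scheme \<Rightarrow> ('a, 'n, 'z) module_scheme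
     \<Rightarrow> 'm \<Rightarrow> 'n \<Rightarrow> ('m \<times> 'n \<Rightarrow> 'a) set" where
  "pure_tensor R M N x y =
     tensor_relations R M N +>\<^bsub>free_module R (carrier M \<times> carrier N)\<^esub> basis_vector R (x, y)"


section \<open>Localization, rank and torsion\<close>

text \<open>The fraction \<open>x / w\<close>, as the equivalence class of the pair \<open>(x, w)\<close>, for a multiplicative
  set \<open>W\<close> of the ring \<open>R\<close>.\<close>

definition fraction ::
  "('a, 'x) ring_scheme \<Rightarrow> 'a set \<Rightarrow> ('a, 'm, 'y) module_scheme \<Rightarrow> 'm \<Rightarrow> 'a \<Rightarrow> ('m \<times> 'a) set" where
  "fraction R W M x w = {(y, v). y \<in> carrier M \<and> v \<in> W \<and>
     (\<exists>u \<in> W. (u \<otimes>\<^bsub>R\<^esub> v) \<odot>\<^bsub>M\<^esub> x = (u \<otimes>\<^bsub>R\<^esub> w) \<odot>\<^bsub>M\<^esub> y)}"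

text \<open>As usual for operations on classes, the unions below range over all representatives and
  are unions of equal sets.\<close>

definition localized_ring ::
  "('a, 'x) ring_scheme \<Rightarrow> 'a set \<Rightarrow> ('a \<times> 'a) set ring" where
  "localized_ring R W = (let frac = fraction R W (self_module R) in
     \<lparr>carrier = {frac a w | a w. a \<in> carrier R \<and> w \<in> W},
      monoid.mult = (\<lambda>A B. \<Union>(a, v)\<in>A. \<Union>(b, w)\<in>B. frac (a \<otimes>\<^bsub>R\<^esub> b) (v \<otimes>\<^bsub>R\<^esub> w)),
      one = frac \<one>\<^bsub>R\<^esub> \<one>\<^bsub>R\<^esub>,
      ring.zero = frac \<zero>\<^bsub>R\<^esub> \<one>\<^bsub>R\<^esub>,
      add = (\<lambda>A B. \<Union>(a, v)\<in>A. \<Union>(b, w)\<in>B.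
               frac (w \<otimes>\<^bsub>R\<^esub> a \<oplus>\<^bsub>R\<^esub> v \<otimes>\<^bsub>R\<^esub> b) (v \<otimes>\<^bsub>R\<^esub> w))\<rparr>)"

definition localized_module ::
  "('a, 'x) ring_scheme \<Rightarrow> 'a set \<Rightarrow> ('a, 'm, 'y) module_scheme
     \<Rightarrow> (('a \<times> 'a) set, ('m \<times> 'a) set) module" where
  "localized_module R W M = (let frac = fraction R W M in
     \<lparr>carrier = {frac x w | x w. x \<in> carrier M \<and> w \<in> W},
      monoid.mult = undefined, one = undefined,
      ring.zero = frac \<zero>\<^bsub>M\<^esub> \<one>\<^bsub>R\<^esub>,
      add = (\<lambda>C D. \<Union>(x, v)\<in>C. \<Union>(y, w)\<in>D.
               frac (w \<odot>\<^bsub>M\<^esub> x \<oplus>\<^bsub>M\<^esub> v \<odot>\<^bsub>M\<^esub> y) (v \<otimes>\<^bsub>R\<^esub> w)),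
      smult = (\<lambda>A C. \<Union>(a, v)\<in>A. \<Union>(x, w)\<in>C. frac (a \<odot>\<^bsub>M\<^esub> x) (v \<otimes>\<^bsub>R\<^esub> w))\<rparr>)"

definition has_rank :: "('a, 'x) ring_scheme \<Rightarrow> ('a, 'm, 'y) module_scheme \<Rightarrow> bool" where
  "has_rank R M \<longleftrightarrow> (\<exists>r :: nat. \<forall>P \<in> associated_primes R.
     module_isomorphic (localized_ring R (carrier R - P))
       (localized_module R (carrier R - P) M)
       (free_module (localized_ring R (carrier R - P)) {..<r}))"

definition total_quotient_ring :: "('a, 'x) ring_scheme \<Rightarrow> ('a \<times> 'a) set ring" where
  "total_quotient_ring R = localized_ring R (nonzerodivisors R)"

definition total_quotient_module :: "('a, 'x) ring_scheme \<Rightarrow> ('a, ('a \<times> 'a) set) module" where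
  "total_quotient_module R = restrict_scalars
     (\<lambda>a. fraction R (nonzerodivisors R) (self_module R) a \<one>\<^bsub>R\<^esub>)
     (self_module (total_quotient_ring R))"

definition torsion_submodule ::
  "('a, 'x) ring_scheme \<Rightarrow> ('a, 'm, 'y) module_scheme \<Rightarrow> 'm set" where
  "torsion_submodule R M = {x \<in> carrier M.
     pure_tensor R (total_quotient_module R) M \<one>\<^bsub>total_quotient_ring R\<^esub> x
       = \<zero>\<^bsub>tensor_module R (total_quotient_module R) M\<^esub>}"

definition torsion_free :: "('a, 'x) ring_scheme \<Rightarrow> ('a, 'm, 'y) module_scheme \<Rightarrow> bool" where
  "torsion_free R M \<longleftrightarrow> torsion_submodule R M = {\<zero>\<^bsub>M\<^esub>}"

definition has_torsion :: "('a, 'x) ring_scheme \<Rightarrow> ('a, 'm, 'y) module_scheme \<Rightarrow> bool" where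
  "has_torsion R M \<longleftrightarrow> torsion_submodule R M \<noteq> {\<zero>\<^bsub>M\<^esub>}"


section \<open>Projective dimension\<close>

text \<open>A module is projective if it is a retract (equivalently, a direct summand) of a free
  module. The basis may be taken in the type of the module itself, since a split surjection from
  some free module yields a splitting of the surjection from the free module on \<open>carrier P\<close>.\<close>

definition projective_module :: "('a, 'x) ring_scheme \<Rightarrow> ('a, 'm, 'y) module_scheme \<Rightarrow> bool" where
  "projective_module R P \<longleftrightarrow> module R P \<and>
     (\<exists>B :: 'm set. \<exists>\<iota> \<in> module_hom R P (free_module R B). \<exists>\<pi> \<in> module_hom R (free_module R B) P.
        \<forall>x \<in> carrier P. \<pi> (\<iota> x) = x)"

definition projective_resolution ::
  "('a, 'x) ring_scheme \<Rightarrow> ('a, 'm, 'y) module_scheme \<Rightarrow> (nat \<Rightarrow> ('a, 'p) module)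
     \<Rightarrow> (nat \<Rightarrow> 'p \<Rightarrow> 'p) \<Rightarrow> ('p \<Rightarrow> 'm) \<Rightarrow> bool" where
  "projective_resolution R M P d \<epsilon> \<longleftrightarrow>
     (\<forall>i. projective_module R (P i)) \<and>
     \<epsilon> \<in> module_hom R (P 0) M \<and> (\<forall>i. d i \<in> module_hom R (P (Suc i)) (P i)) \<and>
     \<epsilon> ` carrier (P 0) = carrier M \<and>
     a_kernel (P 0) M \<epsilon> = d 0 ` carrier (P 1) \<and>
     (\<forall>i. a_kernel (P (Suc i)) (P i) (d i) = d (Suc i) ` carrier (P (Suc (Suc i))))"

text \<open>The infimum of the lengths of projective resolutions (\<open>\<infinity>\<close> if none is finite). The terms
  range over modules with elements of type \<open>'m + nat \<Rightarrow> 'a\<close>, which loses nothing: \<open>M\<close> has a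
  free resolution with terms of cardinality at most the maximum of those of \<open>M\<close>, \<open>R\<close> and
  \<open>\<aleph>\<^sub>0\<close>; these and their submodules fit into that type, and if \<open>M\<close> has a projective
  resolution of length \<open>n\<close> at all, then the \<open>n\<close>-th syzygy of that free resolution is projective
  (Schanuel).\<close>

definition proj_dim :: "('a, 'x) ring_scheme \<Rightarrow> ('a, 'm, 'y) module_scheme \<Rightarrow> enat" where
  "proj_dim R M = Inf {enat n | n.
     \<exists>(P :: nat \<Rightarrow> ('a, 'm + nat \<Rightarrow> 'a) module) d \<epsilon>.
       projective_resolution R M P d \<epsilon> \<and> (\<forall>i>n. carrier (P i) = {\<zero>\<^bsub>P i\<^esub>})}"


section \<open>Matrix factorizations\<close>

text \<open>An \<open>m \<times> m\<close> matrix is a function of two indices, of which only the values at indices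
  below \<open>m\<close> matter.\<close>

definition matrix_factorization ::
  "('a, 'x) ring_scheme \<Rightarrow> 'a \<Rightarrow> nat \<Rightarrow> (nat \<Rightarrow> nat \<Rightarrow> 'a) \<Rightarrow> (nat \<Rightarrow> nat \<Rightarrow> 'a) \<Rightarrow> bool" where
  "matrix_factorization S f m \<alpha> \<beta> \<longleftrightarrow> m \<ge> 1 \<and>
     (\<forall>i<m. \<forall>j<m. \<alpha> i j \<in> carrier S \<and> \<beta> i j \<in> carrier S \<and>
        (\<Oplus>\<^bsub>S\<^esub>k\<in>{..<m}. \<alpha> i k \<otimes>\<^bsub>S\<^esub> \<beta> k j) = (if i = j then f else \<zero>\<^bsub>S\<^esub>) \<and>
        (\<Oplus>\<^bsub>S\<^esub>k\<in>{..<m}. \<beta> i k \<otimes>\<^bsub>S\<^esub> \<alpha> k j) = (if i = j then f else \<zero>\<^bsub>S\<^esub>))"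

definition reduced_matrix_factorization ::
  "('a, 'x) ring_scheme \<Rightarrow> 'a set \<Rightarrow> 'a \<Rightarrow> nat \<Rightarrow> (nat \<Rightarrow> nat \<Rightarrow> 'a) \<Rightarrow> (nat \<Rightarrow> nat \<Rightarrow> 'a) \<Rightarrow> bool" where
  "reduced_matrix_factorization S \<nn> f m \<alpha> \<beta> \<longleftrightarrow>
     matrix_factorization S f m \<alpha> \<beta> \<and> (\<forall>i<m. \<forall>j<m. \<alpha> i j \<in> \<nn> \<and> \<beta> i j \<in> \<nn>)"

definition matrix_map ::
  "('a, 'x) ring_scheme \<Rightarrow> nat \<Rightarrow> (nat \<Rightarrow> nat \<Rightarrow> 'a) \<Rightarrow> (nat \<Rightarrow> 'a) \<Rightarrow> nat \<Rightarrow> 'a" where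
  "matrix_map S m \<alpha> v =
     (\<lambda>i. if i < m then (\<Oplus>\<^bsub>S\<^esub>j\<in>{..<m}. \<alpha> i j \<otimes>\<^bsub>S\<^esub> v j) else \<zero>\<^bsub>S\<^esub>)"

definition matrix_cokernel ::
  "('a, 'x) ring_scheme \<Rightarrow> nat \<Rightarrow> (nat \<Rightarrow> nat \<Rightarrow> 'a) \<Rightarrow> ('a, (nat \<Rightarrow> 'a) set) module" where
  "matrix_cokernel S m \<alpha> = quotient_module (free_module S {..<m})
     (matrix_map S m \<alpha> ` carrier (free_module S {..<m}))"

end

theory Submission
  imports Defs
begin

text \<open>Suppose that \<open>M \<otimes> M\<^sup>*\<close> has no torsion and that \<open>M\<close> is the cokernel of \<open>A\<close> for a matrix
  factorization \<open>(A, B)\<close> of \<open>f\<close>. Over \<open>R\<close> the module \<open>M\<close> then has a two-periodic resolution with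
  differentials \<open>A\<close>, \<open>B\<close>. Since \<open>M\<close> has rank, it contains a free module \<open>U\<close> with \<open>y M \<subseteq> U\<close> for a
  non zero-divisor \<open>y\<close>, so the elements of the tensor product that encode classes in
  \<open>Ext\<^sup>1(M, M)\<close> are torsion, and \<open>Ext\<^sup>1(M, M) = 0\<close>. As \<open>M / U\<close> has finite length and
  \<open>U\<close> is free, the cohomology modules of \<open>Hom(-, M)\<close> in even and in odd degrees have the same length, so
  \<open>Ext\<^sup>2(M, M) = 0\<close> as well. Hence the projection \<open>\<pi>\<close> onto \<open>M\<close> factors through \<open>B\<close>, and lifting the
  factorization to \<open>S\<close> gives \<open>1 = C B + A D\<close> for some matrices \<open>C\<close>, \<open>D\<close>. If \<open>A\<close> and \<open>B\<close> have entries in \<open>\<nn>\<close>,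
  this is absurd.

  If \<open>M\<close> is torsion-free of finite projective dimension over \<open>S\<close>, then the first syzygy \<open>K\<close> of a minimal
  cover of \<open>M\<close> is free: \<open>S\<close> has depth two, and so has every syzygy of \<open>K\<close>, which forces the minimal
  resolution of \<open>K\<close> to stop at once. Multiplication by \<open>f\<close> turns \<open>K \<subseteq> S\<^sup>m\<close> into a matrix factorization with
  cokernel \<open>M\<close> whose \<open>A\<close> has entries in \<open>\<nn>\<close>. Then \<open>A = A D A + f C\<close>, so \<open>A\<close> vanishes modulo \<open>f\<close> by
  Nakayama's lemma, and \<open>M\<close> is free.\<close>

section \<open>Modules and free modules\<close>

text \<open>The tensor product enters because the dual complex is exact: the dual of
  \<open>M\<close> is the cokernel of the transpose of \<open>A\<close>, so its tensor product with
  \<open>M\<close> is \<open>M^m\<close> modulo the tuples \<open>w A\<close>, and Ext^1, the tuples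
  \<open>z\<close> with \<open>z B = 0\<close> modulo the tuples \<open>w A\<close>, sits inside it.
  The equality of lengths is the triviality of the Herbrand quotient of a two-periodic complex on
  modules of finite length; the free part contributes nothing, again by exactness of the dual
  complex.

  Quotients, direct sums and lengths would each force new types, and this shapes the argument.
  Classes are kept as congruences modulo submodules, lengths as bounds on chains of submodules of
  one power \<open>M^m\<close>, and resolutions are compared through maps alone. Determinants give
  way to two devices: generators are eliminated one at a time, and \<open>a b = t\<close> on a
  noetherian module forces a power of \<open>t\<close> to kill the kernel of \<open>a\<close>. The
  residue field is replaced by a socle element of \<open>S / (f, x)\<close>, where \<open>x\<close>
  lifts a non zero-divisor of \<open>R\<close>.\<close>

lemma module_homI:
  assumes "\<And>x. x \<in> carrier M \<Longrightarrow> h x \<in> carrier N"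
    and "\<And>x y. x \<in> carrier M \<Longrightarrow> y \<in> carrier M \<Longrightarrow> h (x \<oplus>\<^bsub>M\<^esub> y) = h x \<oplus>\<^bsub>N\<^esub> h y"
    and "\<And>a x. a \<in> carrier R \<Longrightarrow> x \<in> carrier M \<Longrightarrow> h (a \<odot>\<^bsub>M\<^esub> x) = a \<odot>\<^bsub>N\<^esub> h x"
  shows "h \<in> module_hom R M N"
  using assms by (auto simp: module_hom_def)

lemma module_hom_closed: "h \<in> module_hom R M N \<Longrightarrow> x \<in> carrier M \<Longrightarrow> h x \<in> carrier N"
  by (auto simp: module_hom_def)

lemma module_hom_add:
  "h \<in> module_hom R M N \<Longrightarrow> x \<in> carrier M \<Longrightarrow> y \<in> carrier M \<Longrightarrow> h (x \<oplus>\<^bsub>M\<^esub> y) = h x \<oplus>\<^bsub>N\<^esub> h y"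
  by (auto simp: module_hom_def)

lemma module_hom_smult:
  "h \<in> module_hom R M N \<Longrightarrow> a \<in> carrier R \<Longrightarrow> x \<in> carrier M \<Longrightarrow> h (a \<odot>\<^bsub>M\<^esub> x) = a \<odot>\<^bsub>N\<^esub> h x"
  by (auto simp: module_hom_def)

lemma module_hom_zero:
  assumes "module R M" "module R N" "h \<in> module_hom R M N"
  shows "h \<zero>\<^bsub>M\<^esub> = \<zero>\<^bsub>N\<^esub>"
proof -
  interpret M: module R M by fact
  interpret N: module R N by fact
  have "h (\<zero>\<^bsub>R\<^esub> \<odot>\<^bsub>M\<^esub> \<zero>\<^bsub>M\<^esub>) = \<zero>\<^bsub>R\<^esub> \<odot>\<^bsub>N\<^esub> h \<zero>\<^bsub>M\<^esub>"
    by (rule module_hom_smult[OF assms(3)]) auto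
  then show ?thesis using module_hom_closed[OF assms(3), of "\<zero>\<^bsub>M\<^esub>"] by simp
qed

lemma module_hom_neg:
  assumes "module R M" "module R N" "h \<in> module_hom R M N" "x \<in> carrier M"
  shows "h (\<ominus>\<^bsub>M\<^esub> x) = \<ominus>\<^bsub>N\<^esub> h x"
proof -
  interpret M: module R M by fact
  interpret N: module R N by fact
  have "h ((\<ominus>\<^bsub>R\<^esub> \<one>\<^bsub>R\<^esub>) \<odot>\<^bsub>M\<^esub> x) = (\<ominus>\<^bsub>R\<^esub> \<one>\<^bsub>R\<^esub>) \<odot>\<^bsub>N\<^esub> h x"
    by (rule module_hom_smult[OF assms(3)]) (auto simp: assms)
  then show ?thesis using module_hom_closed[OF assms(3,4)] assms(4)
    by (simp add: M.smult_l_minus N.smult_l_minus)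
qed

lemma module_hom_minus:
  assumes "module R M" "module R N" "h \<in> module_hom R M N" "x \<in> carrier M" "y \<in> carrier M"
  shows "h (x \<ominus>\<^bsub>M\<^esub> y) = h x \<ominus>\<^bsub>N\<^esub> h y"
proof -
  interpret M: module R M by fact
  interpret N: module R N by fact
  show ?thesis using assms
    by (simp add: M.minus_eq N.minus_eq module_hom_add[OF assms(3)] module_hom_neg)
qed

lemma module_hom_finsum:
  assumes "module R M" "module R N" "h \<in> module_hom R M N" "finite A" "g \<in> A \<rightarrow> carrier M"
  shows "h (\<Oplus>\<^bsub>M\<^esub>i\<in>A. g i) = (\<Oplus>\<^bsub>N\<^esub>i\<in>A. h (g i))"
proof -
  interpret M: module R M by fact
  interpret N: module R N by fact
  show ?thesis using assms(4,5)
  proof (induction A rule: finite_induct)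
    case empty
    then show ?case using module_hom_zero assms by auto
  next
    case (insert a A)
    then have "(\<lambda>i. h (g i)) \<in> insert a A \<rightarrow> carrier N"
      by (auto intro!: module_hom_closed[OF assms(3)])
    then show ?case using insert by (auto simp: module_hom_add[OF assms(3)] Pi_def)
  qed
qed

lemma module_hom_comp:
  assumes "g \<in> module_hom R M N" "h \<in> module_hom R N L"
  shows "(\<lambda>x. h (g x)) \<in> module_hom R M L"
  using assms by (auto simp: module_hom_def Pi_def)

lemma module_hom_sum:
  assumes "module R N" "g \<in> module_hom R M N" "h \<in> module_hom R M N"
    "module R M"
  shows "(\<lambda>x. g x \<oplus>\<^bsub>N\<^esub> h x) \<in> module_hom R M N"
proof -
  interpret N: module R N by fact
  interpret M: module R M by fact
  show ?thesis
    using assms(2,3) by (intro module_homI)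
      (auto simp: module_hom_closed module_hom_add module_hom_smult N.smult_r_distr N.a_ac)
qed

lemma module_hom_scaled:
  assumes "module R N" "g \<in> module_hom R M N" "a \<in> carrier R"
  shows "(\<lambda>x. a \<odot>\<^bsub>N\<^esub> g x) \<in> module_hom R M N"
proof -
  interpret N: module R N by fact
  have "a \<odot>\<^bsub>N\<^esub> (b \<odot>\<^bsub>N\<^esub> z) = b \<odot>\<^bsub>N\<^esub> (a \<odot>\<^bsub>N\<^esub> z)" if "b \<in> carrier R" "z \<in> carrier N" for b z
    using that assms by (simp add: N.smult_assoc1[symmetric] N.R.m_comm)
  then show ?thesis
    using assms(2,3) by (intro module_homI)
      (auto simp: module_hom_closed module_hom_add module_hom_smult N.smult_r_distr)
qed

lemma module_hom_diff:
  assumes "module R N" "module R M" "g \<in> module_hom R M N" "h \<in> module_hom R M N"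
  shows "(\<lambda>x. g x \<ominus>\<^bsub>N\<^esub> h x) \<in> module_hom R M N"
proof -
  interpret N: module R N by fact
  interpret M: module R M by fact
  have "(\<lambda>x. g x \<oplus>\<^bsub>N\<^esub> (\<ominus>\<^bsub>R\<^esub> \<one>\<^bsub>R\<^esub>) \<odot>\<^bsub>N\<^esub> h x) \<in> module_hom R M N"
    using assms by (intro module_hom_sum module_hom_scaled) auto
  moreover have "g x \<oplus>\<^bsub>N\<^esub> (\<ominus>\<^bsub>R\<^esub> \<one>\<^bsub>R\<^esub>) \<odot>\<^bsub>N\<^esub> h x = g x \<ominus>\<^bsub>N\<^esub> h x" if "x \<in> carrier M" for x
    using that assms by (simp add: N.minus_eq N.smult_l_minus module_hom_closed)
  ultimately show ?thesis
    by (auto simp: module_hom_def Pi_def)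
qed

lemma module_hom_id: "(\<lambda>x. x) \<in> module_hom R M M"
  by (auto simp: module_hom_def)

lemma module_hom_restrict_dom:
  "h \<in> module_hom R M N \<Longrightarrow> K \<subseteq> carrier M \<Longrightarrow> h \<in> module_hom R (M\<lparr>carrier := K\<rparr>) N"
  by (auto simp: module_hom_def subset_iff)

lemma module_hom_restrict_cod:
  "h \<in> module_hom R M N \<Longrightarrow> (\<And>x. x \<in> carrier M \<Longrightarrow> h x \<in> K) \<Longrightarrow> h \<in> module_hom R M (N\<lparr>carrier := K\<rparr>)"
  by (auto simp: module_hom_def)

section \<open>Submodules: preimages, images and generation\<close>

text \<open>Preimages of arbitrary submodules are covered because conditions such as
  \<open>t z \<in> U\<close> come up later in that form; kernels are the case of the zero
  submodule.\<close>

lemma kernel_submodule: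
  assumes "module R M" "module R N" "h \<in> module_hom R M N" "submodule K R N"
  shows "submodule {x \<in> carrier M. h x \<in> K} R M"
proof -
  interpret M: module R M by fact
  interpret N: module R N by fact
  note K = N.submoduleE[OF assms(4)]
  have z: "\<zero>\<^bsub>N\<^esub> \<in> K" using K(2,3,5) K(1) N.r_neg by (metis equals0I subset_iff)
  show ?thesis
    using K z assms(1-3)
    by (intro M.submoduleI)
      (auto simp: module_hom_zero module_hom_neg module_hom_add[OF assms(3)] module_hom_smult[OF assms(3)])
qed

lemma image_submodule:
  assumes "module R M" "module R N" "h \<in> module_hom R M N" "submodule K R M"
  shows "submodule (h ` K) R N"
proof -
  interpret M: module R M by fact
  interpret N: module R N by fact
  note K = M.submoduleE[OF assms(4)]
  have z: "\<zero>\<^bsub>M\<^esub> \<in> K" using K(2,3,5) K(1) M.r_neg by (metis equals0I subset_iff)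
  have ad: "h x \<oplus>\<^bsub>N\<^esub> h y \<in> h ` K" if "x \<in> K" "y \<in> K" for x y
    using that K(1,5) imageI[of "x \<oplus>\<^bsub>M\<^esub> y" K h] by (simp add: module_hom_add[OF assms(3)] subset_iff)
  have sm: "a \<odot>\<^bsub>N\<^esub> h x \<in> h ` K" if "a \<in> carrier R" "x \<in> K" for a x
    using that K(1,4) imageI[of "a \<odot>\<^bsub>M\<^esub> x" K h] by (simp add: module_hom_smult[OF assms(3)] subset_iff)
  have ng: "\<ominus>\<^bsub>N\<^esub> h x \<in> h ` K" if "x \<in> K" for x
    using that K(1,3) imageI[of "\<ominus>\<^bsub>M\<^esub> x" K h] by (simp add: module_hom_neg[OF assms(1-3)] subset_iff)
  show ?thesis
  proof (rule N.submoduleI)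
    show "h ` K \<subseteq> carrier N" using K(1) module_hom_closed[OF assms(3)] by blast
    show "\<zero>\<^bsub>N\<^esub> \<in> h ` K" using z module_hom_zero[OF assms(1-3)] by (metis image_eqI)
  qed (use ad sm ng in blast)+
qed

lemma (in module) submodule_zero: "submodule N R M \<Longrightarrow> \<zero>\<^bsub>M\<^esub> \<in> N"
  using submoduleE[of N] M.r_neg by (metis equals0I subset_iff)

lemma (in module) submodule_minus:
  "submodule N R M \<Longrightarrow> x \<in> N \<Longrightarrow> y \<in> N \<Longrightarrow> x \<ominus>\<^bsub>M\<^esub> y \<in> N"
  using submoduleE[of N] by (simp add: M.minus_eq)

lemma (in module) zero_submodule: "submodule {\<zero>\<^bsub>M\<^esub>} R M"
  by (intro submoduleI) auto

lemma (in module) submodule_finsum: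
  assumes "submodule N R M" "finite A" "\<And>i. i \<in> A \<Longrightarrow> g i \<in> N"
  shows "(\<Oplus>\<^bsub>M\<^esub>i\<in>A. g i) \<in> N"
  using assms(2,3)
proof (induction A rule: finite_induct)
  case empty
  then show ?case using submodule_zero[OF assms(1)] by simp
next
  case (insert a A)
  then have "g \<in> insert a A \<rightarrow> carrier M" using submoduleE(1)[OF assms(1)] by auto
  then show ?case using insert submoduleE(5)[OF assms(1)] by (simp add: Pi_def)
qed

lemma (in module) submodule_generated_submodule:
  assumes "A \<subseteq> carrier M"
  shows "submodule (submodule_generated R M A) R M"
  unfolding submodule_generated_def
proof (intro submoduleI)
  \<comment> \<open>The whole module belongs to the family, since \<open>A\<close> lies in its
    carrier; an empty family would have the whole type as its intersection.\<close>
  show "\<Inter> {N. submodule N R M \<and> A \<subseteq> N} \<subseteq> carrier M"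
    using carrier_is_submodule assms by auto
qed (auto intro: submodule_zero submoduleE)

lemma submodule_generated_incl: "A \<subseteq> submodule_generated R M A"
  by (auto simp: submodule_generated_def)

lemma submodule_generated_least: "submodule N R M \<Longrightarrow> A \<subseteq> N \<Longrightarrow> submodule_generated R M A \<subseteq> N"
  by (auto simp: submodule_generated_def)

section \<open>Free modules and their linear maps\<close>

lemma free_module_carrier_iff:
  "v \<in> carrier (free_module R B) \<longleftrightarrow> (\<forall>i. v i \<in> carrier R) \<and> finite {i. v i \<noteq> \<zero>\<^bsub>R\<^esub>} \<and> {i. v i \<noteq> \<zero>\<^bsub>R\<^esub>} \<subseteq> B"
  by (simp add: free_module_def)

lemma free_module_simps [simp]:
  "\<zero>\<^bsub>free_module R B\<^esub> = (\<lambda>i. \<zero>\<^bsub>R\<^esub>)"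
  "v \<oplus>\<^bsub>free_module R B\<^esub> w = (\<lambda>i. v i \<oplus>\<^bsub>R\<^esub> w i)"
  "a \<odot>\<^bsub>free_module R B\<^esub> v = (\<lambda>i. a \<otimes>\<^bsub>R\<^esub> v i)"
  by (simp_all add: free_module_def)

lemma free_module_module:
  assumes "cring R"
  shows "module R (free_module R B)"
proof -
  interpret cring R by fact
  have fin: "finite {i. v i \<oplus>\<^bsub>R\<^esub> w i \<noteq> \<zero>\<^bsub>R\<^esub>}"
    if "finite {i. v i \<noteq> \<zero>\<^bsub>R\<^esub>}" "finite {i. w i \<noteq> \<zero>\<^bsub>R\<^esub>}" "\<forall>i. v i \<in> carrier R" "\<forall>i. w i \<in> carrier R" for v w :: "_ \<Rightarrow> 'a"
    by (rule finite_subset[of _ "{i. v i \<noteq> \<zero>\<^bsub>R\<^esub>} \<union> {i. w i \<noteq> \<zero>\<^bsub>R\<^esub>}"]) (use that in \<open>auto\<close>)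
  have fin2: "finite {i. a \<otimes>\<^bsub>R\<^esub> v i \<noteq> \<zero>\<^bsub>R\<^esub>}"
    if "finite {i. v i \<noteq> \<zero>\<^bsub>R\<^esub>}" "a \<in> carrier R" for v :: "_ \<Rightarrow> 'a" and a
    by (rule finite_subset[of _ "{i. v i \<noteq> \<zero>\<^bsub>R\<^esub>}"]) (use that in \<open>auto\<close>)
  show ?thesis
  proof (rule moduleI)
    show "abelian_group (free_module R B)"
    proof (rule abelian_groupI)
      fix v assume v: "v \<in> carrier (free_module R B)"
      show "\<exists>y\<in>carrier (free_module R B). y \<oplus>\<^bsub>free_module R B\<^esub> v = \<zero>\<^bsub>free_module R B\<^esub>"
      proof (rule bexI[of _ "\<lambda>i. \<ominus>\<^bsub>R\<^esub> v i"])
        have "{i. \<ominus>\<^bsub>R\<^esub> v i \<noteq> \<zero>\<^bsub>R\<^esub>} \<subseteq> {i. v i \<noteq> \<zero>\<^bsub>R\<^esub>}" by auto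
        then show "(\<lambda>i. \<ominus>\<^bsub>R\<^esub> v i) \<in> carrier (free_module R B)"
          using v by (auto simp: free_module_carrier_iff dest: finite_subset)
      qed (use v in \<open>auto simp: free_module_carrier_iff l_neg\<close>)
    next
      fix v w assume "v \<in> carrier (free_module R B)" "w \<in> carrier (free_module R B)"
      then show "v \<oplus>\<^bsub>free_module R B\<^esub> w \<in> carrier (free_module R B)"
        by (auto simp: free_module_carrier_iff subset_iff intro!: fin) (metis l_zero zero_closed)
    qed (auto simp: free_module_carrier_iff a_ac)
  next
    fix a v assume "a \<in> carrier R" "v \<in> carrier (free_module R B)"
    then show "a \<odot>\<^bsub>free_module R B\<^esub> v \<in> carrier (free_module R B)"
      by (auto simp: free_module_carrier_iff intro!: fin2)
  qed (auto simp: free_module_carrier_iff l_distr r_distr m_assoc assms)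
qed

lemma free_module_neg:
  assumes "cring R" "v \<in> carrier (free_module R B)"
  shows "\<ominus>\<^bsub>free_module R B\<^esub> v = (\<lambda>i. \<ominus>\<^bsub>R\<^esub> v i)"
proof -
  interpret F: module R "free_module R B" by (rule free_module_module[OF assms(1)])
  have "\<ominus>\<^bsub>free_module R B\<^esub> v = (\<ominus>\<^bsub>R\<^esub> \<one>\<^bsub>R\<^esub>) \<odot>\<^bsub>free_module R B\<^esub> v"
    using assms(2) by (simp only: F.smult_l_minus F.R.one_closed F.smult_one)
  also have "\<dots> = (\<lambda>i. \<ominus>\<^bsub>R\<^esub> v i)"
    using assms(2) by (auto simp: free_module_carrier_iff F.R.l_minus)
  finally show ?thesis .
qed

lemma free_module_minus:
  assumes "cring R" "v \<in> carrier (free_module R B)" "w \<in> carrier (free_module R B)"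
  shows "v \<ominus>\<^bsub>free_module R B\<^esub> w = (\<lambda>i. v i \<ominus>\<^bsub>R\<^esub> w i)"
  using assms by (simp add: a_minus_def free_module_neg)

lemma basis_vector_closed:
  assumes "cring R" "p \<in> B"
  shows "basis_vector R p \<in> carrier (free_module R B)"
proof -
  interpret cring R by fact
  have "{i. basis_vector R p i \<noteq> \<zero>\<^bsub>R\<^esub>} \<subseteq> {p}" by (auto simp: basis_vector_def)
  then show ?thesis using assms(2)
    by (auto simp: free_module_carrier_iff basis_vector_def dest: finite_subset split: if_splits)
qed

text \<open>The map from a free module to \<open>M\<close> with prescribed values on the basis. The
  sum runs over the support, which is finite for every vector, so infinite bases are allowed as
  well; tensor products need them. \<open>linear_extension_eq\<close> replaces the support by any
  larger finite set of indices.\<close>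

definition linear_extension ::
  "('a, 'x) ring_scheme \<Rightarrow> ('a, 'm, 'y) module_scheme \<Rightarrow> ('i \<Rightarrow> 'm) \<Rightarrow> ('i \<Rightarrow> 'a) \<Rightarrow> 'm" where
  "linear_extension R M b v = (\<Oplus>\<^bsub>M\<^esub>p\<in>{p. v p \<noteq> \<zero>\<^bsub>R\<^esub>}. v p \<odot>\<^bsub>M\<^esub> b p)"

lemma (in module) linear_extension_eq:
  assumes "v \<in> carrier (free_module R B)" "b \<in> B \<rightarrow> carrier M"
    and "finite A" "{p. v p \<noteq> \<zero>\<^bsub>R\<^esub>} \<subseteq> A" "A \<subseteq> B"
  shows "linear_extension R M b v = (\<Oplus>\<^bsub>M\<^esub>p\<in>A. v p \<odot>\<^bsub>M\<^esub> b p)"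
  unfolding linear_extension_def
  by (rule M.add.finprod_mono_neutral_cong_left)
    (use assms in \<open>auto simp: free_module_carrier_iff Pi_def intro!: smult_closed\<close>)

lemma linear_extension_hom:
  assumes "module R M" "b \<in> B \<rightarrow> carrier M"
  shows "linear_extension R M b \<in> module_hom R (free_module R B) M"
proof -
  interpret module R M by fact
  interpret F: module R "free_module R B" by (rule free_module_module) unfold_locales
  show ?thesis
  proof (rule module_homI)
    fix v assume v: "v \<in> carrier (free_module R B)"
    then show "linear_extension R M b v \<in> carrier M"
      unfolding linear_extension_def using assms(2)
      by (intro M.finsum_closed) (auto simp: free_module_carrier_iff)
  next
    fix v w assume vw: "v \<in> carrier (free_module R B)" "w \<in> carrier (free_module R B)"
    let ?A = "{p. v p \<noteq> \<zero>\<^bsub>R\<^esub>} \<union> {p. w p \<noteq> \<zero>\<^bsub>R\<^esub>}"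
    have A: "finite ?A" "?A \<subseteq> B" using vw by (auto simp: free_module_carrier_iff)
    have b: "\<And>p. p \<in> ?A \<Longrightarrow> b p \<in> carrier M" using A assms(2) by auto
    have vc: "\<And>p. v p \<in> carrier R" "\<And>p. w p \<in> carrier R" using vw by (auto simp: free_module_carrier_iff)
    have "linear_extension R M b (v \<oplus>\<^bsub>free_module R B\<^esub> w) = (\<Oplus>\<^bsub>M\<^esub>p\<in>?A. (v p \<oplus>\<^bsub>R\<^esub> w p) \<odot>\<^bsub>M\<^esub> b p)"
      using linear_extension_eq[OF F.M.a_closed[OF vw] assms(2) A(1) _ A(2)] by fastforce
    also have "\<dots> = (\<Oplus>\<^bsub>M\<^esub>p\<in>?A. v p \<odot>\<^bsub>M\<^esub> b p \<oplus>\<^bsub>M\<^esub> w p \<odot>\<^bsub>M\<^esub> b p)"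
      using vc b by (intro M.finsum_cong') (auto simp: smult_l_distr)
    also have "\<dots> = (\<Oplus>\<^bsub>M\<^esub>p\<in>?A. v p \<odot>\<^bsub>M\<^esub> b p) \<oplus>\<^bsub>M\<^esub> (\<Oplus>\<^bsub>M\<^esub>p\<in>?A. w p \<odot>\<^bsub>M\<^esub> b p)"
      using vc b by (intro M.finsum_addf) auto
    finally show "linear_extension R M b (v \<oplus>\<^bsub>free_module R B\<^esub> w) =
        linear_extension R M b v \<oplus>\<^bsub>M\<^esub> linear_extension R M b w"
      using linear_extension_eq[OF vw(1) assms(2) A(1) _ A(2)]
        linear_extension_eq[OF vw(2) assms(2) A(1) _ A(2)] by simp
  next
    fix a v assume av: "a \<in> carrier R" "v \<in> carrier (free_module R B)"
    let ?A = "{p. v p \<noteq> \<zero>\<^bsub>R\<^esub>}"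
    have A: "finite ?A" "?A \<subseteq> B" using av by (auto simp: free_module_carrier_iff)
    have b: "\<And>p. p \<in> ?A \<Longrightarrow> b p \<in> carrier M" using A assms(2) by auto
    have vc: "\<And>p. v p \<in> carrier R" using av by (auto simp: free_module_carrier_iff)
    have "linear_extension R M b (a \<odot>\<^bsub>free_module R B\<^esub> v) = (\<Oplus>\<^bsub>M\<^esub>p\<in>?A. (a \<otimes>\<^bsub>R\<^esub> v p) \<odot>\<^bsub>M\<^esub> b p)"
      using linear_extension_eq[OF F.smult_closed[OF av] assms(2) A(1) _ A(2)] av by fastforce
    also have "\<dots> = (\<Oplus>\<^bsub>M\<^esub>p\<in>?A. a \<odot>\<^bsub>M\<^esub> (v p \<odot>\<^bsub>M\<^esub> b p))"
      using vc b av by (intro M.finsum_cong') (auto simp: smult_assoc1)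
    also have "\<dots> = a \<odot>\<^bsub>M\<^esub> (\<Oplus>\<^bsub>M\<^esub>p\<in>?A. v p \<odot>\<^bsub>M\<^esub> b p)"
      using vc b av A by (intro finsum_smult_ldistr[symmetric]) auto
    finally show "linear_extension R M b (a \<odot>\<^bsub>free_module R B\<^esub> v) = a \<odot>\<^bsub>M\<^esub> linear_extension R M b v"
      using linear_extension_eq[OF av(2) assms(2) A(1) _ A(2)] by simp
  qed
qed

lemma linear_extension_basis:
  assumes "module R M" "b p \<in> carrier M"
  shows "linear_extension R M b (basis_vector R p) = b p"
proof -
  interpret module R M by fact
  \<comment> \<open>Summing over \<open>{p}\<close> instead of the support also covers the zero
    ring, where the basis vector is zero and its support is empty.\<close>
  have "linear_extension R M b (basis_vector R p) = (\<Oplus>\<^bsub>M\<^esub>q\<in>{p}. basis_vector R p q \<odot>\<^bsub>M\<^esub> b q)"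
    using assms(2) basis_vector_closed[of R p "{p}"] R.is_cring
    by (intro linear_extension_eq[of _ "{p}"]) (auto simp: basis_vector_def)
  then show ?thesis using assms(2) by (simp add: basis_vector_def)
qed

lemma finsum_apply:
  assumes "cring R" "finite A" "g \<in> A \<rightarrow> carrier (free_module R B)"
  shows "(\<Oplus>\<^bsub>free_module R B\<^esub>i\<in>A. g i) q = (\<Oplus>\<^bsub>R\<^esub>i\<in>A. g i q)"
proof -
  interpret F: module R "free_module R B" by (rule free_module_module[OF assms(1)])
  show ?thesis using assms(2,3)
    by (induction A rule: finite_induct) (auto simp: free_module_carrier_iff Pi_def)
qed

lemma vector_expansion:
  assumes "cring R" "v \<in> carrier (free_module R B)"
  shows "linear_extension R (free_module R B) (basis_vector R) v = v"
proof
  fix q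
  interpret F: module R "free_module R B" by (rule free_module_module[OF assms(1)])
  let ?A = "{p. v p \<noteq> \<zero>\<^bsub>R\<^esub>}"
  have fin: "finite ?A" "?A \<subseteq> B" and vc: "\<And>p. v p \<in> carrier R"
    using assms(2) by (auto simp: free_module_carrier_iff)
  have g: "(\<lambda>p. v p \<odot>\<^bsub>free_module R B\<^esub> basis_vector R p) \<in> ?A \<rightarrow> carrier (free_module R B)"
    using fin vc by (intro Pi_I F.smult_closed basis_vector_closed[OF assms(1)]) auto
  have "linear_extension R (free_module R B) (basis_vector R) v q
      = (\<Oplus>\<^bsub>R\<^esub>p\<in>?A. v p \<otimes>\<^bsub>R\<^esub> basis_vector R p q)"
    unfolding linear_extension_def by (subst finsum_apply[OF assms(1) fin(1) g]) simp
  also have "\<dots> = (\<Oplus>\<^bsub>R\<^esub>p\<in>?A. if q = p then v p else \<zero>\<^bsub>R\<^esub>)"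
    using vc by (intro F.R.finsum_cong') (auto simp: basis_vector_def)
  also have "\<dots> = v q"
  proof (cases "q \<in> ?A")
    case True
    then show ?thesis using fin vc by (intro F.R.finsum_singleton) auto
  next
    case False
    then have "(\<Oplus>\<^bsub>R\<^esub>p\<in>?A. if q = p then v p else \<zero>\<^bsub>R\<^esub>) = (\<Oplus>\<^bsub>R\<^esub>p\<in>?A. \<zero>\<^bsub>R\<^esub>)"
      by (intro F.R.finsum_cong') auto
    then show ?thesis using False by simp
  qed
  finally show "linear_extension R (free_module R B) (basis_vector R) v q = v q" .
qed

lemma hom_eq_linear_extension:
  assumes "module R M" "h \<in> module_hom R (free_module R B) M" "v \<in> carrier (free_module R B)"
  shows "h v = linear_extension R M (\<lambda>p. h (basis_vector R p)) v"
proof -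
  interpret module R M by fact
  interpret F: module R "free_module R B" by (rule free_module_module) unfold_locales
  let ?A = "{p. v p \<noteq> \<zero>\<^bsub>R\<^esub>}"
  have fin: "finite ?A" "?A \<subseteq> B" and vc: "\<And>p. v p \<in> carrier R"
    using assms(3) by (auto simp: free_module_carrier_iff)
  have e: "\<And>p. p \<in> ?A \<Longrightarrow> basis_vector R p \<in> carrier (free_module R B)"
    by (rule basis_vector_closed[OF R.is_cring]) (use fin in auto)
  have g: "(\<lambda>p. v p \<odot>\<^bsub>free_module R B\<^esub> basis_vector R p) \<in> ?A \<rightarrow> carrier (free_module R B)"
    using e vc by (intro Pi_I F.smult_closed) auto
  have "h v = h (\<Oplus>\<^bsub>free_module R B\<^esub>p\<in>?A. v p \<odot>\<^bsub>free_module R B\<^esub> basis_vector R p)"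
    using vector_expansion[OF R.is_cring assms(3)] by (simp add: linear_extension_def)
  also have "\<dots> = (\<Oplus>\<^bsub>M\<^esub>p\<in>?A. h (v p \<odot>\<^bsub>free_module R B\<^esub> basis_vector R p))"
    by (rule module_hom_finsum[OF F.module_axioms assms(1,2) fin(1) g])
  also have "\<dots> = linear_extension R M (\<lambda>p. h (basis_vector R p)) v"
    unfolding linear_extension_def
    by (intro M.finsum_cong')
      (auto simp del: free_module_simps intro!: module_hom_smult[OF assms(2)] module_hom_closed[OF assms(2)] e vc smult_closed)
  finally show ?thesis .
qed

lemma linear_extension_cong:
  assumes "module R M" "v \<in> carrier (free_module R B)" "\<And>p. p \<in> B \<Longrightarrow> b p = c p" "b \<in> B \<rightarrow> carrier M"
  shows "linear_extension R M b v = linear_extension R M c v"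
proof -
  interpret module R M by fact
  show ?thesis unfolding linear_extension_def
    using assms by (intro M.finsum_cong') (auto simp: free_module_carrier_iff subset_iff Pi_def intro!: smult_closed)
qed

text \<open>Both maps are linear extensions of their values on basis vectors. Identities between
  matrices are reduced to their columns in this way.\<close>

lemma hom_eqI:
  assumes "module R M" "g \<in> module_hom R (free_module R B) M" "h \<in> module_hom R (free_module R B) M"
    and "\<And>p. p \<in> B \<Longrightarrow> g (basis_vector R p) = h (basis_vector R p)"
    and "v \<in> carrier (free_module R B)"
  shows "g v = h v"
proof -
  interpret module R M by fact
  have "(\<lambda>p. g (basis_vector R p)) \<in> B \<rightarrow> carrier M"
    using basis_vector_closed[OF R.is_cring] by (auto intro!: module_hom_closed[OF assms(2)])
  then show ?thesis
    using linear_extension_cong[OF assms(1,5), of "\<lambda>p. g (basis_vector R p)" "\<lambda>p. h (basis_vector R p)"]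
      hom_eq_linear_extension[OF assms(1,2,5)] hom_eq_linear_extension[OF assms(1,3,5)] assms(4)
    by simp
qed

text \<open>Preimages are chosen for the basis vectors and extended linearly. Asking only that the
  values of \<open>h\<close> lie in the image of \<open>\<pi>\<close>, not that \<open>\<pi>\<close>
  be onto, lets exactness of a complex be used directly.\<close>

lemma free_lifting:
  assumes "module R N" "module R M" "h \<in> module_hom R (free_module R B) M" "\<pi> \<in> module_hom R N M"
    and "\<And>v. v \<in> carrier (free_module R B) \<Longrightarrow> h v \<in> \<pi> ` carrier N"
  obtains g where "g \<in> module_hom R (free_module R B) N"
    "\<And>v. v \<in> carrier (free_module R B) \<Longrightarrow> \<pi> (g v) = h v"
proof -
  interpret module R M by fact
  have "\<forall>p\<in>B. \<exists>y\<in>carrier N. \<pi> y = h (basis_vector R p)"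
    using assms(5)[OF basis_vector_closed[OF R.is_cring]] by (metis imageE)
  then obtain b where b: "\<And>p. p \<in> B \<Longrightarrow> b p \<in> carrier N" "\<And>p. p \<in> B \<Longrightarrow> \<pi> (b p) = h (basis_vector R p)"
    by metis
  let ?g = "linear_extension R N b"
  have g: "?g \<in> module_hom R (free_module R B) N"
    using b by (intro linear_extension_hom assms) auto
  have "\<pi> (?g v) = h v" if "v \<in> carrier (free_module R B)" for v
    by (rule hom_eqI[OF assms(2) module_hom_comp[OF g assms(4)] assms(3) _ that])
      (simp add: linear_extension_basis[OF assms(1)] b)
  with g show thesis using that by blast
qed

section \<open>Noetherian modules\<close>

definition noetherian_module :: "('a, 'x) ring_scheme \<Rightarrow> ('a, 'm, 'y) module_scheme \<Rightarrow> bool" where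
  "noetherian_module R M \<longleftrightarrow>
     (\<forall>N. submodule N R M \<longrightarrow> (\<exists>A\<subseteq>N. finite A \<and> submodule_generated R M A = N))"

text \<open>The union of a nonempty chain is a submodule, and its finitely many generators already
  lie in one member, so the union is that member and Zorn's lemma applies.\<close>

lemma noetherian_module_maximal:
  assumes "module R M" "noetherian_module R M" "\<C> \<noteq> {}" "\<And>N. N \<in> \<C> \<Longrightarrow> submodule N R M"
  obtains N where "N \<in> \<C>" "\<And>N'. N' \<in> \<C> \<Longrightarrow> N \<subseteq> N' \<Longrightarrow> N' = N"
proof -
  interpret module R M by fact
  have "\<Union>C \<in> \<C>" if C: "C \<noteq> {}" "subset.chain \<C> C" for C
  proof -
    have "C \<subseteq> \<C>" using C(2) by (simp add: subset_chain_def)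
    then have sub: "\<And>N. N \<in> C \<Longrightarrow> submodule N R M" by (blast intro: assms(4))
    have two: "\<exists>N\<in>C. x \<in> N \<and> y \<in> N" if xy: "x \<in> \<Union>C" "y \<in> \<Union>C" for x y
    proof -
      obtain A B where AB: "A \<in> C" "x \<in> A" "B \<in> C" "y \<in> B" using xy by blast
      then have "A \<subseteq> B \<or> B \<subseteq> A" using C(2) by (metis subset_chain_def)
      then show ?thesis using AB by (metis subsetD)
    qed
    have "submodule (\<Union>C) R M"
    proof (rule submoduleI)
      show "\<Union>C \<subseteq> carrier M" using submoduleE(1)[OF sub] by auto
      show "\<zero>\<^bsub>M\<^esub> \<in> \<Union>C" using C(1) submodule_zero[OF sub] by auto
      show "\<ominus>\<^bsub>M\<^esub> a \<in> \<Union>C" if "a \<in> \<Union>C" for a using that submoduleE(3)[OF sub] by auto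
      show "a \<odot>\<^bsub>M\<^esub> x \<in> \<Union>C" if "a \<in> carrier R" "x \<in> \<Union>C" for a x
        using that submoduleE(4)[OF sub] by auto
      show "a \<oplus>\<^bsub>M\<^esub> b \<in> \<Union>C" if "a \<in> \<Union>C" "b \<in> \<Union>C" for a b
        using two[OF that] submoduleE(5)[OF sub] by auto
    qed
    then obtain A where A: "A \<subseteq> \<Union>C" "finite A" "submodule_generated R M A = \<Union>C"
      using assms(2) by (auto simp: noetherian_module_def)
    then obtain N where N: "N \<in> C" "A \<subseteq> N"
      using finite_subset_Union_chain[OF A(2,1) C] by blast
    then have "\<Union>C \<subseteq> N"
      using submodule_generated_least[OF sub[OF N(1)] N(2)] A(3) by simp
    then have "\<Union>C = N" using N(1) by auto
    then show ?thesis using N(1) C(2) by (auto simp: subset_chain_def)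
  qed
  then have "\<exists>N\<in>\<C>. \<forall>K\<in>\<C>. N \<subseteq> K \<longrightarrow> K = N"
    by (intro subset_Zorn_nonempty assms(3))
  then show thesis using that by blast
qed

lemma (in module) submodule_generated_image:
  assumes "g \<in> {..<n::nat} \<rightarrow> carrier M"
  shows "submodule_generated R M (g ` {..<n}) = linear_extension R M g ` carrier (free_module R {..<n})"
    (is "?G = ?I")
proof
  note mF = free_module_module[OF R.is_cring, of "{..<n}"]
  have hom: "linear_extension R M g \<in> module_hom R (free_module R {..<n}) M"
    by (rule linear_extension_hom[OF module_axioms assms])
  show "?G \<subseteq> ?I"
  proof (rule submodule_generated_least)
    show "submodule ?I R M"
      by (rule image_submodule[OF mF module_axioms hom module.carrier_is_submodule[OF mF]])
    show "g ` {..<n} \<subseteq> ?I"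
    proof safe
      fix i assume "i < n"
      then show "g i \<in> ?I"
        using linear_extension_basis[OF module_axioms, of g i] assms basis_vector_closed[OF R.is_cring, of i "{..<n}"]
        by (metis imageI lessThan_iff PiE)
    qed
  qed
  have sub: "submodule ?G R M" by (rule submodule_generated_submodule) (use assms in auto)
  show "?I \<subseteq> ?G"
  proof safe
    fix v assume v: "v \<in> carrier (free_module R {..<n})"
    show "linear_extension R M g v \<in> ?G"
      unfolding linear_extension_def
    proof (rule submodule_finsum[OF sub])
      fix i assume "i \<in> {p. v p \<noteq> \<zero>\<^bsub>R\<^esub>}"
      then have "g i \<in> ?G" "v i \<in> carrier R"
        using v submodule_generated_incl[of "g ` {..<n}" R M] by (auto simp: free_module_carrier_iff)
      then show "v i \<odot>\<^bsub>M\<^esub> g i \<in> ?G" using submoduleE(4)[OF sub] by blast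
    qed (use v in \<open>auto simp: free_module_carrier_iff\<close>)
  qed
qed

lemma finite_enumeration:
  assumes "finite A"
  obtains n :: nat and g where "g ` {..<n} = A" "inj_on g {..<n}"
proof -
  obtain g where "bij_betw g {0..<card A} A" using ex_bij_betw_nat_finite[OF assms] by blast
  then show thesis using that[of g "card A"] by (auto simp: bij_betw_def lessThan_atLeast0)
qed

section \<open>The ring as a module over itself\<close>

lemma self_module_simps [simp]:
  "carrier (self_module R) = carrier R" "\<zero>\<^bsub>self_module R\<^esub> = \<zero>\<^bsub>R\<^esub>"
  "add (self_module R) = add R" "smult (self_module R) = monoid.mult R"
  by (simp_all add: self_module_def)

lemma self_module_module:
  assumes "cring R"
  shows "module R (self_module R)"
proof -
  interpret cring R by fact
  show ?thesis
    by (rule moduleI)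
      (auto intro!: abelian_groupI simp: assms l_distr r_distr m_assoc a_ac intro: l_neg bexI[of _ "\<ominus>\<^bsub>R\<^esub> _"])
qed

lemma self_module_neg: "a_inv (self_module R) = a_inv R"
  by (simp add: fun_eq_iff a_inv_def m_inv_def)

lemma self_module_minus: "a_minus (self_module R) = a_minus R"
  by (simp add: fun_eq_iff a_minus_def self_module_neg)

text \<open>The bridge over which results on modules are used for ideals.\<close>

lemma submodule_self_module_iff:
  assumes "cring R"
  shows "submodule I R (self_module R) \<longleftrightarrow> ideal I R"
proof -
  interpret cring R by fact
  interpret S: module R "self_module R" by (rule self_module_module[OF assms])
  show ?thesis
  proof
    assume I: "submodule I R (self_module R)"
    note E = S.submoduleE[OF I, simplified]
    show "ideal I R"
    proof (rule idealI[OF ring_axioms])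
      show "subgroup I (add_monoid R)"
      proof -
        have "\<And>a. a \<in> I \<Longrightarrow> \<ominus>\<^bsub>R\<^esub> a \<in> I" using E(3) by (simp add: self_module_neg)
        then show ?thesis by (intro add.subgroupI) (use E(1,2,5) in \<open>auto simp: a_inv_def\<close>)
      qed
    next
      fix a x assume ax: "a \<in> I" "x \<in> carrier R"
      show "x \<otimes>\<^bsub>R\<^esub> a \<in> I" using E(4) ax by blast
      then show "a \<otimes>\<^bsub>R\<^esub> x \<in> I" using E(1) ax m_comm[of a x] by auto
    qed
  next
    assume I: "ideal I R"
    interpret I: ideal I R by fact
    show "submodule I R (self_module R)"
      by (rule S.submoduleI)
        (auto simp: self_module_neg I.I_l_closed I.a_subset[THEN subsetD] dest: I.a_Hcarr)
  qed
qed

lemma genideal_eq_submodule_generated: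
  assumes "cring R" "A \<subseteq> carrier R"
  shows "submodule_generated R (self_module R) A = Idl\<^bsub>R\<^esub> A"
  using assms by (simp add: submodule_generated_def genideal_def submodule_self_module_iff)

lemma noetherian_ring_self_module:
  assumes "cring R" "noetherian_ring R"
  shows "noetherian_module R (self_module R)"
  unfolding noetherian_module_def
proof safe
  fix I assume "submodule I R (self_module R)"
  then have I: "ideal I R" using submodule_self_module_iff assms(1) by blast
  then obtain A where A: "A \<subseteq> carrier R" "finite A" "I = Idl\<^bsub>R\<^esub> A"
    using noetherian_ring.finetely_gen[OF assms(2)] by blast
  moreover have "A \<subseteq> I" using A ring.genideal_self[of R A] assms(1) by (simp add: cring.axioms(1))
  ultimately show "\<exists>A\<subseteq>I. finite A \<and> submodule_generated R (self_module R) A = I"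
    using genideal_eq_submodule_generated[OF assms(1) A(1)] by auto
qed

section \<open>Images, extensions and powers of noetherian modules\<close>

lemma noetherian_module_image:
  assumes "module R M" "module R N" "h \<in> module_hom R M N" "h ` carrier M = carrier N"
    "noetherian_module R M"
  shows "noetherian_module R N"
  unfolding noetherian_module_def
proof safe
  interpret M: module R M by fact
  interpret N: module R N by fact
  fix K assume K: "submodule K R N"
  let ?K = "{x \<in> carrier M. h x \<in> K}"
  have "submodule ?K R M" by (rule kernel_submodule[OF assms(1-3) K])
  then obtain A where A: "A \<subseteq> ?K" "finite A" "submodule_generated R M A = ?K"
    using assms(5) by (auto simp: noetherian_module_def)
  have hA: "h ` A \<subseteq> K" using A by auto
  have subc: "h ` A \<subseteq> carrier N" using hA N.submoduleE(1)[OF K] by auto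
  have "submodule {x \<in> carrier M. h x \<in> submodule_generated R N (h ` A)} R M"
    by (rule kernel_submodule[OF assms(1-3) N.submodule_generated_submodule[OF subc]])
  moreover have "A \<subseteq> {x \<in> carrier M. h x \<in> submodule_generated R N (h ` A)}"
    using A(1) submodule_generated_incl[of "h ` A" R N] by auto
  ultimately have "?K \<subseteq> {x \<in> carrier M. h x \<in> submodule_generated R N (h ` A)}"
    using submodule_generated_least A(3) by metis
  have "K \<subseteq> submodule_generated R N (h ` A)"
  proof (intro subsetI)
    fix k assume "k \<in> K"
    then show "k \<in> submodule_generated R N (h ` A)"
      using \<open>?K \<subseteq> _\<close> N.submoduleE(1)[OF K] assms(4) by (auto simp: subset_iff) (metis imageE)
  qed
  moreover have "submodule_generated R N (h ` A) \<subseteq> K"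
    by (rule submodule_generated_least[OF K hA])
  ultimately show "\<exists>A\<subseteq>K. finite A \<and> submodule_generated R N A = K"
    using hA A(2) by (intro exI[of _ "h ` A"]) auto
qed

text \<open>Generators of \<open>W\<close> are those of its intersection with the kernel together
  with lifts of those of its image. The condition on the kernel speaks of submodules of
  \<open>M\<close>, so the kernel never has to become a module of its own.\<close>

lemma noetherian_module_extension:
  assumes "module R M" "module R N" "h \<in> module_hom R M N" "noetherian_module R N"
    and ker: "\<And>K. submodule K R M \<Longrightarrow> K \<subseteq> {x \<in> carrier M. h x = \<zero>\<^bsub>N\<^esub>} \<Longrightarrow>
      \<exists>A\<subseteq>K. finite A \<and> submodule_generated R M A = K"
  shows "noetherian_module R M"
  unfolding noetherian_module_def
proof safe
  interpret M: module R M by fact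
  interpret N: module R N by fact
  fix W assume W: "submodule W R M"
  note E = M.submoduleE[OF W]
  let ?K = "{x \<in> carrier M. h x \<in> {\<zero>\<^bsub>N\<^esub>}} \<inter> W"
  have k0: "submodule {x \<in> carrier M. h x \<in> {\<zero>\<^bsub>N\<^esub>}} R M"
    by (rule kernel_submodule[OF assms(1-3) N.zero_submodule])
  have "submodule ?K R M"
    by (rule M.submoduleI) (use E M.submoduleE[OF k0] M.submodule_zero[OF W] M.submodule_zero[OF k0] in auto)
  then obtain A where A: "A \<subseteq> ?K" "finite A" "submodule_generated R M A = ?K"
    using ker[of ?K] by auto
  have "submodule (h ` W) R N" by (rule image_submodule[OF assms(1-3) W])
  then obtain B where B: "B \<subseteq> h ` W" "finite B" "submodule_generated R N B = h ` W"
    using assms(4) by (auto simp: noetherian_module_def)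
  obtain B' where B': "B' \<subseteq> W" "finite B'" "B = h ` B'"
    using B finite_subset_image[OF B(2,1)] by blast
  let ?G = "submodule_generated R M (A \<union> B')"
  have sub: "A \<union> B' \<subseteq> W" using A B' by auto
  have G: "submodule ?G R M" by (rule M.submodule_generated_submodule) (use sub E(1) in auto)
  have "h ` W \<subseteq> h ` ?G"
    unfolding B(3)[symmetric]
    by (rule submodule_generated_least[OF image_submodule[OF assms(1-3) G]])
      (use submodule_generated_incl[of "A \<union> B'" R M] B'(3) in auto)
  moreover have "?K \<subseteq> ?G"
    unfolding A(3)[symmetric]
    by (rule submodule_generated_least[OF G]) (use submodule_generated_incl[of "A \<union> B'" R M] in auto)
  moreover have GW: "?G \<subseteq> W" by (rule submodule_generated_least[OF W sub])
  ultimately have "W \<subseteq> ?G"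
  proof -
    assume hW: "h ` W \<subseteq> h ` ?G" and K: "?K \<subseteq> ?G" and GW: "?G \<subseteq> W"
    show "W \<subseteq> ?G"
    proof
      fix w assume w: "w \<in> W"
      then obtain g where g: "g \<in> ?G" "h w = h g" using hW by auto
      have c: "w \<in> carrier M" "g \<in> carrier M" using w g GW E(1) by auto
      have "h (w \<ominus>\<^bsub>M\<^esub> g) = \<zero>\<^bsub>N\<^esub>"
        using module_hom_minus[OF assms(1-3) c] g(2) module_hom_closed[OF assms(3) c(2)]
        by (simp add: N.minus_eq N.r_neg)
      moreover have "w \<ominus>\<^bsub>M\<^esub> g \<in> W" using M.submodule_minus[OF W w] g(1) GW by blast
      ultimately have "w \<ominus>\<^bsub>M\<^esub> g \<in> ?G" using K E(1) by blast
      then have "w \<ominus>\<^bsub>M\<^esub> g \<oplus>\<^bsub>M\<^esub> g \<in> ?G" using M.submoduleE(5)[OF G] g(1) by blast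
      then show "w \<in> ?G" using c by (simp add: M.minus_eq M.a_assoc M.l_neg)
    qed
  qed
  then show "\<exists>A\<subseteq>W. finite A \<and> submodule_generated R M A = W"
    using GW sub A(2) B'(2) by (intro exI[of _ "A \<union> B'"]) auto
qed

text \<open>Tuples are extended by zero, which makes \<open>M^m\<close> a subset of
  \<open>M^(m+1)\<close> and permits induction on \<open>m\<close>. For \<open>M = R\<close> the
  result is literally \<open>free_module R {..<m}\<close>.\<close>

definition power_module :: "('a, 'm, 'y) module_scheme \<Rightarrow> nat \<Rightarrow> ('a, nat \<Rightarrow> 'm) module" where
  "power_module M m =
     \<lparr>carrier = {v. (\<forall>i. v i \<in> carrier M) \<and> (\<forall>i\<ge>m. v i = \<zero>\<^bsub>M\<^esub>)},
      monoid.mult = undefined, one = undefined,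
      ring.zero = (\<lambda>i. \<zero>\<^bsub>M\<^esub>), add = (\<lambda>v w i. v i \<oplus>\<^bsub>M\<^esub> w i), smult = (\<lambda>a v i. a \<odot>\<^bsub>M\<^esub> v i)\<rparr>"

lemma power_module_simps [simp]:
  "\<zero>\<^bsub>power_module M m\<^esub> = (\<lambda>i. \<zero>\<^bsub>M\<^esub>)"
  "v \<oplus>\<^bsub>power_module M m\<^esub> w = (\<lambda>i. v i \<oplus>\<^bsub>M\<^esub> w i)"
  "a \<odot>\<^bsub>power_module M m\<^esub> v = (\<lambda>i. a \<odot>\<^bsub>M\<^esub> v i)"
  by (simp_all add: power_module_def)

lemma power_module_carrier_iff:
  "v \<in> carrier (power_module M m) \<longleftrightarrow> (\<forall>i. v i \<in> carrier M) \<and> (\<forall>i\<ge>m. v i = \<zero>\<^bsub>M\<^esub>)"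
  by (simp add: power_module_def)

lemma power_module_module:
  assumes "module R M"
  shows "module R (power_module M m)"
proof -
  interpret module R M by fact
  show ?thesis
  proof (rule moduleI)
    show "abelian_group (power_module M m)"
    proof (rule abelian_groupI)
      fix v assume v: "v \<in> carrier (power_module M m)"
      show "\<exists>y\<in>carrier (power_module M m). y \<oplus>\<^bsub>power_module M m\<^esub> v = \<zero>\<^bsub>power_module M m\<^esub>"
        by (rule bexI[of _ "\<lambda>i. \<ominus>\<^bsub>M\<^esub> v i"]) (use v in \<open>auto simp: power_module_carrier_iff M.l_neg\<close>)
    qed (auto simp: power_module_carrier_iff M.a_ac)
  qed (auto simp: power_module_carrier_iff smult_l_distr smult_r_distr smult_assoc1 R.is_cring)
qed

lemma free_module_eq_power_module:
  "free_module R {..<m} = power_module (self_module R) m"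
proof -
  have "finite {i. v i \<noteq> \<zero>\<^bsub>R\<^esub>}" if "{i. v i \<noteq> \<zero>\<^bsub>R\<^esub>} \<subseteq> {..<m}" for v :: "nat \<Rightarrow> _"
    using that finite_subset by blast
  moreover have "{i. v i \<noteq> \<zero>\<^bsub>R\<^esub>} \<subseteq> {..<m} \<longleftrightarrow> (\<forall>i\<ge>m. v i = \<zero>\<^bsub>R\<^esub>)" for v :: "nat \<Rightarrow> _"
  proof
    assume sub: "{i. v i \<noteq> \<zero>\<^bsub>R\<^esub>} \<subseteq> {..<m}"
    show "\<forall>i\<ge>m. v i = \<zero>\<^bsub>R\<^esub>"
    proof (intro allI impI, rule ccontr)
      fix i assume "m \<le> i" "v i \<noteq> \<zero>\<^bsub>R\<^esub>"
      then show False using subsetD[OF sub, of i] by simp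
    qed
  next
    assume z: "\<forall>i\<ge>m. v i = \<zero>\<^bsub>R\<^esub>"
    show "{i. v i \<noteq> \<zero>\<^bsub>R\<^esub>} \<subseteq> {..<m}"
    proof
      fix i assume "i \<in> {i. v i \<noteq> \<zero>\<^bsub>R\<^esub>}"
      then show "i \<in> {..<m}" using spec[OF z, of i] by (cases "m \<le> i") auto
    qed
  qed
  ultimately have "(\<forall>i. v i \<in> carrier R) \<and> finite {i. v i \<noteq> \<zero>\<^bsub>R\<^esub>} \<and> {i. v i \<noteq> \<zero>\<^bsub>R\<^esub>} \<subseteq> {..<m} \<longleftrightarrow>
      (\<forall>i. v i \<in> carrier R) \<and> (\<forall>i\<ge>m. v i = \<zero>\<^bsub>R\<^esub>)" for v :: "nat \<Rightarrow> _"
    by (cases "{i. v i \<noteq> \<zero>\<^bsub>R\<^esub>} \<subseteq> {..<m}") (simp_all only: simp_thms)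
  then show ?thesis
    by (simp add: free_module_def power_module_def)
qed

lemma free_module_carrier_nat:
  "v \<in> carrier (free_module R {..<m::nat}) \<longleftrightarrow> (\<forall>i. v i \<in> carrier R) \<and> (\<forall>i\<ge>m. v i = \<zero>\<^bsub>R\<^esub>)"
  by (simp add: free_module_eq_power_module power_module_carrier_iff)

text \<open>The last coordinate maps \<open>M^(m+1)\<close> onto \<open>M\<close>, and its kernel is
  \<open>M^m\<close>.\<close>

lemma noetherian_power_module:
  assumes "module R M" "noetherian_module R M"
  shows "noetherian_module R (power_module M m)"
proof (induction m)
  case 0
  interpret P: module R "power_module M 0" by (rule power_module_module[OF assms(1)])
  have c: "carrier (power_module M 0) = {\<zero>\<^bsub>power_module M 0\<^esub>}"
    using module.axioms(2)[OF assms(1)]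
    by (auto simp: power_module_carrier_iff fun_eq_iff abelian_group_def abelian_monoid.zero_closed)
  show ?case unfolding noetherian_module_def
  proof safe
    fix N assume N: "submodule N R (power_module M 0)"
    then have "N = {\<zero>\<^bsub>power_module M 0\<^esub>}" using P.submoduleE(1)[OF N] P.submodule_zero[OF N] c by auto
    moreover have "submodule_generated R (power_module M 0) N = N"
      using submodule_generated_least[OF N order_refl] submodule_generated_incl[of N] by (rule subset_antisym)
    ultimately show "\<exists>A\<subseteq>N. finite A \<and> submodule_generated R (power_module M 0) A = N"
      by (intro exI[of _ N]) simp
  qed
next
  case (Suc m)
  interpret module R M by fact
  interpret P: module R "power_module M (Suc m)" by (rule power_module_module[OF assms(1)])
  interpret Q: module R "power_module M m" by (rule power_module_module[OF assms(1)])
  \<comment> \<open>Additive inverses are defined relative to a carrier, so those of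
    \<open>M^m\<close> and of \<open>M^(m+1)\<close> have to be matched; both are multiplication by
    minus one.\<close>
  have sub_iff: "submodule K R (power_module M m)"
    if K: "submodule K R (power_module M (Suc m))" "K \<subseteq> carrier (power_module M m)" for K
  proof (rule Q.submoduleI)
    note E = P.submoduleE[OF K(1)]
    fix a assume "a \<in> K"
    moreover from this have "\<ominus>\<^bsub>power_module M m\<^esub> a = (\<ominus>\<^bsub>R\<^esub> \<one>\<^bsub>R\<^esub>) \<odot>\<^bsub>power_module M m\<^esub> a"
      using K(2) Q.smult_l_minus[of "\<one>\<^bsub>R\<^esub>" a] Q.smult_one[of a] by (metis R.one_closed subsetD)
    ultimately show "\<ominus>\<^bsub>power_module M m\<^esub> a \<in> K"
      using E(4)[of "\<ominus>\<^bsub>R\<^esub> \<one>\<^bsub>R\<^esub>" a] by simp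
  qed (use K P.submoduleE[OF K(1)] P.submodule_zero[OF K(1)] in auto)
  have hom: "(\<lambda>v. v m) \<in> module_hom R (power_module M (Suc m)) M"
    by (rule module_homI) (auto simp: power_module_carrier_iff)
  show ?case
  proof (rule noetherian_module_extension[OF P.module_axioms assms(1) hom assms(2)])
    fix K assume K: "submodule K R (power_module M (Suc m))"
      and ker: "K \<subseteq> {x \<in> carrier (power_module M (Suc m)). x m = \<zero>\<^bsub>M\<^esub>}"
    have Km: "K \<subseteq> carrier (power_module M m)"
    proof
      fix v assume "v \<in> K"
      then have v: "\<forall>i. v i \<in> carrier M" "\<forall>i\<ge>Suc m. v i = \<zero>\<^bsub>M\<^esub>" "v m = \<zero>\<^bsub>M\<^esub>"
        using ker by (auto simp: power_module_carrier_iff)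
      then have "\<forall>i\<ge>m. v i = \<zero>\<^bsub>M\<^esub>" by (metis le_antisym not_less_eq_eq)
      then show "v \<in> carrier (power_module M m)" using v by (simp add: power_module_carrier_iff)
    qed
    then obtain A where A: "A \<subseteq> K" "finite A" "submodule_generated R (power_module M m) A = K"
      using Suc sub_iff[OF K] by (auto simp: noetherian_module_def)
    let ?G = "submodule_generated R (power_module M (Suc m)) A"
    have GK: "?G \<subseteq> K" by (rule submodule_generated_least[OF K A(1)])
    have "submodule ?G R (power_module M (Suc m))"
      by (rule P.submodule_generated_submodule) (use A(1) P.submoduleE(1)[OF K] in auto)
    then have "submodule ?G R (power_module M m)" using sub_iff GK Km by auto
    then have "K \<subseteq> ?G"
      using submodule_generated_least[OF _ submodule_generated_incl[of A R "power_module M (Suc m)"]] A(3) by metis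
    then show "\<exists>A\<subseteq>K. finite A \<and> submodule_generated R (power_module M (Suc m)) A = K"
      using A GK by (intro exI[of _ A]) auto
  qed
qed

lemma noetherian_free_module:
  assumes "cring R" "noetherian_ring R"
  shows "noetherian_module R (free_module R {..<m::nat})"
  unfolding free_module_eq_power_module
  by (rule noetherian_power_module[OF self_module_module[OF assms(1)] noetherian_ring_self_module[OF assms]])

lemma finitely_generated_cover:
  assumes "module R M" "finitely_generated_module R M"
  obtains n :: nat and g where "g \<in> {..<n} \<rightarrow> carrier M"
    "linear_extension R M g ` carrier (free_module R {..<n}) = carrier M"
proof -
  interpret module R M by fact
  obtain A where A: "A \<subseteq> carrier M" "finite A" "submodule_generated R M A = carrier M"
    using assms(2) by (auto simp: finitely_generated_module_def)
  obtain n :: nat and g where g: "g ` {..<n} = A" using finite_enumeration[OF A(2)] by metis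
  have "g \<in> {..<n} \<rightarrow> carrier M" using A g by auto
  then show thesis using that submodule_generated_image[of g n] g A by auto
qed

lemma noetherian_finitely_generated:
  assumes "cring R" "noetherian_ring R" "module R M" "finitely_generated_module R M"
  shows "noetherian_module R M"
proof -
  obtain n :: nat and g where g: "g \<in> {..<n} \<rightarrow> carrier M"
    "linear_extension R M g ` carrier (free_module R {..<n}) = carrier M"
    using finitely_generated_cover[OF assms(3,4)] .
  show ?thesis
    by (rule noetherian_module_image[OF free_module_module[OF assms(1)] assms(3)
          linear_extension_hom[OF assms(3) g(1)] g(2) noetherian_free_module[OF assms(1,2)]])
qed

text \<open>The kernels of the powers of \<open>a\<close> stabilize, and \<open>a\<^sup>n b\<^sup>n = \<tau>\<^sup>n\<close>.\<close>

lemma kernel_killed_by_power: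
  assumes "module R M" "noetherian_module R M" "a \<in> module_hom R M M" "b \<in> module_hom R M M"
    "\<tau> \<in> carrier R" "\<And>v. v \<in> carrier M \<Longrightarrow> a (b v) = \<tau> \<odot>\<^bsub>M\<^esub> v"
  obtains n :: nat where "\<And>v. v \<in> carrier M \<Longrightarrow> a v = \<zero>\<^bsub>M\<^esub> \<Longrightarrow> (\<tau> [^]\<^bsub>R\<^esub> n) \<odot>\<^bsub>M\<^esub> v = \<zero>\<^bsub>M\<^esub>"
proof -
  interpret module R M by fact
  have an: "a ^^ n \<in> module_hom R M M" for n
    by (induction n) (use module_hom_comp[OF _ assms(3)] in \<open>auto simp: module_hom_id comp_def id_def\<close>)
  have bn: "b ^^ n \<in> module_hom R M M" for n
    by (induction n) (use module_hom_comp[OF _ assms(4)] in \<open>auto simp: module_hom_id comp_def id_def\<close>)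
  have ab: "(a ^^ n) ((b ^^ n) v) = (\<tau> [^]\<^bsub>R\<^esub> n) \<odot>\<^bsub>M\<^esub> v" if "v \<in> carrier M" for n v
    using that
  proof (induction n arbitrary: v)
    case (Suc n)
    have c: "(b ^^ n) v \<in> carrier M" using module_hom_closed[OF bn] Suc.prems by blast
    have "(a ^^ Suc n) ((b ^^ Suc n) v) = (a ^^ n) (a (b ((b ^^ n) v)))"
      by (simp add: funpow_swap1)
    also have "\<dots> = (a ^^ n) (\<tau> \<odot>\<^bsub>M\<^esub> (b ^^ n) v)" using assms(6)[OF c] by simp
    also have "\<dots> = \<tau> \<odot>\<^bsub>M\<^esub> (a ^^ n) ((b ^^ n) v)" by (rule module_hom_smult[OF an assms(5) c])
    also have "\<dots> = \<tau> \<odot>\<^bsub>M\<^esub> ((\<tau> [^]\<^bsub>R\<^esub> n) \<odot>\<^bsub>M\<^esub> v)" using Suc by simp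
    also have "\<dots> = (\<tau> [^]\<^bsub>R\<^esub> Suc n) \<odot>\<^bsub>M\<^esub> v"
      using assms(5) Suc.prems by (simp add: smult_assoc1[symmetric] R.m_comm)
    finally show ?case .
  qed simp
  let ?K = "\<lambda>n. {x \<in> carrier M. (a ^^ n) x \<in> {\<zero>\<^bsub>M\<^esub>}}"
  obtain N where N: "N \<in> range ?K" "\<And>N'. N' \<in> range ?K \<Longrightarrow> N \<subseteq> N' \<Longrightarrow> N' = N"
    using noetherian_module_maximal[OF assms(1,2), of "range ?K"]
      kernel_submodule[OF assms(1,1) an zero_submodule] by blast
  then obtain n where n: "N = ?K n" by blast
  have "?K n \<subseteq> ?K (Suc n)" using module_hom_zero[OF assms(1,1,3)] by auto
  then have eq: "?K (Suc n) = ?K n" using N(2)[of "?K (Suc n)"] n by blast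
  show thesis
  proof (rule that)
    fix v assume v: "v \<in> carrier M" "a v = \<zero>\<^bsub>M\<^esub>"
    \<comment> \<open>Applying \<open>a\<close> once more to \<open>a^n b^n v = \<tau>^n v\<close>
      gives zero, as \<open>a v = 0\<close>. So \<open>b^n v\<close> lies in the kernel of
      \<open>a^(n+1)\<close>, which is that of \<open>a^n\<close>, and
      \<open>\<tau>^n v = a^n b^n v\<close> vanishes.\<close>
    let ?w = "(b ^^ n) v"
    have w: "?w \<in> carrier M" using module_hom_closed[OF bn v(1)] .
    have "(a ^^ Suc n) ?w = a ((\<tau> [^]\<^bsub>R\<^esub> n) \<odot>\<^bsub>M\<^esub> v)" using ab[OF v(1)] by simp
    also have "\<dots> = \<zero>\<^bsub>M\<^esub>" using v module_hom_smult[OF assms(3)] assms(5) by simp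
    finally have "?w \<in> ?K n" using eq w by blast
    then show "(\<tau> [^]\<^bsub>R\<^esub> n) \<odot>\<^bsub>M\<^esub> v = \<zero>\<^bsub>M\<^esub>" using ab[OF v(1)] by simp
  qed
qed

section \<open>Local rings, Nakayama's lemma and finite length\<close>

definition submodule_sum :: "('a, 'm, 'y) module_scheme \<Rightarrow> 'm set \<Rightarrow> 'm set \<Rightarrow> 'm set" where
  "submodule_sum M A B = {x \<oplus>\<^bsub>M\<^esub> y | x y. x \<in> A \<and> y \<in> B}"

lemma (in module) submodule_sum_submodule:
  assumes "submodule A R M" "submodule B R M"
  shows "submodule (submodule_sum M A B) R M"
proof (rule submoduleI)
  note A = submoduleE[OF assms(1)] and B = submoduleE[OF assms(2)]
  have Ac: "\<And>x. x \<in> A \<Longrightarrow> x \<in> carrier M" and Bc: "\<And>x. x \<in> B \<Longrightarrow> x \<in> carrier M"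
    using A(1) B(1) by auto
  show "submodule_sum M A B \<subseteq> carrier M" using Ac Bc by (auto simp: submodule_sum_def)
  show "\<zero>\<^bsub>M\<^esub> \<in> submodule_sum M A B"
    unfolding submodule_sum_def using submodule_zero[OF assms(1)] submodule_zero[OF assms(2)]
    by (intro CollectI exI[of _ "\<zero>\<^bsub>M\<^esub>"]) simp
  show "\<ominus>\<^bsub>M\<^esub> z \<in> submodule_sum M A B" if z: "z \<in> submodule_sum M A B" for z
  proof -
    obtain x y where "x \<in> A" "y \<in> B" "z = x \<oplus>\<^bsub>M\<^esub> y" using z by (auto simp: submodule_sum_def)
    then show ?thesis unfolding submodule_sum_def using A(3) B(3) Ac Bc
      by (intro CollectI exI[of _ "\<ominus>\<^bsub>M\<^esub> x"] exI[of _ "\<ominus>\<^bsub>M\<^esub> y"]) (simp add: M.minus_add)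
  qed
  show "z \<oplus>\<^bsub>M\<^esub> z' \<in> submodule_sum M A B" if z: "z \<in> submodule_sum M A B" "z' \<in> submodule_sum M A B" for z z'
  proof -
    obtain x y where 1: "x \<in> A" "y \<in> B" "z = x \<oplus>\<^bsub>M\<^esub> y" using z by (auto simp: submodule_sum_def)
    obtain x' y' where 2: "x' \<in> A" "y' \<in> B" "z' = x' \<oplus>\<^bsub>M\<^esub> y'" using z by (auto simp: submodule_sum_def)
    have "z \<oplus>\<^bsub>M\<^esub> z' = (x \<oplus>\<^bsub>M\<^esub> x') \<oplus>\<^bsub>M\<^esub> (y \<oplus>\<^bsub>M\<^esub> y')"
      using Ac[OF 1(1)] Ac[OF 2(1)] Bc[OF 1(2)] Bc[OF 2(2)] 1(3) 2(3) by (simp add: M.a_ac)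
    then show ?thesis unfolding submodule_sum_def
      using A(5)[OF 1(1) 2(1)] B(5)[OF 1(2) 2(2)] by blast
  qed
  show "a \<odot>\<^bsub>M\<^esub> z \<in> submodule_sum M A B" if z: "a \<in> carrier R" "z \<in> submodule_sum M A B" for a z
  proof -
    obtain x y where 1: "x \<in> A" "y \<in> B" "z = x \<oplus>\<^bsub>M\<^esub> y" using z by (auto simp: submodule_sum_def)
    have "a \<odot>\<^bsub>M\<^esub> z = a \<odot>\<^bsub>M\<^esub> x \<oplus>\<^bsub>M\<^esub> a \<odot>\<^bsub>M\<^esub> y"
      using smult_r_distr[OF z(1) Ac[OF 1(1)] Bc[OF 1(2)]] 1(3) by simp
    then show ?thesis unfolding submodule_sum_def
      using A(4)[OF z(1) 1(1)] B(4)[OF z(1) 1(2)] by blast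
  qed
qed

lemma submodule_sumI: "x \<in> A \<Longrightarrow> y \<in> B \<Longrightarrow> x \<oplus>\<^bsub>M\<^esub> y \<in> submodule_sum M A B"
  by (auto simp: submodule_sum_def)

lemma submodule_sumE:
  assumes "z \<in> submodule_sum M A B"
  obtains x y where "x \<in> A" "y \<in> B" "z = x \<oplus>\<^bsub>M\<^esub> y"
  using assms by (auto simp: submodule_sum_def)

lemma (in module) submodule_sum_incl1:
  assumes "submodule A R M" "submodule B R M"
  shows "A \<subseteq> submodule_sum M A B"
proof
  fix x assume x: "x \<in> A"
  then have "x = x \<oplus>\<^bsub>M\<^esub> \<zero>\<^bsub>M\<^esub>" using submoduleE(1)[OF assms(1)] by auto
  then show "x \<in> submodule_sum M A B"
    using submodule_sumI[OF x submodule_zero[OF assms(2)], of M] by simp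
qed

lemma (in module) submodule_sum_incl2:
  assumes "submodule A R M" "submodule B R M"
  shows "B \<subseteq> submodule_sum M A B"
proof
  fix x assume x: "x \<in> B"
  then have "x = \<zero>\<^bsub>M\<^esub> \<oplus>\<^bsub>M\<^esub> x" using submoduleE(1)[OF assms(2)] by auto
  then show "x \<in> submodule_sum M A B"
    using submodule_sumI[OF submodule_zero[OF assms(1)] x, of M] by simp
qed

lemma (in module) submodule_sum_least:
  assumes "submodule C R M" "A \<subseteq> C" "B \<subseteq> C"
  shows "submodule_sum M A B \<subseteq> C"
  using assms(2,3) submoduleE(5)[OF assms(1)] by (auto simp: submodule_sum_def)

lemma (in module) submodule_Int:
  assumes "submodule A R M" "submodule B R M"
  shows "submodule (A \<inter> B) R M"
  by (rule submoduleI)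
    (use submoduleE[OF assms(1)] submoduleE[OF assms(2)] submodule_zero[OF assms(1)] submodule_zero[OF assms(2)] in auto)

lemma (in module) eq_plus_diff:
  "x \<in> carrier M \<Longrightarrow> y \<in> carrier M \<Longrightarrow> x = y \<oplus>\<^bsub>M\<^esub> (x \<ominus>\<^bsub>M\<^esub> y)"
  by (simp add: M.minus_eq M.a_lcomm M.r_neg)

lemma (in module) diff_eq:
  "x \<in> carrier M \<Longrightarrow> y \<in> carrier M \<Longrightarrow> z = x \<oplus>\<^bsub>M\<^esub> y \<Longrightarrow> z \<ominus>\<^bsub>M\<^esub> x = y"
  by (simp add: M.minus_eq M.a_comm[of x y] M.a_assoc M.r_neg)

lemma (in module) diff_eq_zero_iff:
  "x \<in> carrier M \<Longrightarrow> y \<in> carrier M \<Longrightarrow> x \<ominus>\<^bsub>M\<^esub> y = \<zero>\<^bsub>M\<^esub> \<longleftrightarrow> x = y"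
  using eq_plus_diff[of x y] by (auto simp: M.minus_eq M.r_neg)

subsection \<open>Nakayama's lemma at a prime\<close>

text \<open>The submodule \<open>U + P v 0 + ... + P v (n - 1)\<close>; the recursion peels off the
  last generator.\<close>

primrec nakayama_filtration ::
  "('a, 'm, 'y) module_scheme \<Rightarrow> 'm set \<Rightarrow> 'a set \<Rightarrow> (nat \<Rightarrow> 'm) \<Rightarrow> nat \<Rightarrow> 'm set" where
  "nakayama_filtration M U P v 0 = U"
| "nakayama_filtration M U P v (Suc n) =
     submodule_sum M (nakayama_filtration M U P v n) ((\<lambda>p. p \<odot>\<^bsub>M\<^esub> v n) ` P)"

lemma (in module) ideal_multiples_submodule:
  assumes "ideal P R" "x \<in> carrier M"
  shows "submodule ((\<lambda>p. p \<odot>\<^bsub>M\<^esub> x) ` P) R M"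
proof -
  have hom: "(\<lambda>p. p \<odot>\<^bsub>M\<^esub> x) \<in> module_hom R (self_module R) M"
    by (rule module_homI) (auto simp: smult_l_distr smult_assoc1 assms)
  show ?thesis
    by (rule image_submodule[OF self_module_module[OF R.is_cring] module_axioms hom])
      (simp add: submodule_self_module_iff[OF R.is_cring] assms)
qed

lemma (in module) nakayama_filtration_submodule:
  assumes "submodule U R M" "ideal P R" "\<And>i. i < n \<Longrightarrow> v i \<in> carrier M"
  shows "submodule (nakayama_filtration M U P v n) R M"
  using assms(3)
  by (induction n) (auto simp: assms(1) intro!: submodule_sum_submodule ideal_multiples_submodule assms(2))

lemma (in module) nakayama_filtration_incl:
  assumes "submodule U R M" "ideal P R" "\<And>i. i < n \<Longrightarrow> v i \<in> carrier M" "m \<le> n"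
  shows "nakayama_filtration M U P v m \<subseteq> nakayama_filtration M U P v n"
  using assms(4,3)
proof (induction n rule: dec_induct)
  case (step n)
  then have "nakayama_filtration M U P v n \<subseteq> nakayama_filtration M U P v (Suc n)"
    unfolding nakayama_filtration.simps
    by (intro submodule_sum_incl1 nakayama_filtration_submodule ideal_multiples_submodule assms) auto
  then show ?case using step by auto
qed simp

lemma (in module) nakayama_filtration_term:
  assumes "submodule U R M" "ideal P R" "\<And>i. i < n \<Longrightarrow> v i \<in> carrier M" "k < n" "p \<in> P"
  shows "p \<odot>\<^bsub>M\<^esub> v k \<in> nakayama_filtration M U P v n"
proof -
  have "(\<lambda>p. p \<odot>\<^bsub>M\<^esub> v k) ` P \<subseteq> nakayama_filtration M U P v (Suc k)"
    unfolding nakayama_filtration.simps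
    by (rule submodule_sum_incl2) (use assms in \<open>auto intro!: nakayama_filtration_submodule ideal_multiples_submodule\<close>)
  moreover have "nakayama_filtration M U P v (Suc k) \<subseteq> nakayama_filtration M U P v n"
    by (rule nakayama_filtration_incl) (use assms in auto)
  ultimately show ?thesis using assms(5) by blast
qed

text \<open>With \<open>P\<close> the maximal ideal of a local ring this is the usual lemma; eliminating the
  generators one at a time avoids determinants.\<close>

lemma (in module) nakayama_at_prime:
  assumes "primeideal P R" "submodule U R M" "\<And>i. i < n \<Longrightarrow> v i \<in> carrier M"
    and "\<And>i. i < n \<Longrightarrow> \<exists>h\<in>carrier R - P. h \<odot>\<^bsub>M\<^esub> v i \<in> nakayama_filtration M U P v n"
  shows "\<exists>t\<in>carrier R - P. \<forall>i<n. t \<odot>\<^bsub>M\<^esub> v i \<in> U"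
  using assms(3,4)
proof (induction n)
  case 0
  interpret P: primeideal P R by fact
  have "\<one>\<^bsub>R\<^esub> \<in> carrier R - P" using P.I_notcarr P.one_imp_carrier by auto
  then show ?case by blast
next
  case (Suc n)
  interpret P: primeideal P R by fact
  let ?W = "nakayama_filtration M U P v"
  have vc: "\<And>i. i < Suc n \<Longrightarrow> v i \<in> carrier M" by (rule Suc.prems(1))
  have W: "submodule (?W n) R M"
    by (rule nakayama_filtration_submodule[OF assms(2) P.is_ideal]) (use vc in auto)
  note WE = submoduleE[OF W]
  have Wc: "\<And>x. x \<in> ?W n \<Longrightarrow> x \<in> carrier M" using WE(1) by auto
  have prod: "a \<otimes>\<^bsub>R\<^esub> b \<in> carrier R - P" if "a \<in> carrier R - P" "b \<in> carrier R - P" for a b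
    using that P.I_prime by auto
  obtain h where h: "h \<in> carrier R - P" "h \<odot>\<^bsub>M\<^esub> v n \<in> ?W (Suc n)" using Suc.prems(2)[of n] by auto
  obtain w p where wp: "w \<in> ?W n" "p \<in> P" "h \<odot>\<^bsub>M\<^esub> v n = w \<oplus>\<^bsub>M\<^esub> p \<odot>\<^bsub>M\<^esub> v n"
    using h(2) by (auto elim!: submodule_sumE)
  have pc: "p \<in> carrier R" using wp(2) P.a_Hcarr by blast
  \<comment> \<open>From \<open>h v_n = w + p v_n\<close> with \<open>p\<close> in \<open>P\<close>
    follows \<open>(h - p) v_n = w\<close>, and \<open>h - p\<close> is still outside
    \<open>P\<close>.\<close>
  let ?h = "h \<ominus>\<^bsub>R\<^esub> p"
  have hn: "?h \<odot>\<^bsub>M\<^esub> v n \<in> ?W n"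
  proof -
    have "?h \<odot>\<^bsub>M\<^esub> v n = h \<odot>\<^bsub>M\<^esub> v n \<oplus>\<^bsub>M\<^esub> \<ominus>\<^bsub>M\<^esub> (p \<odot>\<^bsub>M\<^esub> v n)"
      using h(1) pc vc[of n] by (simp add: R.minus_eq smult_l_distr smult_l_minus)
    also have "\<dots> = w"
      using wp(3) Wc[OF wp(1)] pc vc[of n] by (simp add: M.a_assoc M.r_neg)
    finally show ?thesis using wp(1) by simp
  qed
  have hP: "?h \<in> carrier R - P"
  proof -
    have "?h \<notin> P"
    proof
      assume "?h \<in> P"
      then have "?h \<oplus>\<^bsub>R\<^esub> p \<in> P" using wp(2) by (rule P.a_closed)
      moreover have "?h \<oplus>\<^bsub>R\<^esub> p = h" using h(1) pc by (simp add: R.minus_eq R.a_assoc R.l_neg)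
      ultimately show False using h(1) by simp
    qed
    then show ?thesis using h(1) pc by simp
  qed
  \<comment> \<open>Multiplication by \<open>?h\<close> rewrites the multiple of \<open>v_n\<close>
    in the relation for \<open>v_i\<close> through the earlier terms.\<close>
  have step: "\<exists>h\<in>carrier R - P. h \<odot>\<^bsub>M\<^esub> v i \<in> ?W n" if i: "i < n" for i
  proof -
    obtain g where g: "g \<in> carrier R - P" "g \<odot>\<^bsub>M\<^esub> v i \<in> ?W (Suc n)" using Suc.prems(2)[of i] i by auto
    obtain w q where wq: "w \<in> ?W n" "q \<in> P" "g \<odot>\<^bsub>M\<^esub> v i = w \<oplus>\<^bsub>M\<^esub> q \<odot>\<^bsub>M\<^esub> v n"
      using g(2) by (auto elim!: submodule_sumE)
    have qc: "q \<in> carrier R" using wq(2) P.a_Hcarr by blast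
    have "(?h \<otimes>\<^bsub>R\<^esub> g) \<odot>\<^bsub>M\<^esub> v i = ?h \<odot>\<^bsub>M\<^esub> (w \<oplus>\<^bsub>M\<^esub> q \<odot>\<^bsub>M\<^esub> v n)"
      using hP g(1) vc[of i] i wq(3) by (simp add: smult_assoc1)
    also have "\<dots> = ?h \<odot>\<^bsub>M\<^esub> w \<oplus>\<^bsub>M\<^esub> q \<odot>\<^bsub>M\<^esub> (?h \<odot>\<^bsub>M\<^esub> v n)"
      using hP qc Wc[OF wq(1)] vc[of n]
      by (simp add: smult_r_distr smult_assoc1[symmetric] R.m_comm)
    also have "\<dots> \<in> ?W n"
      using WE(4,5) hn hP wq(1) qc by auto
    finally show ?thesis using prod[OF hP g(1)] by blast
  qed
  obtain t where t: "t \<in> carrier R - P" "\<And>i. i < n \<Longrightarrow> t \<odot>\<^bsub>M\<^esub> v i \<in> U"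
    using Suc.IH[OF _ step] vc by auto
  note UE = submoduleE[OF assms(2)]
  \<comment> \<open>Since \<open>t\<close> takes every earlier generator into \<open>U\<close>, it
    takes the whole filtration there, in particular the relation for \<open>v_n\<close>.\<close>
  have tW: "t \<odot>\<^bsub>M\<^esub> x \<in> U" if x: "x \<in> ?W k" and k: "k \<le> n" for x k
    using x k
  proof (induction k arbitrary: x)
    case 0
    then show ?case using t(1) UE(4) by auto
  next
    case (Suc k)
    have vk: "v k \<in> carrier M" using vc Suc.prems(2) by simp
    obtain w q where wq: "w \<in> ?W k" "q \<in> P" "x = w \<oplus>\<^bsub>M\<^esub> q \<odot>\<^bsub>M\<^esub> v k"
      using Suc.prems(1) by (auto elim!: submodule_sumE)
    have qc: "q \<in> carrier R" using wq(2) P.a_Hcarr by blast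
    have wc: "w \<in> carrier M"
      using wq(1) nakayama_filtration_incl[OF assms(2) P.is_ideal, of n v k] vc Suc.prems(2) Wc by auto
    have "t \<odot>\<^bsub>M\<^esub> x = t \<odot>\<^bsub>M\<^esub> w \<oplus>\<^bsub>M\<^esub> q \<odot>\<^bsub>M\<^esub> (t \<odot>\<^bsub>M\<^esub> v k)"
      using wq(3) wc qc vk t(1) by (simp add: smult_r_distr smult_assoc1[symmetric] R.m_comm)
    then show ?case using Suc.IH[OF wq(1)] Suc.prems(2) t(2)[of k] qc UE(4,5) by auto
  qed
  have "(?h \<otimes>\<^bsub>R\<^esub> t) \<odot>\<^bsub>M\<^esub> v i \<in> U" if "i < Suc n" for i
  proof (cases "i = n")
    case True
    have "(?h \<otimes>\<^bsub>R\<^esub> t) \<odot>\<^bsub>M\<^esub> v n = t \<odot>\<^bsub>M\<^esub> (?h \<odot>\<^bsub>M\<^esub> v n)"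
      using hP t(1) vc[of n] by (simp add: smult_assoc1[symmetric] R.m_comm)
    then show ?thesis using tW[OF hn] True by simp
  next
    case False
    then have "i < n" using that by simp
    then have "(?h \<otimes>\<^bsub>R\<^esub> t) \<odot>\<^bsub>M\<^esub> v i = ?h \<odot>\<^bsub>M\<^esub> (t \<odot>\<^bsub>M\<^esub> v i)" using hP t(1) vc[of i] by (simp add: smult_assoc1)
    then show ?thesis using t(2)[OF \<open>i < n\<close>] hP UE(4) by auto
  qed
  then show ?case using prod[OF hP t(1)] by blast
qed

subsection \<open>Chains of submodules\<close>

text \<open>The number counts the strict inclusions of a chain that ends in \<open>Y\<close>. Its
  first member only has to contain \<open>W\<close>, which makes the notion monotone at both ends.
  The largest possible number is the length of \<open>Y / W\<close>, so lengths are compared without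
  forming quotients.\<close>

inductive submodule_chain ::
  "('a, 'x) ring_scheme \<Rightarrow> ('a, 'm, 'y) module_scheme \<Rightarrow> 'm set \<Rightarrow> 'm set \<Rightarrow> nat \<Rightarrow> bool"
  for R M W where
  chain_base: "submodule Y R M \<Longrightarrow> W \<subseteq> Y \<Longrightarrow> submodule_chain R M W Y 0"
| chain_step: "submodule_chain R M W Y n \<Longrightarrow> submodule Z R M \<Longrightarrow> Y \<subset> Z \<Longrightarrow> submodule_chain R M W Z (Suc n)"

lemma submodule_chainD:
  "submodule_chain R M W Y n \<Longrightarrow> submodule Y R M \<and> W \<subseteq> Y"
  by (induction rule: submodule_chain.induct) auto

lemma submodule_chain_mono:
  assumes "submodule_chain R M W Y n" "submodule Z R M" "Y \<subseteq> Z"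
  shows "submodule_chain R M W Z n"
  using assms(1)
proof cases
  case chain_base
  then show ?thesis using assms by (auto intro!: submodule_chain.chain_base)
next
  case (chain_step Y' m)
  then show ?thesis using assms by (auto intro!: submodule_chain.chain_step[of R M W Y' m Z])
qed

lemma submodule_chain_trans:
  assumes "submodule_chain R M W Y n" "submodule_chain R M Y Z m"
  shows "submodule_chain R M W Z (n + m)"
  using assms(2)
proof (induction rule: submodule_chain.induct)
  case (chain_base Z)
  then show ?case using submodule_chain_mono[OF assms(1)] by simp
next
  case (chain_step Z m Z')
  then show ?case by (auto intro: submodule_chain.chain_step)
qed

text \<open>By modularity a proper step \<open>Y \<subset> Z\<close> stays proper in \<open>Y \<inter> V\<close> or in \<open>Y + V\<close>.\<close>

lemma (in module) submodule_chain_split: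
  assumes "submodule_chain R M W Y n" "submodule V R M" "W \<subseteq> V"
  shows "\<exists>p q. n \<le> p + q \<and> submodule_chain R M W (Y \<inter> V) p \<and> submodule_chain R M V (submodule_sum M V Y) q"
  using assms(1)
proof (induction rule: submodule_chain.induct)
  case (chain_base Y)
  have "submodule_chain R M W (Y \<inter> V) 0"
    by (rule submodule_chain.chain_base) (use chain_base assms submodule_Int in auto)
  moreover have "submodule_chain R M V (submodule_sum M V Y) 0"
    by (rule submodule_chain.chain_base)
      (use chain_base assms submodule_sum_submodule submodule_sum_incl1 in auto)
  ultimately show ?case by fastforce
next
  case (chain_step Y n Z)
  then obtain p q where pq: "n \<le> p + q" "submodule_chain R M W (Y \<inter> V) p"
    "submodule_chain R M V (submodule_sum M V Y) q" by blast
  have Y: "submodule Y R M" using submodule_chainD[OF chain_step.hyps(1)] by simp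
  note Z = chain_step.hyps(2)
  have Zc: "\<And>z. z \<in> Z \<Longrightarrow> z \<in> carrier M" and Vc: "\<And>z. z \<in> V \<Longrightarrow> z \<in> carrier M"
    using submoduleE(1)[OF Z] submoduleE(1)[OF assms(2)] by auto
  have ZV: "submodule (Z \<inter> V) R M" and sV: "submodule (submodule_sum M V Z) R M"
    using submodule_Int[OF Z assms(2)] submodule_sum_submodule[OF assms(2) Z] by auto
  have sub: "submodule_sum M V Y \<subseteq> submodule_sum M V Z"
    using chain_step.hyps(3) by (auto simp: submodule_sum_def)
  consider "Y \<inter> V \<subset> Z \<inter> V" | "Y \<inter> V = Z \<inter> V" using chain_step.hyps(3) by blast
  then show ?case
  proof cases
    case 1
    have "submodule_chain R M W (Z \<inter> V) (Suc p)" by (rule submodule_chain.chain_step[OF pq(2) ZV 1])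
    moreover have "submodule_chain R M V (submodule_sum M V Z) q" by (rule submodule_chain_mono[OF pq(3) sV sub])
    ultimately show ?thesis using pq(1) by (intro exI[of _ "Suc p"] exI[of _ q]) auto
  next
    case 2
    have "submodule_sum M V Y \<noteq> submodule_sum M V Z"
    proof
      assume eq: "submodule_sum M V Y = submodule_sum M V Z"
      obtain z where z: "z \<in> Z" "z \<notin> Y" using chain_step.hyps(3) by blast
      have "z \<in> submodule_sum M V Y" using submodule_sum_incl2[OF assms(2) Z] z(1) eq by blast
      then obtain v y where vy: "v \<in> V" "y \<in> Y" "z = v \<oplus>\<^bsub>M\<^esub> y" by (rule submodule_sumE)
      have yZ: "y \<in> Z" using vy(2) chain_step.hyps(3) by blast
      have "z \<ominus>\<^bsub>M\<^esub> y = v" using diff_eq[of y v z] vy(3) Zc[OF yZ] Vc[OF vy(1)] by (simp add: M.a_comm)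
      then have "v \<in> Z" using submodule_minus[OF Z z(1) yZ] by simp
      then have "v \<in> Y" using vy(1) 2 by blast
      then show False using z(2) vy(2,3) submoduleE(5)[OF Y] by blast
    qed
    then have "submodule_chain R M V (submodule_sum M V Z) (Suc q)"
      using sub by (intro submodule_chain.chain_step[OF pq(3) sV]) blast
    moreover have "submodule_chain R M W (Z \<inter> V) p" using pq(2) 2 by simp
    ultimately show ?thesis using pq(1) by (intro exI[of _ p] exI[of _ "Suc q"]) auto
  qed
qed

text \<open>Above the preimage of \<open>U\<close> nothing is lost under
  \<open>Y \<mapsto> U + b(Y)\<close>: if \<open>b z = u + b y\<close>, then \<open>z - y\<close>
  lies in that preimage, hence in \<open>Y\<close>. So \<open>M\<close> modulo the preimage is at
  most as long as \<open>U + b(M)\<close> modulo \<open>U\<close>.\<close>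

lemma submodule_chain_push:
  assumes "module R M" "b \<in> module_hom R M M" "submodule U R M"
    and "submodule_chain R M {v \<in> carrier M. b v \<in> U} Y n"
  shows "submodule_chain R M U (submodule_sum M U (b ` Y)) n"
  using assms(4)
proof (induction rule: submodule_chain.induct)
  interpret module R M by fact
  case (chain_base Y)
  then show ?case
    by (intro submodule_chain.chain_base submodule_sum_submodule submodule_sum_incl1 assms(3)
        image_submodule[OF assms(1,1,2)])
next
  interpret module R M by fact
  case (chain_step Y n Z)
  have Y: "submodule Y R M" "{v \<in> carrier M. b v \<in> U} \<subseteq> Y"
    using submodule_chainD[OF chain_step.hyps(1)] by auto
  have Zc: "\<And>z. z \<in> Z \<Longrightarrow> z \<in> carrier M" and Uc: "\<And>z. z \<in> U \<Longrightarrow> z \<in> carrier M"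
    using submoduleE(1)[OF chain_step.hyps(2)] submoduleE(1)[OF assms(3)] by auto
  have "submodule_sum M U (b ` Y) \<noteq> submodule_sum M U (b ` Z)"
  proof
    assume eq: "submodule_sum M U (b ` Y) = submodule_sum M U (b ` Z)"
    obtain z where z: "z \<in> Z" "z \<notin> Y" using chain_step.hyps(3) by blast
    have "b z \<in> submodule_sum M U (b ` Z)"
      using submodule_sum_incl2[OF assms(3) image_submodule[OF assms(1,1,2) chain_step.hyps(2)]] z(1) by blast
    then obtain u y where uy: "u \<in> U" "y \<in> Y" "b z = u \<oplus>\<^bsub>M\<^esub> b y" unfolding eq[symmetric] by (auto elim!: submodule_sumE)
    have c: "z \<in> carrier M" "y \<in> carrier M" using Zc z(1) uy(2) chain_step.hyps(3) by auto
    have "b (z \<ominus>\<^bsub>M\<^esub> y) = u"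
      using module_hom_minus[OF assms(1,1,2) c] diff_eq[of "b y" u "b z"] uy module_hom_closed[OF assms(2) c(2)] Uc
      by (simp add: M.a_comm)
    then have "z \<ominus>\<^bsub>M\<^esub> y \<in> Y" using Y(2) uy(1) c by auto
    then have "y \<oplus>\<^bsub>M\<^esub> (z \<ominus>\<^bsub>M\<^esub> y) \<in> Y" using submoduleE(5)[OF Y(1) uy(2)] by blast
    then show False using eq_plus_diff[OF c] z(2) by simp
  qed
  moreover have "submodule_sum M U (b ` Y) \<subseteq> submodule_sum M U (b ` Z)"
    using chain_step.hyps(3) by (auto simp: submodule_sum_def)
  ultimately show ?case
    by (intro submodule_chain.chain_step[OF chain_step.IH] submodule_sum_submodule assms(3)
        image_submodule[OF assms(1,1,2)] chain_step.hyps(2)) blast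
qed

text \<open>Below \<open>U + a(M)\<close> every element is some \<open>a v\<close> up to
  \<open>U\<close>, so a strict inclusion above \<open>U\<close> is witnessed by a value of
  \<open>a\<close> and survives in the preimages.\<close>

lemma submodule_chain_pull:
  assumes "module R M" "a \<in> module_hom R M M" "submodule U R M"
    and "submodule_chain R M U Y n" "Y \<subseteq> submodule_sum M U (a ` carrier M)"
  shows "submodule_chain R M {v \<in> carrier M. a v \<in> U} {v \<in> carrier M. a v \<in> Y} n"
  using assms(4,5)
proof (induction rule: submodule_chain.induct)
  case (chain_base Y)
  then show ?case
    by (intro submodule_chain.chain_base kernel_submodule[OF assms(1,1,2)]) auto
next
  interpret module R M by fact
  case (chain_step Y n Z)
  have Y: "submodule Y R M" "U \<subseteq> Y"
    using submodule_chainD[OF chain_step.hyps(1)] by auto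
  have IH: "submodule_chain R M {v \<in> carrier M. a v \<in> U} {v \<in> carrier M. a v \<in> Y} n"
    using chain_step by blast
  obtain z where z: "z \<in> Z" "z \<notin> Y" using chain_step.hyps(3) by blast
  then have "z \<in> submodule_sum M U (a ` carrier M)" using chain_step.prems by blast
  then obtain u v where uv: "u \<in> U" "v \<in> carrier M" "z = u \<oplus>\<^bsub>M\<^esub> a v" by (auto elim!: submodule_sumE)
  have "u \<in> carrier M" using uv(1) submoduleE(1)[OF assms(3)] by blast
  then have "z \<ominus>\<^bsub>M\<^esub> u = a v" using diff_eq[OF _ _ uv(3)] module_hom_closed[OF assms(2) uv(2)] by blast
  moreover have "u \<in> Z" using uv(1) Y(2) chain_step.hyps(3) by blast
  ultimately have "a v \<in> Z" using submodule_minus[OF chain_step.hyps(2) z(1)] by metis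
  moreover have "a v \<notin> Y" using uv Y submoduleE(5)[OF Y(1)] z(2) by blast
  ultimately have "{v \<in> carrier M. a v \<in> Y} \<subset> {v \<in> carrier M. a v \<in> Z}"
    using chain_step.hyps(3) uv(2) by blast
  then show ?case
    by (intro submodule_chain.chain_step[OF IH] kernel_submodule[OF assms(1,1,2)] chain_step.hyps(2))
qed

subsection \<open>Noetherian local rings of dimension one\<close>

lemma noetherian_ideal_maximal:
  assumes "cring R" "noetherian_ring R" "\<C> \<noteq> {}" "\<And>N. N \<in> \<C> \<Longrightarrow> ideal N R"
  obtains N where "N \<in> \<C>" "\<And>N'. N' \<in> \<C> \<Longrightarrow> N \<subseteq> N' \<Longrightarrow> N' = N"
proof -
  have "\<And>N. N \<in> \<C> \<Longrightarrow> submodule N R (self_module R)"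
    using assms(4) by (simp add: submodule_self_module_iff[OF assms(1)])
  then show thesis
    using noetherian_module_maximal[OF self_module_module noetherian_ring_self_module, OF assms(1,1,2,3)] that
    by blast
qed

lemma ideal_sum_principal:
  assumes "cring R" "ideal I R" "a \<in> carrier R"
  obtains J where "ideal J R" "I \<subseteq> J" "a \<in> J"
    "\<And>z. z \<in> J \<Longrightarrow> \<exists>p\<in>I. \<exists>r\<in>carrier R. z = p \<oplus>\<^bsub>R\<^esub> r \<otimes>\<^bsub>R\<^esub> a"
proof -
  interpret cring R by fact
  interpret S: module R "self_module R" by (rule self_module_module[OF assms(1)])
  let ?B = "(\<lambda>r. r \<otimes>\<^bsub>R\<^esub> a) ` carrier R"
  let ?J = "submodule_sum (self_module R) I ?B"
  have I: "submodule I R (self_module R)" using assms by (simp add: submodule_self_module_iff)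
  have B: "submodule ?B R (self_module R)"
    using S.ideal_multiples_submodule[OF oneideal, of a] assms(3) by simp
  have "submodule ?J R (self_module R)" by (rule S.submodule_sum_submodule[OF I B])
  then have "ideal ?J R" using assms by (simp add: submodule_self_module_iff)
  moreover have "I \<subseteq> ?J" by (rule S.submodule_sum_incl1[OF I B])
  moreover have "a \<in> ?J"
    using S.submodule_sum_incl2[OF I B] assms(3) by (metis (no_types, lifting) image_eqI l_one one_closed subsetD)
  moreover have "\<exists>p\<in>I. \<exists>r\<in>carrier R. z = p \<oplus>\<^bsub>R\<^esub> r \<otimes>\<^bsub>R\<^esub> a" if zJ: "z \<in> ?J" for z
  proof -
    obtain x y where xy: "x \<in> I" "y \<in> ?B" "z = x \<oplus>\<^bsub>self_module R\<^esub> y" by (rule submodule_sumE[OF zJ])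
    then obtain r where "r \<in> carrier R" "y = r \<otimes>\<^bsub>R\<^esub> a" by auto
    then show ?thesis using xy by (intro bexI[of _ x] bexI[of _ r]) auto
  qed
  ultimately show thesis by (rule that)
qed

text \<open>A maximal member of the ideals that contain \<open>I\<close> and miss \<open>T\<close>
  is prime: if \<open>P + R a\<close> and \<open>P + R b\<close> both meet \<open>T\<close>, the
  product of two such elements lies in \<open>T\<close> and in \<open>P + R a b\<close>.\<close>

lemma prime_avoiding_multiplicative_set:
  assumes "cring R" "noetherian_ring R" "T \<subseteq> carrier R" "\<one>\<^bsub>R\<^esub> \<in> T"
    and mult: "\<And>s t. s \<in> T \<Longrightarrow> t \<in> T \<Longrightarrow> s \<otimes>\<^bsub>R\<^esub> t \<in> T"
    and "ideal I R" "I \<inter> T = {}"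
  obtains P where "primeideal P R" "I \<subseteq> P" "P \<inter> T = {}"
proof -
  interpret cring R by fact
  let ?C = "{J. ideal J R \<and> I \<subseteq> J \<and> J \<inter> T = {}}"
  have "?C \<noteq> {}" using assms(6,7) by blast
  then obtain P where P: "P \<in> ?C" "\<And>N'. N' \<in> ?C \<Longrightarrow> P \<subseteq> N' \<Longrightarrow> N' = P"
    using noetherian_ideal_maximal[OF assms(1,2), of ?C] by blast
  interpret P: ideal P R using P(1) by blast
  have big: "\<exists>p\<in>P. \<exists>r\<in>carrier R. p \<oplus>\<^bsub>R\<^esub> r \<otimes>\<^bsub>R\<^esub> a \<in> T" if a: "a \<in> carrier R" "a \<notin> P" for a
  proof -
    obtain J where J: "ideal J R" "P \<subseteq> J" "a \<in> J"
      "\<And>z. z \<in> J \<Longrightarrow> \<exists>p\<in>P. \<exists>r\<in>carrier R. z = p \<oplus>\<^bsub>R\<^esub> r \<otimes>\<^bsub>R\<^esub> a"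
      using ideal_sum_principal[OF assms(1) P.is_ideal a(1)] by blast
    have "J \<inter> T \<noteq> {}" using P J(1-3) a(2) by blast
    then show ?thesis using J(4) by blast
  qed
  have "primeideal P R"
  proof (rule primeidealI[OF P.is_ideal assms(1)])
    show "carrier R \<noteq> P" using P(1) assms(4) by blast
    fix a b assume ab: "a \<in> carrier R" "b \<in> carrier R" "a \<otimes>\<^bsub>R\<^esub> b \<in> P"
    show "a \<in> P \<or> b \<in> P"
    proof (rule ccontr)
      assume "\<not> (a \<in> P \<or> b \<in> P)"
      then obtain p r q s where 1: "p \<in> P" "r \<in> carrier R" "p \<oplus>\<^bsub>R\<^esub> r \<otimes>\<^bsub>R\<^esub> a \<in> T"
        and 2: "q \<in> P" "s \<in> carrier R" "q \<oplus>\<^bsub>R\<^esub> s \<otimes>\<^bsub>R\<^esub> b \<in> T"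
        using big[OF ab(1)] big[OF ab(2)] by blast
      have c: "p \<in> carrier R" "q \<in> carrier R" using 1 2 P.a_Hcarr by auto
      have "(p \<oplus>\<^bsub>R\<^esub> r \<otimes>\<^bsub>R\<^esub> a) \<otimes>\<^bsub>R\<^esub> (q \<oplus>\<^bsub>R\<^esub> s \<otimes>\<^bsub>R\<^esub> b) =
          p \<otimes>\<^bsub>R\<^esub> (q \<oplus>\<^bsub>R\<^esub> s \<otimes>\<^bsub>R\<^esub> b) \<oplus>\<^bsub>R\<^esub> ((r \<otimes>\<^bsub>R\<^esub> a) \<otimes>\<^bsub>R\<^esub> q \<oplus>\<^bsub>R\<^esub> (r \<otimes>\<^bsub>R\<^esub> s) \<otimes>\<^bsub>R\<^esub> (a \<otimes>\<^bsub>R\<^esub> b))"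
        using c ab 1(2) 2(2) by algebra
      also have "\<dots> \<in> P"
      proof (intro P.a_closed)
        show "p \<otimes>\<^bsub>R\<^esub> (q \<oplus>\<^bsub>R\<^esub> s \<otimes>\<^bsub>R\<^esub> b) \<in> P" using c ab 2(2) by (intro P.I_r_closed 1(1)) auto
        show "(r \<otimes>\<^bsub>R\<^esub> a) \<otimes>\<^bsub>R\<^esub> q \<in> P" using ab 1(2) by (intro P.I_l_closed 2(1)) auto
        show "(r \<otimes>\<^bsub>R\<^esub> s) \<otimes>\<^bsub>R\<^esub> (a \<otimes>\<^bsub>R\<^esub> b) \<in> P" using 1(2) 2(2) by (intro P.I_l_closed ab(3)) auto
      qed
      finally show False using mult[OF 1(3) 2(3)] P(1) by blast
    qed
  qed
  then show thesis using P(1) that by blast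
qed

lemma noetherian_local_ringD:
  assumes "noetherian_local_ring R \<mm>"
  shows "cring R" "noetherian_ring R" "maximalideal \<mm> R" "ideal \<mm> R" "primeideal \<mm> R"
  using assms maximalideal.is_maximalideal[of \<mm> R] cring.maximalideal_prime[of R \<mm>]
  by (auto simp: noetherian_local_ring_def maximalideal_def)

text \<open>An element without inverse generates a proper ideal; an ideal maximal among those that
  contain it and miss 1 is a maximal ideal, hence \<open>\<mm>\<close>.\<close>

lemma local_ring_inverse:
  assumes "noetherian_local_ring R \<mm>" "r \<in> carrier R" "r \<notin> \<mm>"
  obtains s where "s \<in> carrier R" "s \<otimes>\<^bsub>R\<^esub> r = \<one>\<^bsub>R\<^esub>"
proof (rule ccontr)
  note L = noetherian_local_ringD[OF assms(1)]
  interpret cring R by (rule L)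
  assume "\<not> thesis"
  then have no: "\<And>s. s \<in> carrier R \<Longrightarrow> s \<otimes>\<^bsub>R\<^esub> r \<noteq> \<one>\<^bsub>R\<^esub>" using that by blast
  let ?C = "{J. ideal J R \<and> r \<in> J \<and> \<one>\<^bsub>R\<^esub> \<notin> J}"
  obtain J where J: "ideal J R" "r \<in> J" "\<And>z. z \<in> J \<Longrightarrow> \<exists>p\<in>{\<zero>\<^bsub>R\<^esub>}. \<exists>s\<in>carrier R. z = p \<oplus>\<^bsub>R\<^esub> s \<otimes>\<^bsub>R\<^esub> r"
    using ideal_sum_principal[OF L(1) zeroideal assms(2)] by blast
  have "\<one>\<^bsub>R\<^esub> \<notin> J"
  proof
    assume "\<one>\<^bsub>R\<^esub> \<in> J"
    then obtain s where s: "s \<in> carrier R" "\<one>\<^bsub>R\<^esub> = \<zero>\<^bsub>R\<^esub> \<oplus>\<^bsub>R\<^esub> s \<otimes>\<^bsub>R\<^esub> r" using J(3) by blast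
    then have "\<one>\<^bsub>R\<^esub> = s \<otimes>\<^bsub>R\<^esub> r" using assms(2) s(1) l_zero[OF m_closed] by simp
    then show False using no[OF s(1)] by simp
  qed
  then have "?C \<noteq> {}" using J by blast
  then obtain N where N: "N \<in> ?C" "\<And>N'. N' \<in> ?C \<Longrightarrow> N \<subseteq> N' \<Longrightarrow> N' = N"
    using noetherian_ideal_maximal[OF L(1,2), of ?C] by blast
  then interpret N: ideal N R by blast
  have "maximalideal N R"
  proof (rule maximalidealI[OF N.is_ideal])
    show "carrier R \<noteq> N" using N(1) by blast
    fix K assume K: "ideal K R" "N \<subseteq> K" "K \<subseteq> carrier R"
    interpret K: ideal K R by fact
    show "K = N \<or> K = carrier R"
      using N(2)[of K] N(1) K K.one_imp_carrier by blast
  qed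
  then have "N = \<mm>" using assms(1) by (auto simp: noetherian_local_ring_def)
  then show False using N(1) assms(3) by blast
qed

lemma proper_ideal_subset_maximal:
  assumes "noetherian_local_ring R \<mm>" "ideal I R" "\<one>\<^bsub>R\<^esub> \<notin> I"
  shows "I \<subseteq> \<mm>"
proof
  interpret I: ideal I R by fact
  fix r assume r: "r \<in> I"
  show "r \<in> \<mm>"
  proof (rule ccontr)
    assume "r \<notin> \<mm>"
    then obtain s where "s \<in> carrier R" "s \<otimes>\<^bsub>R\<^esub> r = \<one>\<^bsub>R\<^esub>"
      using local_ring_inverse[OF assms(1)] I.a_Hcarr[OF r] by blast
    then show False using I.I_l_closed[OF r] assms(3) by metis
  qed
qed

lemma no_prime_chain:
  assumes "krull_dim R = 1" "primeideal P R" "primeideal Q R" "primeideal \<mm> R" "P \<subset> Q" "Q \<subset> \<mm>"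
  shows False
proof -
  define C where "C = (\<lambda>i::nat. if i = 0 then P else if i = 1 then Q else \<mm>)"
  have "(\<forall>i\<le>2. primeideal (C i) R) \<and> (\<forall>i<2. C i \<subset> C (Suc i))"
    using assms by (auto simp: C_def less_2_cases_iff)
  then have "enat 2 \<le> krull_dim R"
    unfolding krull_dim_def by (intro Sup_upper) blast
  then show False using assms(1) by (simp add: one_enat_def)
qed

lemma nonzerodivisor_power:
  assumes "cring R" "y \<in> nonzerodivisors R" "s \<in> carrier R" "y [^]\<^bsub>R\<^esub> (k::nat) \<otimes>\<^bsub>R\<^esub> s = \<zero>\<^bsub>R\<^esub>"
  shows "s = \<zero>\<^bsub>R\<^esub>"
  using assms(4)
proof (induction k)
  case 0
  interpret cring R by fact
  show ?case using 0 assms(3) by simp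
next
  case (Suc k)
  interpret cring R by fact
  have y: "y \<in> carrier R" using assms(2) by (simp add: nonzerodivisors_def)
  have "y \<otimes>\<^bsub>R\<^esub> (y [^]\<^bsub>R\<^esub> k \<otimes>\<^bsub>R\<^esub> s) = y [^]\<^bsub>R\<^esub> Suc k \<otimes>\<^bsub>R\<^esub> s"
    using y assms(3) by (simp add: m_assoc[symmetric] m_comm)
  then have "y [^]\<^bsub>R\<^esub> k \<otimes>\<^bsub>R\<^esub> s = \<zero>\<^bsub>R\<^esub>"
    using Suc.prems assms(2,3) y by (simp add: nonzerodivisors_def)
  then show ?case by (rule Suc.IH)
qed

text \<open>If no power of \<open>r\<close> were a multiple of \<open>y\<close>, some prime
  \<open>P\<close> would contain \<open>y\<close> and miss all powers of \<open>r\<close>, hence be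
  smaller than \<open>\<mm>\<close>. A non zero-divisor lies in no minimal prime, so below
  \<open>P\<close> there is a further prime \<open>Q\<close>, too many for dimension one.\<close>

lemma nilpotent_mod_nonzerodivisor:
  assumes "noetherian_local_ring R \<mm>" "krull_dim R = 1" "y \<in> nonzerodivisors R" "r \<in> \<mm>"
  obtains k :: nat and c where "c \<in> carrier R" "r [^]\<^bsub>R\<^esub> k = y \<otimes>\<^bsub>R\<^esub> c"
proof (rule ccontr)
  note L = noetherian_local_ringD[OF assms(1)]
  interpret cring R by (rule L)
  interpret \<mm>: primeideal \<mm> R by (rule L)
  assume "\<not> thesis"
  then have no: "\<And>c k. c \<in> carrier R \<Longrightarrow> r [^]\<^bsub>R\<^esub> (k::nat) \<noteq> y \<otimes>\<^bsub>R\<^esub> c" using that by blast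
  have y: "y \<in> carrier R" using assms(3) by (simp add: nonzerodivisors_def)
  have r: "r \<in> carrier R" using assms(4) \<mm>.a_Hcarr by blast
  obtain J where J: "ideal J R" "y \<in> J" "\<And>z. z \<in> J \<Longrightarrow> \<exists>p\<in>{\<zero>\<^bsub>R\<^esub>}. \<exists>s\<in>carrier R. z = p \<oplus>\<^bsub>R\<^esub> s \<otimes>\<^bsub>R\<^esub> y"
    using ideal_sum_principal[OF L(1) zeroideal y] by blast
  let ?T = "range (\<lambda>k::nat. r [^]\<^bsub>R\<^esub> k)"
  have disj: "J \<inter> ?T = {}"
  proof (rule equals0I)
    fix z assume "z \<in> J \<inter> ?T"
    then obtain k s where "z = r [^]\<^bsub>R\<^esub> (k::nat)" "s \<in> carrier R" "z = \<zero>\<^bsub>R\<^esub> \<oplus>\<^bsub>R\<^esub> s \<otimes>\<^bsub>R\<^esub> y" using J(3) by blast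
    then show False using no[of s k] y by (simp add: m_comm)
  qed
  have Tc: "?T \<subseteq> carrier R" using r by auto
  have T1: "\<one>\<^bsub>R\<^esub> \<in> ?T" by (rule range_eqI[of _ _ 0]) simp
  have Tm: "s \<otimes>\<^bsub>R\<^esub> t \<in> ?T" if "s \<in> ?T" "t \<in> ?T" for s t
    using that r by (auto simp: nat_pow_mult)
  obtain P where P: "primeideal P R" "J \<subseteq> P" "P \<inter> ?T = {}"
    by (rule prime_avoiding_multiplicative_set[OF L(1,2) Tc T1 Tm J(1) disj])
  interpret P: primeideal P R by fact
  have "r \<notin> P" using P(3) r by (metis (no_types) disjoint_iff nat_pow_eone rangeI)
  have one: "\<one>\<^bsub>R\<^esub> \<notin> P" using P(3) \<open>\<one>\<^bsub>R\<^esub> \<in> ?T\<close> by blast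
  have "P \<subset> \<mm>" using proper_ideal_subset_maximal[OF assms(1) P.is_ideal one] assms(4) \<open>r \<notin> P\<close> by blast
  \<comment> \<open>A prime that misses these products is the desired \<open>Q\<close>: the exponent
    0 forces it into \<open>P\<close>, and \<open>s = 1\<close> keeps \<open>y\<close> out of it.
    Zero is not such a product because \<open>y\<close> is regular and \<open>s\<close> lies outside
    \<open>P\<close>.\<close>
  let ?T' = "{y [^]\<^bsub>R\<^esub> k \<otimes>\<^bsub>R\<^esub> s | (k::nat) s. s \<in> carrier R - P}"
  have disj': "{\<zero>\<^bsub>R\<^esub>} \<inter> ?T' = {}"
  proof (rule equals0I)
    fix z assume "z \<in> {\<zero>\<^bsub>R\<^esub>} \<inter> ?T'"
    then obtain k s where "s \<in> carrier R - P" "y [^]\<^bsub>R\<^esub> (k::nat) \<otimes>\<^bsub>R\<^esub> s = \<zero>\<^bsub>R\<^esub>" by auto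
    then show False using nonzerodivisor_power[OF L(1) assms(3), of s k] P.zero_closed by auto
  qed
  have Tc': "?T' \<subseteq> carrier R" using y by auto
  have T1': "\<one>\<^bsub>R\<^esub> \<in> ?T'"
    using one y by (intro CollectI exI[of _ "0::nat"] exI[of _ "\<one>\<^bsub>R\<^esub>"]) simp
  have Tm': "s \<otimes>\<^bsub>R\<^esub> t \<in> ?T'" if st: "s \<in> ?T'" "t \<in> ?T'" for s t
  proof -
    obtain k s' where 1: "s' \<in> carrier R - P" "s = y [^]\<^bsub>R\<^esub> (k::nat) \<otimes>\<^bsub>R\<^esub> s'" using st(1) by blast
    obtain l t' where 2: "t' \<in> carrier R - P" "t = y [^]\<^bsub>R\<^esub> (l::nat) \<otimes>\<^bsub>R\<^esub> t'" using st(2) by blast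
    have "s \<otimes>\<^bsub>R\<^esub> t = (y [^]\<^bsub>R\<^esub> k \<otimes>\<^bsub>R\<^esub> y [^]\<^bsub>R\<^esub> l) \<otimes>\<^bsub>R\<^esub> (s' \<otimes>\<^bsub>R\<^esub> t')"
      using 1 2 y by (simp add: m_ac)
    then have "s \<otimes>\<^bsub>R\<^esub> t = y [^]\<^bsub>R\<^esub> (k + l) \<otimes>\<^bsub>R\<^esub> (s' \<otimes>\<^bsub>R\<^esub> t')" using y by (simp add: nat_pow_mult)
    moreover have "s' \<otimes>\<^bsub>R\<^esub> t' \<in> carrier R - P" using 1 2 P.I_prime by blast
    ultimately show ?thesis by blast
  qed
  obtain Q where Q: "primeideal Q R" "Q \<inter> ?T' = {}"
    by (rule prime_avoiding_multiplicative_set[OF L(1,2) Tc' T1' Tm' zeroideal disj'])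
  interpret Q: primeideal Q R by fact
  have "Q \<subseteq> P"
  proof
    fix q assume q: "q \<in> Q"
    show "q \<in> P"
    proof (rule ccontr)
      assume "q \<notin> P"
      then have "y [^]\<^bsub>R\<^esub> (0::nat) \<otimes>\<^bsub>R\<^esub> q \<in> ?T'" using Q.a_Hcarr[OF q] by blast
      then show False using Q(2) q Q.a_Hcarr[OF q] by auto
    qed
  qed
  moreover have "y \<notin> Q"
  proof
    assume "y \<in> Q"
    moreover have "y [^]\<^bsub>R\<^esub> (1::nat) \<otimes>\<^bsub>R\<^esub> \<one>\<^bsub>R\<^esub> \<in> ?T'" using one by blast
    ultimately show False using Q(2) y by (auto simp: nat_pow_eone)
  qed
  moreover have "y \<in> P" using J(2) P(2) by blast
  ultimately have "Q \<subset> P" by blast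
  then show False using no_prime_chain[OF assms(2) Q(1) P(1) L(5)] \<open>P \<subset> \<mm>\<close> by blast
qed

text \<open>The generators are treated one at a time: \<open>g\<close> is replaced by
  \<open>y^(k-1) g\<close>, where \<open>k\<close> is the least exponent with \<open>y^k g\<close>
  in \<open>W\<close>. The generators treated before still send the new element into
  \<open>W\<close>.\<close>

lemma socle_element:
  assumes "module R M" "submodule W R M" "v0 \<in> carrier M - W"
    and fin: "finite G" "G \<subseteq> carrier R"
    and nil: "\<And>y v. y \<in> G \<Longrightarrow> v \<in> carrier M \<Longrightarrow> \<exists>k::nat. (y [^]\<^bsub>R\<^esub> k) \<odot>\<^bsub>M\<^esub> v \<in> W"
  shows "\<exists>g\<in>carrier M - W. \<forall>r\<in>Idl\<^bsub>R\<^esub> G. r \<odot>\<^bsub>M\<^esub> g \<in> W"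
proof -
  interpret module R M by fact
  note WE = submoduleE[OF assms(2)]
  have "\<exists>g\<in>carrier M - W. \<forall>y\<in>G. y \<odot>\<^bsub>M\<^esub> g \<in> W"
    using fin nil
  proof (induction G rule: finite_induct)
    case empty
    then show ?case using assms(3) by blast
  next
    case (insert y G)
    then obtain g where g: "g \<in> carrier M - W" "\<And>z. z \<in> G \<Longrightarrow> z \<odot>\<^bsub>M\<^esub> g \<in> W" by blast
    define k where "k = (LEAST k::nat. (y [^]\<^bsub>R\<^esub> k) \<odot>\<^bsub>M\<^esub> g \<in> W)"
    have k: "(y [^]\<^bsub>R\<^esub> k) \<odot>\<^bsub>M\<^esub> g \<in> W"
      unfolding k_def by (rule LeastI_ex) (use insert.prems(2)[of y g] g in auto)
    have y: "y \<in> carrier R" using insert.prems by blast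
    have "k \<noteq> 0"
    proof
      assume "k = 0"
      then show False using k g by simp
    qed
    then obtain l where l: "k = Suc l" using not0_implies_Suc by blast
    have nl: "(y [^]\<^bsub>R\<^esub> l) \<odot>\<^bsub>M\<^esub> g \<notin> W"
      using not_less_Least[of l "\<lambda>k. (y [^]\<^bsub>R\<^esub> k) \<odot>\<^bsub>M\<^esub> g \<in> W"] l by (simp add: k_def)
    have "y \<odot>\<^bsub>M\<^esub> ((y [^]\<^bsub>R\<^esub> l) \<odot>\<^bsub>M\<^esub> g) \<in> W"
      using k l y g(1) by (simp add: smult_assoc1[symmetric] R.m_comm)
    moreover have "z \<odot>\<^bsub>M\<^esub> ((y [^]\<^bsub>R\<^esub> l) \<odot>\<^bsub>M\<^esub> g) \<in> W" if z: "z \<in> G" for z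
    proof -
      have zc: "z \<in> carrier R" using z insert.prems by blast
      have "z \<odot>\<^bsub>M\<^esub> ((y [^]\<^bsub>R\<^esub> l) \<odot>\<^bsub>M\<^esub> g) = (y [^]\<^bsub>R\<^esub> l) \<odot>\<^bsub>M\<^esub> (z \<odot>\<^bsub>M\<^esub> g)"
        using zc y g(1) by (simp add: smult_assoc1[symmetric] R.m_comm)
      then show ?thesis using WE(4)[OF _ g(2)[OF z], of "y [^]\<^bsub>R\<^esub> l"] y by simp
    qed
    ultimately show ?case using nl y g(1) by (intro bexI[of _ "(y [^]\<^bsub>R\<^esub> l) \<odot>\<^bsub>M\<^esub> g"]) auto
  qed
  then obtain g where g: "g \<in> carrier M - W" "\<And>y. y \<in> G \<Longrightarrow> y \<odot>\<^bsub>M\<^esub> g \<in> W" by blast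
  have hom: "(\<lambda>p. p \<odot>\<^bsub>M\<^esub> g) \<in> module_hom R (self_module R) M"
    by (rule module_homI) (use g(1) in \<open>auto simp: smult_l_distr smult_assoc1\<close>)
  have "submodule {r \<in> carrier (self_module R). r \<odot>\<^bsub>M\<^esub> g \<in> W} R (self_module R)"
    by (rule kernel_submodule[OF self_module_module[OF R.is_cring] assms(1) hom assms(2)])
  then have "ideal {r \<in> carrier R. r \<odot>\<^bsub>M\<^esub> g \<in> W} R"
    by (simp add: submodule_self_module_iff[OF R.is_cring])
  then have "Idl\<^bsub>R\<^esub> G \<subseteq> {r \<in> carrier R. r \<odot>\<^bsub>M\<^esub> g \<in> W}"
    by (rule R.genideal_minimal) (use g(2) fin(2) in auto)
  then show ?thesis using g(1) by blast
qed

text \<open>Modulo \<open>y\<close> every element of the maximal ideal is nilpotent, so a nonzero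
  quotient killed by \<open>y\<close> has a nonzero socle. This serves both the finite-length
  argument and the choice of a socle element of the ring modulo a regular element.\<close>

lemma socle_mod_nonzerodivisor:
  assumes "noetherian_local_ring R \<mm>" "krull_dim R = 1" "y \<in> nonzerodivisors R"
    and "module R M" "submodule W R M" "v0 \<in> carrier M - W" "\<And>v. v \<in> carrier M \<Longrightarrow> y \<odot>\<^bsub>M\<^esub> v \<in> W"
  shows "\<exists>g\<in>carrier M - W. \<forall>r\<in>\<mm>. r \<odot>\<^bsub>M\<^esub> g \<in> W"
proof -
  note L = noetherian_local_ringD[OF assms(1)]
  interpret module R M by fact
  interpret \<mm>: ideal \<mm> R by (rule L)
  have y: "y \<in> carrier R" using assms(3) by (simp add: nonzerodivisors_def)
  obtain G where G: "G \<subseteq> carrier R" "finite G" "\<mm> = Idl\<^bsub>R\<^esub> G"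
    using noetherian_ring.finetely_gen[OF L(2,4)] by blast
  have "\<exists>k::nat. (r [^]\<^bsub>R\<^esub> k) \<odot>\<^bsub>M\<^esub> v \<in> W" if r: "r \<in> G" and v: "v \<in> carrier M" for r v
  proof -
    have "r \<in> \<mm>" using G R.genideal_self r by blast
    then obtain k :: nat and c where c: "c \<in> carrier R" "r [^]\<^bsub>R\<^esub> k = y \<otimes>\<^bsub>R\<^esub> c"
      using nilpotent_mod_nonzerodivisor[OF assms(1-3)] by blast
    then have "(r [^]\<^bsub>R\<^esub> k) \<odot>\<^bsub>M\<^esub> v = y \<odot>\<^bsub>M\<^esub> (c \<odot>\<^bsub>M\<^esub> v)" using v y by (simp add: smult_assoc1)
    then have "(r [^]\<^bsub>R\<^esub> k) \<odot>\<^bsub>M\<^esub> v \<in> W" using assms(7)[of "c \<odot>\<^bsub>M\<^esub> v"] c v by simp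
    then show ?thesis by blast
  qed
  then show ?thesis using socle_element[OF assms(4-6) G(2,1)] G(3) by blast
qed

text \<open>Noetherian induction: let \<open>W\<close> be maximal among the submodules above
  \<open>U\<close> over which chains are unbounded. A socle element outside \<open>W\<close> gives a
  submodule \<open>W + R g\<close> with nothing strictly in between, so a bound \<open>N\<close>
  above it yields the bound \<open>Suc N\<close> above \<open>W\<close>.\<close>

lemma finite_length_mod_nonzerodivisor:
  assumes "noetherian_local_ring R \<mm>" "krull_dim R = 1" "y \<in> nonzerodivisors R"
    and "module R M" "noetherian_module R M" "submodule U R M" "\<And>v. v \<in> carrier M \<Longrightarrow> y \<odot>\<^bsub>M\<^esub> v \<in> U"
  shows "\<exists>N. \<forall>n. submodule_chain R M U (carrier M) n \<longrightarrow> n \<le> N"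
proof (rule ccontr)
  assume unb: "\<not> ?thesis"
  interpret module R M by fact
  let ?bd = "\<lambda>W. \<exists>N. \<forall>n. submodule_chain R M W (carrier M) n \<longrightarrow> n \<le> N"
  let ?C = "{W. submodule W R M \<and> U \<subseteq> W \<and> \<not> ?bd W}"
  have "?C \<noteq> {}" using assms(6) unb by blast
  then obtain W where "W \<in> ?C" and max: "\<And>N'. N' \<in> ?C \<Longrightarrow> W \<subseteq> N' \<Longrightarrow> N' = W"
    using noetherian_module_maximal[OF assms(4,5), of ?C] by blast
  then have W: "submodule W R M" "U \<subseteq> W" "\<not> ?bd W" by auto
  note WE = submoduleE[OF W(1)]
  have "W \<noteq> carrier M"
  proof
    assume eq: "W = carrier M"
    have "n = 0" if "submodule_chain R M W (carrier M) n" for n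
      using that
    proof cases
      case (chain_step Y m)
      then show ?thesis using submodule_chainD[OF chain_step(2)] eq by blast
    qed
    then show False using W(3) by blast
  qed
  then obtain v0 where v0: "v0 \<in> carrier M - W" using WE(1) by blast
  have yW: "\<And>v. v \<in> carrier M \<Longrightarrow> y \<odot>\<^bsub>M\<^esub> v \<in> W" using assms(7) W(2) by (rule subsetD[rotated])
  obtain g where g: "g \<in> carrier M - W" "\<And>r. r \<in> \<mm> \<Longrightarrow> r \<odot>\<^bsub>M\<^esub> g \<in> W"
    using socle_mod_nonzerodivisor[OF assms(1-4) W(1) v0 yW] by blast
  let ?G = "(\<lambda>r. r \<odot>\<^bsub>M\<^esub> g) ` carrier R"
  have G: "submodule ?G R M" by (rule ideal_multiples_submodule[OF R.oneideal]) (use g in auto)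
  let ?W = "submodule_sum M W ?G"
  have W': "submodule ?W R M" by (rule submodule_sum_submodule[OF W(1) G])
  have inc: "W \<subseteq> ?W" by (rule submodule_sum_incl1[OF W(1) G])
  have "g \<in> ?G" using g(1) by (metis DiffD1 R.one_closed image_eqI smult_one)
  then have gW: "g \<in> ?W" using submodule_sum_incl2[OF W(1) G] by blast
  \<comment> \<open>An element \<open>w + r g\<close> outside \<open>W\<close> has \<open>r\<close>
    outside \<open>\<mm>\<close>, since \<open>\<mm> g\<close> lies in \<open>W\<close>; so
    \<open>r\<close> is a unit and \<open>g\<close> itself is recovered.\<close>
  have cover: "Y = ?W" if Y: "submodule Y R M" "W \<subset> Y" "Y \<subseteq> ?W" for Y
  proof -
    obtain z where z: "z \<in> Y" "z \<notin> W" using Y(2) by blast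
    then obtain w r where wr: "w \<in> W" "r \<in> carrier R" "z = w \<oplus>\<^bsub>M\<^esub> r \<odot>\<^bsub>M\<^esub> g"
      using Y(3) by (auto elim!: submodule_sumE)
    have "r \<notin> \<mm>" using g(2) wr WE(5) z(2) by blast
    then obtain s where s: "s \<in> carrier R" "s \<otimes>\<^bsub>R\<^esub> r = \<one>\<^bsub>R\<^esub>" using local_ring_inverse[OF assms(1) wr(2)] by blast
    have wc: "w \<in> carrier M" using wr(1) WE(1) by blast
    have "z \<ominus>\<^bsub>M\<^esub> w = r \<odot>\<^bsub>M\<^esub> g" using diff_eq[OF wc _ wr(3)] wr(2) g(1) by blast
    then have "r \<odot>\<^bsub>M\<^esub> g \<in> Y" using submodule_minus[OF Y(1) z(1)] wr(1) Y(2) by (metis psubsetD)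
    then have "s \<odot>\<^bsub>M\<^esub> (r \<odot>\<^bsub>M\<^esub> g) \<in> Y" using submoduleE(4)[OF Y(1) s(1)] by blast
    then have gY: "g \<in> Y" using s wr(2) g(1) smult_assoc1[of s r g] by simp
    have "?W \<subseteq> Y"
      by (rule submodule_sum_least[OF Y(1)]) (use Y(2) gY submoduleE(4)[OF Y(1)] in auto)
    then show ?thesis using Y(3) by blast
  qed
  have one: "p \<le> 1" if p: "submodule_chain R M W Y p" "Y \<subseteq> ?W" for Y p
    using p(1)
  proof cases
    case (chain_step Y1 m)
    have Y1: "submodule Y1 R M" "W \<subseteq> Y1" using submodule_chainD[OF chain_step(2)] by auto
    have "Y1 = W" using cover[of Y1] cover[of Y] Y1 chain_step p(2) by blast
    moreover have "m = 0"
      using chain_step(2)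
    proof cases
      case (chain_step Y0 k)
      then show ?thesis using submodule_chainD[OF chain_step(2)] \<open>Y1 = W\<close> by blast
    qed
    ultimately show ?thesis using chain_step by simp
  qed simp
  have "?bd ?W"
    using max[of ?W] W' inc W(2) gW g(1) by blast
  then obtain N where N: "\<And>n. submodule_chain R M ?W (carrier M) n \<Longrightarrow> n \<le> N" by blast
  have "n \<le> Suc N" if n: "submodule_chain R M W (carrier M) n" for n
  proof -
    obtain p q where pq: "n \<le> p + q" "submodule_chain R M W (carrier M \<inter> ?W) p"
      "submodule_chain R M ?W (submodule_sum M ?W (carrier M)) q"
      using submodule_chain_split[OF n W' inc] by blast
    have "p \<le> 1" using one[OF pq(2)] by simp
    moreover have "submodule_sum M ?W (carrier M) \<subseteq> carrier M"
      using submodule_sum_least[OF carrier_is_submodule] submoduleE(1)[OF W'] by blast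
    then have "q \<le> N" using N submodule_chain_mono[OF pq(3) carrier_is_submodule] by blast
    ultimately show ?thesis using pq(1) by simp
  qed
  then show False using W(3) by blast
qed

text \<open>Depth one provides a nonempty regular sequence, and the condition on its first member
  refers to the ideal generated by the empty set, which is zero.\<close>

lemma cohen_macaulay_nonzerodivisor:
  assumes "cohen_macaulay_local_ring R" "krull_dim R = 1"
  obtains \<mm> x where "noetherian_local_ring R \<mm>" "x \<in> \<mm>" "x \<in> nonzerodivisors R"
proof -
  obtain \<mm> where m: "noetherian_local_ring R \<mm>" "depth R \<mm> = 1"
    using assms by (auto simp: cohen_macaulay_local_ring_def)
  note L = noetherian_local_ringD[OF m(1)]
  interpret cring R by (rule L)
  have "\<exists>xs. regular_sequence R xs \<and> set xs \<subseteq> \<mm> \<and> xs \<noteq> []"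
  proof (rule ccontr)
    assume no: "\<not> ?thesis"
    have "depth R \<mm> \<le> 0"
      unfolding depth_def by (rule Sup_least) (use no in \<open>auto simp: zero_enat_def\<close>)
    then show False using m(2) by simp
  qed
  then obtain xs where xs: "regular_sequence R xs" "set xs \<subseteq> \<mm>" "xs \<noteq> []" by blast
  have idl: "Idl\<^bsub>R\<^esub> {} \<subseteq> {\<zero>\<^bsub>R\<^esub>}" by (rule genideal_minimal[OF zeroideal]) simp
  have "\<forall>a\<in>carrier R. xs ! 0 \<otimes>\<^bsub>R\<^esub> a \<in> Idl\<^bsub>R\<^esub> {} \<longrightarrow> a \<in> Idl\<^bsub>R\<^esub> {}"
    using xs(1,3) unfolding regular_sequence_def by (metis length_greater_0_conv list.set(1) take0)
  moreover have "\<zero>\<^bsub>R\<^esub> \<in> Idl\<^bsub>R\<^esub> {}" using genideal_ideal[of "{}"] additive_subgroup.zero_closed ideal.axioms(1) by blast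
  moreover have "xs ! 0 \<in> \<mm>" using xs(2,3) by (auto simp: subset_iff)
  moreover from this have "xs ! 0 \<in> carrier R" using ideal.Icarr[OF L(4)] by blast
  ultimately have "xs ! 0 \<in> nonzerodivisors R" using idl by (auto simp: nonzerodivisors_def)
  then show thesis using that[OF m(1) \<open>xs ! 0 \<in> \<mm>\<close>] by blast
qed

section \<open>Associated primes, localization and rank\<close>

lemma annihilator_ideal:
  assumes "cring R" "z \<in> carrier R"
  shows "ideal {a \<in> carrier R. a \<otimes>\<^bsub>R\<^esub> z = \<zero>\<^bsub>R\<^esub>} R"
proof -
  interpret cring R by fact
  interpret S: module R "self_module R" by (rule self_module_module[OF assms(1)])
  have hom: "(\<lambda>a. a \<otimes>\<^bsub>R\<^esub> z) \<in> module_hom R (self_module R) (self_module R)"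
    by (rule module_homI) (use assms(2) in \<open>auto simp: l_distr m_assoc\<close>)
  have "submodule {a \<in> carrier (self_module R). a \<otimes>\<^bsub>R\<^esub> z \<in> {\<zero>\<^bsub>self_module R\<^esub>}} R (self_module R)"
    by (rule kernel_submodule[OF S.module_axioms S.module_axioms hom S.zero_submodule])
  then show ?thesis by (simp add: submodule_self_module_iff[OF assms(1)])
qed

text \<open>A maximal member among the annihilators of nonzero elements is prime. Admitting only
  annihilators that contain the one of \<open>c\<close> places the prime above it.\<close>

lemma exists_associated_prime:
  assumes "cring R" "noetherian_ring R" "c \<in> carrier R" "c \<noteq> \<zero>\<^bsub>R\<^esub>"
  obtains P where "P \<in> associated_primes R" "{a \<in> carrier R. a \<otimes>\<^bsub>R\<^esub> c = \<zero>\<^bsub>R\<^esub>} \<subseteq> P"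
proof -
  interpret cring R by fact
  define ann where "ann z = {a \<in> carrier R. a \<otimes>\<^bsub>R\<^esub> z = \<zero>\<^bsub>R\<^esub>}" for z
  have ann_iff: "a \<in> ann z \<longleftrightarrow> a \<in> carrier R \<and> a \<otimes>\<^bsub>R\<^esub> z = \<zero>\<^bsub>R\<^esub>" for a z by (simp add: ann_def)
  define D where "D = {z \<in> carrier R. z \<noteq> \<zero>\<^bsub>R\<^esub> \<and> ann c \<subseteq> ann z}"
  have "c \<in> D" using assms(3,4) by (simp add: D_def)
  then have ne: "ann ` D \<noteq> {}" by blast
  have id: "ideal N R" if N: "N \<in> ann ` D" for N
  proof -
    obtain z where "z \<in> D" "N = ann z" using N by blast
    then show ?thesis using annihilator_ideal[OF assms(1), of z] by (simp add: D_def ann_def)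
  qed
  obtain P where P: "P \<in> ann ` D" "\<And>N'. N' \<in> ann ` D \<Longrightarrow> P \<subseteq> N' \<Longrightarrow> N' = P"
    using noetherian_ideal_maximal[OF assms(1,2) ne id] by blast
  obtain z where zD: "P = ann z" "z \<in> D" using P(1) by blast
  have z: "P = ann z" "z \<in> carrier R" "z \<noteq> \<zero>\<^bsub>R\<^esub>" "ann c \<subseteq> ann z" using zD by (simp_all add: D_def)
  have "primeideal P R"
  proof (rule primeidealI[OF _ assms(1)])
    show "ideal P R" by (rule id[OF P(1)])
    have "\<one>\<^bsub>R\<^esub> \<notin> P" using z by (simp add: ann_iff)
    then show "carrier R \<noteq> P" by (metis one_closed)
    fix a b assume ab: "a \<in> carrier R" "b \<in> carrier R" "a \<otimes>\<^bsub>R\<^esub> b \<in> P"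
    show "a \<in> P \<or> b \<in> P"
    proof (rule ccontr)
      assume n: "\<not> (a \<in> P \<or> b \<in> P)"
      have bz: "b \<otimes>\<^bsub>R\<^esub> z \<noteq> \<zero>\<^bsub>R\<^esub>" using n ab z(1) by (simp add: ann_iff)
      have sub: "P \<subseteq> ann (b \<otimes>\<^bsub>R\<^esub> z)"
      proof
        fix p assume "p \<in> P"
        then have p: "p \<in> carrier R" "p \<otimes>\<^bsub>R\<^esub> z = \<zero>\<^bsub>R\<^esub>" using z(1) by (simp_all add: ann_iff)
        then show "p \<in> ann (b \<otimes>\<^bsub>R\<^esub> z)" using m_lcomm[OF p(1) ab(2) z(2)] ab(2) by (simp add: ann_iff)
      qed
      then have "b \<otimes>\<^bsub>R\<^esub> z \<in> D" using z bz ab(2) by (simp add: D_def)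
      then have "ann (b \<otimes>\<^bsub>R\<^esub> z) = P" using P(2)[OF imageI sub] by simp
      moreover have "a \<in> ann (b \<otimes>\<^bsub>R\<^esub> z)" using ab z by (simp add: ann_iff m_assoc)
      ultimately show False using n by simp
    qed
  qed
  then have "P \<in> associated_primes R" using z(1,2) unfolding associated_primes_def ann_def by blast
  then show thesis using that[of P] z(1,4) by (simp add: ann_def)
qed

lemma associated_primeE:
  assumes "P \<in> associated_primes R"
  obtains z where "primeideal P R" "z \<in> carrier R" "P = {a \<in> carrier R. a \<otimes>\<^bsub>R\<^esub> z = \<zero>\<^bsub>R\<^esub>}"
  using assms unfolding associated_primes_def by blast

text \<open>There are no embedded primes: the regular element \<open>x\<close> of
  \<open>\<mm>\<close> lies in no associated prime, so \<open>Q\<close> is smaller than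
  \<open>\<mm>\<close>, and a strict inclusion of \<open>P\<close> in \<open>Q\<close> would give a
  chain of three primes.\<close>

lemma associated_prime_incomparable:
  assumes "noetherian_local_ring R \<mm>" "krull_dim R = 1" "x \<in> \<mm>" "x \<in> nonzerodivisors R"
    and "P \<in> associated_primes R" "Q \<in> associated_primes R" "P \<subseteq> Q"
  shows "P = Q"
proof (rule ccontr)
  assume "P \<noteq> Q"
  note L = noetherian_local_ringD[OF assms(1)]
  interpret cring R by (rule L)
  have pr: "primeideal P R" by (rule associated_primeE[OF assms(5)])
  obtain z where z: "primeideal Q R" "z \<in> carrier R" "Q = {a \<in> carrier R. a \<otimes>\<^bsub>R\<^esub> z = \<zero>\<^bsub>R\<^esub>}"
    by (rule associated_primeE[OF assms(6)])
  interpret Q: primeideal Q R by (rule z(1))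
  have Q_iff: "a \<in> Q \<longleftrightarrow> a \<in> carrier R \<and> a \<otimes>\<^bsub>R\<^esub> z = \<zero>\<^bsub>R\<^esub>" for a
    using z(3) by blast
  have one: "\<one>\<^bsub>R\<^esub> \<notin> Q" using Q.I_notcarr Q.one_imp_carrier by auto
  have "x \<notin> Q"
  proof
    assume "x \<in> Q"
    then have "z = \<zero>\<^bsub>R\<^esub>" using Q_iff[of x] z(2) assms(4) by (simp add: nonzerodivisors_def)
    then show False using one Q_iff[of "\<one>\<^bsub>R\<^esub>"] by simp
  qed
  then have "Q \<subset> \<mm>" using proper_ideal_subset_maximal[OF assms(1) Q.is_ideal one] assms(3) by blast
  then show False using no_prime_chain[OF assms(2) pr z(1) L(5)] assms(7) \<open>P \<noteq> Q\<close> by blast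
qed

lemma element_in_ideals_outside_prime:
  assumes "primeideal P R" "finite \<Q>" "\<And>Q. Q \<in> \<Q> \<Longrightarrow> ideal Q R" "\<And>Q. Q \<in> \<Q> \<Longrightarrow> \<not> Q \<subseteq> P"
  shows "\<exists>a\<in>carrier R - P. \<forall>Q\<in>\<Q>. a \<in> Q"
  using assms(2-4)
proof (induction \<Q> rule: finite_induct)
  case empty
  interpret P: primeideal P R by fact
  have "\<one>\<^bsub>R\<^esub> \<in> carrier R - P" using P.I_notcarr P.one_imp_carrier by auto
  then show ?case by blast
next
  case (insert Q \<Q>)
  interpret P: primeideal P R by fact
  interpret Q: ideal Q R using insert.prems(1) by blast
  obtain a where a: "a \<in> carrier R - P" "\<And>Q. Q \<in> \<Q> \<Longrightarrow> a \<in> Q" using insert by auto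
  obtain b where b: "b \<in> Q" "b \<notin> P" using insert.prems(2) by blast
  have bc: "b \<in> carrier R" using b(1) Q.a_Hcarr by blast
  have "a \<otimes>\<^bsub>R\<^esub> b \<in> carrier R - P" using a(1) b(2) bc P.I_prime by blast
  moreover have "a \<otimes>\<^bsub>R\<^esub> b \<in> Q" using a(1) b(1) Q.I_l_closed by blast
  moreover have "a \<otimes>\<^bsub>R\<^esub> b \<in> K" if "K \<in> \<Q>" for K
    using ideal.I_r_closed[OF insert.prems(1)[of K] a(2)[of K] bc] that by blast
  ultimately show ?case by blast
qed

text \<open>Let \<open>N\<close> be maximal among the ideals generated by finite sets
  \<open>F\<close> of elements whose annihilators are associated primes; it contains all such
  elements. If no annihilator from \<open>F\<close> lay below \<open>P\<close>, an element outside
  \<open>P\<close> would annihilate all of \<open>N\<close>, in particular an element with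
  annihilator \<open>P\<close>. By incomparability the annihilator below \<open>P\<close> equals
  \<open>P\<close>.\<close>

lemma finite_associated_primes:
  assumes "noetherian_local_ring R \<mm>" "krull_dim R = 1" "x \<in> \<mm>" "x \<in> nonzerodivisors R"
  shows "finite (associated_primes R)"
proof -
  note L = noetherian_local_ringD[OF assms(1)]
  interpret cring R by (rule L)
  define ann where "ann z = {a \<in> carrier R. a \<otimes>\<^bsub>R\<^esub> z = \<zero>\<^bsub>R\<^esub>}" for z
  have ann_iff: "a \<in> ann z \<longleftrightarrow> a \<in> carrier R \<and> a \<otimes>\<^bsub>R\<^esub> z = \<zero>\<^bsub>R\<^esub>" for a z by (simp add: ann_def)
  have ann_ideal: "ideal (ann z) R" if "z \<in> carrier R" for z
    using annihilator_ideal[OF L(1) that] by (simp add: ann_def)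
  define Z where "Z = {z \<in> carrier R. ann z \<in> associated_primes R}"
  have Zc: "Z \<subseteq> carrier R" by (auto simp: Z_def)
  define C where "C = genideal R ` {F. finite F \<and> F \<subseteq> Z}"
  have ne: "C \<noteq> {}" by (auto simp: C_def)
  have id: "ideal N R" if N: "N \<in> C" for N
  proof -
    obtain F where F: "F \<subseteq> Z" "N = Idl\<^bsub>R\<^esub> F" using N by (auto simp: C_def)
    show "ideal N R" unfolding F(2) by (rule genideal_ideal) (use F(1) Zc in order)
  qed
  obtain N where N: "N \<in> C" "\<And>N'. N' \<in> C \<Longrightarrow> N \<subseteq> N' \<Longrightarrow> N' = N"
    using noetherian_ideal_maximal[OF L(1,2) ne id] by blast
  obtain F where F: "finite F" "F \<subseteq> Z" "N = Idl\<^bsub>R\<^esub> F" using N(1) by (auto simp: C_def)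
  have inN: "z \<in> N" if z: "z \<in> Z" for z
  proof -
    have c: "insert z F \<subseteq> carrier R" using z F(2) Zc by blast
    have "Idl\<^bsub>R\<^esub> (insert z F) \<in> C" unfolding C_def by (rule imageI) (use z F in simp)
    moreover have "N \<subseteq> Idl\<^bsub>R\<^esub> (insert z F)"
      unfolding F(3) by (rule genideal_minimal[OF genideal_ideal[OF c]]) (use genideal_self[OF c] in blast)
    ultimately have "Idl\<^bsub>R\<^esub> (insert z F) = N" by (rule N(2))
    then show ?thesis using genideal_self[OF c] by blast
  qed
  have "associated_primes R \<subseteq> ann ` F"
  proof
    fix P assume P: "P \<in> associated_primes R"
    obtain z where z: "primeideal P R" "z \<in> carrier R" "P = ann z"
      unfolding ann_def by (rule associated_primeE[OF P])
    have "\<exists>Q\<in>ann ` F. Q \<subseteq> P"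
    proof (rule ccontr)
      assume no: "\<not> ?thesis"
      have i: "\<And>Q. Q \<in> ann ` F \<Longrightarrow> ideal Q R" using ann_ideal F(2) Zc by blast
      have n: "\<And>Q. Q \<in> ann ` F \<Longrightarrow> \<not> Q \<subseteq> P" using no by blast
      obtain a where a: "a \<in> carrier R - P" "\<forall>Q\<in>ann ` F. a \<in> Q"
        using element_in_ideals_outside_prime[OF z(1) finite_imageI[OF F(1)] i n] by (rule bexE)
      have ac: "a \<in> carrier R" using a(1) by simp
      have "Idl\<^bsub>R\<^esub> F \<subseteq> ann a"
      proof (rule genideal_minimal[OF ann_ideal[OF ac]])
        show "F \<subseteq> ann a"
        proof
          fix y assume y: "y \<in> F"
          then have "a \<in> ann y" using a(2) by simp
          then have "a \<otimes>\<^bsub>R\<^esub> y = \<zero>\<^bsub>R\<^esub>" by (simp add: ann_iff)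
          moreover have yc: "y \<in> carrier R" using y F(2) Zc by blast
          ultimately show "y \<in> ann a" using m_comm[OF ac yc] by (simp add: ann_iff)
        qed
      qed
      moreover have "z \<in> N" using inN[of z] z P by (simp add: Z_def)
      ultimately have "z \<in> ann a" using F(3) by (rule_tac subsetD) simp_all
      then have "z \<otimes>\<^bsub>R\<^esub> a = \<zero>\<^bsub>R\<^esub>" by (simp add: ann_iff)
      then have "a \<in> P" using z(2,3) ac m_comm[OF z(2) ac] by (simp add: ann_iff)
      then show False using a(1) by simp
    qed
    then obtain y where y: "y \<in> F" "ann y \<subseteq> P" by blast
    then have "ann y \<in> associated_primes R" using F(2) by (auto simp: Z_def)
    then have "ann y = P" by (rule associated_prime_incomparable[OF assms _ P y(2)])
    then show "P \<in> ann ` F" using y(1) by blast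
  qed
  then show ?thesis using F(1) finite_subset by blast
qed

lemma prime_complement:
  assumes "primeideal P R"
  shows "carrier R - P \<subseteq> carrier R" "\<one>\<^bsub>R\<^esub> \<in> carrier R - P"
    "\<And>s t. s \<in> carrier R - P \<Longrightarrow> t \<in> carrier R - P \<Longrightarrow> s \<otimes>\<^bsub>R\<^esub> t \<in> carrier R - P"
proof -
  interpret P: primeideal P R by fact
  show "\<one>\<^bsub>R\<^esub> \<in> carrier R - P" using P.I_notcarr P.one_imp_carrier by auto
  show "s \<otimes>\<^bsub>R\<^esub> t \<in> carrier R - P" if "s \<in> carrier R - P" "t \<in> carrier R - P" for s t
    using that P.I_prime by blast
qed blast

text \<open>Clears finitely many denominators at once by taking a product, which stays outside
  \<open>P\<close>; the last premise says that the property passes to multiples.\<close>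

lemma common_multiplier:
  assumes "primeideal P R" "\<And>i. i < (n::nat) \<Longrightarrow> \<exists>s\<in>carrier R - P. Q s i"
    and "\<And>i s t. i < n \<Longrightarrow> s \<in> carrier R \<Longrightarrow> t \<in> carrier R \<Longrightarrow> Q s i \<Longrightarrow> Q (t \<otimes>\<^bsub>R\<^esub> s) i"
  shows "\<exists>s\<in>carrier R - P. \<forall>i<n. Q s i"
  using assms(2,3)
proof (induction n)
  case 0
  then show ?case using prime_complement(2)[OF assms(1)] by blast
next
  case (Suc n)
  interpret P: primeideal P R by fact
  obtain s where s: "s \<in> carrier R - P" "\<forall>i<n. Q s i" using Suc by (metis less_SucI)
  obtain t where t: "t \<in> carrier R - P" "Q t n" using Suc.prems(1) by blast
  have "Q (t \<otimes>\<^bsub>R\<^esub> s) i" if i: "i < Suc n" for i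
  proof (cases "i = n")
    case True
    then have "Q (s \<otimes>\<^bsub>R\<^esub> t) i" using Suc.prems(2)[of n t s] s t by blast
    then show ?thesis using s(1) t(1) P.m_comm by auto
  next
    case False
    then show ?thesis using Suc.prems(2)[OF i, of s t] s t i by auto
  qed
  moreover have "t \<otimes>\<^bsub>R\<^esub> s \<in> carrier R - P" using prime_complement(3)[OF assms(1)] s t by blast
  ultimately show ?case by blast
qed

subsection \<open>Fractions\<close>

text \<open>Used for complements of primes and for the non zero-divisors. With
  \<open>self_module R\<close> in place of \<open>M\<close> it also supplies the arithmetic of the
  localized ring.\<close>

locale fractions = module +
  fixes W
  assumes W_sub: "W \<subseteq> carrier R" and W_one: "\<one>\<^bsub>R\<^esub> \<in> W"
    and W_mult: "\<And>s t. s \<in> W \<Longrightarrow> t \<in> W \<Longrightarrow> s \<otimes>\<^bsub>R\<^esub> t \<in> W"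
begin

lemma Wc: "w \<in> W \<Longrightarrow> w \<in> carrier R" using W_sub by blast

lemma mem_fraction: "(y, v) \<in> fraction R W M x w \<longleftrightarrow> y \<in> carrier M \<and> v \<in> W \<and>
    (\<exists>u\<in>W. (u \<otimes>\<^bsub>R\<^esub> v) \<odot>\<^bsub>M\<^esub> x = (u \<otimes>\<^bsub>R\<^esub> w) \<odot>\<^bsub>M\<^esub> y)"
  by (auto simp: fraction_def)

lemma fraction_refl: "x \<in> carrier M \<Longrightarrow> w \<in> W \<Longrightarrow> (x, w) \<in> fraction R W M x w"
  using W_one by (auto simp: mem_fraction)

lemma fraction_subset:
  assumes x: "x \<in> carrier M" "w \<in> W" and y: "(y, v) \<in> fraction R W M x w"
  shows "fraction R W M y v \<subseteq> fraction R W M x w"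
proof (rule subrelI)
  fix z t assume z: "(z, t) \<in> fraction R W M y v"
  obtain u where u: "y \<in> carrier M" "v \<in> W" "u \<in> W" "(u \<otimes>\<^bsub>R\<^esub> v) \<odot>\<^bsub>M\<^esub> x = (u \<otimes>\<^bsub>R\<^esub> w) \<odot>\<^bsub>M\<^esub> y"
    using y by (auto simp: mem_fraction)
  obtain u' where u': "z \<in> carrier M" "t \<in> W" "u' \<in> W" "(u' \<otimes>\<^bsub>R\<^esub> t) \<odot>\<^bsub>M\<^esub> y = (u' \<otimes>\<^bsub>R\<^esub> v) \<odot>\<^bsub>M\<^esub> z"
    using z by (auto simp: mem_fraction)
  note c = Wc[OF x(2)] Wc[OF u(2)] Wc[OF u(3)] Wc[OF u'(2)] Wc[OF u'(3)] u(1) u'(1) x(1)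
  \<comment> \<open>Transitivity: the two relations meet in \<open>y\<close>, once scaled by
    \<open>u w\<close> and once by \<open>u' t\<close>. The factor \<open>v\<close> is the price of
    eliminating \<open>y\<close>.\<close>
  let ?u = "(u \<otimes>\<^bsub>R\<^esub> u') \<otimes>\<^bsub>R\<^esub> v"
  have "(?u \<otimes>\<^bsub>R\<^esub> t) \<odot>\<^bsub>M\<^esub> x = (u' \<otimes>\<^bsub>R\<^esub> t) \<odot>\<^bsub>M\<^esub> ((u \<otimes>\<^bsub>R\<^esub> v) \<odot>\<^bsub>M\<^esub> x)"
    using c by (simp add: smult_assoc1[symmetric] R.m_ac)
  also have "\<dots> = (u \<otimes>\<^bsub>R\<^esub> w) \<odot>\<^bsub>M\<^esub> ((u' \<otimes>\<^bsub>R\<^esub> t) \<odot>\<^bsub>M\<^esub> y)"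
    unfolding u(4) using c by (simp add: smult_assoc1[symmetric] R.m_ac)
  also have "\<dots> = (?u \<otimes>\<^bsub>R\<^esub> w) \<odot>\<^bsub>M\<^esub> z"
    unfolding u'(4) using c by (simp add: smult_assoc1[symmetric] R.m_ac)
  finally show "(z, t) \<in> fraction R W M x w"
    using u' u by (auto simp: mem_fraction intro!: bexI[of _ ?u] W_mult)
qed

lemma fraction_cong:
  assumes x: "x \<in> carrier M" "w \<in> W" and y: "(y, v) \<in> fraction R W M x w"
  shows "fraction R W M y v = fraction R W M x w"
proof
  show "fraction R W M y v \<subseteq> fraction R W M x w" by (rule fraction_subset[OF assms])
  have "y \<in> carrier M" "v \<in> W" "(x, w) \<in> fraction R W M y v"
    using y x by (auto simp: mem_fraction intro: sym)
  then show "fraction R W M x w \<subseteq> fraction R W M y v" by (rule fraction_subset)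
qed

lemma fraction_eqI:
  assumes "x \<in> carrier M" "w \<in> W" "y \<in> carrier M" "v \<in> W" "u \<in> W"
    "(u \<otimes>\<^bsub>R\<^esub> v) \<odot>\<^bsub>M\<^esub> x = (u \<otimes>\<^bsub>R\<^esub> w) \<odot>\<^bsub>M\<^esub> y"
  shows "fraction R W M x w = fraction R W M y v"
proof -
  have "(y, v) \<in> fraction R W M x w" using assms by (auto simp: mem_fraction)
  from fraction_cong[OF assms(1,2) this] show ?thesis by simp
qed

lemma fraction_eqD:
  assumes "x \<in> carrier M" "w \<in> W" "y \<in> carrier M" "v \<in> W" "fraction R W M x w = fraction R W M y v"
  shows "\<exists>u\<in>W. (u \<otimes>\<^bsub>R\<^esub> v) \<odot>\<^bsub>M\<^esub> x = (u \<otimes>\<^bsub>R\<^esub> w) \<odot>\<^bsub>M\<^esub> y"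
proof -
  have "(y, v) \<in> fraction R W M x w" using fraction_refl[OF assms(3,4)] assms(5) by simp
  then show ?thesis by (simp add: mem_fraction)
qed

lemma localized_add:
  assumes "x \<in> carrier M" "v \<in> W" "y \<in> carrier M" "w \<in> W"
  shows "fraction R W M x v \<oplus>\<^bsub>localized_module R W M\<^esub> fraction R W M y w =
    fraction R W M (w \<odot>\<^bsub>M\<^esub> x \<oplus>\<^bsub>M\<^esub> v \<odot>\<^bsub>M\<^esub> y) (v \<otimes>\<^bsub>R\<^esub> w)"
proof -
  have eq: "fraction R W M (w' \<odot>\<^bsub>M\<^esub> x' \<oplus>\<^bsub>M\<^esub> v' \<odot>\<^bsub>M\<^esub> y') (v' \<otimes>\<^bsub>R\<^esub> w') =
      fraction R W M (w \<odot>\<^bsub>M\<^esub> x \<oplus>\<^bsub>M\<^esub> v \<odot>\<^bsub>M\<^esub> y) (v \<otimes>\<^bsub>R\<^esub> w)"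
    if 1: "(x', v') \<in> fraction R W M x v" and 2: "(y', w') \<in> fraction R W M y w" for x' v' y' w'
  proof -
    obtain u where u: "x' \<in> carrier M" "v' \<in> W" "u \<in> W" "(u \<otimes>\<^bsub>R\<^esub> v') \<odot>\<^bsub>M\<^esub> x = (u \<otimes>\<^bsub>R\<^esub> v) \<odot>\<^bsub>M\<^esub> x'"
      using 1 by (auto simp: mem_fraction)
    obtain t where t: "y' \<in> carrier M" "w' \<in> W" "t \<in> W" "(t \<otimes>\<^bsub>R\<^esub> w') \<odot>\<^bsub>M\<^esub> y = (t \<otimes>\<^bsub>R\<^esub> w) \<odot>\<^bsub>M\<^esub> y'"
      using 2 by (auto simp: mem_fraction)
    note c = Wc[OF u(2)] Wc[OF u(3)] Wc[OF t(2)] Wc[OF t(3)] Wc[OF assms(2)] Wc[OF assms(4)] u(1) t(1) assms(1,3)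
    have "((u \<otimes>\<^bsub>R\<^esub> t) \<otimes>\<^bsub>R\<^esub> (v' \<otimes>\<^bsub>R\<^esub> w')) \<odot>\<^bsub>M\<^esub> (w \<odot>\<^bsub>M\<^esub> x) = ((t \<otimes>\<^bsub>R\<^esub> w) \<otimes>\<^bsub>R\<^esub> w') \<odot>\<^bsub>M\<^esub> ((u \<otimes>\<^bsub>R\<^esub> v') \<odot>\<^bsub>M\<^esub> x)"
      using c by (simp add: smult_assoc1[symmetric] R.m_ac)
    also have "\<dots> = ((u \<otimes>\<^bsub>R\<^esub> t) \<otimes>\<^bsub>R\<^esub> (v \<otimes>\<^bsub>R\<^esub> w)) \<odot>\<^bsub>M\<^esub> (w' \<odot>\<^bsub>M\<^esub> x')"
      unfolding u(4) using c by (simp add: smult_assoc1[symmetric] R.m_ac)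
    finally have A: "((u \<otimes>\<^bsub>R\<^esub> t) \<otimes>\<^bsub>R\<^esub> (v' \<otimes>\<^bsub>R\<^esub> w')) \<odot>\<^bsub>M\<^esub> (w \<odot>\<^bsub>M\<^esub> x) = \<dots>" .
    have "((u \<otimes>\<^bsub>R\<^esub> t) \<otimes>\<^bsub>R\<^esub> (v' \<otimes>\<^bsub>R\<^esub> w')) \<odot>\<^bsub>M\<^esub> (v \<odot>\<^bsub>M\<^esub> y) = ((u \<otimes>\<^bsub>R\<^esub> v) \<otimes>\<^bsub>R\<^esub> v') \<odot>\<^bsub>M\<^esub> ((t \<otimes>\<^bsub>R\<^esub> w') \<odot>\<^bsub>M\<^esub> y)"
      using c by (simp add: smult_assoc1[symmetric] R.m_ac)
    also have "\<dots> = ((u \<otimes>\<^bsub>R\<^esub> t) \<otimes>\<^bsub>R\<^esub> (v \<otimes>\<^bsub>R\<^esub> w)) \<odot>\<^bsub>M\<^esub> (v' \<odot>\<^bsub>M\<^esub> y')"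
      unfolding t(4) using c by (simp add: smult_assoc1[symmetric] R.m_ac)
    finally have B: "((u \<otimes>\<^bsub>R\<^esub> t) \<otimes>\<^bsub>R\<^esub> (v' \<otimes>\<^bsub>R\<^esub> w')) \<odot>\<^bsub>M\<^esub> (v \<odot>\<^bsub>M\<^esub> y) = \<dots>" .
    have "((u \<otimes>\<^bsub>R\<^esub> t) \<otimes>\<^bsub>R\<^esub> (v' \<otimes>\<^bsub>R\<^esub> w')) \<odot>\<^bsub>M\<^esub> (w \<odot>\<^bsub>M\<^esub> x \<oplus>\<^bsub>M\<^esub> v \<odot>\<^bsub>M\<^esub> y) =
        ((u \<otimes>\<^bsub>R\<^esub> t) \<otimes>\<^bsub>R\<^esub> (v \<otimes>\<^bsub>R\<^esub> w)) \<odot>\<^bsub>M\<^esub> (w' \<odot>\<^bsub>M\<^esub> x' \<oplus>\<^bsub>M\<^esub> v' \<odot>\<^bsub>M\<^esub> y')"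
      using A B c by (simp add: smult_r_distr)
    then show ?thesis
      using c u t assms W_mult by (intro fraction_eqI[symmetric, of _ _ _ _ "u \<otimes>\<^bsub>R\<^esub> t"]) auto
  qed
  have ne: "fraction R W M x v \<noteq> {}" "fraction R W M y w \<noteq> {}" using fraction_refl assms by blast+
  show ?thesis
    unfolding localized_module_def Let_def
    using eq ne by (auto 0 3 simp: split_beta)
qed

lemma localized_smult:
  assumes "a \<in> carrier R" "v \<in> W" "x \<in> carrier M" "w \<in> W"
  shows "fraction R W (self_module R) a v \<odot>\<^bsub>localized_module R W M\<^esub> fraction R W M x w =
    fraction R W M (a \<odot>\<^bsub>M\<^esub> x) (v \<otimes>\<^bsub>R\<^esub> w)"
proof -
  have eq: "fraction R W M (a' \<odot>\<^bsub>M\<^esub> x') (v' \<otimes>\<^bsub>R\<^esub> w') = fraction R W M (a \<odot>\<^bsub>M\<^esub> x) (v \<otimes>\<^bsub>R\<^esub> w)"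
    if 1: "(a', v') \<in> fraction R W (self_module R) a v" and 2: "(x', w') \<in> fraction R W M x w" for a' v' x' w'
  proof -
    obtain u where u: "a' \<in> carrier R" "v' \<in> W" "u \<in> W" "(u \<otimes>\<^bsub>R\<^esub> v') \<otimes>\<^bsub>R\<^esub> a = (u \<otimes>\<^bsub>R\<^esub> v) \<otimes>\<^bsub>R\<^esub> a'"
      using 1 by (auto simp: fraction_def)
    obtain t where t: "x' \<in> carrier M" "w' \<in> W" "t \<in> W" "(t \<otimes>\<^bsub>R\<^esub> w') \<odot>\<^bsub>M\<^esub> x = (t \<otimes>\<^bsub>R\<^esub> w) \<odot>\<^bsub>M\<^esub> x'"
      using 2 by (auto simp: mem_fraction)
    note c = Wc[OF u(2)] Wc[OF u(3)] Wc[OF t(2)] Wc[OF t(3)] Wc[OF assms(2)] Wc[OF assms(4)] u(1) t(1) assms(1,3)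
    have "((u \<otimes>\<^bsub>R\<^esub> t) \<otimes>\<^bsub>R\<^esub> (v' \<otimes>\<^bsub>R\<^esub> w')) \<odot>\<^bsub>M\<^esub> (a \<odot>\<^bsub>M\<^esub> x) = ((u \<otimes>\<^bsub>R\<^esub> v') \<otimes>\<^bsub>R\<^esub> a) \<odot>\<^bsub>M\<^esub> ((t \<otimes>\<^bsub>R\<^esub> w') \<odot>\<^bsub>M\<^esub> x)"
      using c by (simp add: smult_assoc1[symmetric] R.m_ac)
    also have "\<dots> = ((u \<otimes>\<^bsub>R\<^esub> t) \<otimes>\<^bsub>R\<^esub> (v \<otimes>\<^bsub>R\<^esub> w)) \<odot>\<^bsub>M\<^esub> (a' \<odot>\<^bsub>M\<^esub> x')"
      unfolding u(4) t(4) using c by (simp add: smult_assoc1[symmetric] R.m_ac)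
    finally show ?thesis
      using c u t assms W_mult by (intro fraction_eqI[symmetric, of _ _ _ _ "u \<otimes>\<^bsub>R\<^esub> t"]) auto
  qed
  have "(a, v) \<in> fraction R W (self_module R) a v"
    using assms W_one by (auto simp: fraction_def)
  then have ne: "fraction R W (self_module R) a v \<noteq> {}" "fraction R W M x w \<noteq> {}" using fraction_refl assms by blast+
  show ?thesis
    unfolding localized_module_def Let_def
    using eq ne by (auto 0 3 simp: split_beta)
qed

end

lemma localized_ring_eq:
  "carrier (localized_ring R W) = carrier (localized_module R W (self_module R))"
  "\<zero>\<^bsub>localized_ring R W\<^esub> = \<zero>\<^bsub>localized_module R W (self_module R)\<^esub>"
  "add (localized_ring R W) = add (localized_module R W (self_module R))"
  "monoid.mult (localized_ring R W) = smult (localized_module R W (self_module R))"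
  by (simp_all add: localized_ring_def localized_module_def Let_def)

subsection \<open>Local bases\<close>

text \<open>Restates the isomorphism with a free module over the localized ring without fractions:
  \<open>v\<close> generates and is independent up to factors outside \<open>P\<close>. The
  \<open>v l\<close> are numerators of the elements of the localized module that correspond to the
  standard basis.\<close>

lemma localized_basis:
  fixes r :: nat
  assumes "module R M" "primeideal P R"
    and iso: "module_isomorphic (localized_ring R (carrier R - P)) (localized_module R (carrier R - P) M)
       (free_module (localized_ring R (carrier R - P)) {..<r})"
  shows "\<exists>v\<in>{..<r} \<rightarrow> carrier M.
      (\<forall>z\<in>carrier M. \<exists>s\<in>carrier R - P. s \<odot>\<^bsub>M\<^esub> z \<in> linear_extension R M v ` carrier (free_module R {..<r})) \<and>
      (\<forall>c\<in>carrier (free_module R {..<r}). linear_extension R M v c = \<zero>\<^bsub>M\<^esub> \<longrightarrow>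
        (\<forall>l<r. \<exists>s\<in>carrier R - P. s \<otimes>\<^bsub>R\<^esub> c l = \<zero>\<^bsub>R\<^esub>))"
proof -
  define W where "W = carrier R - P"
  interpret module R M by fact
  interpret fr: fractions R M W
    by unfold_locales (use prime_complement[OF assms(2)] in \<open>auto simp: W_def\<close>)
  interpret sf: fractions R "self_module R" W
    by (rule fractions.intro[OF self_module_module[OF R.is_cring]])
      (use fr.fractions_axioms in \<open>simp add: fractions_def fractions_axioms_def\<close>)
  let ?L = "localized_ring R W" and ?F = "free_module R {..<r}"
  note W = fr.Wc fr.W_one fr.W_mult
  define fM where "fM = fraction R W M"
  define fR where "fR = fraction R W (self_module R)"
  have L0: "\<zero>\<^bsub>?L\<^esub> = fR \<zero>\<^bsub>R\<^esub> \<one>\<^bsub>R\<^esub>" and L1: "\<one>\<^bsub>?L\<^esub> = fR \<one>\<^bsub>R\<^esub> \<one>\<^bsub>R\<^esub>"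
    and Lc: "carrier ?L = {fR a w | a w. a \<in> carrier R \<and> w \<in> W}"
    by (simp_all add: localized_ring_def Let_def fR_def)
  have Lmult: "fR a v \<otimes>\<^bsub>?L\<^esub> fR b w = fR (a \<otimes>\<^bsub>R\<^esub> b) (v \<otimes>\<^bsub>R\<^esub> w)"
    if "a \<in> carrier R" "v \<in> W" "b \<in> carrier R" "w \<in> W" for a b v w
    using sf.localized_smult[of a v b w] that by (simp add: localized_ring_eq fR_def)
  have Ladd: "fR a \<one>\<^bsub>R\<^esub> \<oplus>\<^bsub>?L\<^esub> fR b \<one>\<^bsub>R\<^esub> = fR (a \<oplus>\<^bsub>R\<^esub> b) \<one>\<^bsub>R\<^esub>"
    if "a \<in> carrier R" "b \<in> carrier R" for a b
    using sf.localized_add[of a "\<one>\<^bsub>R\<^esub>" b "\<one>\<^bsub>R\<^esub>"] that W(2) by (simp add: localized_ring_eq fR_def)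
  have fMc: "fM x w \<in> carrier (localized_module R W M)" if "x \<in> carrier M" "w \<in> W" for x w
    using that by (auto simp: localized_module_def Let_def fM_def)
  have fRc: "fR a w \<in> carrier ?L" if "a \<in> carrier R" "w \<in> W" for a w
    using that Lc by blast
  obtain h where h: "h \<in> module_hom ?L (localized_module R W M) (free_module ?L {..<r})"
    and bij: "bij_betw h (carrier (localized_module R W M)) (carrier (free_module ?L {..<r}))"
    using iso unfolding module_isomorphic_def W_def by blast
  \<comment> \<open>The coordinate vector of the fraction \<open>z / 1\<close>.\<close>
  define j where "j z = h (fM z \<one>\<^bsub>R\<^esub>)" for z
  have jc: "j z \<in> carrier (free_module ?L {..<r})" if "z \<in> carrier M" for z
    unfolding j_def by (rule module_hom_closed[OF h fMc[OF that W(2)]])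
  have jadd: "j (x \<oplus>\<^bsub>M\<^esub> y) i = j x i \<oplus>\<^bsub>?L\<^esub> j y i" if "x \<in> carrier M" "y \<in> carrier M" for x y i
  proof -
    have "fM x \<one>\<^bsub>R\<^esub> \<oplus>\<^bsub>localized_module R W M\<^esub> fM y \<one>\<^bsub>R\<^esub> = fM (x \<oplus>\<^bsub>M\<^esub> y) \<one>\<^bsub>R\<^esub>"
      using fr.localized_add[of x "\<one>\<^bsub>R\<^esub>" y "\<one>\<^bsub>R\<^esub>"] that W(2) by (simp add: fM_def)
    then show ?thesis
      using module_hom_add[OF h fMc[OF that(1) W(2)] fMc[OF that(2) W(2)]] by (simp add: j_def)
  qed
  have hsm: "h (fM (a \<odot>\<^bsub>M\<^esub> x) w) i = fR a \<one>\<^bsub>R\<^esub> \<otimes>\<^bsub>?L\<^esub> h (fM x w) i"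
    if "a \<in> carrier R" "x \<in> carrier M" "w \<in> W" for a x w i
  proof -
    have "fR a \<one>\<^bsub>R\<^esub> \<odot>\<^bsub>localized_module R W M\<^esub> fM x w = fM (a \<odot>\<^bsub>M\<^esub> x) w"
      using fr.localized_smult[of a "\<one>\<^bsub>R\<^esub>" x w] that W(1,2) by (simp add: fM_def fR_def)
    then show ?thesis
      using module_hom_smult[OF h fRc[OF that(1) W(2)] fMc[OF that(2,3)]] by (simp add: W(2))
  qed
  \<comment> \<open>Only the formulas for sums and products of fractions are available for the
    localization, not the ring axioms; so this closure property, and below the coordinates of zero,
    are computed by hand.\<close>
  have E: "basis_vector ?L l \<in> carrier (free_module ?L {..<r})" if "l < r" for l
  proof -
    have "{i. basis_vector ?L l i \<noteq> \<zero>\<^bsub>?L\<^esub>} \<subseteq> {l}" by (auto simp: basis_vector_def)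
    then have "finite {i. basis_vector ?L l i \<noteq> \<zero>\<^bsub>?L\<^esub>}" "{i. basis_vector ?L l i \<noteq> \<zero>\<^bsub>?L\<^esub>} \<subseteq> {..<r}"
      using that by (auto dest: finite_subset)
    moreover have "basis_vector ?L l i \<in> carrier ?L" for i
      using fRc[OF R.zero_closed W(2)] fRc[OF R.one_closed W(2)] by (simp add: basis_vector_def L0 L1)
    ultimately show ?thesis by (simp add: free_module_carrier_iff)
  qed
  have "\<exists>x w. x \<in> carrier M \<and> w \<in> W \<and> h (fM x w) = basis_vector ?L l" if "l < r" for l
  proof -
    have "basis_vector ?L l \<in> h ` carrier (localized_module R W M)"
      using E[OF that] bij by (simp add: bij_betw_def)
    then obtain A where A: "A \<in> carrier (localized_module R W M)" "basis_vector ?L l = h A" by blast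
    then obtain x w where "x \<in> carrier M" "w \<in> W" "A = fM x w"
      by (auto simp: localized_module_def Let_def fM_def)
    then show ?thesis using A(2) by auto
  qed
  then obtain v w where vw: "\<And>l. l < r \<Longrightarrow> v l \<in> carrier M" "\<And>l. l < r \<Longrightarrow> w l \<in> W"
    "\<And>l. l < r \<Longrightarrow> h (fM (v l) (w l)) = basis_vector ?L l" by metis
  have vP: "v \<in> {..<r} \<rightarrow> carrier M" using vw(1) by auto
  \<comment> \<open>As \<open>v l / 1\<close> is \<open>w l\<close> times \<open>v l / w l\<close>,
    its coordinate vector is \<open>w l\<close> times a basis vector.\<close>
  have jv: "j (v l) i = (if i = l then fR (w l) \<one>\<^bsub>R\<^esub> else fR \<zero>\<^bsub>R\<^esub> \<one>\<^bsub>R\<^esub>)" if l: "l < r" for l i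
  proof -
    have "fM (v l) \<one>\<^bsub>R\<^esub> = fM (w l \<odot>\<^bsub>M\<^esub> v l) (w l)"
      unfolding fM_def using vw(1,2)[OF l] W
      by (intro fr.fraction_eqI[of _ _ _ _ "\<one>\<^bsub>R\<^esub>"]) auto
    then have "j (v l) i = fR (w l) \<one>\<^bsub>R\<^esub> \<otimes>\<^bsub>?L\<^esub> basis_vector ?L l i"
      using hsm[of "w l" "v l" "w l" i] vw[OF l] W(1) by (simp add: j_def)
    then show ?thesis using vw(2)[OF l] W(1,2) Lmult by (simp add: basis_vector_def L0 L1)
  qed
  have zmult: "fR a \<one>\<^bsub>R\<^esub> \<otimes>\<^bsub>?L\<^esub> fR \<zero>\<^bsub>R\<^esub> \<one>\<^bsub>R\<^esub> = fR \<zero>\<^bsub>R\<^esub> \<one>\<^bsub>R\<^esub>" if "a \<in> carrier R" for a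
    using Lmult[of a "\<one>\<^bsub>R\<^esub>" "\<zero>\<^bsub>R\<^esub>" "\<one>\<^bsub>R\<^esub>"] that W(2) by simp
  have jzero: "j \<zero>\<^bsub>M\<^esub> i = fR \<zero>\<^bsub>R\<^esub> \<one>\<^bsub>R\<^esub>" for i
  proof -
    have "j \<zero>\<^bsub>M\<^esub> i \<in> carrier ?L" using jc[OF M.zero_closed] by (simp add: free_module_carrier_iff)
    then obtain a s where as: "a \<in> carrier R" "s \<in> W" "j \<zero>\<^bsub>M\<^esub> i = fR a s" using Lc by blast
    have "j \<zero>\<^bsub>M\<^esub> i = fR \<zero>\<^bsub>R\<^esub> \<one>\<^bsub>R\<^esub> \<otimes>\<^bsub>?L\<^esub> j \<zero>\<^bsub>M\<^esub> i"
      using hsm[of "\<zero>\<^bsub>R\<^esub>" "\<zero>\<^bsub>M\<^esub>" "\<one>\<^bsub>R\<^esub>" i] W(2) by (simp add: j_def)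
    also have "\<dots> = fR \<zero>\<^bsub>R\<^esub> s"
      using as W Lmult[of "\<zero>\<^bsub>R\<^esub>" "\<one>\<^bsub>R\<^esub>" a s] by simp
    also have "\<dots> = fR \<zero>\<^bsub>R\<^esub> \<one>\<^bsub>R\<^esub>"
      unfolding fR_def using as(2) W by (intro sf.fraction_eqI[of _ _ _ _ "\<one>\<^bsub>R\<^esub>"]) auto
    finally show ?thesis .
  qed
  have jsum: "j (\<Oplus>\<^bsub>M\<^esub>k\<in>A. c k \<odot>\<^bsub>M\<^esub> v k) i = (if i \<in> A then fR (c i \<otimes>\<^bsub>R\<^esub> w i) \<one>\<^bsub>R\<^esub> else fR \<zero>\<^bsub>R\<^esub> \<one>\<^bsub>R\<^esub>)"
    if c: "\<And>k. c k \<in> carrier R" and A: "finite A" "A \<subseteq> {..<r}" for c A i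
    using A
  proof (induction A rule: finite_induct)
    case empty
    then show ?case by (simp add: jzero)
  next
    case (insert k A)
    have k: "k < r" using insert.prems by simp
    have cv: "c l \<odot>\<^bsub>M\<^esub> v l \<in> carrier M" if "l \<in> insert k A" for l
      using that insert.prems c vw(1) by auto
    have "(\<Oplus>\<^bsub>M\<^esub>l\<in>insert k A. c l \<odot>\<^bsub>M\<^esub> v l) = c k \<odot>\<^bsub>M\<^esub> v k \<oplus>\<^bsub>M\<^esub> (\<Oplus>\<^bsub>M\<^esub>l\<in>A. c l \<odot>\<^bsub>M\<^esub> v l)"
      by (rule M.finsum_insert) (use insert.hyps cv in auto)
    moreover have "(\<Oplus>\<^bsub>M\<^esub>l\<in>A. c l \<odot>\<^bsub>M\<^esub> v l) \<in> carrier M" by (rule M.finsum_closed) (use cv in auto)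
    moreover have "j (c k \<odot>\<^bsub>M\<^esub> v k) i = (if i = k then fR (c k \<otimes>\<^bsub>R\<^esub> w k) \<one>\<^bsub>R\<^esub> else fR \<zero>\<^bsub>R\<^esub> \<one>\<^bsub>R\<^esub>)"
      using hsm[OF c vw(1)[OF k] W(2), of k i] jv[OF k, of i] Lmult[OF c W(2) W(1)[OF vw(2)[OF k]] W(2), of k]
        zmult[OF c[of k]] W(2) by (simp add: j_def)
    moreover have "j (\<Oplus>\<^bsub>M\<^esub>l\<in>A. c l \<odot>\<^bsub>M\<^esub> v l) i = (if i \<in> A then fR (c i \<otimes>\<^bsub>R\<^esub> w i) \<one>\<^bsub>R\<^esub> else fR \<zero>\<^bsub>R\<^esub> \<one>\<^bsub>R\<^esub>)"
      using insert by simp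
    moreover have wi: "c i \<otimes>\<^bsub>R\<^esub> w i \<in> carrier R" if "i < r"
      using W(1)[OF vw(2)[OF that]] c by simp
    ultimately show ?case
      using jadd[of "c k \<odot>\<^bsub>M\<^esub> v k" "\<Oplus>\<^bsub>M\<^esub>l\<in>A. c l \<odot>\<^bsub>M\<^esub> v l" i] cv[of k] insert.hyps insert.prems k Ladd
      by (auto simp: subset_iff)
  qed
  have jlin: "j (linear_extension R M v c) i = fR (c i \<otimes>\<^bsub>R\<^esub> w i) \<one>\<^bsub>R\<^esub>"
    if c: "c \<in> carrier ?F" and i: "i < r" for c i
  proof -
    have "linear_extension R M v c = (\<Oplus>\<^bsub>M\<^esub>k\<in>{..<r}. c k \<odot>\<^bsub>M\<^esub> v k)"
      by (rule linear_extension_eq[OF c vP]) (use c in \<open>auto simp: free_module_carrier_iff\<close>)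
    then show ?thesis using jsum[of c "{..<r}" i] c i by (simp add: free_module_carrier_iff)
  qed
  have lin: "linear_extension R M v \<in> module_hom R ?F M" by (rule linear_extension_hom[OF assms(1) vP])
  have gen: "\<exists>s\<in>W. s \<odot>\<^bsub>M\<^esub> z \<in> linear_extension R M v ` carrier ?F" if z: "z \<in> carrier M" for z
  proof -
    \<comment> \<open>A coordinate \<open>a / s\<close> of \<open>z\<close> is multiplied by
      \<open>s w_i\<close> rather than by \<open>s\<close>: the result \<open>a w_i\<close> is the
      form taken by the coordinates of a combination of the \<open>v_i\<close>.\<close>
    have "\<exists>q\<in>carrier R - P. \<forall>i<r. \<exists>b\<in>carrier R. fR q \<one>\<^bsub>R\<^esub> \<otimes>\<^bsub>?L\<^esub> j z i = fR (b \<otimes>\<^bsub>R\<^esub> w i) \<one>\<^bsub>R\<^esub>"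
    proof (rule common_multiplier[OF assms(2)])
      fix i assume i: "i < r"
      have "j z i \<in> carrier ?L" using jc[OF z] by (simp add: free_module_carrier_iff)
      then obtain a s where as: "a \<in> carrier R" "s \<in> W" "j z i = fR a s" using Lc by blast
      have wi: "w i \<in> carrier R" "s \<in> carrier R" using W(1) vw(2)[OF i] as(2) by auto
      have "fR (s \<otimes>\<^bsub>R\<^esub> w i) \<one>\<^bsub>R\<^esub> \<otimes>\<^bsub>?L\<^esub> j z i = fR (s \<otimes>\<^bsub>R\<^esub> w i \<otimes>\<^bsub>R\<^esub> a) (\<one>\<^bsub>R\<^esub> \<otimes>\<^bsub>R\<^esub> s)"
        unfolding as(3) using as wi W(2) by (intro Lmult) auto
      also have "\<dots> = fR (a \<otimes>\<^bsub>R\<^esub> w i) \<one>\<^bsub>R\<^esub>"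
        unfolding fR_def using as wi W(2)
        by (intro sf.fraction_eqI[of _ _ _ _ "\<one>\<^bsub>R\<^esub>"]) (auto simp: R.m_ac)
      finally have eq: "fR (s \<otimes>\<^bsub>R\<^esub> w i) \<one>\<^bsub>R\<^esub> \<otimes>\<^bsub>?L\<^esub> j z i = fR (a \<otimes>\<^bsub>R\<^esub> w i) \<one>\<^bsub>R\<^esub>" .
      have "s \<otimes>\<^bsub>R\<^esub> w i \<in> W" by (rule W(3)[OF as(2) vw(2)[OF i]])
      then have "s \<otimes>\<^bsub>R\<^esub> w i \<in> carrier R - P" by (simp only: W_def)
      then show "\<exists>s\<in>carrier R - P. \<exists>b\<in>carrier R. fR s \<one>\<^bsub>R\<^esub> \<otimes>\<^bsub>?L\<^esub> j z i = fR (b \<otimes>\<^bsub>R\<^esub> w i) \<one>\<^bsub>R\<^esub>"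
        using eq as(1) by (intro bexI[of _ "s \<otimes>\<^bsub>R\<^esub> w i"] bexI[of _ a])
    next
      fix i s t assume i: "i < r" and st: "s \<in> carrier R" "t \<in> carrier R"
        and "\<exists>b\<in>carrier R. fR s \<one>\<^bsub>R\<^esub> \<otimes>\<^bsub>?L\<^esub> j z i = fR (b \<otimes>\<^bsub>R\<^esub> w i) \<one>\<^bsub>R\<^esub>"
      then obtain b where b: "b \<in> carrier R" "fR s \<one>\<^bsub>R\<^esub> \<otimes>\<^bsub>?L\<^esub> j z i = fR (b \<otimes>\<^bsub>R\<^esub> w i) \<one>\<^bsub>R\<^esub>" by (elim bexE)
      have wi: "w i \<in> carrier R" using W(1) vw(2)[OF i] by auto
      have "fR (t \<otimes>\<^bsub>R\<^esub> s) \<one>\<^bsub>R\<^esub> \<otimes>\<^bsub>?L\<^esub> j z i = j ((t \<otimes>\<^bsub>R\<^esub> s) \<odot>\<^bsub>M\<^esub> z) i"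
        unfolding j_def using st z W(2) by (intro hsm[symmetric]) auto
      also have "\<dots> = j (t \<odot>\<^bsub>M\<^esub> (s \<odot>\<^bsub>M\<^esub> z)) i" using st z by (simp add: smult_assoc1)
      also have "\<dots> = fR t \<one>\<^bsub>R\<^esub> \<otimes>\<^bsub>?L\<^esub> j (s \<odot>\<^bsub>M\<^esub> z) i"
        unfolding j_def using st z W(2) by (intro hsm) auto
      also have "j (s \<odot>\<^bsub>M\<^esub> z) i = fR s \<one>\<^bsub>R\<^esub> \<otimes>\<^bsub>?L\<^esub> j z i"
        unfolding j_def using st z W(2) by (intro hsm) auto
      also have "fR t \<one>\<^bsub>R\<^esub> \<otimes>\<^bsub>?L\<^esub> (fR s \<one>\<^bsub>R\<^esub> \<otimes>\<^bsub>?L\<^esub> j z i) = fR ((t \<otimes>\<^bsub>R\<^esub> b) \<otimes>\<^bsub>R\<^esub> w i) \<one>\<^bsub>R\<^esub>"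
        unfolding b(2) using Lmult[of t "\<one>\<^bsub>R\<^esub>" "b \<otimes>\<^bsub>R\<^esub> w i" "\<one>\<^bsub>R\<^esub>"] st b(1) wi W(2) by (simp add: R.m_assoc)
      finally have "fR (t \<otimes>\<^bsub>R\<^esub> s) \<one>\<^bsub>R\<^esub> \<otimes>\<^bsub>?L\<^esub> j z i = fR ((t \<otimes>\<^bsub>R\<^esub> b) \<otimes>\<^bsub>R\<^esub> w i) \<one>\<^bsub>R\<^esub>" .
      then show "\<exists>b\<in>carrier R. fR (t \<otimes>\<^bsub>R\<^esub> s) \<one>\<^bsub>R\<^esub> \<otimes>\<^bsub>?L\<^esub> j z i = fR (b \<otimes>\<^bsub>R\<^esub> w i) \<one>\<^bsub>R\<^esub>"
        using st b(1) by (intro bexI[of _ "t \<otimes>\<^bsub>R\<^esub> b"]) simp_all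
    qed
    then obtain q where q: "q \<in> carrier R - P" and
      "\<forall>i<r. \<exists>b\<in>carrier R. fR q \<one>\<^bsub>R\<^esub> \<otimes>\<^bsub>?L\<^esub> j z i = fR (b \<otimes>\<^bsub>R\<^esub> w i) \<one>\<^bsub>R\<^esub>" by (rule bexE)
    then obtain b where b: "\<And>i. i < r \<Longrightarrow> b i \<in> carrier R"
      "\<And>i. i < r \<Longrightarrow> fR q \<one>\<^bsub>R\<^esub> \<otimes>\<^bsub>?L\<^esub> j z i = fR (b i \<otimes>\<^bsub>R\<^esub> w i) \<one>\<^bsub>R\<^esub>" by metis
    have qW: "q \<in> W" "q \<in> carrier R" using q by (simp_all add: W_def)
    define c where "c i = (if i < r then b i else \<zero>\<^bsub>R\<^esub>)" for i
    have c: "c \<in> carrier ?F" using b(1) by (simp add: free_module_carrier_nat c_def)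
    let ?y = "linear_extension R M v c"
    have y: "?y \<in> carrier M" by (rule module_hom_closed[OF lin c])
    have "j (q \<odot>\<^bsub>M\<^esub> z) i = j ?y i" for i
    proof (cases "i < r")
      case True
      have "j (q \<odot>\<^bsub>M\<^esub> z) i = fR q \<one>\<^bsub>R\<^esub> \<otimes>\<^bsub>?L\<^esub> j z i"
        unfolding j_def using qW z W(2) by (intro hsm) auto
      then show ?thesis using b(2)[OF True] jlin[OF c True] True by (simp add: c_def)
    next
      case False
      have zi: "j u i = \<zero>\<^bsub>?L\<^esub>" if "u \<in> carrier M" for u
        using jc[OF that] False by (simp add: free_module_carrier_nat)
      show ?thesis using zi[OF y] zi[of "q \<odot>\<^bsub>M\<^esub> z"] qW z by simp
    qed
    then have "h (fM (q \<odot>\<^bsub>M\<^esub> z) \<one>\<^bsub>R\<^esub>) = h (fM ?y \<one>\<^bsub>R\<^esub>)" by (auto simp: j_def)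
    then have "fM (q \<odot>\<^bsub>M\<^esub> z) \<one>\<^bsub>R\<^esub> = fM ?y \<one>\<^bsub>R\<^esub>"
      using fMc[of "q \<odot>\<^bsub>M\<^esub> z", OF _ W(2)] fMc[OF y W(2)] qW z
      by (intro inj_onD[OF bij_betw_imp_inj_on[OF bij]]) simp_all
    then obtain u where u: "u \<in> W" "(u \<otimes>\<^bsub>R\<^esub> \<one>\<^bsub>R\<^esub>) \<odot>\<^bsub>M\<^esub> (q \<odot>\<^bsub>M\<^esub> z) = (u \<otimes>\<^bsub>R\<^esub> \<one>\<^bsub>R\<^esub>) \<odot>\<^bsub>M\<^esub> ?y"
      unfolding fM_def using fr.fraction_eqD[of "q \<odot>\<^bsub>M\<^esub> z" "\<one>\<^bsub>R\<^esub>" ?y "\<one>\<^bsub>R\<^esub>"] qW z y W(2) by auto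
    have "(u \<otimes>\<^bsub>R\<^esub> q) \<odot>\<^bsub>M\<^esub> z = linear_extension R M v (u \<odot>\<^bsub>?F\<^esub> c)"
      using u W(1)[OF u(1)] qW z module_hom_smult[OF lin W(1)[OF u(1)] c] by (simp add: smult_assoc1 del: free_module_simps)
    moreover have "u \<odot>\<^bsub>?F\<^esub> c \<in> carrier ?F"
      using module.smult_closed[OF free_module_module[OF R.is_cring] W(1)[OF u(1)] c] .
    ultimately show ?thesis
      using W(3)[OF u(1) qW(1)] by (intro bexI[of _ "u \<otimes>\<^bsub>R\<^esub> q"]) (simp_all del: free_module_simps)
  qed
  have ind: "\<exists>s\<in>W. s \<otimes>\<^bsub>R\<^esub> c l = \<zero>\<^bsub>R\<^esub>"
    if c: "c \<in> carrier ?F" "linear_extension R M v c = \<zero>\<^bsub>M\<^esub>" and l: "l < r" for c l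
  proof -
    have cl: "c l \<in> carrier R" "w l \<in> carrier R" using c(1) W(1)[OF vw(2)[OF l]] by (simp_all add: free_module_carrier_iff)
    have "fR (c l \<otimes>\<^bsub>R\<^esub> w l) \<one>\<^bsub>R\<^esub> = fR \<zero>\<^bsub>R\<^esub> \<one>\<^bsub>R\<^esub>"
      using jlin[OF c(1) l] jzero[of l] c(2) by simp
    then obtain u where u: "u \<in> W" "(u \<otimes>\<^bsub>R\<^esub> \<one>\<^bsub>R\<^esub>) \<otimes>\<^bsub>R\<^esub> (c l \<otimes>\<^bsub>R\<^esub> w l) = (u \<otimes>\<^bsub>R\<^esub> \<one>\<^bsub>R\<^esub>) \<otimes>\<^bsub>R\<^esub> \<zero>\<^bsub>R\<^esub>"
      unfolding fR_def using sf.fraction_eqD[of "c l \<otimes>\<^bsub>R\<^esub> w l" "\<one>\<^bsub>R\<^esub>" "\<zero>\<^bsub>R\<^esub>" "\<one>\<^bsub>R\<^esub>"] cl W(2) by auto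
    then have "(u \<otimes>\<^bsub>R\<^esub> w l) \<otimes>\<^bsub>R\<^esub> c l = \<zero>\<^bsub>R\<^esub>" using cl W(1)[OF u(1)] by (simp add: R.m_ac)
    then show ?thesis using W(3)[OF u(1) vw(2)[OF l]] by (rule bexI)
  qed
  show ?thesis
    using vP gen ind unfolding W_def by (intro bexI[of _ v] conjI ballI allI impI)
qed

section \<open>From local bases to one free submodule\<close>

lemma (in module) saturation_submodule:
  assumes "primeideal P R" "submodule N R M"
  shows "submodule {z \<in> carrier M. \<exists>s\<in>carrier R - P. s \<odot>\<^bsub>M\<^esub> z \<in> N} R M" (is "submodule ?S R M")
proof (rule submoduleI)
  note pc = prime_complement[OF assms(1)]
  note N = submoduleE[OF assms(2)]
  show "?S \<subseteq> carrier M" by blast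
  show "\<zero>\<^bsub>M\<^esub> \<in> ?S"
    using submodule_zero[OF assms(2)] pc(2) by (intro CollectI conjI bexI[of _ "\<one>\<^bsub>R\<^esub>"]) simp_all
  show "\<ominus>\<^bsub>M\<^esub> a \<in> ?S" if a: "a \<in> ?S" for a
  proof -
    obtain s where s: "a \<in> carrier M" "s \<in> carrier R - P" "s \<odot>\<^bsub>M\<^esub> a \<in> N" using a by blast
    then show ?thesis using N(3)[OF s(3)] by (intro CollectI conjI bexI[of _ s]) (simp_all add: smult_r_minus)
  qed
  show "a \<oplus>\<^bsub>M\<^esub> b \<in> ?S" if ab: "a \<in> ?S" "b \<in> ?S" for a b
  proof -
    obtain s where s: "a \<in> carrier M" "s \<in> carrier R - P" "s \<odot>\<^bsub>M\<^esub> a \<in> N" using ab(1) by blast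
    obtain t where t: "b \<in> carrier M" "t \<in> carrier R - P" "t \<odot>\<^bsub>M\<^esub> b \<in> N" using ab(2) by blast
    have c: "s \<in> carrier R" "t \<in> carrier R" using s t by auto
    have "(s \<otimes>\<^bsub>R\<^esub> t) \<odot>\<^bsub>M\<^esub> (a \<oplus>\<^bsub>M\<^esub> b) = t \<odot>\<^bsub>M\<^esub> (s \<odot>\<^bsub>M\<^esub> a) \<oplus>\<^bsub>M\<^esub> s \<odot>\<^bsub>M\<^esub> (t \<odot>\<^bsub>M\<^esub> b)"
      using s(1) t(1) c by (simp add: smult_r_distr smult_assoc1[symmetric] R.m_comm)
    also have "\<dots> \<in> N" using N(4)[OF c(2) s(3)] N(4)[OF c(1) t(3)] N(5) by blast
    finally show ?thesis using pc(3)[OF s(2) t(2)] s(1) t(1) by (intro CollectI conjI bexI[of _ "s \<otimes>\<^bsub>R\<^esub> t"]) simp_all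
  qed
  show "c \<odot>\<^bsub>M\<^esub> a \<in> ?S" if ca: "c \<in> carrier R" "a \<in> ?S" for c a
  proof -
    obtain s where s: "a \<in> carrier M" "s \<in> carrier R - P" "s \<odot>\<^bsub>M\<^esub> a \<in> N" using ca(2) by blast
    have "s \<odot>\<^bsub>M\<^esub> (c \<odot>\<^bsub>M\<^esub> a) = c \<odot>\<^bsub>M\<^esub> (s \<odot>\<^bsub>M\<^esub> a)"
      using s(1,2) ca(1) by (simp add: smult_assoc1[symmetric] R.m_comm)
    also have "\<dots> \<in> N" by (rule N(4)[OF ca(1) s(3)])
    finally show ?thesis using s(1,2) ca(1) by (intro CollectI conjI bexI[of _ s]) simp_all
  qed
qed

lemma finsum_self_module:
  assumes "cring R" "finite A" "g \<in> A \<rightarrow> carrier R"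
  shows "(\<Oplus>\<^bsub>self_module R\<^esub>i\<in>A. g i) = (\<Oplus>\<^bsub>R\<^esub>i\<in>A. g i)"
proof -
  interpret cring R by fact
  interpret S: module R "self_module R" by (rule self_module_module[OF assms(1)])
  show ?thesis using assms(2,3)
    by (induction A rule: finite_induct) (auto simp: Pi_def)
qed

lemma (in module) scaling_hom: "a \<in> carrier R \<Longrightarrow> (\<lambda>z. a \<odot>\<^bsub>M\<^esub> z) \<in> module_hom R M M"
  by (rule module_hom_scaled[OF module_axioms module_hom_id])

lemma (in module) finitely_generated_saturation:
  assumes "primeideal P R" "submodule U R M" "finitely_generated_module R M"
    and "\<And>z. z \<in> carrier M \<Longrightarrow> \<exists>s\<in>carrier R - P. s \<odot>\<^bsub>M\<^esub> z \<in> U"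
  shows "\<exists>s\<in>carrier R - P. \<forall>z\<in>carrier M. s \<odot>\<^bsub>M\<^esub> z \<in> U"
proof -
  obtain n :: nat and g where g: "g \<in> {..<n} \<rightarrow> carrier M"
    "linear_extension R M g ` carrier (free_module R {..<n}) = carrier M"
    using finitely_generated_cover[OF module_axioms assms(3)] .
  have "\<exists>s\<in>carrier R - P. \<forall>i<n. s \<odot>\<^bsub>M\<^esub> g i \<in> U"
  proof (rule common_multiplier[OF assms(1)])
    show "\<exists>s\<in>carrier R - P. s \<odot>\<^bsub>M\<^esub> g i \<in> U" if "i < n" for i
      using assms(4)[of "g i"] g(1) that by auto
    show "(t \<otimes>\<^bsub>R\<^esub> s) \<odot>\<^bsub>M\<^esub> g i \<in> U" if "i < n" "s \<in> carrier R" "t \<in> carrier R" "s \<odot>\<^bsub>M\<^esub> g i \<in> U" for i s t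
      using that g(1) submoduleE(4)[OF assms(2)] by (simp add: smult_assoc1 Pi_iff)
  qed
  then obtain s where s: "s \<in> carrier R - P" "\<forall>i<n. s \<odot>\<^bsub>M\<^esub> g i \<in> U" by (rule bexE)
  have sub: "submodule {z \<in> carrier M. s \<odot>\<^bsub>M\<^esub> z \<in> U} R M"
    by (rule kernel_submodule[OF module_axioms module_axioms scaling_hom assms(2)]) (use s in simp)
  have "submodule_generated R M (g ` {..<n}) \<subseteq> {z \<in> carrier M. s \<odot>\<^bsub>M\<^esub> z \<in> U}"
    by (rule submodule_generated_least[OF sub]) (use s(2) g(1) in auto)
  then have "\<forall>z\<in>carrier M. s \<odot>\<^bsub>M\<^esub> z \<in> U" using submodule_generated_image[OF g(1)] g(2) by auto
  then show ?thesis using s(1) by (rule bexI)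
qed

lemma (in module) linear_extension_mem:
  assumes "submodule N R M" "c \<in> carrier (free_module R B)" "\<And>i. i \<in> B \<Longrightarrow> c i \<odot>\<^bsub>M\<^esub> v i \<in> N"
  shows "linear_extension R M v c \<in> N"
  unfolding linear_extension_def
  by (rule submodule_finsum[OF assms(1)]) (use assms(2,3) in \<open>auto simp: free_module_carrier_iff\<close>)

text \<open>At each associated prime \<open>P\<close> the combination \<open>\<Sum>\<^sub>Q a\<^sub>Q v\<^sub>Q\<close> of the local bases is, up to a unit,
  congruent to \<open>v\<^sub>P\<close> modulo \<open>P\<close>, so it generates locally by Nakayama's lemma.\<close>

lemma local_generation:
  fixes r :: nat
  assumes "module R M" "primeideal P R" "finite A" "P \<in> A"
    and v: "\<And>Q l. Q \<in> A \<Longrightarrow> l < r \<Longrightarrow> v Q l \<in> carrier M"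
    and gen: "\<And>z. z \<in> carrier M \<Longrightarrow> \<exists>s\<in>carrier R - P. s \<odot>\<^bsub>M\<^esub> z \<in> linear_extension R M (v P) ` carrier (free_module R {..<r})"
    and a: "\<And>Q. Q \<in> A \<Longrightarrow> a Q \<in> carrier R" "a P \<notin> P" "\<And>Q. Q \<in> A \<Longrightarrow> Q \<noteq> P \<Longrightarrow> a Q \<in> P"
    and U: "submodule U R M" "\<And>l. l < r \<Longrightarrow> (\<Oplus>\<^bsub>M\<^esub>Q\<in>A. a Q \<odot>\<^bsub>M\<^esub> v Q l) \<in> U"
  shows "\<exists>t\<in>carrier R - P. \<forall>l<r. t \<odot>\<^bsub>M\<^esub> v P l \<in> U"
proof -
  interpret module R M by fact
  interpret P: primeideal P R by fact
  let ?W = "nakayama_filtration M U P (v P) r"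
  have vP: "\<And>i. i < r \<Longrightarrow> v P i \<in> carrier M" using v[OF assms(4)] .
  have vPi: "v P \<in> {..<r} \<rightarrow> carrier M" using vP by auto
  have W: "submodule ?W R M" by (rule nakayama_filtration_submodule[OF U(1) P.is_ideal vP])
  have UW: "U \<subseteq> ?W" using nakayama_filtration_incl[OF U(1) P.is_ideal vP le0] by simp
  \<comment> \<open>Membership in the filtration up to a factor outside \<open>P\<close>. Being a
    submodule, \<open>S\<close> allows all summands with \<open>Q \<noteq> P\<close> to be
    subtracted at once, which leaves \<open>a P\<close> times \<open>v P l\<close>.\<close>
  define S where "S = {z \<in> carrier M. \<exists>s\<in>carrier R - P. s \<odot>\<^bsub>M\<^esub> z \<in> ?W}"
  have S: "submodule S R M" unfolding S_def by (rule saturation_submodule[OF assms(2) W])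
  have summand: "a Q \<odot>\<^bsub>M\<^esub> v Q l \<in> S" if Q: "Q \<in> A" "Q \<noteq> P" and l: "l < r" for Q l
  proof -
    have vc: "v Q l \<in> carrier M" using v[OF Q(1) l] .
    obtain s where s: "s \<in> carrier R - P" "s \<odot>\<^bsub>M\<^esub> v Q l \<in> linear_extension R M (v P) ` carrier (free_module R {..<r})"
      using gen[OF vc] by (rule bexE)
    obtain c where c: "c \<in> carrier (free_module R {..<r})" "s \<odot>\<^bsub>M\<^esub> v Q l = linear_extension R M (v P) c"
      using s(2) by (rule imageE)
    have sc: "s \<in> carrier R" using s(1) by simp
    have cc: "\<And>i. c i \<in> carrier R" using c(1) by (simp add: free_module_carrier_iff)
    have ac: "a Q \<odot>\<^bsub>free_module R {..<r}\<^esub> c \<in> carrier (free_module R {..<r})"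
      by (rule module.smult_closed[OF free_module_module[OF R.is_cring] a(1)[OF Q(1)] c(1)])
    have "s \<odot>\<^bsub>M\<^esub> (a Q \<odot>\<^bsub>M\<^esub> v Q l) = a Q \<odot>\<^bsub>M\<^esub> (s \<odot>\<^bsub>M\<^esub> v Q l)"
      using sc vc a(1)[OF Q(1)] by (simp add: smult_assoc1[symmetric] R.m_comm)
    also have "\<dots> = linear_extension R M (v P) (a Q \<odot>\<^bsub>free_module R {..<r}\<^esub> c)"
      unfolding c(2) by (rule module_hom_smult[OF linear_extension_hom[OF assms(1) vPi] a(1)[OF Q(1)] c(1), symmetric])
    also have "\<dots> \<in> ?W"
    proof (rule linear_extension_mem[OF W ac])
      fix i assume "i \<in> {..<r}"
      moreover have "a Q \<otimes>\<^bsub>R\<^esub> c i \<in> P" by (rule P.I_r_closed[OF a(3)[OF Q] cc])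
      ultimately show "(a Q \<odot>\<^bsub>free_module R {..<r}\<^esub> c) i \<odot>\<^bsub>M\<^esub> v P i \<in> ?W"
        using nakayama_filtration_term[OF U(1) P.is_ideal vP] by simp
    qed
    finally show ?thesis unfolding S_def using s(1) vc a(1)[OF Q(1)] by (intro CollectI conjI bexI[of _ s]) simp_all
  qed
  show ?thesis
  proof (rule nakayama_at_prime[OF assms(2) U(1) vP])
    fix l assume l: "l < r"
    let ?rest = "\<Oplus>\<^bsub>M\<^esub>Q\<in>A - {P}. a Q \<odot>\<^bsub>M\<^esub> v Q l" and ?u = "\<Oplus>\<^bsub>M\<^esub>Q\<in>A. a Q \<odot>\<^bsub>M\<^esub> v Q l"
    have cl: "\<And>Q. Q \<in> A \<Longrightarrow> a Q \<odot>\<^bsub>M\<^esub> v Q l \<in> carrier M" using a(1) v l by simp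
    have rest: "?rest \<in> S" by (rule submodule_finsum[OF S]) (use assms(3) summand l in auto)
    have rc: "?rest \<in> carrier M" using rest submoduleE(1)[OF S] by (rule subsetD[rotated])
    have "?u = (\<Oplus>\<^bsub>M\<^esub>Q\<in>insert P (A - {P}). a Q \<odot>\<^bsub>M\<^esub> v Q l)" using assms(4) by (simp add: insert_absorb)
    also have "\<dots> = a P \<odot>\<^bsub>M\<^esub> v P l \<oplus>\<^bsub>M\<^esub> ?rest"
      by (rule M.finsum_insert) (use assms(3,4) cl in auto)
    finally have "?u \<ominus>\<^bsub>M\<^esub> ?rest = a P \<odot>\<^bsub>M\<^esub> v P l"
      using diff_eq[OF rc cl[OF assms(4)]] M.a_comm[OF rc cl[OF assms(4)]] by simp
    moreover have "?u \<in> S"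
    proof -
      have "?u \<in> ?W" "?u \<in> carrier M" using U(2)[OF l] UW submoduleE(1)[OF U(1)] by auto
      then show ?thesis unfolding S_def
        using prime_complement(2)[OF assms(2)] by (intro CollectI conjI bexI[of _ "\<one>\<^bsub>R\<^esub>"]) simp_all
    qed
    ultimately have "a P \<odot>\<^bsub>M\<^esub> v P l \<in> S" using submodule_minus[OF S _ rest] by metis
    then obtain s where s: "s \<in> carrier R - P" "s \<odot>\<^bsub>M\<^esub> (a P \<odot>\<^bsub>M\<^esub> v P l) \<in> ?W" unfolding S_def by blast
    have "(s \<otimes>\<^bsub>R\<^esub> a P) \<odot>\<^bsub>M\<^esub> v P l \<in> ?W" using s a(1)[OF assms(4)] vP[OF l] by (simp add: smult_assoc1)
    moreover have "s \<otimes>\<^bsub>R\<^esub> a P \<in> carrier R - P"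
      by (rule prime_complement(3)[OF assms(2) s(1)]) (use a(1)[OF assms(4)] a(2) in simp)
    ultimately show "\<exists>h\<in>carrier R - P. h \<odot>\<^bsub>M\<^esub> v P l \<in> ?W" by (rule bexI)
  qed
qed

text \<open>\<open>r\<close> generators of a free module of rank \<open>r\<close> form a basis; here locally at \<open>P\<close>.\<close>

lemma local_independence:
  fixes r :: nat
  assumes "module R M" "noetherian_ring R" "primeideal P R"
    and u: "u \<in> {..<r} \<rightarrow> carrier M" and v: "v \<in> {..<r} \<rightarrow> carrier M"
    and gen: "\<And>z. z \<in> carrier M \<Longrightarrow> \<exists>s\<in>carrier R - P. s \<odot>\<^bsub>M\<^esub> z \<in> linear_extension R M v ` carrier (free_module R {..<r})"
    and ind: "\<And>c. c \<in> carrier (free_module R {..<r}) \<Longrightarrow> linear_extension R M v c = \<zero>\<^bsub>M\<^esub> \<Longrightarrow>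
        \<forall>l<r. \<exists>s\<in>carrier R - P. s \<otimes>\<^bsub>R\<^esub> c l = \<zero>\<^bsub>R\<^esub>"
    and t: "t \<in> carrier R - P" "\<forall>l<r. t \<odot>\<^bsub>M\<^esub> v l \<in> linear_extension R M u ` carrier (free_module R {..<r})"
    and c: "c \<in> carrier (free_module R {..<r})" "linear_extension R M u c = \<zero>\<^bsub>M\<^esub>"
  shows "\<exists>s\<in>carrier R - P. \<forall>l<r. s \<otimes>\<^bsub>R\<^esub> c l = \<zero>\<^bsub>R\<^esub>"
proof -
  interpret module R M by fact
  let ?F = "free_module R {..<r}"
  interpret F: module R ?F by (rule free_module_module) (rule R.is_cring)
  note pc = prime_complement[OF assms(3)]
  let ?u = "linear_extension R M u" and ?v = "linear_extension R M v"
  have hu: "?u \<in> module_hom R ?F M" and hv: "?v \<in> module_hom R ?F M"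
    using linear_extension_hom[OF assms(1)] u v by auto
  have su: "submodule (?u ` carrier ?F) R M" and sv: "submodule (?v ` carrier ?F) R M"
    using image_submodule[OF F.module_axioms assms(1) _ F.carrier_is_submodule] hu hv by auto
  have tc: "t \<in> carrier R" using t(1) by simp
  have ind': "\<exists>s\<in>carrier R - P. s \<odot>\<^bsub>?F\<^esub> d = \<zero>\<^bsub>?F\<^esub>" if d: "d \<in> carrier ?F" "?v d = \<zero>\<^bsub>M\<^esub>" for d
  proof -
    have dc: "\<And>i. d i \<in> carrier R" "\<And>i. i \<ge> r \<Longrightarrow> d i = \<zero>\<^bsub>R\<^esub>" using d(1) by (simp_all add: free_module_carrier_nat)
    have "\<exists>s\<in>carrier R - P. \<forall>l<r. s \<otimes>\<^bsub>R\<^esub> d l = \<zero>\<^bsub>R\<^esub>"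
    proof (rule common_multiplier[OF assms(3)])
      show "\<exists>s\<in>carrier R - P. s \<otimes>\<^bsub>R\<^esub> d l = \<zero>\<^bsub>R\<^esub>" if "l < r" for l using ind[OF d] that by simp
      show "(b \<otimes>\<^bsub>R\<^esub> s) \<otimes>\<^bsub>R\<^esub> d l = \<zero>\<^bsub>R\<^esub>" if "s \<in> carrier R" "b \<in> carrier R" "s \<otimes>\<^bsub>R\<^esub> d l = \<zero>\<^bsub>R\<^esub>" for l s b
        using that dc by (simp add: R.m_assoc)
    qed
    then obtain s where s: "s \<in> carrier R - P" "\<forall>l<r. s \<otimes>\<^bsub>R\<^esub> d l = \<zero>\<^bsub>R\<^esub>" by (rule bexE)
    have "s \<otimes>\<^bsub>R\<^esub> d l = \<zero>\<^bsub>R\<^esub>" for l using s dc by (cases "l < r") auto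
    then show ?thesis using s(1) by (intro bexI[of _ s]) simp_all
  qed
  have "\<exists>s\<in>carrier R - P. \<forall>l<r. s \<odot>\<^bsub>M\<^esub> u l \<in> ?v ` carrier ?F"
  proof (rule common_multiplier[OF assms(3)])
    show "\<exists>s\<in>carrier R - P. s \<odot>\<^bsub>M\<^esub> u l \<in> ?v ` carrier ?F" if "l < r" for l using gen u that by auto
    show "(b \<otimes>\<^bsub>R\<^esub> s) \<odot>\<^bsub>M\<^esub> u l \<in> ?v ` carrier ?F"
      if "l < r" "s \<in> carrier R" "b \<in> carrier R" "s \<odot>\<^bsub>M\<^esub> u l \<in> ?v ` carrier ?F" for l s b
      using that u submoduleE(4)[OF sv that(3,4)] by (simp add: smult_assoc1 Pi_iff)
  qed
  then obtain s where s: "s \<in> carrier R - P" "\<forall>l<r. s \<odot>\<^bsub>M\<^esub> u l \<in> ?v ` carrier ?F" by (rule bexE)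
  have sc: "s \<in> carrier R" using s(1) by simp
  have img: "a \<odot>\<^bsub>M\<^esub> linear_extension R M w d \<in> N"
    if "submodule N R M" "a \<in> carrier R" "w \<in> {..<r} \<rightarrow> carrier M" "\<forall>l<r. a \<odot>\<^bsub>M\<^esub> w l \<in> N" "d \<in> carrier ?F" for N a w d
  proof -
    have hw: "linear_extension R M w \<in> module_hom R ?F M" by (rule linear_extension_hom[OF assms(1) that(3)])
    have "a \<odot>\<^bsub>M\<^esub> linear_extension R M w d = linear_extension R M (\<lambda>p. a \<odot>\<^bsub>M\<^esub> linear_extension R M w (basis_vector R p)) d"
      by (rule hom_eq_linear_extension[OF assms(1) module_hom_scaled[OF assms(1) hw that(2)] that(5)])
    also have "\<dots> \<in> N"
    proof (rule linear_extension_mem[OF that(1,5)])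
      fix i assume i: "i \<in> {..<r}"
      then have "linear_extension R M w (basis_vector R i) = w i"
        using that(3) by (intro linear_extension_basis[OF assms(1)]) auto
      then show "d i \<odot>\<^bsub>M\<^esub> (a \<odot>\<^bsub>M\<^esub> linear_extension R M w (basis_vector R i)) \<in> N"
        using that(4,5) i submoduleE(4)[OF that(1)] by (simp add: free_module_carrier_iff)
    qed
    finally show ?thesis .
  qed
  \<comment> \<open>\<open>G\<close> and \<open>H\<close> are the two changes of basis between
    \<open>u\<close> and \<open>v\<close>, up to the denominators \<open>t\<close> and
    \<open>s\<close>. Their composite is multiplication by \<open>s t\<close> up to vectors killed
    by \<open>v\<close>, and independence of \<open>v\<close> kills these by a factor
    \<open>q\<close> outside \<open>P\<close>.\<close>
  obtain G where G: "G \<in> module_hom R ?F ?F" "\<And>d. d \<in> carrier ?F \<Longrightarrow> ?u (G d) = t \<odot>\<^bsub>M\<^esub> ?v d"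
    using free_lifting[OF F.module_axioms assms(1) module_hom_scaled[OF assms(1) hv tc] hu img[OF su tc v t(2)]] by blast
  obtain H where H: "H \<in> module_hom R ?F ?F" "\<And>d. d \<in> carrier ?F \<Longrightarrow> ?v (H d) = s \<odot>\<^bsub>M\<^esub> ?u d"
    using free_lifting[OF F.module_axioms assms(1) module_hom_scaled[OF assms(1) hu sc] hv img[OF sv sc u s(2)]] by blast
  note Gc = module_hom_closed[OF G(1)] and Hc = module_hom_closed[OF H(1)]
  have st: "s \<otimes>\<^bsub>R\<^esub> t \<in> carrier R" using sc tc by simp
  have vHG: "?v (H (G d) \<ominus>\<^bsub>?F\<^esub> (s \<otimes>\<^bsub>R\<^esub> t) \<odot>\<^bsub>?F\<^esub> d) = \<zero>\<^bsub>M\<^esub>" if d: "d \<in> carrier ?F" for d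
  proof -
    have "?v (H (G d)) = (s \<otimes>\<^bsub>R\<^esub> t) \<odot>\<^bsub>M\<^esub> ?v d"
      using H(2)[OF Gc[OF d]] G(2)[OF d] sc tc module_hom_closed[OF hv d] by (simp add: smult_assoc1)
    also have "\<dots> = ?v ((s \<otimes>\<^bsub>R\<^esub> t) \<odot>\<^bsub>?F\<^esub> d)" by (rule module_hom_smult[OF hv st d, symmetric])
    finally show ?thesis
      using module_hom_minus[OF F.module_axioms assms(1) hv Hc[OF Gc[OF d]] F.smult_closed[OF st d]]
        module_hom_closed[OF hv F.smult_closed[OF st d]] by (simp add: M.minus_eq M.r_neg del: free_module_simps)
  qed
  have "\<exists>q\<in>carrier R - P. \<forall>l<r. q \<odot>\<^bsub>?F\<^esub> (H (G (basis_vector R l)) \<ominus>\<^bsub>?F\<^esub> (s \<otimes>\<^bsub>R\<^esub> t) \<odot>\<^bsub>?F\<^esub> basis_vector R l) = \<zero>\<^bsub>?F\<^esub>"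
  proof (rule common_multiplier[OF assms(3)])
    fix l assume l: "l < r"
    have e: "basis_vector R l \<in> carrier ?F" by (rule basis_vector_closed[OF R.is_cring]) (use l in simp)
    let ?d = "H (G (basis_vector R l)) \<ominus>\<^bsub>?F\<^esub> (s \<otimes>\<^bsub>R\<^esub> t) \<odot>\<^bsub>?F\<^esub> basis_vector R l"
    have d: "?d \<in> carrier ?F" by (rule F.M.minus_closed[OF Hc[OF Gc[OF e]] F.smult_closed[OF st e]])
    show "\<exists>q\<in>carrier R - P. q \<odot>\<^bsub>?F\<^esub> ?d = \<zero>\<^bsub>?F\<^esub>" by (rule ind'[OF d vHG[OF e]])
    fix q b assume qb: "q \<in> carrier R" "b \<in> carrier R" "q \<odot>\<^bsub>?F\<^esub> ?d = \<zero>\<^bsub>?F\<^esub>"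
    then have "(b \<otimes>\<^bsub>R\<^esub> q) \<odot>\<^bsub>?F\<^esub> ?d = b \<odot>\<^bsub>?F\<^esub> (q \<odot>\<^bsub>?F\<^esub> ?d)" using F.smult_assoc1[OF qb(2,1) d] by blast
    also have "\<dots> = \<zero>\<^bsub>?F\<^esub>" unfolding qb(3) by (rule F.smult_r_null[OF qb(2)])
    finally show "(b \<otimes>\<^bsub>R\<^esub> q) \<odot>\<^bsub>?F\<^esub> ?d = \<zero>\<^bsub>?F\<^esub>" .
  qed
  then obtain q where q: "q \<in> carrier R - P"
    "\<forall>l<r. q \<odot>\<^bsub>?F\<^esub> (H (G (basis_vector R l)) \<ominus>\<^bsub>?F\<^esub> (s \<otimes>\<^bsub>R\<^esub> t) \<odot>\<^bsub>?F\<^esub> basis_vector R l) = \<zero>\<^bsub>?F\<^esub>" by (rule bexE)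
  have qc: "q \<in> carrier R" using q(1) by simp
  define \<tau> where "\<tau> = q \<otimes>\<^bsub>R\<^esub> (s \<otimes>\<^bsub>R\<^esub> t)"
  have \<tau>: "\<tau> \<in> carrier R - P" unfolding \<tau>_def by (intro pc(3) q(1) s(1) t(1))
  then have \<tau>c: "\<tau> \<in> carrier R" by simp
  define b where "b d = q \<odot>\<^bsub>?F\<^esub> G d" for d
  have b: "b \<in> module_hom R ?F ?F" unfolding b_def by (rule module_hom_scaled[OF F.module_axioms G(1) qc])
  have Hb: "H (b d) = \<tau> \<odot>\<^bsub>?F\<^esub> d" if d: "d \<in> carrier ?F" for d
  proof (rule hom_eqI[OF F.module_axioms module_hom_comp[OF b H(1)] F.scaling_hom[OF \<tau>c] _ d])
    fix l assume l: "l \<in> {..<r}"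
    have e: "basis_vector R l \<in> carrier ?F" by (rule basis_vector_closed[OF R.is_cring l])
    have c1: "q \<odot>\<^bsub>?F\<^esub> H (G (basis_vector R l)) \<in> carrier ?F" by (rule F.smult_closed[OF qc Hc[OF Gc[OF e]]])
    have c2: "\<tau> \<odot>\<^bsub>?F\<^esub> basis_vector R l \<in> carrier ?F" by (rule F.smult_closed[OF \<tau>c e])
    have "q \<odot>\<^bsub>?F\<^esub> (H (G (basis_vector R l)) \<ominus>\<^bsub>?F\<^esub> (s \<otimes>\<^bsub>R\<^esub> t) \<odot>\<^bsub>?F\<^esub> basis_vector R l) = \<zero>\<^bsub>?F\<^esub>" using q(2) l by simp
    moreover have "q \<odot>\<^bsub>?F\<^esub> (H (G (basis_vector R l)) \<ominus>\<^bsub>?F\<^esub> (s \<otimes>\<^bsub>R\<^esub> t) \<odot>\<^bsub>?F\<^esub> basis_vector R l) =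
      q \<odot>\<^bsub>?F\<^esub> H (G (basis_vector R l)) \<ominus>\<^bsub>?F\<^esub> q \<odot>\<^bsub>?F\<^esub> ((s \<otimes>\<^bsub>R\<^esub> t) \<odot>\<^bsub>?F\<^esub> basis_vector R l)"
      by (rule module_hom_minus[OF F.module_axioms F.module_axioms F.scaling_hom[OF qc] Hc[OF Gc[OF e]] F.smult_closed[OF st e]])
    moreover have "q \<odot>\<^bsub>?F\<^esub> ((s \<otimes>\<^bsub>R\<^esub> t) \<odot>\<^bsub>?F\<^esub> basis_vector R l) = \<tau> \<odot>\<^bsub>?F\<^esub> basis_vector R l"
      unfolding \<tau>_def by (rule F.smult_assoc1[OF qc st e, symmetric])
    ultimately have "q \<odot>\<^bsub>?F\<^esub> H (G (basis_vector R l)) = \<tau> \<odot>\<^bsub>?F\<^esub> basis_vector R l"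
      using F.diff_eq_zero_iff[OF c1 c2] by (simp del: free_module_simps)
    then show "H (b (basis_vector R l)) = \<tau> \<odot>\<^bsub>?F\<^esub> basis_vector R l"
      unfolding b_def using module_hom_smult[OF H(1) qc Gc[OF e]] by (simp del: free_module_simps)
  qed
  \<comment> \<open>\<open>H\<close> has the right inverse \<open>b\<close> up to
    \<open>\<tau>\<close>, so its kernel is killed by a power of \<open>\<tau>\<close>, which is
    again outside \<open>P\<close>. This is the step from generating to independent.\<close>
  obtain n :: nat where n: "\<And>d. d \<in> carrier ?F \<Longrightarrow> H d = \<zero>\<^bsub>?F\<^esub> \<Longrightarrow> (\<tau> [^]\<^bsub>R\<^esub> n) \<odot>\<^bsub>?F\<^esub> d = \<zero>\<^bsub>?F\<^esub>"
    using kernel_killed_by_power[OF F.module_axioms noetherian_free_module[OF R.is_cring assms(2)] H(1) b \<tau>c Hb] by blast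
  \<comment> \<open>A relation \<open>c\<close> of the \<open>u l\<close> gives the relation
    \<open>H c\<close> of the \<open>v l\<close>, which vanishes locally; so \<open>c\<close> is, up
    to the factor \<open>p\<close>, in the kernel of \<open>H\<close>.\<close>
  have "?v (H c) = \<zero>\<^bsub>M\<^esub>" using H(2)[OF c(1)] c(2) sc by simp
  then obtain p where p: "p \<in> carrier R - P" "p \<odot>\<^bsub>?F\<^esub> H c = \<zero>\<^bsub>?F\<^esub>" using ind'[OF Hc[OF c(1)]] by blast
  have pcr: "p \<in> carrier R" using p(1) by simp
  have "H (p \<odot>\<^bsub>?F\<^esub> c) = \<zero>\<^bsub>?F\<^esub>" using module_hom_smult[OF H(1) pcr c(1)] p(2) by (simp del: free_module_simps)
  then have "(\<tau> [^]\<^bsub>R\<^esub> n) \<odot>\<^bsub>?F\<^esub> (p \<odot>\<^bsub>?F\<^esub> c) = \<zero>\<^bsub>?F\<^esub>" by (rule n[OF F.smult_closed[OF pcr c(1)]])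
  moreover have "\<tau> [^]\<^bsub>R\<^esub> n \<in> carrier R - P"
  proof (induction n)
    case 0
    then show ?case using pc(2) by simp
  next
    case (Suc n)
    then show ?case using pc(3)[OF Suc \<tau>] by simp
  qed
  moreover have "(\<tau> [^]\<^bsub>R\<^esub> n \<otimes>\<^bsub>R\<^esub> p) \<odot>\<^bsub>?F\<^esub> c = (\<tau> [^]\<^bsub>R\<^esub> n) \<odot>\<^bsub>?F\<^esub> (p \<odot>\<^bsub>?F\<^esub> c)"
    by (rule F.smult_assoc1[OF _ pcr c(1)]) (use \<tau>c in simp)
  ultimately show ?thesis
    using pc(3)[OF _ p(1), of "\<tau> [^]\<^bsub>R\<^esub> n"] by (intro bexI[of _ "\<tau> [^]\<^bsub>R\<^esub> n \<otimes>\<^bsub>R\<^esub> p"]) (simp_all add: fun_eq_iff)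
qed

text \<open>The number of basis elements is the same at all associated primes, so the local bases
  can be glued to one family \<open>u\<close>. The multiplier \<open>y\<close> is glued from local
  ones with the same coefficients; it lies in no associated prime and is therefore regular.\<close>

lemma rank_embedding:
  assumes "noetherian_local_ring R \<mm>" "krull_dim R = 1" "x \<in> \<mm>" "x \<in> nonzerodivisors R"
    and "module R M" "finitely_generated_module R M" "has_rank R M"
  obtains r :: nat and u y where "u \<in> {..<r} \<rightarrow> carrier M" "y \<in> nonzerodivisors R"
    "\<And>c. c \<in> carrier (free_module R {..<r}) \<Longrightarrow> linear_extension R M u c = \<zero>\<^bsub>M\<^esub> \<Longrightarrow> c = (\<lambda>i. \<zero>\<^bsub>R\<^esub>)"
    "\<And>z. z \<in> carrier M \<Longrightarrow> y \<odot>\<^bsub>M\<^esub> z \<in> linear_extension R M u ` carrier (free_module R {..<r})"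
proof -
  note L = noetherian_local_ringD[OF assms(1)]
  interpret module R M by fact
  define A where "A = associated_primes R"
  have finA: "finite A" unfolding A_def by (rule finite_associated_primes[OF assms(1-4)])
  have prA: "\<And>P. P \<in> A \<Longrightarrow> primeideal P R" unfolding A_def by (erule associated_primeE)
  obtain r :: nat where r: "\<And>P. P \<in> A \<Longrightarrow> module_isomorphic (localized_ring R (carrier R - P))
       (localized_module R (carrier R - P) M) (free_module (localized_ring R (carrier R - P)) {..<r})"
    using assms(7) unfolding has_rank_def A_def by blast
  let ?F = "free_module R {..<r}"
  interpret F: module R ?F by (rule free_module_module) (rule R.is_cring)
  have "\<forall>P\<in>A. \<exists>v\<in>{..<r} \<rightarrow> carrier M.
      (\<forall>z\<in>carrier M. \<exists>s\<in>carrier R - P. s \<odot>\<^bsub>M\<^esub> z \<in> linear_extension R M v ` carrier ?F) \<and>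
      (\<forall>c\<in>carrier ?F. linear_extension R M v c = \<zero>\<^bsub>M\<^esub> \<longrightarrow>
        (\<forall>l<r. \<exists>s\<in>carrier R - P. s \<otimes>\<^bsub>R\<^esub> c l = \<zero>\<^bsub>R\<^esub>))"
    using localized_basis[OF assms(5) prA r] by (rule ballI)
  from bchoice[OF this[unfolded Bex_def]] obtain v where v: "\<forall>P\<in>A. v P \<in> {..<r} \<rightarrow> carrier M \<and>
      (\<forall>z\<in>carrier M. \<exists>s\<in>carrier R - P. s \<odot>\<^bsub>M\<^esub> z \<in> linear_extension R M (v P) ` carrier ?F) \<and>
      (\<forall>c\<in>carrier ?F. linear_extension R M (v P) c = \<zero>\<^bsub>M\<^esub> \<longrightarrow>
        (\<forall>l<r. \<exists>s\<in>carrier R - P. s \<otimes>\<^bsub>R\<^esub> c l = \<zero>\<^bsub>R\<^esub>))"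
    unfolding Bex_def by (rule exE)
  \<comment> \<open>Coefficients as in the Chinese remainder theorem: \<open>a P\<close> lies in
    every associated prime except \<open>P\<close>. They exist because these primes are
    incomparable.\<close>
  have "\<forall>P\<in>A. \<exists>a\<in>carrier R - P. \<forall>Q\<in>A - {P}. a \<in> Q"
  proof
    fix P assume P: "P \<in> A"
    show "\<exists>a\<in>carrier R - P. \<forall>Q\<in>A - {P}. a \<in> Q"
    proof (rule element_in_ideals_outside_prime[OF prA[OF P]])
      show "finite (A - {P})" using finA by simp
      show "ideal Q R" if "Q \<in> A - {P}" for Q using prA[of Q] that primeideal.axioms(1) by blast
      show "\<not> Q \<subseteq> P" if Q: "Q \<in> A - {P}" for Q
        using associated_prime_incomparable[OF assms(1-4), of Q P] Q P unfolding A_def by blast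
    qed
  qed
  from bchoice[OF this[unfolded Bex_def]] obtain a where a: "\<forall>P\<in>A. a P \<in> carrier R - P \<and> (\<forall>Q\<in>A - {P}. a P \<in> Q)"
    unfolding Bex_def by (rule exE)
  define u where "u l = (\<Oplus>\<^bsub>M\<^esub>Q\<in>A. a Q \<odot>\<^bsub>M\<^esub> v Q l)" for l
  have vc: "v Q l \<in> carrier M" if "Q \<in> A" "l < r" for Q l using v that by auto
  have ac: "a Q \<in> carrier R" if "Q \<in> A" for Q using a that by auto
  have u: "u \<in> {..<r} \<rightarrow> carrier M" unfolding u_def using vc ac by (intro Pi_I M.finsum_closed) auto
  let ?U = "linear_extension R M u ` carrier ?F"
  have hu: "linear_extension R M u \<in> module_hom R ?F M" by (rule linear_extension_hom[OF assms(5) u])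
  have U: "submodule ?U R M" by (rule image_submodule[OF F.module_axioms assms(5) hu F.carrier_is_submodule])
  have uU: "u l \<in> ?U" if l: "l < r" for l
  proof -
    have "linear_extension R M u (basis_vector R l) = u l"
      by (rule linear_extension_basis[OF assms(5)]) (use u l in auto)
    moreover have "basis_vector R l \<in> carrier ?F" by (rule basis_vector_closed[OF R.is_cring]) (use l in simp)
    ultimately show ?thesis by (metis image_eqI)
  qed
  have loc: "\<exists>t\<in>carrier R - P. \<forall>l<r. t \<odot>\<^bsub>M\<^esub> v P l \<in> ?U" if P: "P \<in> A" for P
  proof (rule local_generation[OF assms(5) prA[OF P] finA P vc])
    show "\<exists>s\<in>carrier R - P. s \<odot>\<^bsub>M\<^esub> z \<in> linear_extension R M (v P) ` carrier ?F" if "z \<in> carrier M" for z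
      using v P that by blast
    show "a Q \<in> P" if "Q \<in> A" "Q \<noteq> P" for Q using a P that by simp
    show "a P \<notin> P" using a P by simp
    show "(\<Oplus>\<^bsub>M\<^esub>Q\<in>A. a Q \<odot>\<^bsub>M\<^esub> v Q l) \<in> ?U" if "l < r" for l using uU[OF that] unfolding u_def .
  qed (use ac U in auto)
  have conductor: "\<exists>s\<in>carrier R - P. \<forall>z\<in>carrier M. s \<odot>\<^bsub>M\<^esub> z \<in> ?U" if P: "P \<in> A" for P
  proof (rule finitely_generated_saturation[OF prA[OF P] U assms(6)])
    fix z assume z: "z \<in> carrier M"
    obtain t where t: "t \<in> carrier R - P" "\<forall>l<r. t \<odot>\<^bsub>M\<^esub> v P l \<in> ?U" using loc[OF P] by (rule bexE)
    have "\<exists>s\<in>carrier R - P. s \<odot>\<^bsub>M\<^esub> z \<in> linear_extension R M (v P) ` carrier ?F" using v P z by blast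
    then obtain s where s: "s \<in> carrier R - P" "s \<odot>\<^bsub>M\<^esub> z \<in> linear_extension R M (v P) ` carrier ?F" by (rule bexE)
    from s(2) obtain c where c: "c \<in> carrier ?F" "s \<odot>\<^bsub>M\<^esub> z = linear_extension R M (v P) c" by (rule imageE)
    have cc: "s \<in> carrier R" "t \<in> carrier R" using s t by auto
    have vP: "v P \<in> {..<r} \<rightarrow> carrier M" using v P by blast
    have sub: "submodule {z \<in> carrier M. t \<odot>\<^bsub>M\<^esub> z \<in> ?U} R M"
      by (rule kernel_submodule[OF module_axioms module_axioms scaling_hom[OF cc(2)] U])
    have "linear_extension R M (v P) c \<in> {z \<in> carrier M. t \<odot>\<^bsub>M\<^esub> z \<in> ?U}"
      by (rule linear_extension_mem[OF sub c(1)], rule submoduleE(4)[OF sub])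
        (use c(1) t(2) vc[OF P] in \<open>auto simp: free_module_carrier_iff\<close>)
    then have "(t \<otimes>\<^bsub>R\<^esub> s) \<odot>\<^bsub>M\<^esub> z \<in> ?U" using c(2) cc z by (simp add: smult_assoc1)
    then show "\<exists>s\<in>carrier R - P. s \<odot>\<^bsub>M\<^esub> z \<in> ?U"
      using prime_complement(3)[OF prA[OF P] t(1) s(1)] by (rule bexI)
  qed
  then have "\<forall>P\<in>A. \<exists>s. s \<in> carrier R - P \<and> (\<forall>z\<in>carrier M. s \<odot>\<^bsub>M\<^esub> z \<in> ?U)" by blast
  from bchoice[OF this] obtain t where t: "\<forall>P\<in>A. t P \<in> carrier R - P \<and> (\<forall>z\<in>carrier M. t P \<odot>\<^bsub>M\<^esub> z \<in> ?U)" by (rule exE)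
  \<comment> \<open>Modulo \<open>P\<close> only the summand \<open>a P \<otimes> t P\<close>
    survives, and it is outside \<open>P\<close>.\<close>
  define y where "y = (\<Oplus>\<^bsub>R\<^esub>P\<in>A. a P \<otimes>\<^bsub>R\<^esub> t P)"
  have tc: "t P \<in> carrier R" if "P \<in> A" for P using t that by simp
  have yc: "y \<in> carrier R" unfolding y_def using ac tc by (intro R.finsum_closed) auto
  have yU: "y \<odot>\<^bsub>M\<^esub> z \<in> ?U" if z: "z \<in> carrier M" for z
  proof -
    interpret SM: module R "self_module R" by (rule self_module_module) (rule R.is_cring)
    have hom: "(\<lambda>p. p \<odot>\<^bsub>M\<^esub> z) \<in> module_hom R (self_module R) M"
      by (rule module_homI) (auto simp: smult_l_distr smult_assoc1 z)
    have sub: "submodule {p \<in> carrier (self_module R). p \<odot>\<^bsub>M\<^esub> z \<in> ?U} R (self_module R)"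
      by (rule kernel_submodule[OF SM.module_axioms assms(5) hom U])
    have "(\<Oplus>\<^bsub>self_module R\<^esub>P\<in>A. a P \<otimes>\<^bsub>R\<^esub> t P) \<in> {p \<in> carrier (self_module R). p \<odot>\<^bsub>M\<^esub> z \<in> ?U}"
    proof (rule SM.submodule_finsum[OF sub finA])
      fix P assume P: "P \<in> A"
      have "t P \<odot>\<^bsub>M\<^esub> z \<in> ?U" using t P z by blast
      then have "a P \<odot>\<^bsub>M\<^esub> (t P \<odot>\<^bsub>M\<^esub> z) \<in> ?U" by (rule submoduleE(4)[OF U ac[OF P]])
      then show "a P \<otimes>\<^bsub>R\<^esub> t P \<in> {p \<in> carrier (self_module R). p \<odot>\<^bsub>M\<^esub> z \<in> ?U}"
        using ac[OF P] tc[OF P] z by (simp add: smult_assoc1)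
    qed
    moreover have "(\<Oplus>\<^bsub>self_module R\<^esub>P\<in>A. a P \<otimes>\<^bsub>R\<^esub> t P) = y"
      unfolding y_def by (rule finsum_self_module[OF R.is_cring finA]) (use ac tc in auto)
    ultimately show ?thesis by simp
  qed
  have yP: "y \<notin> P" if P: "P \<in> A" for P
  proof
    assume yP: "y \<in> P"
    interpret P: primeideal P R by (rule prA[OF P])
    let ?rest = "\<Oplus>\<^bsub>R\<^esub>Q\<in>A - {P}. a Q \<otimes>\<^bsub>R\<^esub> t Q"
    have fin: "finite (A - {P})" "P \<notin> A - {P}" using finA by auto
    have f: "(\<lambda>Q. a Q \<otimes>\<^bsub>R\<^esub> t Q) \<in> A - {P} \<rightarrow> carrier R" using ac tc by auto
    have "y = (\<Oplus>\<^bsub>R\<^esub>Q\<in>insert P (A - {P}). a Q \<otimes>\<^bsub>R\<^esub> t Q)" unfolding y_def using P by (simp add: insert_absorb)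
    also have "\<dots> = a P \<otimes>\<^bsub>R\<^esub> t P \<oplus>\<^bsub>R\<^esub> ?rest"
      by (rule R.finsum_insert[OF fin f]) (use ac tc P in auto)
    finally have eq: "y = a P \<otimes>\<^bsub>R\<^esub> t P \<oplus>\<^bsub>R\<^esub> ?rest" .
    have rest: "?rest \<in> P"
    proof -
      have "(\<Oplus>\<^bsub>R\<^esub>Q\<in>B. a Q \<otimes>\<^bsub>R\<^esub> t Q) \<in> P" if "finite B" "B \<subseteq> A - {P}" for B
        using that
      proof (induction B rule: finite_induct)
        case (insert Q B)
        have "Q \<in> A" "Q \<noteq> P" using insert.prems by auto
        then have "a Q \<in> P" "t Q \<in> carrier R" using a P tc by auto
        then have "a Q \<otimes>\<^bsub>R\<^esub> t Q \<in> P" by (rule P.I_r_closed)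
        moreover have "(\<lambda>Q. a Q \<otimes>\<^bsub>R\<^esub> t Q) \<in> B \<rightarrow> carrier R" using f insert.prems by auto
        moreover have "(\<Oplus>\<^bsub>R\<^esub>Q\<in>B. a Q \<otimes>\<^bsub>R\<^esub> t Q) \<in> P" using insert by simp
        ultimately show ?case using insert.hyps P.a_Hcarr by (simp add: R.finsum_insert)
      qed simp
      from this[OF fin(1) order_refl] show ?thesis .
    qed
    have "a P \<otimes>\<^bsub>R\<^esub> t P \<in> carrier R - P" by (rule prime_complement(3)[OF prA[OF P]]) (use a t P in auto)
    moreover have "y \<oplus>\<^bsub>R\<^esub> \<ominus>\<^bsub>R\<^esub> ?rest = a P \<otimes>\<^bsub>R\<^esub> t P"
      unfolding eq using ac[OF P] tc[OF P] P.a_Hcarr[OF rest] by (simp add: R.a_assoc R.r_neg)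
    moreover have "y \<oplus>\<^bsub>R\<^esub> \<ominus>\<^bsub>R\<^esub> ?rest \<in> P" using P.a_closed[OF yP P.a_inv_closed[OF rest]] .
    ultimately show False by simp
  qed
  have ynz: "y \<in> nonzerodivisors R"
    unfolding nonzerodivisors_def
  proof (intro CollectI conjI ballI impI yc)
    fix b assume b: "b \<in> carrier R" "y \<otimes>\<^bsub>R\<^esub> b = \<zero>\<^bsub>R\<^esub>"
    show "b = \<zero>\<^bsub>R\<^esub>"
    proof (rule ccontr)
      assume "b \<noteq> \<zero>\<^bsub>R\<^esub>"
      then obtain P where P: "P \<in> associated_primes R" "{a \<in> carrier R. a \<otimes>\<^bsub>R\<^esub> b = \<zero>\<^bsub>R\<^esub>} \<subseteq> P"
        by (rule exists_associated_prime[OF L(1,2) b(1)])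
      then show False using yP[of P] b(2) yc unfolding A_def by blast
    qed
  qed
  \<comment> \<open>The annihilator of a nonzero coordinate \<open>c l\<close> lies in some
    associated prime, while independence at that prime provides an annihilating element outside
    it.\<close>
  have ind: "c = (\<lambda>i. \<zero>\<^bsub>R\<^esub>)" if c: "c \<in> carrier ?F" "linear_extension R M u c = \<zero>\<^bsub>M\<^esub>" for c
  proof
    fix l
    have cc: "c l \<in> carrier R" "l \<ge> r \<Longrightarrow> c l = \<zero>\<^bsub>R\<^esub>" using c(1) by (simp_all add: free_module_carrier_nat)
    show "c l = \<zero>\<^bsub>R\<^esub>"
    proof (rule ccontr)
      assume nz: "c l \<noteq> \<zero>\<^bsub>R\<^esub>"
      then have l: "l < r" using cc(2) by (meson not_le)
      obtain P where P: "P \<in> associated_primes R" "{a \<in> carrier R. a \<otimes>\<^bsub>R\<^esub> c l = \<zero>\<^bsub>R\<^esub>} \<subseteq> P"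
        by (rule exists_associated_prime[OF L(1,2) cc(1) nz])
      then have PA: "P \<in> A" by (simp add: A_def)
      obtain t where t: "t \<in> carrier R - P" "\<forall>l<r. t \<odot>\<^bsub>M\<^esub> v P l \<in> ?U" using loc[OF PA] by (rule bexE)
      have vP: "v P \<in> {..<r} \<rightarrow> carrier M" using v PA by blast
      have g: "\<exists>s\<in>carrier R - P. s \<odot>\<^bsub>M\<^esub> z \<in> linear_extension R M (v P) ` carrier ?F" if "z \<in> carrier M" for z
        using v PA that by blast
      have i: "\<forall>l<r. \<exists>s\<in>carrier R - P. s \<otimes>\<^bsub>R\<^esub> c l = \<zero>\<^bsub>R\<^esub>"
        if "c \<in> carrier ?F" "linear_extension R M (v P) c = \<zero>\<^bsub>M\<^esub>" for c using v PA that by blast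
      have "\<exists>s\<in>carrier R - P. \<forall>l<r. s \<otimes>\<^bsub>R\<^esub> c l = \<zero>\<^bsub>R\<^esub>"
        by (rule local_independence[OF assms(5) L(2) prA[OF PA] u vP g i t c])
      then obtain s where s: "s \<in> carrier R - P" "\<forall>l<r. s \<otimes>\<^bsub>R\<^esub> c l = \<zero>\<^bsub>R\<^esub>" by (rule bexE)
      then have "s \<in> {a \<in> carrier R. a \<otimes>\<^bsub>R\<^esub> c l = \<zero>\<^bsub>R\<^esub>}" using l by simp
      then show False using P(2) s(1) by blast
    qed
  qed
  show thesis by (rule that[OF u ynz ind yU])
qed

section \<open>Quotient modules, tensor products and torsion\<close>

lemma (in module) coset_mem_iff:
  assumes "submodule N R M" "x \<in> carrier M"
  shows "z \<in> N +>\<^bsub>M\<^esub> x \<longleftrightarrow> z \<in> carrier M \<and> z \<ominus>\<^bsub>M\<^esub> x \<in> N"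
proof
  have Nc: "\<And>h. h \<in> N \<Longrightarrow> h \<in> carrier M" using submoduleE(1)[OF assms(1)] by auto
  assume "z \<in> N +>\<^bsub>M\<^esub> x"
  then obtain h where h: "h \<in> N" "z = h \<oplus>\<^bsub>M\<^esub> x" by (auto simp: a_r_coset_def')
  then have "z \<ominus>\<^bsub>M\<^esub> x = h" using diff_eq[OF assms(2) Nc[OF h(1)]] M.a_comm[OF Nc[OF h(1)] assms(2)] by simp
  then show "z \<in> carrier M \<and> z \<ominus>\<^bsub>M\<^esub> x \<in> N" using h Nc[OF h(1)] assms(2) by simp
next
  assume z: "z \<in> carrier M \<and> z \<ominus>\<^bsub>M\<^esub> x \<in> N"
  then have "z = (z \<ominus>\<^bsub>M\<^esub> x) \<oplus>\<^bsub>M\<^esub> x" using eq_plus_diff[of z x] assms(2) by (simp add: M.a_comm)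
  then show "z \<in> N +>\<^bsub>M\<^esub> x" using z by (auto simp: a_r_coset_def')
qed

lemma (in module) coset_eq_iff:
  assumes "submodule N R M" "x \<in> carrier M" "y \<in> carrier M"
  shows "N +>\<^bsub>M\<^esub> x = N +>\<^bsub>M\<^esub> y \<longleftrightarrow> x \<ominus>\<^bsub>M\<^esub> y \<in> N"
proof
  assume eq: "N +>\<^bsub>M\<^esub> x = N +>\<^bsub>M\<^esub> y"
  have "x \<in> N +>\<^bsub>M\<^esub> x" using coset_mem_iff[OF assms(1,2)] assms(2) submodule_zero[OF assms(1)] by (simp add: M.minus_eq M.r_neg)
  then show "x \<ominus>\<^bsub>M\<^esub> y \<in> N" using coset_mem_iff[OF assms(1,3)] eq by simp
next
  assume xy: "x \<ominus>\<^bsub>M\<^esub> y \<in> N"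
  have tr: "z \<ominus>\<^bsub>M\<^esub> y = (z \<ominus>\<^bsub>M\<^esub> x) \<oplus>\<^bsub>M\<^esub> (x \<ominus>\<^bsub>M\<^esub> y)" if "z \<in> carrier M" for z
    using that assms(2,3) by (simp add: M.minus_eq M.a_assoc M.r_neg1)
  have tr': "z \<ominus>\<^bsub>M\<^esub> x = (z \<ominus>\<^bsub>M\<^esub> y) \<ominus>\<^bsub>M\<^esub> (x \<ominus>\<^bsub>M\<^esub> y)" if "z \<in> carrier M" for z
    using that assms(2,3) diff_eq[of "x \<ominus>\<^bsub>M\<^esub> y" "z \<ominus>\<^bsub>M\<^esub> x" "z \<ominus>\<^bsub>M\<^esub> y"] tr[OF that] by (simp add: M.a_comm)
  show "N +>\<^bsub>M\<^esub> x = N +>\<^bsub>M\<^esub> y"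
  proof (rule Set.set_eqI)
    fix z
    show "z \<in> N +>\<^bsub>M\<^esub> x \<longleftrightarrow> z \<in> N +>\<^bsub>M\<^esub> y"
      unfolding coset_mem_iff[OF assms(1,2)] coset_mem_iff[OF assms(1,3)]
      using tr[of z] tr'[of z] submoduleE(5)[OF assms(1) _ xy] submodule_minus[OF assms(1) _ xy] by metis
  qed
qed

lemma (in module) submodule_abelian_subgroup:
  assumes "submodule N R M"
  shows "abelian_subgroup N M"
  by (rule abelian_subgroupI3[OF additive_subgroup.intro M.abelian_group_axioms])
    (rule submodule.axioms(1)[OF assms])

lemma quotient_module_simps:
  "carrier (quotient_module M N) = a_rcosets\<^bsub>M\<^esub> N" "\<zero>\<^bsub>quotient_module M N\<^esub> = N"
  "add (quotient_module M N) = set_add M"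
  "smult (quotient_module M N) = (\<lambda>a C. \<Union>x\<in>C. N +>\<^bsub>M\<^esub> (a \<odot>\<^bsub>M\<^esub> x))"
  by (simp_all add: quotient_module_def)

lemma quotient_module_carrierE:
  assumes "C \<in> carrier (quotient_module M N)"
  obtains x where "x \<in> carrier M" "C = N +>\<^bsub>M\<^esub> x"
  using assms by (auto simp: quotient_module_simps A_RCOSETS_def')

lemma (in module) coset_closed: "x \<in> carrier M \<Longrightarrow> N +>\<^bsub>M\<^esub> x \<in> carrier (quotient_module M N)"
  by (auto simp: quotient_module_simps A_RCOSETS_def')

lemma (in module) coset_add:
  assumes "submodule N R M" "x \<in> carrier M" "y \<in> carrier M"
  shows "(N +>\<^bsub>M\<^esub> x) \<oplus>\<^bsub>quotient_module M N\<^esub> (N +>\<^bsub>M\<^esub> y) = N +>\<^bsub>M\<^esub> (x \<oplus>\<^bsub>M\<^esub> y)"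
  using abelian_subgroup.a_rcos_sum[OF submodule_abelian_subgroup[OF assms(1)] assms(2,3)]
  by (simp add: quotient_module_simps)

lemma (in module) coset_smult:
  assumes "submodule N R M" "x \<in> carrier M" "a \<in> carrier R"
  shows "a \<odot>\<^bsub>quotient_module M N\<^esub> (N +>\<^bsub>M\<^esub> x) = N +>\<^bsub>M\<^esub> (a \<odot>\<^bsub>M\<^esub> x)"
proof -
  have "N +>\<^bsub>M\<^esub> (a \<odot>\<^bsub>M\<^esub> z) = N +>\<^bsub>M\<^esub> (a \<odot>\<^bsub>M\<^esub> x)" if z: "z \<in> N +>\<^bsub>M\<^esub> x" for z
  proof -
    have zc: "z \<in> carrier M" "z \<ominus>\<^bsub>M\<^esub> x \<in> N" using z coset_mem_iff[OF assms(1,2)] by auto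
    have "a \<odot>\<^bsub>M\<^esub> z \<ominus>\<^bsub>M\<^esub> a \<odot>\<^bsub>M\<^esub> x = a \<odot>\<^bsub>M\<^esub> (z \<ominus>\<^bsub>M\<^esub> x)"
      using zc(1) assms(2,3) by (simp add: M.minus_eq smult_r_distr smult_r_minus)
    then show ?thesis
      using coset_eq_iff[OF assms(1), of "a \<odot>\<^bsub>M\<^esub> z" "a \<odot>\<^bsub>M\<^esub> x"] submoduleE(4)[OF assms(1,3) zc(2)] zc(1) assms(2,3) by simp
  qed
  moreover have "x \<in> N +>\<^bsub>M\<^esub> x"
    using coset_mem_iff[OF assms(1,2)] assms(2) submodule_zero[OF assms(1)] by (simp add: M.minus_eq M.r_neg)
  ultimately have "(\<lambda>z. N +>\<^bsub>M\<^esub> (a \<odot>\<^bsub>M\<^esub> z)) ` (N +>\<^bsub>M\<^esub> x) = {N +>\<^bsub>M\<^esub> (a \<odot>\<^bsub>M\<^esub> x)}" by blast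
  then show ?thesis by (simp add: quotient_module_simps)
qed

lemma (in module) coset_zero:
  assumes "submodule N R M" "x \<in> carrier M"
  shows "N +>\<^bsub>M\<^esub> x = N \<longleftrightarrow> x \<in> N"
proof -
  have "N +>\<^bsub>M\<^esub> \<zero>\<^bsub>M\<^esub> = N" by (rule M.a_coset_add_zero[OF submoduleE(1)[OF assms(1)]])
  moreover have "x \<ominus>\<^bsub>M\<^esub> \<zero>\<^bsub>M\<^esub> = x" using diff_eq[OF M.zero_closed assms(2), of x] assms(2) by simp
  ultimately show ?thesis using coset_eq_iff[OF assms M.zero_closed] by simp
qed

lemma (in module) quotient_module_module:
  assumes N: "submodule N R M"
  shows "module R (quotient_module M N)"
proof -
  let ?Q = "quotient_module M N"
  have z: "\<zero>\<^bsub>?Q\<^esub> = N +>\<^bsub>M\<^esub> \<zero>\<^bsub>M\<^esub>"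
    using M.a_coset_add_zero[OF submoduleE(1)[OF N]] by (simp add: quotient_module_simps)
  note simps = coset_add[OF N] coset_smult[OF N] coset_closed
  show ?thesis
  proof (rule moduleI[OF R.is_cring])
    show "abelian_group ?Q"
    proof (rule abelian_groupI)
      show "\<zero>\<^bsub>?Q\<^esub> \<in> carrier ?Q" unfolding z by (rule coset_closed) simp
      fix C assume "C \<in> carrier ?Q"
      then obtain x where x: "x \<in> carrier M" "C = N +>\<^bsub>M\<^esub> x" by (rule quotient_module_carrierE)
      show "\<zero>\<^bsub>?Q\<^esub> \<oplus>\<^bsub>?Q\<^esub> C = C" unfolding z x(2) using x(1) by (simp add: simps)
      show "\<exists>D\<in>carrier ?Q. D \<oplus>\<^bsub>?Q\<^esub> C = \<zero>\<^bsub>?Q\<^esub>"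
        unfolding z x(2) using x(1) by (intro bexI[of _ "N +>\<^bsub>M\<^esub> (\<ominus>\<^bsub>M\<^esub> x)"]) (simp_all add: simps M.l_neg)
      fix D assume "D \<in> carrier ?Q"
      then obtain y where y: "y \<in> carrier M" "D = N +>\<^bsub>M\<^esub> y" by (rule quotient_module_carrierE)
      show "C \<oplus>\<^bsub>?Q\<^esub> D \<in> carrier ?Q" unfolding x(2) y(2) using x(1) y(1) by (simp add: simps)
      show "C \<oplus>\<^bsub>?Q\<^esub> D = D \<oplus>\<^bsub>?Q\<^esub> C" unfolding x(2) y(2) using x(1) y(1) by (simp add: simps M.a_comm)
      fix E assume "E \<in> carrier ?Q"
      then obtain w where w: "w \<in> carrier M" "E = N +>\<^bsub>M\<^esub> w" by (rule quotient_module_carrierE)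
      show "C \<oplus>\<^bsub>?Q\<^esub> D \<oplus>\<^bsub>?Q\<^esub> E = C \<oplus>\<^bsub>?Q\<^esub> (D \<oplus>\<^bsub>?Q\<^esub> E)"
        unfolding x(2) y(2) w(2) using x(1) y(1) w(1) by (simp add: simps M.a_assoc)
    qed
  next
    fix a C assume a: "a \<in> carrier R" and "C \<in> carrier ?Q"
    then obtain x where x: "x \<in> carrier M" "C = N +>\<^bsub>M\<^esub> x" by (blast elim: quotient_module_carrierE)
    show "a \<odot>\<^bsub>?Q\<^esub> C \<in> carrier ?Q" unfolding x(2) using x(1) a by (simp add: simps)
    fix b assume b: "b \<in> carrier R"
    show "(a \<oplus>\<^bsub>R\<^esub> b) \<odot>\<^bsub>?Q\<^esub> C = a \<odot>\<^bsub>?Q\<^esub> C \<oplus>\<^bsub>?Q\<^esub> b \<odot>\<^bsub>?Q\<^esub> C"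
      unfolding x(2) using x(1) a b by (simp add: simps smult_l_distr)
    show "(a \<otimes>\<^bsub>R\<^esub> b) \<odot>\<^bsub>?Q\<^esub> C = a \<odot>\<^bsub>?Q\<^esub> (b \<odot>\<^bsub>?Q\<^esub> C)"
      unfolding x(2) using x(1) a b by (simp add: simps smult_assoc1)
  next
    fix a C D assume a: "a \<in> carrier R" and C: "C \<in> carrier ?Q" and D: "D \<in> carrier ?Q"
    obtain x where x: "x \<in> carrier M" "C = N +>\<^bsub>M\<^esub> x" using C by (rule quotient_module_carrierE)
    obtain y where y: "y \<in> carrier M" "D = N +>\<^bsub>M\<^esub> y" using D by (rule quotient_module_carrierE)
    show "a \<odot>\<^bsub>?Q\<^esub> (C \<oplus>\<^bsub>?Q\<^esub> D) = a \<odot>\<^bsub>?Q\<^esub> C \<oplus>\<^bsub>?Q\<^esub> a \<odot>\<^bsub>?Q\<^esub> D"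
      unfolding x(2) y(2) using x(1) y(1) a by (simp add: simps smult_r_distr)
  next
    fix C assume "C \<in> carrier ?Q"
    then obtain x where x: "x \<in> carrier M" "C = N +>\<^bsub>M\<^esub> x" by (rule quotient_module_carrierE)
    show "\<one>\<^bsub>R\<^esub> \<odot>\<^bsub>?Q\<^esub> C = C" unfolding x(2) using x(1) by (simp add: simps)
  qed
qed

lemma (in module) quotient_hom:
  assumes "submodule N R M"
  shows "(\<lambda>x. N +>\<^bsub>M\<^esub> x) \<in> module_hom R M (quotient_module M N)"
  by (rule module_homI) (simp_all add: coset_closed coset_add[OF assms] coset_smult[OF assms])

section \<open>Tensor products by generators and relations\<close>

text \<open>Here and for the tensor products below only closure under addition and scalars is asked
  of \<open>M\<close> and \<open>N\<close>. The free module on the pairs supplies all other laws, so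
  the total quotient ring can be a factor without a proof that it is a module.\<close>

lemma bilinearity_relations_subset:
  assumes "cring R"
    and "\<And>x x'. x \<in> carrier M \<Longrightarrow> x' \<in> carrier M \<Longrightarrow> x \<oplus>\<^bsub>M\<^esub> x' \<in> carrier M"
    and "\<And>a x. a \<in> carrier R \<Longrightarrow> x \<in> carrier M \<Longrightarrow> a \<odot>\<^bsub>M\<^esub> x \<in> carrier M"
    and "\<And>y y'. y \<in> carrier N \<Longrightarrow> y' \<in> carrier N \<Longrightarrow> y \<oplus>\<^bsub>N\<^esub> y' \<in> carrier N"
    and "\<And>a y. a \<in> carrier R \<Longrightarrow> y \<in> carrier N \<Longrightarrow> a \<odot>\<^bsub>N\<^esub> y \<in> carrier N"
  shows "bilinearity_relations R M N \<subseteq> carrier (free_module R (carrier M \<times> carrier N))"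
proof -
  let ?F = "free_module R (carrier M \<times> carrier N)"
  interpret F: module R ?F by (rule free_module_module[OF assms(1)])
  have e: "\<And>x y. x \<in> carrier M \<Longrightarrow> y \<in> carrier N \<Longrightarrow> basis_vector R (x, y) \<in> carrier ?F"
    by (rule basis_vector_closed[OF assms(1)]) simp
  show ?thesis
    unfolding bilinearity_relations_def Let_def
    by (auto simp del: free_module_simps intro!: F.M.minus_closed F.M.a_closed F.smult_closed e assms(2-5))
qed

context
  fixes R :: "('a, 'x) ring_scheme" and M :: "('a, 'm, 'y) module_scheme" and N :: "('a, 'n, 'z) module_scheme"
  assumes cr: "cring R"
    and cl: "\<And>x x'. x \<in> carrier M \<Longrightarrow> x' \<in> carrier M \<Longrightarrow> x \<oplus>\<^bsub>M\<^esub> x' \<in> carrier M"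
      "\<And>a x. a \<in> carrier R \<Longrightarrow> x \<in> carrier M \<Longrightarrow> a \<odot>\<^bsub>M\<^esub> x \<in> carrier M"
      "\<And>y y'. y \<in> carrier N \<Longrightarrow> y' \<in> carrier N \<Longrightarrow> y \<oplus>\<^bsub>N\<^esub> y' \<in> carrier N"
      "\<And>a y. a \<in> carrier R \<Longrightarrow> y \<in> carrier N \<Longrightarrow> a \<odot>\<^bsub>N\<^esub> y \<in> carrier N"
begin

private abbreviation (input) "F \<equiv> free_module R (carrier M \<times> carrier N)"

lemma tensor_relations_submodule: "submodule (tensor_relations R M N) R F"
  unfolding tensor_relations_def
  by (rule module.submodule_generated_submodule[OF free_module_module[OF cr] bilinearity_relations_subset[OF cr cl]])

lemma tensor_module_module: "module R (tensor_module R M N)"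
  unfolding tensor_module_def
  by (rule module.quotient_module_module[OF free_module_module[OF cr] tensor_relations_submodule])

lemma pure_tensor_closed:
  "x \<in> carrier M \<Longrightarrow> y \<in> carrier N \<Longrightarrow> pure_tensor R M N x y \<in> carrier (tensor_module R M N)"
  unfolding tensor_module_def pure_tensor_def
  by (rule module.coset_closed[OF free_module_module[OF cr] basis_vector_closed[OF cr]]) simp

lemma relation_mem: "d \<in> bilinearity_relations R M N \<Longrightarrow> d \<in> tensor_relations R M N"
  unfolding tensor_relations_def using submodule_generated_incl by (rule subsetD)

lemma pure_tensor_left_add:
  assumes "x \<in> carrier M" "x' \<in> carrier M" "y \<in> carrier N"
  shows "pure_tensor R M N (x \<oplus>\<^bsub>M\<^esub> x') y =
    pure_tensor R M N x y \<oplus>\<^bsub>tensor_module R M N\<^esub> pure_tensor R M N x' y"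
proof -
  interpret F: module R F by (rule free_module_module[OF cr])
  have e: "\<And>x y. x \<in> carrier M \<Longrightarrow> y \<in> carrier N \<Longrightarrow> basis_vector R (x, y) \<in> carrier F"
    by (rule basis_vector_closed[OF cr]) simp
  have "basis_vector R (x \<oplus>\<^bsub>M\<^esub> x', y) \<ominus>\<^bsub>F\<^esub> (basis_vector R (x, y) \<oplus>\<^bsub>F\<^esub> basis_vector R (x', y)) \<in> tensor_relations R M N"
    by (rule relation_mem) (use assms in \<open>auto simp: bilinearity_relations_def Let_def simp del: free_module_simps\<close>)
  then show ?thesis
    unfolding pure_tensor_def tensor_module_def
      F.coset_add[OF tensor_relations_submodule e[OF assms(1,3)] e[OF assms(2,3)]]
    by (subst F.coset_eq_iff[OF tensor_relations_submodule e F.M.a_closed[OF e e]]) (use assms cl in auto)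
qed

lemma pure_tensor_right_add:
  assumes "x \<in> carrier M" "y \<in> carrier N" "y' \<in> carrier N"
  shows "pure_tensor R M N x (y \<oplus>\<^bsub>N\<^esub> y') =
    pure_tensor R M N x y \<oplus>\<^bsub>tensor_module R M N\<^esub> pure_tensor R M N x y'"
proof -
  interpret F: module R F by (rule free_module_module[OF cr])
  have e: "\<And>x y. x \<in> carrier M \<Longrightarrow> y \<in> carrier N \<Longrightarrow> basis_vector R (x, y) \<in> carrier F"
    by (rule basis_vector_closed[OF cr]) simp
  have "basis_vector R (x, y \<oplus>\<^bsub>N\<^esub> y') \<ominus>\<^bsub>F\<^esub> (basis_vector R (x, y) \<oplus>\<^bsub>F\<^esub> basis_vector R (x, y')) \<in> tensor_relations R M N"
    by (rule relation_mem) (use assms in \<open>auto simp: bilinearity_relations_def Let_def simp del: free_module_simps\<close>)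
  then show ?thesis
    unfolding pure_tensor_def tensor_module_def
      F.coset_add[OF tensor_relations_submodule e[OF assms(1,2)] e[OF assms(1,3)]]
    by (subst F.coset_eq_iff[OF tensor_relations_submodule e F.M.a_closed[OF e e]]) (use assms cl in auto)
qed

lemma pure_tensor_left_smult:
  assumes "a \<in> carrier R" "x \<in> carrier M" "y \<in> carrier N"
  shows "pure_tensor R M N (a \<odot>\<^bsub>M\<^esub> x) y = a \<odot>\<^bsub>tensor_module R M N\<^esub> pure_tensor R M N x y"
proof -
  interpret F: module R F by (rule free_module_module[OF cr])
  have e: "\<And>x y. x \<in> carrier M \<Longrightarrow> y \<in> carrier N \<Longrightarrow> basis_vector R (x, y) \<in> carrier F"
    by (rule basis_vector_closed[OF cr]) simp
  have "basis_vector R (a \<odot>\<^bsub>M\<^esub> x, y) \<ominus>\<^bsub>F\<^esub> a \<odot>\<^bsub>F\<^esub> basis_vector R (x, y) \<in> tensor_relations R M N"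
    by (rule relation_mem) (use assms in \<open>auto simp: bilinearity_relations_def Let_def simp del: free_module_simps\<close>)
  then show ?thesis
    unfolding pure_tensor_def tensor_module_def
      F.coset_smult[OF tensor_relations_submodule e[OF assms(2,3)] assms(1)]
    by (subst F.coset_eq_iff[OF tensor_relations_submodule e F.smult_closed[OF _ e]]) (use assms cl in auto)
qed

lemma pure_tensor_right_smult:
  assumes "a \<in> carrier R" "x \<in> carrier M" "y \<in> carrier N"
  shows "pure_tensor R M N x (a \<odot>\<^bsub>N\<^esub> y) = a \<odot>\<^bsub>tensor_module R M N\<^esub> pure_tensor R M N x y"
proof -
  interpret F: module R F by (rule free_module_module[OF cr])
  have e: "\<And>x y. x \<in> carrier M \<Longrightarrow> y \<in> carrier N \<Longrightarrow> basis_vector R (x, y) \<in> carrier F"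
    by (rule basis_vector_closed[OF cr]) simp
  have "basis_vector R (x, a \<odot>\<^bsub>N\<^esub> y) \<ominus>\<^bsub>F\<^esub> a \<odot>\<^bsub>F\<^esub> basis_vector R (x, y) \<in> tensor_relations R M N"
    by (rule relation_mem) (use assms in \<open>auto simp: bilinearity_relations_def Let_def simp del: free_module_simps\<close>)
  then show ?thesis
    unfolding pure_tensor_def tensor_module_def
      F.coset_smult[OF tensor_relations_submodule e[OF assms(2,3)] assms(1)]
    by (subst F.coset_eq_iff[OF tensor_relations_submodule e F.smult_closed[OF _ e]]) (use assms cl in auto)
qed

lemma pure_tensor_left_hom:
  "y \<in> carrier N \<Longrightarrow> (\<lambda>x. pure_tensor R M N x y) \<in> module_hom R M (tensor_module R M N)"
  by (rule module_homI) (simp_all add: pure_tensor_closed pure_tensor_left_add pure_tensor_left_smult)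

lemma pure_tensor_right_hom:
  "x \<in> carrier M \<Longrightarrow> (\<lambda>y. pure_tensor R M N x y) \<in> module_hom R N (tensor_module R M N)"
  by (rule module_homI) (simp_all add: pure_tensor_closed pure_tensor_right_add pure_tensor_right_smult)

text \<open>The universal property for a map \<open>b\<close> that is bilinear only modulo
  \<open>K\<close>: each generating relation is sent into \<open>K\<close> by the linear extension
  of \<open>b\<close>. Stated inside \<open>L\<close>, it avoids forming the quotient of
  \<open>L\<close> by \<open>K\<close>.\<close>

lemma tensor_relations_bilinear:
  assumes L: "module R L" "submodule K R L"
    and b: "\<And>x y. x \<in> carrier M \<Longrightarrow> y \<in> carrier N \<Longrightarrow> b x y \<in> carrier L"
    and "\<And>x x' y. x \<in> carrier M \<Longrightarrow> x' \<in> carrier M \<Longrightarrow> y \<in> carrier N \<Longrightarrow>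
      b (x \<oplus>\<^bsub>M\<^esub> x') y \<ominus>\<^bsub>L\<^esub> (b x y \<oplus>\<^bsub>L\<^esub> b x' y) \<in> K"
    and "\<And>x y y'. x \<in> carrier M \<Longrightarrow> y \<in> carrier N \<Longrightarrow> y' \<in> carrier N \<Longrightarrow>
      b x (y \<oplus>\<^bsub>N\<^esub> y') \<ominus>\<^bsub>L\<^esub> (b x y \<oplus>\<^bsub>L\<^esub> b x y') \<in> K"
    and "\<And>a x y. a \<in> carrier R \<Longrightarrow> x \<in> carrier M \<Longrightarrow> y \<in> carrier N \<Longrightarrow>
      b (a \<odot>\<^bsub>M\<^esub> x) y \<ominus>\<^bsub>L\<^esub> a \<odot>\<^bsub>L\<^esub> b x y \<in> K"
    and "\<And>a x y. a \<in> carrier R \<Longrightarrow> x \<in> carrier M \<Longrightarrow> y \<in> carrier N \<Longrightarrow>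
      b x (a \<odot>\<^bsub>N\<^esub> y) \<ominus>\<^bsub>L\<^esub> a \<odot>\<^bsub>L\<^esub> b x y \<in> K"
    and v: "v \<in> tensor_relations R M N"
  shows "linear_extension R L (\<lambda>(x, y). b x y) v \<in> K"
proof -
  interpret F: module R F by (rule free_module_module[OF cr])
  interpret L: module R L by fact
  let ?h = "linear_extension R L (\<lambda>(x, y). b x y)"
  have h: "?h \<in> module_hom R F L" by (rule linear_extension_hom[OF L(1)]) (use b in auto)
  have e: "\<And>x y. x \<in> carrier M \<Longrightarrow> y \<in> carrier N \<Longrightarrow> basis_vector R (x, y) \<in> carrier F"
    by (rule basis_vector_closed[OF cr]) simp
  have he: "?h (basis_vector R (x, y)) = b x y" if "x \<in> carrier M" "y \<in> carrier N" for x y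
    using linear_extension_basis[OF L(1), of "\<lambda>(x, y). b x y" "(x, y)"] b that by simp
  note hs = module_hom_minus[OF F.module_axioms L(1) h] module_hom_add[OF h] module_hom_smult[OF h] he
    F.M.a_closed F.smult_closed e cl
  have "submodule {v \<in> carrier F. ?h v \<in> K} R F" by (rule kernel_submodule[OF F.module_axioms L(1) h L(2)])
  moreover have "bilinearity_relations R M N \<subseteq> {v \<in> carrier F. ?h v \<in> K}"
  proof
    fix d assume d: "d \<in> bilinearity_relations R M N"
    then have dF: "d \<in> carrier F" using bilinearity_relations_subset[OF cr cl] by (rule subsetD[rotated])
    have "?h d \<in> K"
      using d unfolding bilinearity_relations_def Let_def
    proof (elim UnE CollectE exE conjE)
      fix x x' y assume "d = basis_vector R (x \<oplus>\<^bsub>M\<^esub> x', y) \<ominus>\<^bsub>F\<^esub> (basis_vector R (x, y) \<oplus>\<^bsub>F\<^esub> basis_vector R (x', y))"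
        and c: "x \<in> carrier M" "x' \<in> carrier M" "y \<in> carrier N"
      then show ?thesis using assms(4)[OF c] by (simp only: hs)
    next
      fix x y y' assume "d = basis_vector R (x, y \<oplus>\<^bsub>N\<^esub> y') \<ominus>\<^bsub>F\<^esub> (basis_vector R (x, y) \<oplus>\<^bsub>F\<^esub> basis_vector R (x, y'))"
        and c: "x \<in> carrier M" "y \<in> carrier N" "y' \<in> carrier N"
      then show ?thesis using assms(5)[OF c] by (simp only: hs)
    next
      fix a x y assume "d = basis_vector R (a \<odot>\<^bsub>M\<^esub> x, y) \<ominus>\<^bsub>F\<^esub> a \<odot>\<^bsub>F\<^esub> basis_vector R (x, y)"
        and c: "a \<in> carrier R" "x \<in> carrier M" "y \<in> carrier N"
      then show ?thesis using assms(6)[OF c] by (simp only: hs)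
    next
      fix a x y assume "d = basis_vector R (x, a \<odot>\<^bsub>N\<^esub> y) \<ominus>\<^bsub>F\<^esub> a \<odot>\<^bsub>F\<^esub> basis_vector R (x, y)"
        and c: "a \<in> carrier R" "x \<in> carrier M" "y \<in> carrier N"
      then show ?thesis using assms(7)[OF c] by (simp only: hs)
    qed
    then show "d \<in> {v \<in> carrier F. ?h v \<in> K}" using dF by simp
  qed
  ultimately have "tensor_relations R M N \<subseteq> {v \<in> carrier F. ?h v \<in> K}"
    unfolding tensor_relations_def by (rule submodule_generated_least)
  then show ?thesis using v by blast
qed

end

section \<open>Torsion and modules of homomorphisms\<close>

text \<open>In the tensor product with the total quotient ring the scalar moves across: 1 is
  \<open>y\<close> times \<open>1 / y\<close>, so the image of \<open>t\<close> is the tensor of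
  \<open>1 / y\<close> with \<open>y t = 0\<close>.\<close>

lemma killed_by_nonzerodivisor_torsion:
  assumes "module R N" "y \<in> nonzerodivisors R" "t \<in> carrier N" "y \<odot>\<^bsub>N\<^esub> t = \<zero>\<^bsub>N\<^esub>"
  shows "t \<in> torsion_submodule R N"
proof -
  interpret N: module R N by fact
  define W where "W = nonzerodivisors R"
  let ?Q = "total_quotient_module R"
  have Wc: "W \<subseteq> carrier R" "\<one>\<^bsub>R\<^esub> \<in> W" by (auto simp: W_def nonzerodivisors_def)
  have Wm: "s \<otimes>\<^bsub>R\<^esub> t \<in> W" if st: "s \<in> W" "t \<in> W" for s t
  proof -
    have c: "s \<in> carrier R" "t \<in> carrier R" using st Wc by auto
    have cancel: "b = \<zero>\<^bsub>R\<^esub>" if "w \<in> W" "b \<in> carrier R" "w \<otimes>\<^bsub>R\<^esub> b = \<zero>\<^bsub>R\<^esub>" for w b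
      using that unfolding W_def nonzerodivisors_def by blast
    have "b = \<zero>\<^bsub>R\<^esub>" if b: "b \<in> carrier R" "(s \<otimes>\<^bsub>R\<^esub> t) \<otimes>\<^bsub>R\<^esub> b = \<zero>\<^bsub>R\<^esub>" for b
    proof -
      have "s \<otimes>\<^bsub>R\<^esub> (t \<otimes>\<^bsub>R\<^esub> b) = \<zero>\<^bsub>R\<^esub>" using b c N.R.m_assoc[of s t b] by simp
      then have "t \<otimes>\<^bsub>R\<^esub> b = \<zero>\<^bsub>R\<^esub>" by (rule cancel[OF st(1) N.R.m_closed[OF c(2) b(1)]])
      then show ?thesis by (rule cancel[OF st(2) b(1)])
    qed
    then show ?thesis using c by (simp add: W_def nonzerodivisors_def)
  qed
  interpret sf: fractions R "self_module R" W
    by (rule fractions.intro[OF self_module_module[OF N.R.is_cring]])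
      (unfold_locales, use Wc Wm in auto)
  define fR where "fR = fraction R W (self_module R)"
  have Qc: "carrier ?Q = {fR a w | a w. a \<in> carrier R \<and> w \<in> W}"
    and Q1: "\<one>\<^bsub>total_quotient_ring R\<^esub> = fR \<one>\<^bsub>R\<^esub> \<one>\<^bsub>R\<^esub>"
    by (simp_all add: total_quotient_module_def restrict_scalars_def total_quotient_ring_def localized_ring_def
        Let_def fR_def W_def)
  have Qadd: "fR a v \<oplus>\<^bsub>?Q\<^esub> fR b w = fR (w \<otimes>\<^bsub>R\<^esub> a \<oplus>\<^bsub>R\<^esub> v \<otimes>\<^bsub>R\<^esub> b) (v \<otimes>\<^bsub>R\<^esub> w)"
    if "a \<in> carrier R" "v \<in> W" "b \<in> carrier R" "w \<in> W" for a b v w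
    using sf.localized_add[of a v b w] that
    by (simp add: total_quotient_module_def restrict_scalars_def total_quotient_ring_def localized_ring_eq fR_def W_def)
  have Qsm: "c \<odot>\<^bsub>?Q\<^esub> fR b w = fR (c \<otimes>\<^bsub>R\<^esub> b) (\<one>\<^bsub>R\<^esub> \<otimes>\<^bsub>R\<^esub> w)"
    if "c \<in> carrier R" "b \<in> carrier R" "w \<in> W" for c b w
    using sf.localized_smult[of c "\<one>\<^bsub>R\<^esub>" b w] that Wc(2)
    by (simp add: total_quotient_module_def restrict_scalars_def total_quotient_ring_def localized_ring_eq fR_def W_def)
  have cl1: "q \<oplus>\<^bsub>?Q\<^esub> q' \<in> carrier ?Q" if q: "q \<in> carrier ?Q" "q' \<in> carrier ?Q" for q q'
  proof -
    obtain a v b w where 1: "a \<in> carrier R" "v \<in> W" "q = fR a v" and 2: "b \<in> carrier R" "w \<in> W" "q' = fR b w"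
      using q unfolding Qc by blast
    have "w \<otimes>\<^bsub>R\<^esub> a \<oplus>\<^bsub>R\<^esub> v \<otimes>\<^bsub>R\<^esub> b \<in> carrier R" "v \<otimes>\<^bsub>R\<^esub> w \<in> W" using 1 2 Wc Wm by auto
    then show ?thesis using Qadd[OF 1(1,2) 2(1,2)] 1(3) 2(3) unfolding Qc by blast
  qed
  have cl2: "c \<odot>\<^bsub>?Q\<^esub> q \<in> carrier ?Q" if q: "c \<in> carrier R" "q \<in> carrier ?Q" for c q
  proof -
    obtain b w where 2: "b \<in> carrier R" "w \<in> W" "q = fR b w" using q unfolding Qc by blast
    have "c \<otimes>\<^bsub>R\<^esub> b \<in> carrier R" "\<one>\<^bsub>R\<^esub> \<otimes>\<^bsub>R\<^esub> w \<in> W" using q 2 Wc Wm by auto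
    then show ?thesis using Qsm[OF q(1) 2(1,2)] 2(3) unfolding Qc by blast
  qed
  note cl = N.R.is_cring cl1 cl2 N.M.a_closed N.smult_closed
  let ?T = "tensor_module R ?Q N" and ?p = "pure_tensor R ?Q N"
  interpret T: module R ?T by (rule tensor_module_module[OF cl])
  have yW: "y \<in> W" "y \<in> carrier R" using assms(2) Wc by (auto simp: W_def)
  have g: "fR \<one>\<^bsub>R\<^esub> y \<in> carrier ?Q" unfolding Qc using yW by blast
  have "y \<odot>\<^bsub>?Q\<^esub> fR \<one>\<^bsub>R\<^esub> y = fR y y" using Qsm[OF yW(2) N.R.one_closed yW(1)] yW by simp
  also have "\<dots> = \<one>\<^bsub>total_quotient_ring R\<^esub>"
    unfolding Q1 fR_def using yW Wc by (intro sf.fraction_eqI[of _ _ _ _ "\<one>\<^bsub>R\<^esub>"]) auto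
  finally have y1: "y \<odot>\<^bsub>?Q\<^esub> fR \<one>\<^bsub>R\<^esub> y = \<one>\<^bsub>total_quotient_ring R\<^esub>" .
  have "?p \<one>\<^bsub>total_quotient_ring R\<^esub> t = y \<odot>\<^bsub>?T\<^esub> ?p (fR \<one>\<^bsub>R\<^esub> y) t"
    unfolding y1[symmetric] by (rule pure_tensor_left_smult[OF cl yW(2) g assms(3)])
  also have "\<dots> = ?p (fR \<one>\<^bsub>R\<^esub> y) (y \<odot>\<^bsub>N\<^esub> t)"
    by (rule pure_tensor_right_smult[OF cl yW(2) g assms(3), symmetric])
  also have "\<dots> = \<zero>\<^bsub>?T\<^esub>"
    unfolding assms(4)
    by (rule module_hom_zero[OF N.module_axioms T.module_axioms pure_tensor_right_hom[OF cl g]])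
  finally show ?thesis unfolding torsion_submodule_def using assms(3) by simp
qed

lemma hom_module_module:
  assumes "module R M" "module R N"
  shows "module R (hom_module R M N)"
proof -
  interpret M: module R M by fact
  interpret N: module R N by fact
  let ?H = "hom_module R M N"
  have c: "h \<in> carrier ?H \<longleftrightarrow> h \<in> module_hom R M N \<and> h \<in> extensional (carrier M)" for h
    by (auto simp: hom_module_def)
  then have cD: "\<And>h. h \<in> carrier ?H \<Longrightarrow> h \<in> module_hom R M N"
    and cE: "\<And>h. h \<in> carrier ?H \<Longrightarrow> h \<in> extensional (carrier M)" by simp_all
  have hc: "h x \<in> carrier N" if "h \<in> carrier ?H" "x \<in> carrier M" for h x
    by (rule module_hom_closed[OF cD[OF that(1)] that(2)])
  have r: "restrict h (carrier M) \<in> carrier ?H" if h: "h \<in> module_hom R M N" for h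
    unfolding c
  proof
    show "restrict h (carrier M) \<in> module_hom R M N"
      by (rule module_homI)
        (simp_all add: module_hom_closed[OF h] module_hom_add[OF h] module_hom_smult[OF h])
  qed simp
  have s: "\<zero>\<^bsub>?H\<^esub> = (\<lambda>x\<in>carrier M. \<zero>\<^bsub>N\<^esub>)" "\<And>g h. g \<oplus>\<^bsub>?H\<^esub> h = (\<lambda>x\<in>carrier M. g x \<oplus>\<^bsub>N\<^esub> h x)"
    "\<And>a h. a \<odot>\<^bsub>?H\<^esub> h = (\<lambda>x\<in>carrier M. a \<odot>\<^bsub>N\<^esub> h x)" by (simp_all add: hom_module_def)
  have eqI: "g = h" if "g \<in> carrier ?H" "h \<in> carrier ?H" "\<And>x. x \<in> carrier M \<Longrightarrow> g x = h x" for g h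
    by (rule extensionalityI[OF cE[OF that(1)] cE[OF that(2)] that(3)])
  have z: "\<zero>\<^bsub>?H\<^esub> \<in> carrier ?H" unfolding s by (rule r, rule module_homI) simp_all
  have a: "g \<oplus>\<^bsub>?H\<^esub> h \<in> carrier ?H" if "g \<in> carrier ?H" "h \<in> carrier ?H" for g h
    unfolding s by (rule r[OF module_hom_sum[OF assms(2) cD[OF that(1)] cD[OF that(2)] assms(1)]])
  have sm: "k \<odot>\<^bsub>?H\<^esub> h \<in> carrier ?H" if "k \<in> carrier R" "h \<in> carrier ?H" for k h
    unfolding s by (rule r[OF module_hom_scaled[OF assms(2) cD[OF that(2)] that(1)]])
  show ?thesis
  proof (rule moduleI[OF M.R.is_cring])
    show "abelian_group ?H"
    proof (rule abelian_groupI)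
      fix h assume h: "h \<in> carrier ?H"
      show "\<exists>g\<in>carrier ?H. g \<oplus>\<^bsub>?H\<^esub> h = \<zero>\<^bsub>?H\<^esub>"
      proof
        show m: "(\<ominus>\<^bsub>R\<^esub> \<one>\<^bsub>R\<^esub>) \<odot>\<^bsub>?H\<^esub> h \<in> carrier ?H" by (rule sm) (use h in auto)
        show "((\<ominus>\<^bsub>R\<^esub> \<one>\<^bsub>R\<^esub>) \<odot>\<^bsub>?H\<^esub> h) \<oplus>\<^bsub>?H\<^esub> h = \<zero>\<^bsub>?H\<^esub>"
          by (rule eqI[OF a[OF m h] z]) (use h in \<open>simp_all add: s hc N.smult_l_minus N.M.l_neg\<close>)
      qed
      show "\<zero>\<^bsub>?H\<^esub> \<oplus>\<^bsub>?H\<^esub> h = h" by (rule eqI[OF a[OF z h] h]) (use h in \<open>simp_all add: s hc\<close>)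
      fix g assume g: "g \<in> carrier ?H"
      show "h \<oplus>\<^bsub>?H\<^esub> g = g \<oplus>\<^bsub>?H\<^esub> h" by (rule eqI[OF a[OF h g] a[OF g h]]) (use h g in \<open>simp_all add: s hc N.M.a_comm\<close>)
      fix k assume k: "k \<in> carrier ?H"
      show "h \<oplus>\<^bsub>?H\<^esub> g \<oplus>\<^bsub>?H\<^esub> k = h \<oplus>\<^bsub>?H\<^esub> (g \<oplus>\<^bsub>?H\<^esub> k)"
        by (rule eqI[OF a[OF a[OF h g] k] a[OF h a[OF g k]]]) (use h g k in \<open>simp_all add: s hc N.M.a_assoc\<close>)
    qed (use z a in auto)
  next
    fix k l h assume k: "k \<in> carrier R" "l \<in> carrier R" and h: "h \<in> carrier ?H"
    show "(k \<oplus>\<^bsub>R\<^esub> l) \<odot>\<^bsub>?H\<^esub> h = k \<odot>\<^bsub>?H\<^esub> h \<oplus>\<^bsub>?H\<^esub> l \<odot>\<^bsub>?H\<^esub> h"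
      by (rule eqI[OF sm a[OF sm sm]]) (use k h in \<open>simp_all add: s hc N.smult_l_distr\<close>)
    show "(k \<otimes>\<^bsub>R\<^esub> l) \<odot>\<^bsub>?H\<^esub> h = k \<odot>\<^bsub>?H\<^esub> (l \<odot>\<^bsub>?H\<^esub> h)"
      by (rule eqI[OF sm sm[OF _ sm]]) (use k h in \<open>simp_all add: s hc N.smult_assoc1\<close>)
  next
    fix k g h assume k: "k \<in> carrier R" and g: "g \<in> carrier ?H" and h: "h \<in> carrier ?H"
    show "k \<odot>\<^bsub>?H\<^esub> (g \<oplus>\<^bsub>?H\<^esub> h) = k \<odot>\<^bsub>?H\<^esub> g \<oplus>\<^bsub>?H\<^esub> k \<odot>\<^bsub>?H\<^esub> h"
      by (rule eqI[OF sm[OF k a[OF g h]] a[OF sm[OF k g] sm[OF k h]]]) (use k g h in \<open>simp_all add: s hc N.smult_r_distr\<close>)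
  next
    fix h assume h: "h \<in> carrier ?H"
    show "\<one>\<^bsub>R\<^esub> \<odot>\<^bsub>?H\<^esub> h = h" by (rule eqI[OF sm h]) (use h in \<open>simp_all add: s hc\<close>)
  qed (use sm in auto)
qed

section \<open>Two-periodic resolutions\<close>

lemma (in abelian_monoid) finsum_swap:
  assumes "finite I" "finite J" "\<And>i j. i \<in> I \<Longrightarrow> j \<in> J \<Longrightarrow> f i j \<in> carrier G"
  shows "(\<Oplus>i\<in>I. \<Oplus>j\<in>J. f i j) = (\<Oplus>j\<in>J. \<Oplus>i\<in>I. f i j)"
  using assms(1,3)
proof (induction I rule: finite_induct)
  case empty
  then show ?case by simp
next
  case (insert k I)
  have c: "(\<lambda>i. \<Oplus>j\<in>J. f i j) \<in> I \<rightarrow> carrier G" "(\<Oplus>j\<in>J. f k j) \<in> carrier G"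
    using insert.prems by (auto intro!: finsum_closed)
  have d: "(\<Oplus>i\<in>insert k I. f i j) = f k j \<oplus> (\<Oplus>i\<in>I. f i j)" if "j \<in> J" for j
    by (rule finsum_insert) (use insert that in auto)
  have "(\<Oplus>i\<in>insert k I. \<Oplus>j\<in>J. f i j) = (\<Oplus>j\<in>J. f k j) \<oplus> (\<Oplus>i\<in>I. \<Oplus>j\<in>J. f i j)"
    by (rule finsum_insert[OF insert.hyps c])
  also have "(\<Oplus>i\<in>I. \<Oplus>j\<in>J. f i j) = (\<Oplus>j\<in>J. \<Oplus>i\<in>I. f i j)" using insert by simp
  also have "(\<Oplus>j\<in>J. f k j) \<oplus> (\<Oplus>j\<in>J. \<Oplus>i\<in>I. f i j) = (\<Oplus>j\<in>J. f k j \<oplus> (\<Oplus>i\<in>I. f i j))"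
    by (rule finsum_addf[symmetric]) (use insert.prems in \<open>auto intro!: finsum_closed\<close>)
  also have "\<dots> = (\<Oplus>j\<in>J. \<Oplus>i\<in>insert k I. f i j)"
    by (rule finsum_cong'[symmetric]) (use d insert.prems in \<open>auto intro!: finsum_closed a_closed\<close>)
  finally show ?case .
qed

lemma power_module_neg:
  assumes "module R M" "v \<in> carrier (power_module M m)"
  shows "\<ominus>\<^bsub>power_module M m\<^esub> v = (\<lambda>i. \<ominus>\<^bsub>M\<^esub> v i)"
proof -
  interpret M: module R M by fact
  interpret P: module R "power_module M m" by (rule power_module_module[OF assms(1)])
  have "\<ominus>\<^bsub>power_module M m\<^esub> v = (\<ominus>\<^bsub>R\<^esub> \<one>\<^bsub>R\<^esub>) \<odot>\<^bsub>power_module M m\<^esub> v"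
    using assms(2) by (simp only: P.smult_l_minus M.R.one_closed P.smult_one)
  also have "\<dots> = (\<lambda>i. \<ominus>\<^bsub>M\<^esub> v i)"
    using assms(2) by (simp add: power_module_carrier_iff M.smult_l_minus fun_eq_iff)
  finally show ?thesis .
qed

lemma power_module_minus:
  assumes "module R M" "v \<in> carrier (power_module M m)" "w \<in> carrier (power_module M m)"
  shows "v \<ominus>\<^bsub>power_module M m\<^esub> w = (\<lambda>i. v i \<ominus>\<^bsub>M\<^esub> w i)"
  using assms by (simp add: a_minus_def power_module_neg)

lemma power_module_eval_hom: "(\<lambda>v. v i) \<in> module_hom R (power_module M m) M"
  by (rule module_homI) (simp_all add: power_module_carrier_iff)

lemma free_module_eval_hom: "(\<lambda>v. v i) \<in> module_hom R (free_module R B) (self_module R)"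
  by (rule module_homI) (simp_all add: free_module_carrier_iff)

lemma (in module) finsum_linear_combination:
  assumes "v \<in> carrier (free_module R {..<m::nat})" "b \<in> {..<m} \<rightarrow> carrier M"
  shows "linear_extension R M b v = (\<Oplus>\<^bsub>M\<^esub>i\<in>{..<m}. v i \<odot>\<^bsub>M\<^esub> b i)"
  by (rule linear_extension_eq[OF assms]) (use assms(1) in \<open>auto simp: free_module_carrier_iff\<close>)

text \<open>\<open>\<dots> \<rightarrow> R\<^sup>m \<rightarrow> R\<^sup>m \<rightarrow> M \<rightarrow> 0\<close> with differentials \<open>A\<close>, \<open>B\<close> alternating, and its dual exact
  at every \<open>R\<^sup>m\<close>.\<close>

locale periodic_presentation = module R M
  for R :: "('a, 'x) ring_scheme" (structure) and M :: "('a, 'm, 'y) module_scheme" (structure) +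
  fixes m :: nat and \<pi> A B
  assumes A: "A \<in> module_hom R (free_module R {..<m}) (free_module R {..<m})"
    and B: "B \<in> module_hom R (free_module R {..<m}) (free_module R {..<m})"
    and pi: "\<pi> \<in> module_hom R (free_module R {..<m}) M"
    and surj: "\<pi> ` carrier (free_module R {..<m}) = carrier M"
    and ker: "\<And>a. a \<in> carrier (free_module R {..<m}) \<Longrightarrow>
      \<pi> a = \<zero>\<^bsub>M\<^esub> \<longleftrightarrow> a \<in> A ` carrier (free_module R {..<m})"
    and BA: "\<And>a. a \<in> carrier (free_module R {..<m}) \<Longrightarrow> B (A a) = \<zero>\<^bsub>free_module R {..<m}\<^esub>"
    and exact_A: "\<And>g. g \<in> module_hom R (free_module R {..<m}) (self_module R) \<Longrightarrow>
      (\<And>a. a \<in> carrier (free_module R {..<m}) \<Longrightarrow> g (A a) = \<zero>\<^bsub>R\<^esub>) \<Longrightarrow>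
      \<exists>g'\<in>module_hom R (free_module R {..<m}) (self_module R). \<forall>a\<in>carrier (free_module R {..<m}). g a = g' (B a)"
    and exact_B: "\<And>g. g \<in> module_hom R (free_module R {..<m}) (self_module R) \<Longrightarrow>
      (\<And>a. a \<in> carrier (free_module R {..<m}) \<Longrightarrow> g (B a) = \<zero>\<^bsub>R\<^esub>) \<Longrightarrow>
      \<exists>g'\<in>module_hom R (free_module R {..<m}) (self_module R). \<forall>a\<in>carrier (free_module R {..<m}). g a = g' (A a)"
begin

abbreviation (input) "F \<equiv> free_module R {..<m}"
abbreviation (input) "e \<equiv> basis_vector R"

lemma F: "module R F" by (rule free_module_module[OF R.is_cring])

lemma Rm: "module R (self_module R)" by (rule self_module_module[OF R.is_cring])

lemma e: "i < m \<Longrightarrow> e i \<in> carrier F" by (rule basis_vector_closed[OF R.is_cring]) simp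

lemmas Ac = module_hom_closed[OF A] and Bc = module_hom_closed[OF B] and pc = module_hom_closed[OF pi]

lemma pi_A: "a \<in> carrier F \<Longrightarrow> \<pi> (A a) = \<zero>\<^bsub>M\<^esub>"
  using ker[OF Ac[of a]] by blast

text \<open>Exactness of the dual complex, applied to each of the \<open>r\<close> coordinates
  separately.\<close>

lemma exact_A_power:
  assumes "C \<in> module_hom R F (free_module R {..<r::nat})"
    "\<And>a. a \<in> carrier F \<Longrightarrow> C (A a) = \<zero>\<^bsub>free_module R {..<r}\<^esub>"
  obtains C' where "C' \<in> module_hom R F (free_module R {..<r})" "\<And>a. a \<in> carrier F \<Longrightarrow> C a = C' (B a)"
proof -
  have "\<exists>g'\<in>module_hom R F (self_module R). \<forall>a\<in>carrier F. C a l = g' (B a)" for l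
    by (rule exact_A[OF module_hom_comp[OF assms(1) free_module_eval_hom]]) (simp add: assms(2))
  then obtain g where g: "\<And>l. g l \<in> module_hom R F (self_module R)" "\<And>l a. a \<in> carrier F \<Longrightarrow> C a l = g l (B a)"
    by metis
  have gc: "g l a \<in> carrier R" if "a \<in> carrier F" for l a using module_hom_closed[OF g(1) that] by simp
  define C' where "C' a = (\<lambda>l. if l < r then g l a else \<zero>\<^bsub>R\<^esub>)" for a
  have "C' \<in> module_hom R F (free_module R {..<r})"
  proof (rule module_homI)
    show "C' a \<in> carrier (free_module R {..<r})" if "a \<in> carrier F" for a
      using gc[OF that] by (simp add: C'_def free_module_carrier_nat)
    show "C' (a \<oplus>\<^bsub>F\<^esub> b) = C' a \<oplus>\<^bsub>free_module R {..<r}\<^esub> C' b" if "a \<in> carrier F" "b \<in> carrier F" for a b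
      using module_hom_add[OF g(1) that] by (simp add: C'_def fun_eq_iff)
    show "C' (k \<odot>\<^bsub>F\<^esub> a) = k \<odot>\<^bsub>free_module R {..<r}\<^esub> C' a" if "k \<in> carrier R" "a \<in> carrier F" for k a
      using module_hom_smult[OF g(1) that] that by (simp add: C'_def fun_eq_iff)
  qed
  moreover have "C a = C' (B a)" if a: "a \<in> carrier F" for a
  proof
    fix l
    show "C a l = C' (B a) l"
      using g(2)[OF a, of l] module_hom_closed[OF assms(1) a]
      by (cases "l < r") (simp_all add: C'_def free_module_carrier_nat)
  qed
  ultimately show thesis by (rule that)
qed

text \<open>If the tensor product has no torsion, then \<open>Ext\<^sup>1(M, M) = 0\<close>: for \<open>z B = 0\<close> the element
  \<open>\<Sum>\<^sub>j z\<^sub>j \<otimes> \<phi>\<^sub>j\<close>, where the \<open>\<phi>\<^sub>j\<close> are the rows of \<open>B\<close>, is killed by \<open>y\<close>.\<close>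

lemma vanishing_ext:
  fixes r :: nat
  assumes u: "u \<in> {..<r} \<rightarrow> carrier M" and y: "y \<in> nonzerodivisors R"
    and inj: "\<And>c. c \<in> carrier (free_module R {..<r}) \<Longrightarrow> linear_extension R M u c = \<zero>\<^bsub>M\<^esub> \<Longrightarrow> c = (\<lambda>i. \<zero>\<^bsub>R\<^esub>)"
    and cond: "\<And>z. z \<in> carrier M \<Longrightarrow> y \<odot>\<^bsub>M\<^esub> z \<in> linear_extension R M u ` carrier (free_module R {..<r})"
    and nt: "\<not> has_torsion R (tensor_module R M (dual_module R M))"
    and z: "z \<in> module_hom R F M" "\<And>a. a \<in> carrier F \<Longrightarrow> z (B a) = \<zero>\<^bsub>M\<^esub>"
  shows "\<exists>w\<in>module_hom R F M. \<forall>a\<in>carrier F. z a = w (A a)"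
proof -
  interpret F: module R F by (rule F)
  interpret S: module R "self_module R" by (rule Rm)
  define D where "D = dual_module R M"
  interpret D: module R D unfolding D_def dual_module_def by (rule hom_module_module[OF module_axioms Rm])
  have Dc: "\<psi> \<in> carrier D \<longleftrightarrow> \<psi> \<in> module_hom R M (self_module R) \<and> \<psi> \<in> extensional (carrier M)" for \<psi>
    by (simp add: D_def dual_module_def hom_module_def)
  have Dh: "\<psi> \<in> module_hom R M (self_module R)" if "\<psi> \<in> carrier D" for \<psi> using that Dc by simp
  have Dadd: "(\<psi> \<oplus>\<^bsub>D\<^esub> \<chi>) x = \<psi> x \<oplus>\<^bsub>R\<^esub> \<chi> x" and Dsm: "(k \<odot>\<^bsub>D\<^esub> \<psi>) x = k \<otimes>\<^bsub>R\<^esub> \<psi> x"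
    and Dz: "\<zero>\<^bsub>D\<^esub> x = \<zero>\<^bsub>R\<^esub>" if "x \<in> carrier M" for \<psi> \<chi> k x
    using that by (simp_all add: D_def dual_module_def hom_module_def)
  define \<sigma> where "\<sigma> = inv_into (carrier F) \<pi>"
  have \<sigma>: "\<sigma> x \<in> carrier F" "\<pi> (\<sigma> x) = x" if "x \<in> carrier M" for x
    using that inv_into_into[of x \<pi> "carrier F"] f_inv_into_f[of x \<pi> "carrier F"] surj by (simp_all add: \<sigma>_def)
  \<comment> \<open>Row \<open>j\<close> of \<open>B\<close> as a functional on \<open>M\<close>.
    The section \<open>\<sigma>\<close> of \<open>\<pi>\<close> is not linear; the functional is
    independent of it because two preimages differ by a value of \<open>A\<close>, on which
    \<open>B\<close> vanishes.\<close>
  define \<phi> where "\<phi> j = (\<lambda>x\<in>carrier M. B (\<sigma> x) j)" for j :: nat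
  have \<phi>\<pi>: "\<phi> j (\<pi> a) = B a j" if a: "a \<in> carrier F" for j a
  proof -
    let ?b = "\<sigma> (\<pi> a)"
    have b: "?b \<in> carrier F" "\<pi> ?b = \<pi> a" using \<sigma> pc[OF a] by auto
    have "\<pi> (?b \<ominus>\<^bsub>F\<^esub> a) = \<zero>\<^bsub>M\<^esub>"
      using module_hom_minus[OF F module_axioms pi b(1) a] b(2) pc[OF a] by (simp add: M.minus_eq M.r_neg)
    then have "?b \<ominus>\<^bsub>F\<^esub> a \<in> A ` carrier F" using ker[OF F.M.minus_closed[OF b(1) a]] by simp
    then obtain d where d: "?b \<ominus>\<^bsub>F\<^esub> a = A d" "d \<in> carrier F" by (rule imageE)
    have "B ?b \<ominus>\<^bsub>F\<^esub> B a = \<zero>\<^bsub>F\<^esub>"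
      using module_hom_minus[OF F F B b(1) a] BA[OF d(2)] d(1) by simp
    then have "B ?b = B a" using F.diff_eq_zero_iff[OF Bc[OF b(1)] Bc[OF a]] by simp
    then show ?thesis using pc[OF a] by (simp add: \<phi>_def)
  qed
  have piE: "\<exists>a\<in>carrier F. x = \<pi> a" if "x \<in> carrier M" for x
    using \<sigma>[OF that] by (intro bexI[of _ "\<sigma> x"]) simp_all
  have \<phi>D: "\<phi> j \<in> carrier D" for j
    unfolding Dc
  proof
    show "\<phi> j \<in> module_hom R M (self_module R)"
    proof (rule module_homI)
      fix x assume "x \<in> carrier M"
      from piE[OF this] obtain a where a: "a \<in> carrier F" "x = \<pi> a" by (rule bexE)
      show "\<phi> j x \<in> carrier (self_module R)"
        using Bc[OF a(1)] \<phi>\<pi>[OF a(1)] a(2) by (simp add: free_module_carrier_iff)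
      fix k assume k: "k \<in> carrier R"
      show "\<phi> j (k \<odot>\<^bsub>M\<^esub> x) = k \<odot>\<^bsub>self_module R\<^esub> \<phi> j x"
        using \<phi>\<pi>[OF a(1), of j] \<phi>\<pi>[OF F.smult_closed[OF k a(1)], of j]
          module_hom_smult[OF pi k a(1)] module_hom_smult[OF B k a(1)] a(2) by simp
    next
      fix x x' assume x: "x \<in> carrier M" "x' \<in> carrier M"
      define a a' where "a = \<sigma> x" and "a' = \<sigma> x'"
      then have a: "a \<in> carrier F" "x = \<pi> a" "a' \<in> carrier F" "x' = \<pi> a'" using \<sigma> x by simp_all
      show "\<phi> j (x \<oplus>\<^bsub>M\<^esub> x') = \<phi> j x \<oplus>\<^bsub>self_module R\<^esub> \<phi> j x'"
        using \<phi>\<pi>[OF a(1), of j] \<phi>\<pi>[OF a(3), of j] \<phi>\<pi>[OF F.M.a_closed[OF a(1,3)], of j]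
          module_hom_add[OF pi a(1,3)] module_hom_add[OF B a(1,3)] a(2,4) by simp
    qed
  qed (simp add: \<phi>_def)
  define T where "T = tensor_module R M D"
  define p where "p = pure_tensor R M D"
  interpret T: module R T unfolding T_def by (rule tensor_module_module) (simp_all add: R.is_cring)
  have p_closed: "p x \<psi> \<in> carrier T" if "x \<in> carrier M" "\<psi> \<in> carrier D" for x \<psi>
    unfolding p_def T_def by (rule pure_tensor_closed) (simp_all add: R.is_cring that)
  have p_left: "(\<lambda>x. p x \<psi>) \<in> module_hom R M T" if "\<psi> \<in> carrier D" for \<psi>
    unfolding p_def T_def by (rule pure_tensor_left_hom) (simp_all add: R.is_cring that)
  have p_right: "(\<lambda>\<psi>. p x \<psi>) \<in> module_hom R D T" if "x \<in> carrier M" for x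
    unfolding p_def T_def by (rule pure_tensor_right_hom) (simp_all add: R.is_cring that)
  have zc: "z (e j) \<in> carrier M" if "j < m" for j by (rule module_hom_closed[OF z(1) e[OF that]])
  have yR: "y \<in> carrier R" using y by (simp add: nonzerodivisors_def)
  let ?G = "free_module R {..<r}"
  let ?u = "linear_extension R M u"
  have hu: "?u \<in> module_hom R ?G M" by (rule linear_extension_hom[OF module_axioms u])
  have G: "module R ?G" by (rule free_module_module[OF R.is_cring])
  \<comment> \<open>The multiple \<open>y z\<close> has values in the free submodule spanned by
    \<open>u\<close>, so it is \<open>u C\<close> for a matrix \<open>C\<close>; as \<open>u\<close>
    is injective, \<open>z B = 0\<close> becomes \<open>C B = 0\<close>.\<close>
  obtain C where C: "C \<in> module_hom R F ?G" "\<And>a. a \<in> carrier F \<Longrightarrow> ?u (C a) = y \<odot>\<^bsub>M\<^esub> z a"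
    using free_lifting[OF G module_axioms module_hom_scaled[OF module_axioms z(1) yR] hu cond[OF module_hom_closed[OF z(1)]]] by blast
  have CB: "C (B a) = (\<lambda>i. \<zero>\<^bsub>R\<^esub>)" if a: "a \<in> carrier F" for a
    by (rule inj[OF module_hom_closed[OF C(1) Bc[OF a]]]) (use C(2)[OF Bc[OF a]] z(2)[OF a] yR in simp)
  have Cc: "C (e j) l \<in> carrier R" if "j < m" for j l
    using module_hom_closed[OF C(1) e[OF that]] by (simp add: free_module_carrier_iff)
  \<comment> \<open>The equation \<open>C B = 0\<close>, read as a relation between the rows of
    \<open>B\<close>.\<close>
  have rows: "(\<Oplus>\<^bsub>D\<^esub>j\<in>{..<m}. C (e j) l \<odot>\<^bsub>D\<^esub> \<phi> j) = \<zero>\<^bsub>D\<^esub>" (is "?s = _") for l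
  proof (rule extensionalityI[of _ "carrier M"])
    have sD: "?s \<in> carrier D" by (rule D.M.finsum_closed) (use Cc \<phi>D in auto)
    then show "?s \<in> extensional (carrier M)" using Dc by simp
    show "\<zero>\<^bsub>D\<^esub> \<in> extensional (carrier M)" using D.M.zero_closed Dc by simp
    fix x assume x: "x \<in> carrier M"
    obtain a where a: "a \<in> carrier F" "x = \<pi> a" using piE[OF x] by (rule bexE)
    have ev: "(\<lambda>\<psi>. \<psi> x) \<in> module_hom R D (self_module R)"
      by (rule module_homI) (use x Dadd Dsm module_hom_closed[OF Dh] in auto)
    have Bac: "\<And>j. B a j \<in> carrier R" using Bc[OF a(1)] by (simp add: free_module_carrier_iff)
    have "?s x = (\<Oplus>\<^bsub>self_module R\<^esub>j\<in>{..<m}. (C (e j) l \<odot>\<^bsub>D\<^esub> \<phi> j) x)"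
      by (rule module_hom_finsum[OF D.module_axioms Rm ev]) (use Cc \<phi>D in auto)
    also have "\<dots> = (\<Oplus>\<^bsub>self_module R\<^esub>j\<in>{..<m}. B a j \<odot>\<^bsub>self_module R\<^esub> C (e j) l)"
      by (rule S.M.finsum_cong') (use Cc Bac Dsm[OF x] \<phi>\<pi>[OF a(1)] a(2) in \<open>auto simp: R.m_comm\<close>)
    also have "\<dots> = linear_extension R (self_module R) (\<lambda>j. C (e j) l) (B a)"
      by (rule S.finsum_linear_combination[OF Bc[OF a(1)], symmetric]) (use Cc in auto)
    also have "\<dots> = C (B a) l"
      by (rule hom_eq_linear_extension[OF Rm module_hom_comp[OF C(1) free_module_eval_hom] Bc[OF a(1)], symmetric])
    finally show "?s x = \<zero>\<^bsub>D\<^esub> x" using CB[OF a(1)] Dz[OF x] by simp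
  qed
  define t where "t = (\<Oplus>\<^bsub>T\<^esub>j\<in>{..<m}. p (z (e j)) (\<phi> j))"
  have tT: "t \<in> carrier T" unfolding t_def by (rule T.M.finsum_closed) (use p_closed zc \<phi>D in auto)
  have uc: "u l \<in> carrier M" if "l < r" for l using u that by auto
  \<comment> \<open>After \<open>y z_j\<close> is expanded in the \<open>u_l\<close>, the
    coefficients move to the second factor and the sums are exchanged; for each \<open>l\<close> the
    second factor becomes one of the vanishing combinations \<open>rows\<close>.\<close>
  have "y \<odot>\<^bsub>T\<^esub> t = (\<Oplus>\<^bsub>T\<^esub>j\<in>{..<m}. y \<odot>\<^bsub>T\<^esub> p (z (e j)) (\<phi> j))"
    unfolding t_def by (rule T.finsum_smult_ldistr) (use yR p_closed zc \<phi>D in auto)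
  also have "\<dots> = (\<Oplus>\<^bsub>T\<^esub>j\<in>{..<m}. \<Oplus>\<^bsub>T\<^esub>l\<in>{..<r}. p (u l) (C (e j) l \<odot>\<^bsub>D\<^esub> \<phi> j))"
  proof (rule T.M.finsum_cong')
    show "(\<lambda>j. \<Oplus>\<^bsub>T\<^esub>l\<in>{..<r}. p (u l) (C (e j) l \<odot>\<^bsub>D\<^esub> \<phi> j)) \<in> {..<m} \<rightarrow> carrier T"
      by (intro Pi_I T.M.finsum_closed) (use p_closed uc \<phi>D Cc in auto)
    fix j assume "j \<in> {..<m}"
    then have j: "j < m" by simp
    have "y \<odot>\<^bsub>T\<^esub> p (z (e j)) (\<phi> j) = p (y \<odot>\<^bsub>M\<^esub> z (e j)) (\<phi> j)"
      by (rule module_hom_smult[OF p_left[OF \<phi>D] yR zc[OF j], symmetric])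
    also have "y \<odot>\<^bsub>M\<^esub> z (e j) = (\<Oplus>\<^bsub>M\<^esub>l\<in>{..<r}. C (e j) l \<odot>\<^bsub>M\<^esub> u l)"
      unfolding C(2)[OF e[OF j], symmetric]
      by (rule finsum_linear_combination[OF module_hom_closed[OF C(1) e[OF j]] u])
    also have "p (\<Oplus>\<^bsub>M\<^esub>l\<in>{..<r}. C (e j) l \<odot>\<^bsub>M\<^esub> u l) (\<phi> j) = (\<Oplus>\<^bsub>T\<^esub>l\<in>{..<r}. p (C (e j) l \<odot>\<^bsub>M\<^esub> u l) (\<phi> j))"
      by (rule module_hom_finsum[OF module_axioms T.module_axioms p_left[OF \<phi>D]]) (use Cc[OF j] uc in auto)
    also have "\<dots> = (\<Oplus>\<^bsub>T\<^esub>l\<in>{..<r}. p (u l) (C (e j) l \<odot>\<^bsub>D\<^esub> \<phi> j))"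
    proof (rule T.M.finsum_cong')
      fix l assume "l \<in> {..<r}"
      then have l: "l < r" by simp
      show "p (C (e j) l \<odot>\<^bsub>M\<^esub> u l) (\<phi> j) = p (u l) (C (e j) l \<odot>\<^bsub>D\<^esub> \<phi> j)"
        using module_hom_smult[OF p_left[OF \<phi>D] Cc[OF j] uc[OF l]]
          module_hom_smult[OF p_right[OF uc[OF l]] Cc[OF j] \<phi>D] by simp
    qed (use p_closed uc \<phi>D Cc[OF j] in auto)
    finally show "y \<odot>\<^bsub>T\<^esub> p (z (e j)) (\<phi> j) = (\<Oplus>\<^bsub>T\<^esub>l\<in>{..<r}. p (u l) (C (e j) l \<odot>\<^bsub>D\<^esub> \<phi> j))" .
  qed simp
  also have "\<dots> = (\<Oplus>\<^bsub>T\<^esub>l\<in>{..<r}. \<Oplus>\<^bsub>T\<^esub>j\<in>{..<m}. p (u l) (C (e j) l \<odot>\<^bsub>D\<^esub> \<phi> j))"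
    by (rule T.M.finsum_swap) (use p_closed uc \<phi>D Cc in auto)
  also have "\<dots> = (\<Oplus>\<^bsub>T\<^esub>l\<in>{..<r}. \<zero>\<^bsub>T\<^esub>)"
  proof (rule T.M.finsum_cong')
    fix l assume "l \<in> {..<r}"
    then have l: "l < r" by simp
    have "(\<Oplus>\<^bsub>T\<^esub>j\<in>{..<m}. p (u l) (C (e j) l \<odot>\<^bsub>D\<^esub> \<phi> j)) = p (u l) (\<Oplus>\<^bsub>D\<^esub>j\<in>{..<m}. C (e j) l \<odot>\<^bsub>D\<^esub> \<phi> j)"
      by (rule module_hom_finsum[OF D.module_axioms T.module_axioms p_right[OF uc[OF l]], symmetric]) (use Cc \<phi>D in auto)
    also have "\<dots> = \<zero>\<^bsub>T\<^esub>"
      unfolding rows by (rule module_hom_zero[OF D.module_axioms T.module_axioms p_right[OF uc[OF l]]])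
    finally show "(\<Oplus>\<^bsub>T\<^esub>j\<in>{..<m}. p (u l) (C (e j) l \<odot>\<^bsub>D\<^esub> \<phi> j)) = \<zero>\<^bsub>T\<^esub>" .
  qed simp_all
  finally have "y \<odot>\<^bsub>T\<^esub> t = \<zero>\<^bsub>T\<^esub>" by simp
  then have "t \<in> torsion_submodule R T" by (rule killed_by_nonzerodivisor_torsion[OF T.module_axioms y tT])
  then have t0: "t = \<zero>\<^bsub>T\<^esub>" using nt unfolding has_torsion_def T_def D_def by simp
  let ?F0 = "free_module R (carrier M \<times> carrier D)"
  interpret F0: module R ?F0 by (rule free_module_module[OF R.is_cring])
  have rel: "submodule (tensor_relations R M D) R ?F0"
    by (rule tensor_relations_submodule) (simp_all add: R.is_cring)
  have bv: "basis_vector R (x, \<psi>) \<in> carrier ?F0" if "x \<in> carrier M" "\<psi> \<in> carrier D" for x \<psi>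
    by (rule basis_vector_closed[OF R.is_cring]) (use that in simp)
  \<comment> \<open>A lift of \<open>t\<close> to the free module on all pairs; \<open>t = 0\<close>
    says that this lift is a tensor relation.\<close>
  define v where "v = (\<Oplus>\<^bsub>?F0\<^esub>j\<in>{..<m}. basis_vector R (z (e j), \<phi> j))"
  have bvP: "(\<lambda>j. basis_vector R (z (e j), \<phi> j)) \<in> {..<m} \<rightarrow> carrier ?F0" using bv zc \<phi>D by auto
  have vF0: "v \<in> carrier ?F0" unfolding v_def by (rule F0.M.finsum_closed[OF bvP])
  have "tensor_relations R M D +>\<^bsub>?F0\<^esub> v = t"
    unfolding v_def t_def p_def T_def pure_tensor_def tensor_module_def
    by (rule module_hom_finsum[OF F0.module_axioms F0.quotient_module_module[OF rel] F0.quotient_hom[OF rel] _ bvP]) simp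
  then have "v \<in> tensor_relations R M D"
    using F0.coset_zero[OF rel vF0] t0 by (simp add: T_def tensor_module_def quotient_module_simps)
  \<comment> \<open>Every functional on \<open>M\<close>, composed with \<open>\<pi>\<close>, kills
    \<open>A\<close> and so factors as \<open>g B\<close>. The choice of \<open>g\<close> is unique
    only up to functionals that kill \<open>B\<close>.\<close>
  have "\<exists>g\<in>module_hom R F (self_module R). \<forall>a\<in>carrier F. \<psi> (\<pi> a) = g (B a)" if \<psi>: "\<psi> \<in> carrier D" for \<psi>
  proof (rule exact_A[OF module_hom_comp[OF pi Dh[OF \<psi>]]])
    show "\<psi> (\<pi> (A a)) = \<zero>\<^bsub>R\<^esub>" if "a \<in> carrier F" for a
      using module_hom_zero[OF module_axioms Rm Dh[OF \<psi>]] pi_A[OF that] by simp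
  qed
  then have "\<forall>\<psi>\<in>carrier D. \<exists>g. g \<in> module_hom R F (self_module R) \<and> (\<forall>a\<in>carrier F. \<psi> (\<pi> a) = g (B a))" by blast
  from bchoice[OF this] obtain g where
    "\<forall>\<psi>\<in>carrier D. g \<psi> \<in> module_hom R F (self_module R) \<and> (\<forall>a\<in>carrier F. \<psi> (\<pi> a) = g \<psi> (B a))" by (rule exE)
  then have g: "\<And>\<psi>. \<psi> \<in> carrier D \<Longrightarrow> g \<psi> \<in> module_hom R F (self_module R)"
    and gB: "\<And>\<psi> a. \<psi> \<in> carrier D \<Longrightarrow> a \<in> carrier F \<Longrightarrow> g \<psi> (B a) = \<psi> (\<pi> a)" by simp_all
  have gc: "g \<psi> a \<in> carrier R" if "\<psi> \<in> carrier D" "a \<in> carrier F" for \<psi> a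
    using module_hom_closed[OF g[OF that(1)] that(2)] by simp
  let ?L = "power_module M m"
  interpret L: module R ?L by (rule power_module_module[OF module_axioms])
  \<comment> \<open>The tuples of the form \<open>w A\<close>. The tensor product is
    \<open>M^m\<close> modulo \<open>K\<close>; what follows is the map that sends the tensor of
    \<open>x\<close> and \<open>\<psi>\<close> to the tuple of the
    \<open>g \<psi> (e i) x\<close>.\<close>
  define K where "K = {v \<in> carrier ?L. \<exists>w\<in>module_hom R F M. \<forall>i<m. v i = w (A (e i))}"
  have K: "submodule K R ?L"
  proof (rule L.submoduleI)
    show "K \<subseteq> carrier ?L" by (auto simp: K_def)
    have "(\<lambda>a. \<zero>\<^bsub>M\<^esub>) \<in> module_hom R F M" by (rule module_homI) simp_all
    then show "\<zero>\<^bsub>?L\<^esub> \<in> K" unfolding K_def using L.M.zero_closed by auto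
    have sm: "k \<odot>\<^bsub>?L\<^esub> v \<in> K" if k: "k \<in> carrier R" and v: "v \<in> K" for k v
    proof -
      obtain w where w: "v \<in> carrier ?L" "w \<in> module_hom R F M" "\<forall>i<m. v i = w (A (e i))" using v unfolding K_def by blast
      then show ?thesis unfolding K_def using L.smult_closed[OF k w(1)] module_hom_scaled[OF module_axioms w(2) k]
        by (intro CollectI conjI bexI[of _ "\<lambda>a. k \<odot>\<^bsub>M\<^esub> w a"]) simp_all
    qed
    then show "k \<odot>\<^bsub>?L\<^esub> v \<in> K" if "k \<in> carrier R" "v \<in> K" for k v using that by blast
    show "\<ominus>\<^bsub>?L\<^esub> v \<in> K" if v: "v \<in> K" for v
    proof -
      have "v \<in> carrier ?L" using v by (simp add: K_def)
      then have "\<ominus>\<^bsub>?L\<^esub> v = (\<ominus>\<^bsub>R\<^esub> \<one>\<^bsub>R\<^esub>) \<odot>\<^bsub>?L\<^esub> v" by (simp only: L.smult_l_minus R.one_closed L.smult_one)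
      then show ?thesis using sm[OF _ v, of "\<ominus>\<^bsub>R\<^esub> \<one>\<^bsub>R\<^esub>"] by simp
    qed
    show "v \<oplus>\<^bsub>?L\<^esub> v' \<in> K" if v: "v \<in> K" "v' \<in> K" for v v'
    proof -
      obtain w where w: "v \<in> carrier ?L" "w \<in> module_hom R F M" "\<forall>i<m. v i = w (A (e i))" using v(1) unfolding K_def by blast
      obtain w' where w': "v' \<in> carrier ?L" "w' \<in> module_hom R F M" "\<forall>i<m. v' i = w' (A (e i))" using v(2) unfolding K_def by blast
      show ?thesis unfolding K_def using L.M.a_closed[OF w(1) w'(1)] module_hom_sum[OF module_axioms w(2) w'(2) F] w(3) w'(3)
        by (intro CollectI conjI bexI[of _ "\<lambda>a. w a \<oplus>\<^bsub>M\<^esub> w' a"]) simp_all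
    qed
  qed
  \<comment> \<open>The ambiguity of \<open>g\<close> is harmless: a functional \<open>d\<close>
    that kills \<open>B\<close> has the form \<open>d' A\<close>, so the tuple of the
    \<open>d (e i) x\<close> is in \<open>K\<close>.\<close>
  have KI: "v \<in> K" if v: "v \<in> carrier ?L" and x: "x \<in> carrier M" and d: "d \<in> module_hom R F (self_module R)"
    and dB: "\<And>a. a \<in> carrier F \<Longrightarrow> d (B a) = \<zero>\<^bsub>R\<^esub>" and vi: "\<And>i. i < m \<Longrightarrow> v i = d (e i) \<odot>\<^bsub>M\<^esub> x" for v x d
  proof -
    obtain d' where d': "d' \<in> module_hom R F (self_module R)" "\<forall>a\<in>carrier F. d a = d' (A a)"
      using exact_B[OF d dB] by (rule bexE)
    have "(\<lambda>a. a \<odot>\<^bsub>M\<^esub> x) \<in> module_hom R (self_module R) M"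
      by (rule module_homI) (auto simp: smult_l_distr smult_assoc1 x)
    from module_hom_comp[OF d'(1) this] show ?thesis
      unfolding K_def using v vi d'(2) e by (intro CollectI conjI bexI[of _ "\<lambda>a. d' a \<odot>\<^bsub>M\<^esub> x"]) simp_all
  qed
  define b where "b x \<psi> = (\<lambda>i. if i < m then g \<psi> (e i) \<odot>\<^bsub>M\<^esub> x else \<zero>\<^bsub>M\<^esub>)" for x \<psi>
  have bL: "b x \<psi> \<in> carrier ?L" if "x \<in> carrier M" "\<psi> \<in> carrier D" for x \<psi>
    using gc[OF that(2) e] that(1) by (simp add: b_def power_module_carrier_iff)
  have zero_hom: "(\<lambda>a. \<zero>\<^bsub>R\<^esub>) \<in> module_hom R F (self_module R)" by (rule module_homI) simp_all
  note Lminus = power_module_minus[OF module_axioms]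
  \<comment> \<open>Since \<open>g\<close> is chosen separately for each functional,
    \<open>b\<close> is bilinear only modulo \<open>K\<close>; each defect comes from a functional
    that kills \<open>B\<close>.\<close>
  have "linear_extension R ?L (\<lambda>(x, \<psi>). b x \<psi>) v \<in> K"
  proof (rule tensor_relations_bilinear[OF R.is_cring _ _ _ _ L.module_axioms K bL])
    fix x x' \<psi> assume c: "x \<in> carrier M" "x' \<in> carrier M" "\<psi> \<in> carrier D"
    show "b (x \<oplus>\<^bsub>M\<^esub> x') \<psi> \<ominus>\<^bsub>?L\<^esub> (b x \<psi> \<oplus>\<^bsub>?L\<^esub> b x' \<psi>) \<in> K"
    proof (rule KI[OF L.M.minus_closed[OF bL L.M.a_closed[OF bL bL]] c(1) zero_hom])
      fix i assume i: "i < m"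
      show "(b (x \<oplus>\<^bsub>M\<^esub> x') \<psi> \<ominus>\<^bsub>?L\<^esub> (b x \<psi> \<oplus>\<^bsub>?L\<^esub> b x' \<psi>)) i = \<zero>\<^bsub>R\<^esub> \<odot>\<^bsub>M\<^esub> x"
        using Lminus[OF bL[OF M.a_closed[OF c(1,2)] c(3)] L.M.a_closed[OF bL[OF c(1,3)] bL[OF c(2,3)]]] i c gc[OF c(3) e[OF i]]
        by (simp add: b_def smult_r_distr M.minus_eq M.r_neg)
    qed (use c in simp_all)
  next
    fix x \<psi> \<psi>' assume c: "x \<in> carrier M" "\<psi> \<in> carrier D" "\<psi>' \<in> carrier D"
    note cs = D.M.a_closed[OF c(2,3)]
    show "b x (\<psi> \<oplus>\<^bsub>D\<^esub> \<psi>') \<ominus>\<^bsub>?L\<^esub> (b x \<psi> \<oplus>\<^bsub>?L\<^esub> b x \<psi>') \<in> K"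
    proof (rule KI[OF L.M.minus_closed[OF bL L.M.a_closed[OF bL bL]] c(1)
          module_hom_diff[OF Rm F g[OF cs] module_hom_sum[OF Rm g[OF c(2)] g[OF c(3)] F]]])
      fix a assume a: "a \<in> carrier F"
      show "g (\<psi> \<oplus>\<^bsub>D\<^esub> \<psi>') (B a) \<ominus>\<^bsub>self_module R\<^esub> (g \<psi> (B a) \<oplus>\<^bsub>self_module R\<^esub> g \<psi>' (B a)) = \<zero>\<^bsub>R\<^esub>"
        using gB[OF cs a] gB[OF c(2) a] gB[OF c(3) a] Dadd[OF pc[OF a]] gc[OF c(2) Bc[OF a]] gc[OF c(3) Bc[OF a]]
        by (simp add: self_module_minus R.minus_eq R.r_neg)
    next
      fix i assume i: "i < m"
      show "(b x (\<psi> \<oplus>\<^bsub>D\<^esub> \<psi>') \<ominus>\<^bsub>?L\<^esub> (b x \<psi> \<oplus>\<^bsub>?L\<^esub> b x \<psi>')) i =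
          (g (\<psi> \<oplus>\<^bsub>D\<^esub> \<psi>') (e i) \<ominus>\<^bsub>self_module R\<^esub> (g \<psi> (e i) \<oplus>\<^bsub>self_module R\<^esub> g \<psi>' (e i))) \<odot>\<^bsub>M\<^esub> x"
        using Lminus[OF bL[OF c(1) cs] L.M.a_closed[OF bL[OF c(1,2)] bL[OF c(1,3)]]] i c(1)
          gc[OF cs e[OF i]] gc[OF c(2) e[OF i]] gc[OF c(3) e[OF i]]
        by (simp add: b_def self_module_minus R.minus_eq M.minus_eq smult_l_distr smult_l_minus)
    qed (use c cs in simp_all)
  next
    fix k x \<psi> assume c: "k \<in> carrier R" "x \<in> carrier M" "\<psi> \<in> carrier D"
    show "b (k \<odot>\<^bsub>M\<^esub> x) \<psi> \<ominus>\<^bsub>?L\<^esub> k \<odot>\<^bsub>?L\<^esub> b x \<psi> \<in> K"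
    proof (rule KI[OF L.M.minus_closed[OF bL L.smult_closed[OF _ bL]] c(2) zero_hom])
      fix i assume i: "i < m"
      have "g \<psi> (e i) \<odot>\<^bsub>M\<^esub> (k \<odot>\<^bsub>M\<^esub> x) = k \<odot>\<^bsub>M\<^esub> (g \<psi> (e i) \<odot>\<^bsub>M\<^esub> x)"
        using gc[OF c(3) e[OF i]] c(1,2) by (simp add: smult_assoc1[symmetric] R.m_comm)
      then show "(b (k \<odot>\<^bsub>M\<^esub> x) \<psi> \<ominus>\<^bsub>?L\<^esub> k \<odot>\<^bsub>?L\<^esub> b x \<psi>) i = \<zero>\<^bsub>R\<^esub> \<odot>\<^bsub>M\<^esub> x"
        using Lminus[OF bL[OF smult_closed[OF c(1,2)] c(3)] L.smult_closed[OF c(1) bL[OF c(2,3)]]] i c gc[OF c(3) e[OF i]]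
        by (simp add: b_def M.minus_eq M.r_neg)
    qed (use c in simp_all)
  next
    fix k x \<psi> assume c: "k \<in> carrier R" "x \<in> carrier M" "\<psi> \<in> carrier D"
    note cs = D.smult_closed[OF c(1,3)]
    show "b x (k \<odot>\<^bsub>D\<^esub> \<psi>) \<ominus>\<^bsub>?L\<^esub> k \<odot>\<^bsub>?L\<^esub> b x \<psi> \<in> K"
    proof (rule KI[OF L.M.minus_closed[OF bL L.smult_closed[OF _ bL]] c(2)
          module_hom_diff[OF Rm F g[OF cs] module_hom_scaled[OF Rm g[OF c(3)] c(1)]]])
      fix a assume a: "a \<in> carrier F"
      show "g (k \<odot>\<^bsub>D\<^esub> \<psi>) (B a) \<ominus>\<^bsub>self_module R\<^esub> (k \<odot>\<^bsub>self_module R\<^esub> g \<psi> (B a)) = \<zero>\<^bsub>R\<^esub>"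
        using gB[OF cs a] gB[OF c(3) a] Dsm[OF pc[OF a]] gc[OF c(3) Bc[OF a]] c(1)
        by (simp add: self_module_minus R.minus_eq R.r_neg)
    next
      fix i assume i: "i < m"
      show "(b x (k \<odot>\<^bsub>D\<^esub> \<psi>) \<ominus>\<^bsub>?L\<^esub> k \<odot>\<^bsub>?L\<^esub> b x \<psi>) i =
          (g (k \<odot>\<^bsub>D\<^esub> \<psi>) (e i) \<ominus>\<^bsub>self_module R\<^esub> (k \<odot>\<^bsub>self_module R\<^esub> g \<psi> (e i))) \<odot>\<^bsub>M\<^esub> x"
        using Lminus[OF bL[OF c(2) cs] L.smult_closed[OF c(1) bL[OF c(2,3)]]] i c(1,2)
          gc[OF cs e[OF i]] gc[OF c(3) e[OF i]]
        by (simp add: b_def self_module_minus R.minus_eq M.minus_eq smult_l_distr smult_l_minus smult_assoc1)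
    qed (use c cs in simp_all)
  qed (use \<open>v \<in> tensor_relations R M D\<close> in simp_all)
  moreover have "linear_extension R ?L (\<lambda>(x, \<psi>). b x \<psi>) v = (\<Oplus>\<^bsub>?L\<^esub>j\<in>{..<m}. b (z (e j)) (\<phi> j))"
  proof -
    have h: "linear_extension R ?L (\<lambda>(x, \<psi>). b x \<psi>) \<in> module_hom R ?F0 ?L"
      by (rule linear_extension_hom[OF L.module_axioms]) (use bL in auto)
    have "linear_extension R ?L (\<lambda>(x, \<psi>). b x \<psi>) v =
        (\<Oplus>\<^bsub>?L\<^esub>j\<in>{..<m}. linear_extension R ?L (\<lambda>(x, \<psi>). b x \<psi>) (basis_vector R (z (e j), \<phi> j)))"
      unfolding v_def by (rule module_hom_finsum[OF F0.module_axioms L.module_axioms h _ bvP]) simp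
    also have "\<dots> = (\<Oplus>\<^bsub>?L\<^esub>j\<in>{..<m}. b (z (e j)) (\<phi> j))"
    proof (rule L.M.finsum_cong')
      fix j assume "j \<in> {..<m}"
      then show "linear_extension R ?L (\<lambda>(x, \<psi>). b x \<psi>) (basis_vector R (z (e j), \<phi> j)) = b (z (e j)) (\<phi> j)"
        using linear_extension_basis[OF L.module_axioms, of "\<lambda>(x, \<psi>). b x \<psi>" "(z (e j), \<phi> j)"] bL[OF zc \<phi>D] by simp
    qed (use bL zc \<phi>D in auto)
    finally show ?thesis .
  qed
  ultimately have sb: "(\<Oplus>\<^bsub>?L\<^esub>j\<in>{..<m}. b (z (e j)) (\<phi> j)) \<in> K" by simp
  \<comment> \<open>The tuple with \<open>z (e j)\<close> in place \<open>j\<close>. Modulo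
    \<open>K\<close> it equals \<open>b (z (e j)) (\<phi> j)\<close>, since
    \<open>g (\<phi> j)\<close> and the \<open>j\<close>-th coordinate agree on the image of
    \<open>B\<close>. The sum of all \<open>\<delta> j\<close> is therefore in \<open>K\<close>, and
    it is the tuple of \<open>z\<close>.\<close>
  define \<delta> where "\<delta> j = (\<lambda>i. if i = j then z (e j) else \<zero>\<^bsub>M\<^esub>)" for j :: nat
  have \<delta>L: "\<delta> j \<in> carrier ?L" if "j < m" for j using zc[OF that] that by (simp add: \<delta>_def power_module_carrier_iff)
  have bz: "b (z (e j)) (\<phi> j) \<in> carrier ?L" if "j < m" for j by (rule bL[OF zc[OF that] \<phi>D])
  have diff: "b (z (e j)) (\<phi> j) \<ominus>\<^bsub>?L\<^esub> \<delta> j \<in> K" if j: "j < m" for j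
  proof (rule KI[OF L.M.minus_closed[OF bz[OF j] \<delta>L[OF j]] zc[OF j]
        module_hom_diff[OF Rm F g[OF \<phi>D] free_module_eval_hom]])
    fix a assume a: "a \<in> carrier F"
    show "g (\<phi> j) (B a) \<ominus>\<^bsub>self_module R\<^esub> B a j = \<zero>\<^bsub>R\<^esub>"
      using gB[OF \<phi>D a] \<phi>\<pi>[OF a, of j] gc[OF \<phi>D Bc[OF a], of j] by (simp add: self_module_minus R.minus_eq R.r_neg)
  next
    fix i assume i: "i < m"
    show "(b (z (e j)) (\<phi> j) \<ominus>\<^bsub>?L\<^esub> \<delta> j) i = (g (\<phi> j) (e i) \<ominus>\<^bsub>self_module R\<^esub> e i j) \<odot>\<^bsub>M\<^esub> z (e j)"
      using Lminus[OF bz[OF j] \<delta>L[OF j]] i zc[OF j] gc[OF \<phi>D e[OF i], of j]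
      by (auto simp: b_def \<delta>_def basis_vector_def self_module_minus R.minus_eq M.minus_eq smult_l_distr smult_l_minus)
  qed
  let ?sd = "\<Oplus>\<^bsub>?L\<^esub>j\<in>{..<m}. (b (z (e j)) (\<phi> j) \<ominus>\<^bsub>?L\<^esub> \<delta> j)"
  have sd: "?sd \<in> K" by (rule L.submodule_finsum[OF K]) (use diff in auto)
  have s\<delta>: "(\<Oplus>\<^bsub>?L\<^esub>j\<in>{..<m}. \<delta> j) \<in> carrier ?L" by (rule L.M.finsum_closed) (use \<delta>L in auto)
  have "(\<Oplus>\<^bsub>?L\<^esub>j\<in>{..<m}. b (z (e j)) (\<phi> j)) = (\<Oplus>\<^bsub>?L\<^esub>j\<in>{..<m}. \<delta> j \<oplus>\<^bsub>?L\<^esub> (b (z (e j)) (\<phi> j) \<ominus>\<^bsub>?L\<^esub> \<delta> j))"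
  proof (rule L.M.finsum_cong')
    fix j assume "j \<in> {..<m}"
    then show "b (z (e j)) (\<phi> j) = \<delta> j \<oplus>\<^bsub>?L\<^esub> (b (z (e j)) (\<phi> j) \<ominus>\<^bsub>?L\<^esub> \<delta> j)"
      by (intro L.eq_plus_diff bz \<delta>L) simp_all
  next
    show "(\<lambda>j. \<delta> j \<oplus>\<^bsub>?L\<^esub> (b (z (e j)) (\<phi> j) \<ominus>\<^bsub>?L\<^esub> \<delta> j)) \<in> {..<m} \<rightarrow> carrier ?L"
      by (intro Pi_I L.M.a_closed L.M.minus_closed bz \<delta>L) simp_all
  qed simp
  also have "\<dots> = (\<Oplus>\<^bsub>?L\<^esub>j\<in>{..<m}. \<delta> j) \<oplus>\<^bsub>?L\<^esub> ?sd"
    by (rule L.M.finsum_addf) (intro Pi_I L.M.minus_closed bz \<delta>L; simp)+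
  finally have eq0: "(\<Oplus>\<^bsub>?L\<^esub>j\<in>{..<m}. b (z (e j)) (\<phi> j)) = (\<Oplus>\<^bsub>?L\<^esub>j\<in>{..<m}. \<delta> j) \<oplus>\<^bsub>?L\<^esub> ?sd" .
  have sdc: "?sd \<in> carrier ?L" using sd by (simp only: K_def mem_Collect_eq)
  note eq = trans[OF eq0 L.M.a_comm[OF s\<delta> sdc]]
  have "(\<Oplus>\<^bsub>?L\<^esub>j\<in>{..<m}. b (z (e j)) (\<phi> j)) \<ominus>\<^bsub>?L\<^esub> ?sd = (\<Oplus>\<^bsub>?L\<^esub>j\<in>{..<m}. \<delta> j)"
    by (rule L.diff_eq[OF sdc s\<delta> eq])
  then have "(\<Oplus>\<^bsub>?L\<^esub>j\<in>{..<m}. \<delta> j) \<in> K" using L.submodule_minus[OF K sb sd] by simp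
  then obtain w where w: "w \<in> module_hom R F M" "\<forall>i<m. (\<Oplus>\<^bsub>?L\<^esub>j\<in>{..<m}. \<delta> j) i = w (A (e i))"
    unfolding K_def by blast
  have "z (e i) = w (A (e i))" if i: "i < m" for i
  proof -
    have "(\<Oplus>\<^bsub>?L\<^esub>j\<in>{..<m}. \<delta> j) i = (\<Oplus>\<^bsub>M\<^esub>j\<in>{..<m}. \<delta> j i)"
      by (rule module_hom_finsum[OF L.module_axioms module_axioms power_module_eval_hom]) (use \<delta>L in auto)
    also have "\<dots> = z (e i)"
      unfolding \<delta>_def by (rule M.finsum_singleton) (use i zc in auto)
    finally show ?thesis using w(2) i by simp
  qed
  then have "z a = w (A a)" if "a \<in> carrier F" for a
    by (intro hom_eqI[OF module_axioms z(1) module_hom_comp[OF A w(1)] _ that]) simp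
  then show ?thesis using w(1) by (intro bexI[of _ w]) simp_all
qed

end

section \<open>Comparing the two cohomologies of Hom into M\<close>

lemma submodule_chain_weaken:
  assumes "submodule_chain R M W Y n" "W' \<subseteq> W"
  shows "submodule_chain R M W' Y n"
  using assms(1)
  by (induction rule: submodule_chain.induct)
    (use assms(2) in \<open>auto intro: submodule_chain.intros\<close>)

context periodic_presentation
begin

text \<open>Composition with \<open>C\<close> on the homomorphisms from \<open>R^m\<close> to
  \<open>M\<close>, which are encoded by the tuples of their values on the basis. In this way the
  complex lives on the single module \<open>M^m\<close>.\<close>

definition pullback :: "((nat \<Rightarrow> 'a) \<Rightarrow> nat \<Rightarrow> 'a) \<Rightarrow> (nat \<Rightarrow> 'm) \<Rightarrow> nat \<Rightarrow> 'm" where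
  "pullback C z = (\<lambda>i. if i < m then linear_extension R M z (C (e i)) else \<zero>\<^bsub>M\<^esub>)"

abbreviation (input) "V \<equiv> power_module M m"

lemma V: "module R V" by (rule power_module_module[OF module_axioms])

lemma tuple_hom: "z \<in> carrier V \<Longrightarrow> linear_extension R M z \<in> module_hom R F M"
  by (rule linear_extension_hom[OF module_axioms]) (simp add: power_module_carrier_iff)

lemma tuple_basis: "z \<in> carrier V \<Longrightarrow> linear_extension R M z (e i) = z i"
  by (rule linear_extension_basis[OF module_axioms]) (simp add: power_module_carrier_iff)

lemma hom_tuple:
  assumes "h \<in> module_hom R F M"
  shows "(\<lambda>i. if i < m then h (e i) else \<zero>\<^bsub>M\<^esub>) \<in> carrier V"
    and "a \<in> carrier F \<Longrightarrow> linear_extension R M (\<lambda>i. if i < m then h (e i) else \<zero>\<^bsub>M\<^esub>) a = h a"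
proof -
  show c: "(\<lambda>i. if i < m then h (e i) else \<zero>\<^bsub>M\<^esub>) \<in> carrier V"
    using module_hom_closed[OF assms e] by (simp add: power_module_carrier_iff)
  show "linear_extension R M (\<lambda>i. if i < m then h (e i) else \<zero>\<^bsub>M\<^esub>) a = h a" if "a \<in> carrier F"
    by (rule hom_eqI[OF module_axioms tuple_hom[OF c] assms _ that]) (simp add: tuple_basis[OF c])
qed

lemma tuple_eqI:
  assumes "z \<in> carrier V" "z' \<in> carrier V" "\<And>i. i < m \<Longrightarrow> z i = z' i"
  shows "z = z'"
proof
  fix i show "z i = z' i" using assms by (cases "i < m") (simp_all add: power_module_carrier_iff)
qed

lemma linear_extension_tuple_add:
  assumes "z \<in> carrier V" "z' \<in> carrier V" "a \<in> carrier F"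
  shows "linear_extension R M (\<lambda>i. z i \<oplus>\<^bsub>M\<^esub> z' i) a = linear_extension R M z a \<oplus>\<^bsub>M\<^esub> linear_extension R M z' a"
proof -
  have s: "(\<lambda>i. z i \<oplus>\<^bsub>M\<^esub> z' i) \<in> carrier V" using assms by (simp add: power_module_carrier_iff)
  show ?thesis
    by (rule hom_eqI[OF module_axioms tuple_hom[OF s] module_hom_sum[OF module_axioms tuple_hom[OF assms(1)] tuple_hom[OF assms(2)] F] _ assms(3)])
      (simp add: tuple_basis[OF s] tuple_basis[OF assms(1)] tuple_basis[OF assms(2)])
qed

lemma linear_extension_tuple_smult:
  assumes "z \<in> carrier V" "k \<in> carrier R" "a \<in> carrier F"
  shows "linear_extension R M (\<lambda>i. k \<odot>\<^bsub>M\<^esub> z i) a = k \<odot>\<^bsub>M\<^esub> linear_extension R M z a"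
proof -
  have s: "(\<lambda>i. k \<odot>\<^bsub>M\<^esub> z i) \<in> carrier V" using assms by (simp add: power_module_carrier_iff)
  show ?thesis
    by (rule hom_eqI[OF module_axioms tuple_hom[OF s] module_hom_scaled[OF module_axioms tuple_hom[OF assms(1)] assms(2)] _ assms(3)])
      (simp add: tuple_basis[OF s] tuple_basis[OF assms(1)])
qed

lemma pullback_closed:
  assumes "C \<in> module_hom R F F" "z \<in> carrier V"
  shows "pullback C z \<in> carrier V"
    and "a \<in> carrier F \<Longrightarrow> linear_extension R M (pullback C z) a = linear_extension R M z (C a)"
  using hom_tuple[OF module_hom_comp[OF assms(1) tuple_hom[OF assms(2)]]] by (simp_all add: pullback_def)

lemma pullback_hom:
  assumes C: "C \<in> module_hom R F F"
  shows "pullback C \<in> module_hom R V V"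
proof (rule module_homI)
  fix z assume z: "z \<in> carrier V"
  show "pullback C z \<in> carrier V" by (rule pullback_closed[OF C z])
  show "pullback C (k \<odot>\<^bsub>V\<^esub> z) = k \<odot>\<^bsub>V\<^esub> pullback C z" if k: "k \<in> carrier R" for k
    using linear_extension_tuple_smult[OF z k module_hom_closed[OF C e]] k by (auto simp: pullback_def)
  fix z' assume z': "z' \<in> carrier V"
  show "pullback C (z \<oplus>\<^bsub>V\<^esub> z') = pullback C z \<oplus>\<^bsub>V\<^esub> pullback C z'"
    using linear_extension_tuple_add[OF z z' module_hom_closed[OF C e]] by (auto simp: pullback_def)
qed

text \<open>Both cohomologies of \<open>Hom(-, M)\<close> agree in length because \<open>M\<close> differs from a free module by a
  module of finite length; so the vanishing of \<open>Ext\<^sup>1(M, M)\<close> forces that of \<open>Ext\<^sup>2(M, M)\<close>, and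
  the class of the identity dies.\<close>

lemma cover_factors:
  assumes "noetherian_local_ring R \<mm>" "krull_dim R = 1" "x \<in> \<mm>" "x \<in> nonzerodivisors R"
    and "finitely_generated_module R M" "has_rank R M"
    and nt: "\<not> has_torsion R (tensor_module R M (dual_module R M))"
  obtains w where "w \<in> module_hom R F M" "\<And>a. a \<in> carrier F \<Longrightarrow> \<pi> a = w (B a)"
proof -
  note L = noetherian_local_ringD[OF assms(1)]
  interpret V: module R V by (rule V)
  interpret F: module R F by (rule F)
  obtain r :: nat and u y where u: "u \<in> {..<r} \<rightarrow> carrier M" and y: "y \<in> nonzerodivisors R"
    and inj: "\<And>c. c \<in> carrier (free_module R {..<r}) \<Longrightarrow> linear_extension R M u c = \<zero>\<^bsub>M\<^esub> \<Longrightarrow> c = (\<lambda>i. \<zero>\<^bsub>R\<^esub>)"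
    and cond: "\<And>z. z \<in> carrier M \<Longrightarrow> y \<odot>\<^bsub>M\<^esub> z \<in> linear_extension R M u ` carrier (free_module R {..<r})"
    using rank_embedding[OF assms(1-4) module_axioms assms(5,6)] by metis
  have yR: "y \<in> carrier R" using y by (simp add: nonzerodivisors_def)
  have ext1: "\<exists>w\<in>module_hom R F M. \<forall>a\<in>carrier F. z a = w (A a)"
    if "z \<in> module_hom R F M" "\<And>a. a \<in> carrier F \<Longrightarrow> z (B a) = \<zero>\<^bsub>M\<^esub>" for z
    by (rule vanishing_ext[OF u y inj cond nt that])
  let ?G = "free_module R {..<r}"
  let ?u = "linear_extension R M u"
  have G: "module R ?G" by (rule free_module_module[OF R.is_cring])
  interpret G: module R ?G by (rule G)
  have hu: "?u \<in> module_hom R ?G M" by (rule linear_extension_hom[OF module_axioms u])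
  define U where "U = ?u ` carrier ?G"
  have U: "submodule U R M" unfolding U_def by (rule image_submodule[OF G module_axioms hu G.carrier_is_submodule])
  \<comment> \<open>The homomorphisms with values in the free submodule \<open>U\<close>. The
    quotient of \<open>M^m\<close> by them has finite length, because \<open>y\<close> maps
    \<open>M\<close> into \<open>U\<close>.\<close>
  define Um where "Um = {v \<in> carrier V. \<forall>i. v i \<in> U}"
  have Um: "submodule Um R V"
  proof (rule V.submoduleI)
    show "Um \<subseteq> carrier V" by (auto simp: Um_def)
    show "\<zero>\<^bsub>V\<^esub> \<in> Um" using V.M.zero_closed submodule_zero[OF U] by (simp add: Um_def)
    show "\<ominus>\<^bsub>V\<^esub> v \<in> Um" if "v \<in> Um" for v
      using that V.M.a_inv_closed[of v] power_module_neg[OF module_axioms, of v m] submoduleE(3)[OF U] by (simp add: Um_def)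
    show "v \<oplus>\<^bsub>V\<^esub> v' \<in> Um" if "v \<in> Um" "v' \<in> Um" for v v'
      using that V.M.a_closed[of v v'] submoduleE(5)[OF U] by (simp add: Um_def)
    show "k \<odot>\<^bsub>V\<^esub> v \<in> Um" if "k \<in> carrier R" "v \<in> Um" for k v
      using that V.smult_closed[of k v] submoduleE(4)[OF U] by (simp add: Um_def)
  qed
  have Umc: "v \<in> carrier V" if "v \<in> Um" for v using that by (simp add: Um_def)
  have UmU: "linear_extension R M v a \<in> U" if "v \<in> Um" "a \<in> carrier F" for v a
    by (rule linear_extension_mem[OF U that(2)])
      (use that submoduleE(4)[OF U] in \<open>auto simp: Um_def free_module_carrier_iff\<close>)
  \<comment> \<open>As \<open>U\<close> is free, exactness of the dual complex applies to maps into
    \<open>U\<close>: those that kill \<open>A\<close> factor through \<open>B\<close>.\<close>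
  have exU: "\<exists>C'\<in>module_hom R F ?G. \<forall>a\<in>carrier F. h a = ?u (C' (B a))"
    if h: "h \<in> module_hom R F M" and hU: "\<And>a. a \<in> carrier F \<Longrightarrow> h a \<in> U"
      and hA: "\<And>a. a \<in> carrier F \<Longrightarrow> h (A a) = \<zero>\<^bsub>M\<^esub>" for h
  proof -
    obtain C where C: "C \<in> module_hom R F ?G" "\<And>a. a \<in> carrier F \<Longrightarrow> ?u (C a) = h a"
      using free_lifting[OF G module_axioms h hu hU[unfolded U_def]] by blast
    have CA: "C (A a) = \<zero>\<^bsub>?G\<^esub>" if a: "a \<in> carrier F" for a
      using inj[OF module_hom_closed[OF C(1) Ac[OF a]]] C(2)[OF Ac[OF a]] hA[OF a] by simp
    obtain C' where C': "C' \<in> module_hom R F ?G" "\<And>a. a \<in> carrier F \<Longrightarrow> C a = C' (B a)"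
      using exact_A_power[OF C(1) CA] by blast
    show ?thesis using C'(1) C(2) C'(2) by (intro bexI[of _ C'] ballI) auto
  qed
  let ?a = "pullback A" and ?b = "pullback B"
  have ha: "?a \<in> module_hom R V V" and hb: "?b \<in> module_hom R V V" using pullback_hom A B by auto
  have ba: "?a (?b v) = \<zero>\<^bsub>V\<^esub>" if v: "v \<in> carrier V" for v
  proof -
    have "linear_extension R M (?b v) (A (e i)) = \<zero>\<^bsub>M\<^esub>" if i: "i < m" for i
      using pullback_closed(2)[OF B v Ac[OF e[OF i]]] BA[OF e[OF i]] module_hom_zero[OF F module_axioms tuple_hom[OF v]] by simp
    then show ?thesis unfolding pullback_def[of A] by auto
  qed
  have sa: "submodule (?a ` carrier V) R V" and sb: "submodule (?b ` carrier V) R V"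
    using image_submodule[OF V V _ V.carrier_is_submodule] ha hb by auto
  define Ua where "Ua = submodule_sum V Um (?a ` carrier V)"
  define Ub where "Ub = submodule_sum V Um (?b ` carrier V)"
  \<comment> \<open>The cocycles modulo \<open>Um\<close>; \<open>Ub\<close> is the corresponding
    set of coboundaries. The aim is \<open>Q = Ub\<close>, reached by counting.\<close>
  define Q where "Q = {v \<in> carrier V. ?a v \<in> Um}"
  have Ua: "submodule Ua R V" and Ub: "submodule Ub R V"
    unfolding Ua_def Ub_def by (rule V.submodule_sum_submodule[OF Um], fact)+
  have Q: "submodule Q R V" unfolding Q_def by (rule kernel_submodule[OF V V ha Um])
  \<comment> \<open>If \<open>v B\<close> has values in \<open>U\<close>, it kills \<open>A\<close>,
    so \<open>v B = k B\<close> for a \<open>U\<close>-valued map \<open>k\<close>. Then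
    \<open>v - k\<close> kills \<open>B\<close>, and Ext^1 = 0 writes it as
    \<open>w A\<close>.\<close>
  have kerb: "{v \<in> carrier V. ?b v \<in> Um} \<subseteq> Ua"
  proof
    fix v assume "v \<in> {v \<in> carrier V. ?b v \<in> Um}"
    then have v: "v \<in> carrier V" "?b v \<in> Um" by auto
    let ?h = "\<lambda>a. linear_extension R M v (B a)"
    have h: "?h \<in> module_hom R F M" by (rule module_hom_comp[OF B tuple_hom[OF v(1)]])
    have hU: "?h a \<in> U" if "a \<in> carrier F" for a
      using UmU[OF v(2) that] pullback_closed(2)[OF B v(1) that] by simp
    have hA: "?h (A a) = \<zero>\<^bsub>M\<^esub>" if "a \<in> carrier F" for a
      using BA[OF that] module_hom_zero[OF F module_axioms tuple_hom[OF v(1)]] by simp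
    obtain C' where C': "C' \<in> module_hom R F ?G" "\<forall>a\<in>carrier F. ?h a = ?u (C' (B a))"
      using exU[OF h hU hA] by (rule bexE)
    let ?k = "\<lambda>a. ?u (C' a)"
    have k: "?k \<in> module_hom R F M" by (rule module_hom_comp[OF C'(1) hu])
    have d: "(\<lambda>a. linear_extension R M v a \<ominus>\<^bsub>M\<^esub> ?k a) \<in> module_hom R F M"
      by (rule module_hom_diff[OF module_axioms F tuple_hom[OF v(1)] k])
    have dB: "linear_extension R M v (B a) \<ominus>\<^bsub>M\<^esub> ?k (B a) = \<zero>\<^bsub>M\<^esub>" if a: "a \<in> carrier F" for a
      using C'(2) a module_hom_closed[OF k Bc[OF a]] by (simp add: M.minus_eq M.r_neg)
    obtain w where w: "w \<in> module_hom R F M"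
      "\<forall>a\<in>carrier F. linear_extension R M v a \<ominus>\<^bsub>M\<^esub> ?k a = w (A a)"
      using ext1[OF d dB] by (rule bexE)
    let ?v0 = "\<lambda>i. if i < m then ?k (e i) else \<zero>\<^bsub>M\<^esub>" and ?w = "\<lambda>i. if i < m then w (e i) else \<zero>\<^bsub>M\<^esub>"
    have v0: "?v0 \<in> Um"
      using hom_tuple(1)[OF k] module_hom_closed[OF C'(1) e] submodule_zero[OF U] by (simp add: Um_def U_def)
    have wV: "?w \<in> carrier V" by (rule hom_tuple(1)[OF w(1)])
    have eq: "v = ?v0 \<oplus>\<^bsub>V\<^esub> ?a ?w"
    proof (rule tuple_eqI[OF v(1) V.M.a_closed[OF Umc[OF v0] module_hom_closed[OF ha wV]]])
      fix i assume i: "i < m"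
      have "v i = ?k (e i) \<oplus>\<^bsub>M\<^esub> (v i \<ominus>\<^bsub>M\<^esub> ?k (e i))"
        by (rule eq_plus_diff) (use v(1) module_hom_closed[OF k e[OF i]] in \<open>simp_all add: power_module_carrier_iff\<close>)
      also have "v i \<ominus>\<^bsub>M\<^esub> ?k (e i) = w (A (e i))" using w(2) e[OF i] tuple_basis[OF v(1)] by auto
      also have "\<dots> = ?a ?w i" using hom_tuple(2)[OF w(1) Ac[OF e[OF i]]] i by (simp add: pullback_def)
      finally show "v i = (?v0 \<oplus>\<^bsub>V\<^esub> ?a ?w) i" using i by simp
    qed
    show "v \<in> Ua" unfolding Ua_def by (subst eq) (rule submodule_sumI[OF v0 imageI[OF wV]])
  qed
  have UbQ: "Ub \<subseteq> Q"
  proof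
    fix v assume "v \<in> Ub"
    then obtain v0 bw where v0: "v0 \<in> Um" "bw \<in> ?b ` carrier V" "v = v0 \<oplus>\<^bsub>V\<^esub> bw"
      unfolding Ub_def by (rule submodule_sumE)
    from v0(2) obtain w where "bw = ?b w" "w \<in> carrier V" by (rule imageE)
    with v0 have vw: "v0 \<in> Um" "w \<in> carrier V" "v = v0 \<oplus>\<^bsub>V\<^esub> ?b w" by simp_all
    have bw: "?b w \<in> carrier V" by (rule module_hom_closed[OF hb vw(2)])
    have av: "?a v = ?a v0"
      using module_hom_add[OF ha Umc[OF vw(1)] bw] ba[OF vw(2)] vw(3) module_hom_closed[OF ha Umc[OF vw(1)]]
      by (simp del: power_module_simps)
    have "?a v0 i \<in> U" for i
      using UmU[OF vw(1) Ac[OF e]] submodule_zero[OF U] by (simp add: pullback_def)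
    then have "?a v0 \<in> Um" using module_hom_closed[OF ha Umc[OF vw(1)]] by (simp add: Um_def)
    moreover have "v \<in> carrier V" unfolding vw(3) by (rule V.M.a_closed[OF Umc[OF vw(1)] bw])
    ultimately show "v \<in> Q" using av by (simp add: Q_def)
  qed
  have "noetherian_module R V"
    by (rule noetherian_power_module[OF module_axioms noetherian_finitely_generated[OF L(1,2) module_axioms assms(5)]])
  moreover have "y \<odot>\<^bsub>V\<^esub> v \<in> Um" if "v \<in> carrier V" for v
    using that V.smult_closed[OF yR that] cond by (simp add: Um_def U_def power_module_carrier_iff)
  ultimately obtain N where N: "\<And>n. submodule_chain R V Um (carrier V) n \<Longrightarrow> n \<le> N"
    using finite_length_mod_nonzerodivisor[OF assms(1,2) y V _ Um] by blast
  have c0: "submodule_chain R V Um (carrier V) 0"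
    by (rule submodule_chain.chain_base[OF V.carrier_is_submodule]) (rule V.submoduleE(1)[OF Um])
  have "\<exists>n. submodule_chain R V Um (carrier V) n \<and> (\<forall>k. submodule_chain R V Um (carrier V) k \<longrightarrow> k \<le> n)"
    by (rule ex_has_greatest_nat[of "submodule_chain R V Um (carrier V)" 0 "\<lambda>k. k" "Suc N", OF c0]) (simp add: N le_imp_less_Suc)
  then obtain n where n: "submodule_chain R V Um (carrier V) n" "\<And>k. submodule_chain R V Um (carrier V) k \<Longrightarrow> k \<le> n"
    by (elim exE conjE) simp
  have UmUa: "Um \<subseteq> Ua" unfolding Ua_def by (rule V.submodule_sum_incl1[OF Um sa])
  \<comment> \<open>A longest chain above \<open>Um\<close> is split at \<open>Ua\<close>. By
    \<open>kerb\<close> the upper part, with \<open>q\<close> steps, can be pushed forward by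
    \<open>B\<close> into \<open>Ub\<close>; the lower part, with \<open>p\<close> steps, is pulled
    back by \<open>A\<close> to lie above \<open>Q\<close>.\<close>
  obtain p q where pq: "n \<le> p + q" "submodule_chain R V Um (carrier V \<inter> Ua) p"
    "submodule_chain R V Ua (submodule_sum V Ua (carrier V)) q"
    using V.submodule_chain_split[OF n(1) Ua UmUa] by blast
  have "submodule_chain R V {v \<in> carrier V. ?b v \<in> Um} (submodule_sum V Ua (carrier V)) q"
    by (rule submodule_chain_weaken[OF pq(3) kerb])
  then have "submodule_chain R V Um (submodule_sum V Um (?b ` submodule_sum V Ua (carrier V))) q"
    by (rule submodule_chain_push[OF V hb Um])
  moreover have "submodule_sum V Um (?b ` submodule_sum V Ua (carrier V)) \<subseteq> Ub"
  proof -
    have "submodule_sum V Ua (carrier V) \<subseteq> carrier V"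
      by (rule V.submodule_sum_least[OF V.carrier_is_submodule V.submoduleE(1)[OF Ua]]) simp
    then show ?thesis unfolding Ub_def submodule_sum_def by blast
  qed
  ultimately have c1: "submodule_chain R V Um Ub q" by (rule submodule_chain_mono[OF _ Ub])
  have "submodule_chain R V Q {v \<in> carrier V. ?a v \<in> carrier V \<inter> Ua} p"
    unfolding Q_def by (rule submodule_chain_pull[OF V ha Um pq(2)]) (simp add: Ua_def)
  then have c2: "submodule_chain R V Q (carrier V) p"
    by (rule submodule_chain_mono[OF _ V.carrier_is_submodule]) auto
  \<comment> \<open>If \<open>Ub\<close> were smaller than \<open>Q\<close>, the two transported
    chains and the step between them would have \<open>p + q + 1\<close> steps, more than the
    longest chain.\<close>
  have QUb: "Q \<subseteq> Ub"
  proof (rule ccontr)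
    assume "\<not> Q \<subseteq> Ub"
    then have "Ub \<subset> Q" using UbQ by blast
    then have "submodule_chain R V Um Q (Suc q)" by (rule submodule_chain.chain_step[OF c1 Q])
    then have "submodule_chain R V Um (carrier V) (Suc q + p)" by (rule submodule_chain_trans[OF _ c2])
    then show False using n(2)[of "Suc q + p"] pq(1) by simp
  qed
  \<comment> \<open>The tuple of \<open>\<pi>\<close>, a cocycle because \<open>\<pi> A = 0\<close>;
    it represents the class of the identity of \<open>M\<close>.\<close>
  let ?p = "\<lambda>i. if i < m then \<pi> (e i) else \<zero>\<^bsub>M\<^esub>"
  have pV: "?p \<in> carrier V" by (rule hom_tuple(1)[OF pi])
  have "?a ?p = \<zero>\<^bsub>V\<^esub>"
    using hom_tuple(2)[OF pi Ac[OF e]] pi_A[OF e] unfolding pullback_def[of A] by auto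
  then have ap: "?a ?p = \<zero>\<^bsub>V\<^esub>" "?p \<in> Q" using pV V.submodule_zero[OF Um] by (simp_all add: Q_def del: power_module_simps)
  have "?p \<in> Ub" using QUb ap(2) by (rule subsetD)
  then obtain v0 bw where v0: "v0 \<in> Um" "bw \<in> ?b ` carrier V" "?p = v0 \<oplus>\<^bsub>V\<^esub> bw"
    unfolding Ub_def by (rule submodule_sumE)
  from v0(2) obtain v where "bw = ?b v" "v \<in> carrier V" by (rule imageE)
  with v0 have vv: "v0 \<in> Um" "v \<in> carrier V" "?p = v0 \<oplus>\<^bsub>V\<^esub> ?b v" by simp_all
  note v0V = Umc[OF vv(1)]
  have bv: "?b v \<in> carrier V" by (rule module_hom_closed[OF hb vv(2)])
  have av0: "?a v0 = \<zero>\<^bsub>V\<^esub>"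
    using module_hom_add[OF ha v0V bv] ba[OF vv(2)] ap(1) module_hom_closed[OF ha v0V]
    unfolding vv(3)[symmetric] by (simp del: power_module_simps)
  have v0Ae: "linear_extension R M v0 (A (e i)) = \<zero>\<^bsub>M\<^esub>" if i: "i < m" for i
  proof -
    have "?a v0 i = \<zero>\<^bsub>V\<^esub> i" by (simp only: av0)
    then show ?thesis using i by (simp add: pullback_def)
  qed
  have v0A: "linear_extension R M v0 (A a) = \<zero>\<^bsub>M\<^esub>" if "a \<in> carrier F" for a
  proof -
    have z: "(\<lambda>a. \<zero>\<^bsub>M\<^esub>) \<in> module_hom R F M" by (rule module_homI) simp_all
    show ?thesis
      by (rule hom_eqI[OF module_axioms module_hom_comp[OF A tuple_hom[OF v0V]] z _ that]) (simp add: v0Ae)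
  qed
  \<comment> \<open>The remainder \<open>v0\<close> is \<open>U\<close>-valued and kills
    \<open>A\<close>, so it factors through \<open>B\<close> too, and with it all of
    \<open>\<pi>\<close>.\<close>
  obtain C' where C': "C' \<in> module_hom R F ?G" "\<forall>a\<in>carrier F. linear_extension R M v0 a = ?u (C' (B a))"
    using exU[OF tuple_hom[OF v0V] UmU[OF vv(1)] v0A] by (rule bexE)
  show thesis
  proof (rule that)
    show "(\<lambda>a. ?u (C' a) \<oplus>\<^bsub>M\<^esub> linear_extension R M v a) \<in> module_hom R F M"
      by (rule module_hom_sum[OF module_axioms module_hom_comp[OF C'(1) hu] tuple_hom[OF vv(2)] F])
    fix a assume a: "a \<in> carrier F"
    have "\<pi> a = linear_extension R M ?p a" by (rule hom_tuple(2)[OF pi a, symmetric])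
    also have "\<dots> = linear_extension R M v0 a \<oplus>\<^bsub>M\<^esub> linear_extension R M (?b v) a"
      unfolding vv(3) using linear_extension_tuple_add[OF v0V bv a] by simp
    also have "linear_extension R M (?b v) a = linear_extension R M v (B a)" by (rule pullback_closed(2)[OF B vv(2) a])
    finally show "\<pi> a = ?u (C' (B a)) \<oplus>\<^bsub>M\<^esub> linear_extension R M v (B a)" using C'(2) a by simp
  qed
qed

end

section \<open>Finite projective dimension over a ring of depth two\<close>

text \<open>In a generating set of least cardinality, a relation with a unit as a coefficient would
  express one generator by the others.\<close>

lemma minimal_generators:
  assumes "noetherian_local_ring S \<nn>" "module S M" "noetherian_module S M" "submodule K S M"
  obtains t :: nat and g where "g \<in> {..<t} \<rightarrow> K"
    "linear_extension S M g ` carrier (free_module S {..<t}) = K"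
    "\<And>c i. c \<in> carrier (free_module S {..<t}) \<Longrightarrow> linear_extension S M g c = \<zero>\<^bsub>M\<^esub> \<Longrightarrow> c i \<in> \<nn>"
proof -
  interpret module S M by fact
  note KE = submoduleE[OF assms(4)]
  interpret n: ideal \<nn> S by (rule noetherian_local_ringD[OF assms(1)])
  define \<A> where "\<A> = {A. A \<subseteq> K \<and> finite A \<and> submodule_generated S M A = K}"
  have "\<exists>A. A \<in> \<A>"
    using assms(3,4) unfolding noetherian_module_def \<A>_def by blast
  then obtain A where A: "A \<in> \<A>" "\<And>A'. A' \<in> \<A> \<Longrightarrow> card A \<le> card A'"
    using ex_has_least_nat[of "\<lambda>A. A \<in> \<A>" _ card] by blast
  then have Af: "A \<subseteq> K" "finite A" "submodule_generated S M A = K" by (simp_all add: \<A>_def)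
  obtain t :: nat and g where g: "g ` {..<t} = A" "inj_on g {..<t}"
    using finite_enumeration[OF Af(2)] .
  have gK: "g \<in> {..<t} \<rightarrow> K" using g(1) Af(1) by blast
  then have gP: "g \<in> {..<t} \<rightarrow> carrier M" using KE(1) by blast
  have "c i \<in> \<nn>" if c: "c \<in> carrier (free_module S {..<t})" "linear_extension S M g c = \<zero>\<^bsub>M\<^esub>" for c i
  proof (rule ccontr)
    assume ni: "c i \<notin> \<nn>"
    have cc: "\<And>j. c j \<in> carrier S" using c(1) by (simp add: free_module_carrier_iff)
    have i: "i < t"
    proof (rule ccontr)
      assume "\<not> i < t"
      then show False using c(1) ni by (simp add: free_module_carrier_nat)
    qed
    obtain s where s: "s \<in> carrier S" "s \<otimes>\<^bsub>S\<^esub> c i = \<one>\<^bsub>S\<^esub>" by (rule local_ring_inverse[OF assms(1) cc ni])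
    let ?A = "A - {g i}"
    let ?N = "submodule_generated S M ?A"
    have AK: "?A \<subseteq> K" using Af(1) by blast
    then have Ac: "?A \<subseteq> carrier M" using KE(1) by blast
    have N: "submodule ?N S M" by (rule submodule_generated_submodule[OF Ac])
    have gi: "g i \<in> carrier M" "g i \<in> A" using gP g(1) i by auto
    let ?rest = "\<Oplus>\<^bsub>M\<^esub>j\<in>{..<t} - {i}. c j \<odot>\<^bsub>M\<^esub> g j"
    have rest: "?rest \<in> ?N"
    proof (rule submodule_finsum[OF N])
      fix j assume j: "j \<in> {..<t} - {i}"
      then have "g j \<in> ?A" using g i by (auto simp: inj_on_eq_iff)
      then have "g j \<in> ?N" using submodule_generated_incl by (rule subsetD[rotated])
      then show "c j \<odot>\<^bsub>M\<^esub> g j \<in> ?N" by (rule submoduleE(4)[OF N cc])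
    qed simp
    have restc: "?rest \<in> carrier M" using rest submoduleE(1)[OF N] by (rule subsetD[rotated])
    have "linear_extension S M g c = (\<Oplus>\<^bsub>M\<^esub>j\<in>insert i ({..<t} - {i}). c j \<odot>\<^bsub>M\<^esub> g j)"
      using finsum_linear_combination[OF c(1) gP] i by (simp add: insert_absorb)
    also have "\<dots> = c i \<odot>\<^bsub>M\<^esub> g i \<oplus>\<^bsub>M\<^esub> ?rest"
      by (rule M.finsum_insert) (use gP cc i in auto)
    finally have "c i \<odot>\<^bsub>M\<^esub> g i \<oplus>\<^bsub>M\<^esub> ?rest = \<zero>\<^bsub>M\<^esub>" using c(2) by simp
    then have "c i \<odot>\<^bsub>M\<^esub> g i = \<ominus>\<^bsub>M\<^esub> ?rest" using M.minus_equality[OF _ restc] cc gi(1) by simp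
    then have "c i \<odot>\<^bsub>M\<^esub> g i \<in> ?N" using submoduleE(3)[OF N rest] by simp
    then have "s \<odot>\<^bsub>M\<^esub> (c i \<odot>\<^bsub>M\<^esub> g i) \<in> ?N" by (rule submoduleE(4)[OF N s(1)])
    then have giN: "g i \<in> ?N" using s cc gi(1) smult_assoc1[OF s(1) cc gi(1), of i] by simp
    have "A \<subseteq> ?N" using giN submodule_generated_incl[of ?A S M] by blast
    then have "K \<subseteq> ?N" using submodule_generated_least[OF N] Af(3) by metis
    then have "?A \<in> \<A>" using submodule_generated_least[OF assms(4) AK] AK Af(2) unfolding \<A>_def by blast
    then have "card A \<le> card ?A" by (rule A(2))
    then show False using card_Diff1_less[OF Af(2) gi(2)] by simp
  qed
  moreover have "linear_extension S M g ` carrier (free_module S {..<t}) = K"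
    using submodule_generated_image[OF gP] g(1) Af(3) by simp
  ultimately show thesis using gK that by blast
qed

text \<open>Nakayama's lemma inside \<open>S\<close>, applied to the coordinates of \<open>c\<close>
  as generators and to \<open>J\<close>: each coordinate of \<open>E c\<close> is a combination of
  the \<open>c j\<close> with coefficients in \<open>\<nn>\<close>.\<close>

lemma vector_nakayama:
  fixes m :: nat
  assumes "noetherian_local_ring S \<nn>" "E \<in> module_hom S (free_module S {..<m}) (free_module S {..<m})"
    and En: "\<And>v i. v \<in> carrier (free_module S {..<m}) \<Longrightarrow> E v i \<in> \<nn>"
    and "ideal J S" "c \<in> carrier (free_module S {..<m})" "\<And>i. c i \<ominus>\<^bsub>S\<^esub> E c i \<in> J"
  shows "c i \<in> J"
proof (cases "i < m")
  case False
  then show ?thesis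
    using assms(4,5) by (simp add: free_module_carrier_nat additive_subgroup.zero_closed ideal.axioms(1))
next
  case True
  note L = noetherian_local_ringD[OF assms(1)]
  interpret S0: cring S by (rule L)
  interpret J: ideal J S by fact
  interpret SM: module S "self_module S" by (rule self_module_module[OF L(1)])
  have J: "submodule J S (self_module S)" using assms(4) submodule_self_module_iff[OF L(1)] by blast
  have cc: "\<And>j. c j \<in> carrier S" using assms(5) by (simp add: free_module_carrier_iff)
  have Ec: "E c j \<in> carrier S" for j
    using module_hom_closed[OF assms(2,5)] by (simp add: free_module_carrier_iff)
  have "\<exists>t\<in>carrier S - \<nn>. \<forall>i<m. t \<odot>\<^bsub>self_module S\<^esub> c i \<in> J"
  proof (rule SM.nakayama_at_prime[OF L(5) J])
    show "c i \<in> carrier (self_module S)" for i using cc by simp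
    fix i assume "i < m"
    let ?W = "nakayama_filtration (self_module S) J \<nn> c m"
    have W: "submodule ?W S (self_module S)"
      by (rule SM.nakayama_filtration_submodule[OF J L(4)]) (simp add: cc)
    have "E c i = linear_extension S (self_module S) (\<lambda>j. E (basis_vector S j) i) c"
      by (rule hom_eq_linear_extension[OF SM.module_axioms module_hom_comp[OF assms(2) free_module_eval_hom] assms(5)])
    also have "\<dots> \<in> ?W"
    proof (rule SM.linear_extension_mem[OF W assms(5)])
      fix j assume j: "j \<in> {..<m}"
      have b: "basis_vector S j \<in> carrier (free_module S {..<m})" by (rule basis_vector_closed[OF L(1) j])
      have "E (basis_vector S j) i \<odot>\<^bsub>self_module S\<^esub> c j \<in> ?W"
        by (rule SM.nakayama_filtration_term[OF J L(4) _ _ En[OF b]]) (use cc j in simp_all)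
      moreover have "E (basis_vector S j) i \<in> carrier S"
        using module_hom_closed[OF assms(2) b] by (simp add: free_module_carrier_iff)
      ultimately show "c j \<odot>\<^bsub>self_module S\<^esub> E (basis_vector S j) i \<in> ?W" using cc[of j] by (simp add: S0.m_comm)
    qed
    finally have 1: "E c i \<in> ?W" .
    have "J \<subseteq> ?W" using SM.nakayama_filtration_incl[OF J L(4) _ le0, of m c] cc by simp
    then have 2: "c i \<ominus>\<^bsub>S\<^esub> E c i \<in> ?W" using assms(6) by blast
    have "c i \<in> ?W"
      using SM.submoduleE(5)[OF W 1 2] SM.eq_plus_diff[of "c i" "E c i"] cc Ec by (simp add: self_module_minus)
    then show "\<exists>h\<in>carrier S - \<nn>. h \<odot>\<^bsub>self_module S\<^esub> c i \<in> ?W"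
      using prime_complement(2)[OF L(5)] cc by (intro bexI[of _ "\<one>\<^bsub>S\<^esub>"]) simp_all
  qed
  then obtain t where t: "t \<in> carrier S - \<nn>" "\<forall>i<m. t \<odot>\<^bsub>self_module S\<^esub> c i \<in> J" by (rule bexE)
  have tc: "t \<in> carrier S" "t \<notin> \<nn>" using t(1) by auto
  obtain s where s: "s \<in> carrier S" "s \<otimes>\<^bsub>S\<^esub> t = \<one>\<^bsub>S\<^esub>" by (rule local_ring_inverse[OF assms(1) tc])
  have "t \<otimes>\<^bsub>S\<^esub> c i \<in> J" using t(2) True by simp
  then have "s \<otimes>\<^bsub>S\<^esub> (t \<otimes>\<^bsub>S\<^esub> c i) \<in> J" by (rule J.I_l_closed[OF _ s(1)])
  then show ?thesis using s tc(1) cc[of i] S0.m_assoc[OF s(1) tc(1) cc[of i]] by simp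
qed

section \<open>Syzygies up to free modules\<close>

lemma projective_lifting:
  fixes P :: "('a, 'p, 'y) module_scheme"
  assumes "projective_module S P" "module S N" "module S L"
    and h: "h \<in> module_hom S P L" and p: "p \<in> module_hom S N L" "p ` carrier N = carrier L"
  obtains g where "g \<in> module_hom S P N" "\<And>c. c \<in> carrier P \<Longrightarrow> p (g c) = h c"
proof -
  obtain B :: "'p set" and \<iota> \<pi> where r: "\<iota> \<in> module_hom S P (free_module S B)" "\<pi> \<in> module_hom S (free_module S B) P"
    "\<forall>c\<in>carrier P. \<pi> (\<iota> c) = c"
    using assms(1) unfolding projective_module_def by blast
  have h\<pi>: "(\<lambda>c. h (\<pi> c)) \<in> module_hom S (free_module S B) L" by (rule module_hom_comp[OF r(2) h])
  have img: "h (\<pi> v) \<in> p ` carrier N" if "v \<in> carrier (free_module S B)" for v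
    unfolding p(2) by (rule module_hom_closed[OF h\<pi> that])
  obtain g where g: "g \<in> module_hom S (free_module S B) N" "\<And>v. v \<in> carrier (free_module S B) \<Longrightarrow> p (g v) = h (\<pi> v)"
    using free_lifting[OF assms(2,3) h\<pi> p(1) img] by blast
  show thesis
  proof (rule that)
    show "(\<lambda>c. g (\<iota> c)) \<in> module_hom S P N" by (rule module_hom_comp[OF r(1) g(1)])
    show "p (g (\<iota> c)) = h c" if "c \<in> carrier P" for c
      using g(2)[OF module_hom_closed[OF r(1) that]] r(3) that by simp
  qed
qed

text \<open>\<open>K\<close> is a retract of \<open>Z\<close> up to maps through free modules; a substitute for Schanuel's lemma
  that avoids forming direct sums.\<close>

definition stable_retract ::
  "('a, 'x) ring_scheme \<Rightarrow> ('a, 'k, 'y) module_scheme \<Rightarrow> ('a, 'm, 'z) module_scheme \<Rightarrow> bool" where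
  "stable_retract S K Z \<longleftrightarrow> (\<exists>u\<in>module_hom S K Z. \<exists>v\<in>module_hom S Z K. \<exists>k::nat.
     \<exists>p\<in>module_hom S K (free_module S {..<k}). \<exists>q\<in>module_hom S (free_module S {..<k}) K.
       \<forall>c\<in>carrier K. c = v (u c) \<oplus>\<^bsub>K\<^esub> q (p c))"

lemma stable_retract_refl:
  assumes "module S M"
  shows "stable_retract S M M"
proof -
  interpret module S M by fact
  interpret F: module S "free_module S {..<0::nat}" by (rule free_module_module[OF R.is_cring])
  have p: "(\<lambda>c. \<lambda>i. \<zero>\<^bsub>S\<^esub>) \<in> module_hom S M (free_module S {..<0::nat})"
    by (rule module_homI) (simp_all add: free_module_carrier_iff)
  have q: "(\<lambda>c. \<zero>\<^bsub>M\<^esub>) \<in> module_hom S (free_module S {..<0::nat}) M"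
    by (rule module_homI) simp_all
  show ?thesis
    unfolding stable_retract_def
    by (intro bexI[OF _ module_hom_id] exI[of _ "0::nat"] bexI[OF _ p] bexI[OF _ q]) simp
qed

lemma module_hom_restrict:
  assumes "h \<in> module_hom R M N" "K \<subseteq> carrier M" "\<And>x. x \<in> K \<Longrightarrow> h x \<in> L"
  shows "h \<in> module_hom R (M\<lparr>carrier := K\<rparr>) (N\<lparr>carrier := L\<rparr>)"
  by (rule module_homI)
    (use assms in \<open>auto simp: module_hom_add[OF assms(1)] module_hom_smult[OF assms(1)] subset_iff\<close>)

text \<open>The maps of the retract lift through the two covers. On the whole of the free cover the
  identity differs from the lifted maps by a map \<open>h\<close> into the kernel; on the kernel the
  part through the old free module vanishes, so the free cover takes its place.\<close>

lemma stable_retract_syzygy: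
  fixes t :: nat
  assumes "module S K" "module S Z" "stable_retract S K Z"
    and \<pi>: "\<pi> \<in> module_hom S (free_module S {..<t}) K" "\<pi> ` carrier (free_module S {..<t}) = carrier K"
    and P: "projective_module S P" and \<epsilon>: "\<epsilon> \<in> module_hom S P Z" "\<epsilon> ` carrier P = carrier Z"
  shows "stable_retract S
      (free_module S {..<t}\<lparr>carrier := {c \<in> carrier (free_module S {..<t}). \<pi> c = \<zero>\<^bsub>K\<^esub>}\<rparr>)
      (P\<lparr>carrier := {c \<in> carrier P. \<epsilon> c = \<zero>\<^bsub>Z\<^esub>}\<rparr>)"
proof -
  interpret K: module S K by fact
  interpret Z: module S Z by fact
  have mP: "module S P" using P by (simp add: projective_module_def)
  interpret P: module S P by (rule mP)
  let ?G = "free_module S {..<t}"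
  have mG: "module S ?G" by (rule free_module_module[OF K.R.is_cring])
  interpret G: module S ?G by (rule mG)
  obtain u v k p q where r: "u \<in> module_hom S K Z" "v \<in> module_hom S Z K"
    "p \<in> module_hom S K (free_module S {..<k::nat})" "q \<in> module_hom S (free_module S {..<k}) K"
    "\<forall>c\<in>carrier K. c = v (u c) \<oplus>\<^bsub>K\<^esub> q (p c)"
    using assms(3) unfolding stable_retract_def by blast
  have mk: "module S (free_module S {..<k})" by (rule free_module_module[OF K.R.is_cring])
  obtain u' where u': "u' \<in> module_hom S ?G P" "\<And>c. c \<in> carrier ?G \<Longrightarrow> \<epsilon> (u' c) = u (\<pi> c)"
    using free_lifting[OF mP assms(2) module_hom_comp[OF \<pi>(1) r(1)] \<epsilon>(1)]
      module_hom_closed[OF module_hom_comp[OF \<pi>(1) r(1)]] \<epsilon>(2) by metis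
  obtain v' where v': "v' \<in> module_hom S P ?G" "\<And>c. c \<in> carrier P \<Longrightarrow> \<pi> (v' c) = v (\<epsilon> c)"
    using projective_lifting[OF P mG assms(1) module_hom_comp[OF \<epsilon>(1) r(2)] \<pi>] by blast
  obtain q' where q': "q' \<in> module_hom S (free_module S {..<k}) ?G"
    "\<And>c. c \<in> carrier (free_module S {..<k}) \<Longrightarrow> \<pi> (q' c) = q c"
    using free_lifting[OF mG assms(1) r(4) \<pi>(1)] module_hom_closed[OF r(4)] \<pi>(2) by metis
  let ?K = "{c \<in> carrier ?G. \<pi> c = \<zero>\<^bsub>K\<^esub>}" and ?Z = "{c \<in> carrier P. \<epsilon> c = \<zero>\<^bsub>Z\<^esub>}"
  have vu: "(\<lambda>c. v' (u' c)) \<in> module_hom S ?G ?G" by (rule module_hom_comp[OF u'(1) v'(1)])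
  have qp: "(\<lambda>c. q' (p (\<pi> c))) \<in> module_hom S ?G ?G"
    by (rule module_hom_comp[OF module_hom_comp[OF \<pi>(1) r(3)] q'(1)])
  \<comment> \<open>The lifted decomposition agrees with the identity after \<open>\<pi>\<close>,
    hence the difference has values in the kernel.\<close>
  define h where "h c = c \<ominus>\<^bsub>?G\<^esub> (v' (u' c) \<oplus>\<^bsub>?G\<^esub> q' (p (\<pi> c)))" for c
  have hh: "h \<in> module_hom S ?G ?G"
    unfolding h_def by (rule module_hom_diff[OF mG mG module_hom_id module_hom_sum[OF mG vu qp mG]])
  have hK: "h c \<in> ?K" if c: "c \<in> carrier ?G" for c
  proof -
    have c1: "v' (u' c) \<in> carrier ?G" "q' (p (\<pi> c)) \<in> carrier ?G"
      using module_hom_closed[OF vu c] module_hom_closed[OF qp c] by auto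
    have \<pi>c: "\<pi> c \<in> carrier K" by (rule module_hom_closed[OF \<pi>(1) c])
    have "\<pi> (v' (u' c) \<oplus>\<^bsub>?G\<^esub> q' (p (\<pi> c))) = v (u (\<pi> c)) \<oplus>\<^bsub>K\<^esub> q (p (\<pi> c))"
      using module_hom_add[OF \<pi>(1) c1] v'(2)[OF module_hom_closed[OF u'(1) c]] u'(2)[OF c]
        q'(2)[OF module_hom_closed[OF r(3) \<pi>c]] by simp
    also have "\<dots> = \<pi> c" using r(5) \<pi>c by simp
    finally have "\<pi> (h c) = \<zero>\<^bsub>K\<^esub>"
      unfolding h_def using module_hom_minus[OF mG assms(1) \<pi>(1) c G.M.a_closed[OF c1]] \<pi>c
      by (simp add: K.M.minus_eq K.M.r_neg del: free_module_simps)
    then show ?thesis using module_hom_closed[OF hh c] by simp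
  qed
  show ?thesis
    unfolding stable_retract_def
  proof (intro bexI exI)
    show "u' \<in> module_hom S (?G\<lparr>carrier := ?K\<rparr>) (P\<lparr>carrier := ?Z\<rparr>)"
    proof (rule module_hom_restrict[OF u'(1)])
      fix c assume "c \<in> ?K"
      then show "u' c \<in> ?Z"
        using u'(2)[of c] module_hom_closed[OF u'(1), of c] module_hom_zero[OF assms(1,2) r(1)] by simp
    qed blast
    show "v' \<in> module_hom S (P\<lparr>carrier := ?Z\<rparr>) (?G\<lparr>carrier := ?K\<rparr>)"
    proof (rule module_hom_restrict[OF v'(1)])
      fix c assume "c \<in> ?Z"
      then show "v' c \<in> ?K"
        using v'(2)[of c] module_hom_closed[OF v'(1), of c] module_hom_zero[OF assms(2,1) r(2)] by simp
    qed blast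
    show "(\<lambda>c. c) \<in> module_hom S (?G\<lparr>carrier := ?K\<rparr>) ?G"
      by (rule module_hom_restrict_dom[OF module_hom_id]) blast
    show "h \<in> module_hom S ?G (?G\<lparr>carrier := ?K\<rparr>)" by (rule module_hom_restrict_cod[OF hh hK])
    show "\<forall>c\<in>carrier (?G\<lparr>carrier := ?K\<rparr>). c = v' (u' c) \<oplus>\<^bsub>?G\<lparr>carrier := ?K\<rparr>\<^esub> h c"
    proof
      fix c assume "c \<in> carrier (?G\<lparr>carrier := ?K\<rparr>)"
      then have c: "c \<in> carrier ?G" "\<pi> c = \<zero>\<^bsub>K\<^esub>" by simp_all
      have "q' (p (\<pi> c)) = \<zero>\<^bsub>?G\<^esub>"
        using module_hom_zero[OF assms(1) mk r(3)] module_hom_zero[OF mk mG q'(1)] c(2) by simp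
      then have "h c = c \<ominus>\<^bsub>?G\<^esub> v' (u' c)"
        unfolding h_def using module_hom_closed[OF vu c(1)] by (simp del: free_module_simps)
      then have "c = v' (u' c) \<oplus>\<^bsub>?G\<^esub> h c" using G.eq_plus_diff[OF c(1) module_hom_closed[OF vu c(1)]] by simp
      then show "c = v' (u' c) \<oplus>\<^bsub>?G\<lparr>carrier := ?K\<rparr>\<^esub> h c" by simp
    qed
  qed
qed

text \<open>If \<open>k < m\<close>, truncation to \<open>k\<close> coordinates followed by
  \<open>A\<close> is an endomorphism of \<open>S^m\<close> with right inverse \<open>B\<close> up
  to \<open>f\<close>, so its kernel is killed by a power of \<open>f\<close>. Truncation kills the
  basis vector with index \<open>k\<close>, which no power of a regular \<open>f\<close> can
  kill.\<close>

lemma square_matrix: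
  fixes k m :: nat
  assumes "cring S" "noetherian_ring S" "\<one>\<^bsub>S\<^esub> \<noteq> \<zero>\<^bsub>S\<^esub>" "f \<in> nonzerodivisors S"
    and A: "A \<in> module_hom S (free_module S {..<k}) (free_module S {..<m})"
    and B: "B \<in> module_hom S (free_module S {..<m}) (free_module S {..<k})"
    and AB: "\<And>c. c \<in> carrier (free_module S {..<m}) \<Longrightarrow> A (B c) = f \<odot>\<^bsub>free_module S {..<m}\<^esub> c"
  shows "m \<le> k"
proof (rule ccontr)
  assume "\<not> m \<le> k"
  then have km: "k < m" by simp
  interpret cring S by fact
  let ?F = "free_module S {..<m}" and ?G = "free_module S {..<k}"
  have mF: "module S ?F" and mG: "module S ?G" by (rule free_module_module[OF assms(1)])+
  have fc: "f \<in> carrier S" using assms(4) by (simp add: nonzerodivisors_def)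
  define \<tau> where "\<tau> c = (\<lambda>i. if i < k then c i else \<zero>\<^bsub>S\<^esub>)" for c :: "nat \<Rightarrow> 'a"
  have \<tau>: "\<tau> \<in> module_hom S ?F ?G"
    by (rule module_homI) (auto simp: \<tau>_def free_module_carrier_nat)
  have \<tau>id: "\<tau> c = c" if "c \<in> carrier ?G" for c
    using that by (auto simp: \<tau>_def free_module_carrier_nat)
  have B': "B \<in> module_hom S ?F ?F"
  proof (rule module_homI)
    fix c assume c: "c \<in> carrier ?F"
    show "B c \<in> carrier ?F" using module_hom_closed[OF B c] km by (simp add: free_module_carrier_nat)
  qed (use module_hom_add[OF B] module_hom_smult[OF B] in simp_all)
  have "A (\<tau> (B c)) = f \<odot>\<^bsub>?F\<^esub> c" if c: "c \<in> carrier ?F" for c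
    using AB[OF c] \<tau>id[OF module_hom_closed[OF B c]] by simp
  then obtain n :: nat where n: "\<And>v. v \<in> carrier ?F \<Longrightarrow> A (\<tau> v) = \<zero>\<^bsub>?F\<^esub> \<Longrightarrow> (f [^]\<^bsub>S\<^esub> n) \<odot>\<^bsub>?F\<^esub> v = \<zero>\<^bsub>?F\<^esub>"
    using kernel_killed_by_power[OF mF noetherian_free_module[OF assms(1,2)] module_hom_comp[OF \<tau> A] B' fc] by blast
  have e: "basis_vector S k \<in> carrier ?F" by (rule basis_vector_closed[OF assms(1)]) (use km in simp)
  have "\<tau> (basis_vector S k) = \<zero>\<^bsub>?G\<^esub>" by (auto simp: \<tau>_def basis_vector_def)
  then have "A (\<tau> (basis_vector S k)) = \<zero>\<^bsub>?F\<^esub>" using module_hom_zero[OF mG mF A] by simp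
  then have "((f [^]\<^bsub>S\<^esub> n) \<odot>\<^bsub>?F\<^esub> basis_vector S k) k = \<zero>\<^bsub>S\<^esub>" using n[OF e] by simp
  then have "f [^]\<^bsub>S\<^esub> n \<otimes>\<^bsub>S\<^esub> \<one>\<^bsub>S\<^esub> = \<zero>\<^bsub>S\<^esub>" by (simp add: basis_vector_def)
  then have "\<one>\<^bsub>S\<^esub> = \<zero>\<^bsub>S\<^esub>" by (rule nonzerodivisor_power[OF assms(1,4) one_closed])
  then show False using assms(3) by simp
qed

section \<open>Free syzygies over a local ring of depth two\<close>

text \<open>The element \<open>x\<close> is regular modulo \<open>f\<close>, and
  \<open>\<sigma>\<close> represents a nonzero socle element of \<open>S / (f, x)\<close>;
  multiplication by \<open>\<sigma>\<close> plays the part of passing to the residue field.\<close>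

locale depth_two_local_ring =
  fixes S :: "('a, 'x) ring_scheme" (structure) and \<nn> :: "'a set" and f x \<sigma> :: 'a
  assumes local: "noetherian_local_ring S \<nn>"
    and f: "f \<in> nonzerodivisors S" and x: "x \<in> carrier S" and \<sigma>: "\<sigma> \<in> carrier S"
    and regular: "\<And>s t. s \<in> carrier S \<Longrightarrow> t \<in> carrier S \<Longrightarrow> x \<otimes> s = f \<otimes> t \<Longrightarrow> \<exists>c\<in>carrier S. s = f \<otimes> c"
    and socle_notin: "\<And>a b. a \<in> carrier S \<Longrightarrow> b \<in> carrier S \<Longrightarrow> \<sigma> \<noteq> f \<otimes> a \<oplus> x \<otimes> b"
    and socle: "\<And>n. n \<in> \<nn> \<Longrightarrow> \<exists>a\<in>carrier S. \<exists>b\<in>carrier S. \<sigma> \<otimes> n = f \<otimes> a \<oplus> x \<otimes> b"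

sublocale depth_two_local_ring \<subseteq> cring S
  by (rule noetherian_local_ringD[OF local])

context depth_two_local_ring
begin

lemma fc: "f \<in> carrier S" using f by (simp add: nonzerodivisors_def)

lemma f_cancel:
  assumes "v \<in> carrier (free_module S B)" "f \<odot>\<^bsub>free_module S B\<^esub> v = \<zero>\<^bsub>free_module S B\<^esub>"
  shows "v = \<zero>\<^bsub>free_module S B\<^esub>"
proof -
  have "v i = \<zero>" for i
  proof -
    have "f \<otimes> v i = \<zero>" using fun_cong[OF assms(2), of i] by simp
    moreover have "v i \<in> carrier S" using assms(1) by (simp add: free_module_carrier_iff)
    ultimately show ?thesis using f unfolding nonzerodivisors_def by blast
  qed
  then show ?thesis by auto
qed

text \<open>The condition that \<open>x\<close> is regular on \<open>K / f K\<close>.\<close>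

definition deep :: "('a, 'k, 'y) module_scheme \<Rightarrow> 'k set \<Rightarrow> bool" where
  "deep M K \<longleftrightarrow> (\<forall>c\<in>K. \<forall>k\<in>K. x \<odot>\<^bsub>M\<^esub> c = f \<odot>\<^bsub>M\<^esub> k \<longrightarrow> (\<exists>c'\<in>K. c = f \<odot>\<^bsub>M\<^esub> c'))"

lemma vector_regular:
  fixes t :: nat
  assumes "c \<in> carrier (free_module S {..<t})" "k \<in> carrier (free_module S {..<t})"
    and "x \<odot>\<^bsub>free_module S {..<t}\<^esub> c = f \<odot>\<^bsub>free_module S {..<t}\<^esub> k"
  obtains c' where "c' \<in> carrier (free_module S {..<t})" "c = f \<odot>\<^bsub>free_module S {..<t}\<^esub> c'"
proof -
  have cc: "c i \<in> carrier S" "k i \<in> carrier S" for i using assms(1,2) by (simp_all add: free_module_carrier_iff)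
  have "\<forall>i. \<exists>s. s \<in> carrier S \<and> c i = f \<otimes> s"
  proof
    fix i
    have "x \<otimes> c i = f \<otimes> k i" using fun_cong[OF assms(3), of i] by simp
    then show "\<exists>s. s \<in> carrier S \<and> c i = f \<otimes> s" using regular[OF cc] by blast
  qed
  then obtain s where s: "\<And>i. s i \<in> carrier S" "\<And>i. c i = f \<otimes> s i" by metis
  let ?c = "\<lambda>i. if i < t then s i else \<zero>"
  have "?c \<in> carrier (free_module S {..<t})" using s(1) by (simp add: free_module_carrier_nat)
  moreover have "c = f \<odot>\<^bsub>free_module S {..<t}\<^esub> ?c"
  proof
    fix i show "c i = (f \<odot>\<^bsub>free_module S {..<t}\<^esub> ?c) i"
    proof (cases "i < t")
      case True
      then show ?thesis using s(2)[of i] by simp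
    next
      case False
      then have "c i = \<zero>" using assms(1) by (simp add: free_module_carrier_nat)
      then show ?thesis using False fc by simp
    qed
  qed
  ultimately show thesis by (rule that)
qed

text \<open>From \<open>x c = f k\<close> follow \<open>c = f c'\<close> and \<open>x c' = k\<close>
  in the free module, so \<open>\<pi> c'\<close> is killed by both \<open>f\<close> and
  \<open>x\<close>. The premise on common annihilation is met when \<open>x\<close> is regular on
  the target, as for the torsion-free module, or when \<open>f\<close> is, as for free
  modules.\<close>

lemma deep_kernel:
  fixes t :: nat
  assumes "module S M" "\<pi> \<in> module_hom S (free_module S {..<t}) M"
    and reg: "\<And>z. z \<in> carrier M \<Longrightarrow> f \<odot>\<^bsub>M\<^esub> z = \<zero>\<^bsub>M\<^esub> \<Longrightarrow> x \<odot>\<^bsub>M\<^esub> z = \<zero>\<^bsub>M\<^esub> \<Longrightarrow> z = \<zero>\<^bsub>M\<^esub>"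
  shows "deep (free_module S {..<t}) {c \<in> carrier (free_module S {..<t}). \<pi> c = \<zero>\<^bsub>M\<^esub>}" (is "deep _ ?K")
  unfolding deep_def
proof (intro ballI impI)
  let ?G = "free_module S {..<t}"
  interpret M: module S M by fact
  interpret G: module S ?G by (rule free_module_module) (rule is_cring)
  fix c k assume c: "c \<in> ?K" and k: "k \<in> ?K" and eq: "x \<odot>\<^bsub>?G\<^esub> c = f \<odot>\<^bsub>?G\<^esub> k"
  have cc: "c \<in> carrier ?G" "\<pi> c = \<zero>\<^bsub>M\<^esub>" "k \<in> carrier ?G" "\<pi> k = \<zero>\<^bsub>M\<^esub>" using c k by auto
  obtain c' where c': "c' \<in> carrier ?G" "c = f \<odot>\<^bsub>?G\<^esub> c'" by (rule vector_regular[OF cc(1,3) eq])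
  have 1: "f \<odot>\<^bsub>M\<^esub> \<pi> c' = \<zero>\<^bsub>M\<^esub>" using module_hom_smult[OF assms(2) fc c'(1)] c'(2) cc(2) by simp
  have "f \<odot>\<^bsub>?G\<^esub> (x \<odot>\<^bsub>?G\<^esub> c') = x \<odot>\<^bsub>?G\<^esub> (f \<odot>\<^bsub>?G\<^esub> c')"
    using G.smult_assoc1[OF fc x c'(1)] G.smult_assoc1[OF x fc c'(1)] m_comm[OF fc x] by metis
  then have "f \<odot>\<^bsub>?G\<^esub> (x \<odot>\<^bsub>?G\<^esub> c') = f \<odot>\<^bsub>?G\<^esub> k" using eq c'(2) by metis
  moreover have xc': "x \<odot>\<^bsub>?G\<^esub> c' \<in> carrier ?G" by (rule G.smult_closed[OF x c'(1)])
  ultimately have "f \<odot>\<^bsub>?G\<^esub> (x \<odot>\<^bsub>?G\<^esub> c' \<ominus>\<^bsub>?G\<^esub> k) = \<zero>\<^bsub>?G\<^esub>"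
    using module_hom_minus[OF G.module_axioms G.module_axioms G.scaling_hom[OF fc] xc' cc(3)] G.smult_closed[OF fc cc(3)]
    by (simp add: G.M.minus_eq G.M.r_neg del: free_module_simps)
  then have "x \<odot>\<^bsub>?G\<^esub> c' \<ominus>\<^bsub>?G\<^esub> k = \<zero>\<^bsub>?G\<^esub>" by (rule f_cancel[OF G.M.minus_closed[OF xc' cc(3)]])
  then have "x \<odot>\<^bsub>?G\<^esub> c' = k" using G.diff_eq_zero_iff[OF xc' cc(3)] by simp
  then have "x \<odot>\<^bsub>M\<^esub> \<pi> c' = \<zero>\<^bsub>M\<^esub>" using module_hom_smult[OF assms(2) x c'(1)] cc(4) by simp
  then have "\<pi> c' = \<zero>\<^bsub>M\<^esub>" by (rule reg[OF module_hom_closed[OF assms(2) c'(1)] 1])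
  then show "\<exists>c'\<in>?K. c = f \<odot>\<^bsub>?G\<^esub> c'" using c' by blast
qed

text \<open>Minimality of \<open>\<pi>\<close> makes \<open>\<sigma>\<close> annihilate the kernel modulo \<open>(f, x)\<close>, while depth two of its image
  keeps the kernel injective modulo \<open>(f, x)\<close>.\<close>

lemma minimal_free_kernel_zero:
  fixes s t k :: nat
  assumes K: "submodule K S (free_module S {..<s})" "deep (free_module S {..<s}) K"
    and \<pi>: "\<pi> \<in> module_hom S (free_module S {..<t}) (free_module S {..<s})" "\<pi> ` carrier (free_module S {..<t}) = K"
    and min: "\<And>c i. c \<in> carrier (free_module S {..<t}) \<Longrightarrow> \<pi> c = \<zero>\<^bsub>free_module S {..<s}\<^esub> \<Longrightarrow> c i \<in> \<nn>"
    and b: "\<beta> \<in> module_hom S (free_module S {..<k}) (free_module S {..<t})"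
      "\<beta> ` carrier (free_module S {..<k}) = {c \<in> carrier (free_module S {..<t}). \<pi> c = \<zero>\<^bsub>free_module S {..<s}\<^esub>}"
      "\<And>c. c \<in> carrier (free_module S {..<k}) \<Longrightarrow> \<beta> c = \<zero>\<^bsub>free_module S {..<t}\<^esub> \<Longrightarrow> c = \<zero>\<^bsub>free_module S {..<k}\<^esub>"
    and c: "c \<in> carrier (free_module S {..<t})" "\<pi> c = \<zero>\<^bsub>free_module S {..<s}\<^esub>"
  shows "c = \<zero>\<^bsub>free_module S {..<t}\<^esub>"
proof -
  let ?F = "free_module S {..<s}" and ?G = "free_module S {..<t}" and ?H = "free_module S {..<k}"
  interpret F: module S ?F by (rule free_module_module) (rule is_cring)
  interpret G: module S ?G by (rule free_module_module) (rule is_cring)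
  interpret H: module S ?H by (rule free_module_module) (rule is_cring)
  interpret n: ideal \<nn> S by (rule noetherian_local_ringD[OF local])
  note \<pi>c = module_hom_closed[OF \<pi>(1)]
  note \<pi>K = imageI[of _ "carrier ?G" \<pi>, unfolded \<pi>(2)]
  have "k = 0"
  proof (rule ccontr)
    assume "k \<noteq> 0"
    then have e: "basis_vector S 0 \<in> carrier ?H" by (simp add: basis_vector_closed[OF is_cring])
    \<comment> \<open>A column of \<open>\<beta>\<close> is a relation of the minimal generators, so
      its entries are in \<open>\<nn>\<close> and \<open>\<sigma>\<close> takes them into the ideal
      \<open>(f, x)\<close>.\<close>
    define b0 where "b0 = \<beta> (basis_vector S 0)"
    have "b0 \<in> {c \<in> carrier ?G. \<pi> c = \<zero>\<^bsub>?F\<^esub>}" unfolding b(2)[symmetric] b0_def using e by (rule imageI)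
    then have b0: "b0 \<in> carrier ?G" "\<pi> b0 = \<zero>\<^bsub>?F\<^esub>" by simp_all
    have "\<forall>i. \<exists>g h. g \<in> carrier S \<and> h \<in> carrier S \<and> \<sigma> \<otimes> b0 i = f \<otimes> g \<oplus> x \<otimes> h"
      using socle[OF min[OF b0]] by blast
    then obtain g h where gh: "\<And>i. g i \<in> carrier S" "\<And>i. h i \<in> carrier S" "\<And>i. \<sigma> \<otimes> b0 i = f \<otimes> g i \<oplus> x \<otimes> h i"
      by metis
    define g' h' where "g' i = (if i < t then g i else \<zero>)" and "h' i = (if i < t then h i else \<zero>)" for i
    have g': "g' \<in> carrier ?G" and h': "h' \<in> carrier ?G" using gh by (simp_all add: g'_def h'_def free_module_carrier_nat)
    have eq: "\<sigma> \<odot>\<^bsub>?G\<^esub> b0 = f \<odot>\<^bsub>?G\<^esub> g' \<oplus>\<^bsub>?G\<^esub> x \<odot>\<^bsub>?G\<^esub> h'"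
    proof
      fix i show "(\<sigma> \<odot>\<^bsub>?G\<^esub> b0) i = (f \<odot>\<^bsub>?G\<^esub> g' \<oplus>\<^bsub>?G\<^esub> x \<odot>\<^bsub>?G\<^esub> h') i"
      proof (cases "i < t")
        case True
        then show ?thesis using gh(3)[of i] by (simp add: g'_def h'_def)
      next
        case False
        then have "b0 i = \<zero>" using b0(1) by (simp add: free_module_carrier_nat)
        then show ?thesis using False fc x \<sigma> by (simp add: g'_def h'_def)
      qed
    qed
    have fg: "f \<odot>\<^bsub>?G\<^esub> g' \<in> carrier ?G" and xh: "x \<odot>\<^bsub>?G\<^esub> h' \<in> carrier ?G"
      using G.smult_closed fc x g' h' by blast+
    have "\<pi> (\<sigma> \<odot>\<^bsub>?G\<^esub> b0) = \<zero>\<^bsub>?F\<^esub>" using module_hom_smult[OF \<pi>(1) \<sigma> b0(1)] b0(2) F.smult_r_null[OF \<sigma>] by simp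
    then have sum0: "x \<odot>\<^bsub>?F\<^esub> \<pi> h' \<oplus>\<^bsub>?F\<^esub> f \<odot>\<^bsub>?F\<^esub> \<pi> g' = \<zero>\<^bsub>?F\<^esub>"
      unfolding eq module_hom_add[OF \<pi>(1) fg xh] module_hom_smult[OF \<pi>(1) fc g'] module_hom_smult[OF \<pi>(1) x h']
      using F.M.a_comm[OF F.smult_closed[OF fc \<pi>c[OF g']] F.smult_closed[OF x \<pi>c[OF h']]] by simp
    then have "x \<odot>\<^bsub>?F\<^esub> \<pi> h' = \<ominus>\<^bsub>?F\<^esub> (f \<odot>\<^bsub>?F\<^esub> \<pi> g')"
      using F.M.minus_equality[OF sum0 F.smult_closed[OF fc \<pi>c[OF g']] F.smult_closed[OF x \<pi>c[OF h']]] by metis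
    also have "\<dots> = f \<odot>\<^bsub>?F\<^esub> (\<ominus>\<^bsub>?F\<^esub> \<pi> g')" by (rule F.smult_r_minus[OF fc \<pi>c[OF g'], symmetric])
    finally have "x \<odot>\<^bsub>?F\<^esub> \<pi> h' = f \<odot>\<^bsub>?F\<^esub> (\<ominus>\<^bsub>?F\<^esub> \<pi> g')" .
    then have "\<exists>c'\<in>K. \<pi> h' = f \<odot>\<^bsub>?F\<^esub> c'"
      using K(2) \<pi>K[OF h'] F.submoduleE(3)[OF K(1) \<pi>K[OF g']] unfolding deep_def by blast
    then obtain h2 where h2: "h2 \<in> carrier ?G" "\<pi> h' = f \<odot>\<^bsub>?F\<^esub> \<pi> h2" unfolding \<pi>(2)[symmetric] by blast
    \<comment> \<open>Depth gave \<open>\<pi> h' = f \<pi> h2\<close>. Moving \<open>x f h2\<close>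
      from one summand to the other leaves the sum unchanged and puts \<open>h1\<close>, and then
      \<open>g1\<close>, into the kernel of \<open>\<pi>\<close>.\<close>
    define h1 where "h1 = h' \<ominus>\<^bsub>?G\<^esub> f \<odot>\<^bsub>?G\<^esub> h2"
    define g1 where "g1 = g' \<oplus>\<^bsub>?G\<^esub> x \<odot>\<^bsub>?G\<^esub> h2"
    have fh2: "f \<odot>\<^bsub>?G\<^esub> h2 \<in> carrier ?G" and xh2: "x \<odot>\<^bsub>?G\<^esub> h2 \<in> carrier ?G"
      using G.smult_closed[OF fc h2(1)] G.smult_closed[OF x h2(1)] by blast+
    have h1: "h1 \<in> carrier ?G" and g1: "g1 \<in> carrier ?G"
      unfolding h1_def g1_def by (rule G.M.minus_closed[OF h' fh2], rule G.M.a_closed[OF g' xh2])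
    have "\<pi> h1 = \<pi> h' \<ominus>\<^bsub>?F\<^esub> f \<odot>\<^bsub>?F\<^esub> \<pi> h2"
      unfolding h1_def module_hom_minus[OF G.module_axioms F.module_axioms \<pi>(1) h' fh2] module_hom_smult[OF \<pi>(1) fc h2(1)] ..
    then have \<pi>h1: "\<pi> h1 = \<zero>\<^bsub>?F\<^esub>"
      using F.diff_eq_zero_iff[OF \<pi>c[OF h'] F.smult_closed[OF fc \<pi>c[OF h2(1)]]] h2(2) by simp
    have eq': "\<sigma> \<odot>\<^bsub>?G\<^esub> b0 = f \<odot>\<^bsub>?G\<^esub> g1 \<oplus>\<^bsub>?G\<^esub> x \<odot>\<^bsub>?G\<^esub> h1"
    proof
      fix i
      have ci: "g' i \<in> carrier S" "h' i \<in> carrier S" "h2 i \<in> carrier S"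
        using g' h' h2(1) by (simp_all add: free_module_carrier_iff)
      have "f \<otimes> g' i \<oplus> x \<otimes> h' i = f \<otimes> (g' i \<oplus> x \<otimes> h2 i) \<oplus> x \<otimes> (h' i \<ominus> f \<otimes> h2 i)"
        using ci fc x by algebra
      then show "(\<sigma> \<odot>\<^bsub>?G\<^esub> b0) i = (f \<odot>\<^bsub>?G\<^esub> g1 \<oplus>\<^bsub>?G\<^esub> x \<odot>\<^bsub>?G\<^esub> h1) i"
        unfolding eq using free_module_minus[OF is_cring h' fh2] by (simp add: g1_def h1_def)
    qed
    have fg1: "f \<odot>\<^bsub>?G\<^esub> g1 \<in> carrier ?G" and xh1: "x \<odot>\<^bsub>?G\<^esub> h1 \<in> carrier ?G"
      using G.smult_closed[OF fc g1] G.smult_closed[OF x h1] by blast+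
    have "\<pi> (\<sigma> \<odot>\<^bsub>?G\<^esub> b0) = f \<odot>\<^bsub>?F\<^esub> \<pi> g1 \<oplus>\<^bsub>?F\<^esub> x \<odot>\<^bsub>?F\<^esub> \<pi> h1"
      unfolding eq' module_hom_add[OF \<pi>(1) fg1 xh1] module_hom_smult[OF \<pi>(1) fc g1] module_hom_smult[OF \<pi>(1) x h1] ..
    then have "f \<odot>\<^bsub>?F\<^esub> \<pi> g1 = \<zero>\<^bsub>?F\<^esub>"
      using \<open>\<pi> (\<sigma> \<odot>\<^bsub>?G\<^esub> b0) = \<zero>\<^bsub>?F\<^esub>\<close> F.smult_r_null[OF x] F.smult_closed[OF fc \<pi>c[OF g1]] unfolding \<pi>h1
      by (simp del: free_module_simps)
    then have \<pi>g1: "\<pi> g1 = \<zero>\<^bsub>?F\<^esub>" by (rule f_cancel[OF \<pi>c[OF g1]])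
    have "g1 \<in> \<beta> ` carrier ?H" "h1 \<in> \<beta> ` carrier ?H" unfolding b(2) using g1 h1 \<pi>g1 \<pi>h1 by simp_all
    then obtain \<gamma> \<eta> where \<gamma>: "\<gamma> \<in> carrier ?H" "g1 = \<beta> \<gamma>" and \<eta>: "\<eta> \<in> carrier ?H" "h1 = \<beta> \<eta>" by blast
    have c1: "\<sigma> \<odot>\<^bsub>?H\<^esub> basis_vector S 0 \<in> carrier ?H" by (rule H.smult_closed[OF \<sigma> e])
    have c2: "f \<odot>\<^bsub>?H\<^esub> \<gamma> \<in> carrier ?H" "x \<odot>\<^bsub>?H\<^esub> \<eta> \<in> carrier ?H"
      using H.smult_closed[OF fc \<gamma>(1)] H.smult_closed[OF x \<eta>(1)] by blast+
    \<comment> \<open>As \<open>\<beta>\<close> is injective, the equation descends to the basis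
      vector; its coordinate 0 would put \<open>\<sigma>\<close> into \<open>(f, x)\<close>. So
      there is no basis vector at all.\<close>
    have "\<beta> (\<sigma> \<odot>\<^bsub>?H\<^esub> basis_vector S 0) = \<beta> (f \<odot>\<^bsub>?H\<^esub> \<gamma> \<oplus>\<^bsub>?H\<^esub> x \<odot>\<^bsub>?H\<^esub> \<eta>)"
      unfolding module_hom_smult[OF b(1) \<sigma> e] module_hom_add[OF b(1) c2] module_hom_smult[OF b(1) fc \<gamma>(1)]
        module_hom_smult[OF b(1) x \<eta>(1)] using eq' unfolding b0_def \<gamma>(2) \<eta>(2) .
    then have "\<beta> (\<sigma> \<odot>\<^bsub>?H\<^esub> basis_vector S 0 \<ominus>\<^bsub>?H\<^esub> (f \<odot>\<^bsub>?H\<^esub> \<gamma> \<oplus>\<^bsub>?H\<^esub> x \<odot>\<^bsub>?H\<^esub> \<eta>)) = \<zero>\<^bsub>?G\<^esub>"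
      using module_hom_minus[OF H.module_axioms G.module_axioms b(1) c1 H.M.a_closed[OF c2]]
        module_hom_closed[OF b(1) H.M.a_closed[OF c2]] by (simp add: G.M.minus_eq G.M.r_neg del: free_module_simps)
    then have "\<sigma> \<odot>\<^bsub>?H\<^esub> basis_vector S 0 \<ominus>\<^bsub>?H\<^esub> (f \<odot>\<^bsub>?H\<^esub> \<gamma> \<oplus>\<^bsub>?H\<^esub> x \<odot>\<^bsub>?H\<^esub> \<eta>) = \<zero>\<^bsub>?H\<^esub>"
      by (rule b(3)[OF H.M.minus_closed[OF c1 H.M.a_closed[OF c2]]])
    then have "\<sigma> \<odot>\<^bsub>?H\<^esub> basis_vector S 0 = f \<odot>\<^bsub>?H\<^esub> \<gamma> \<oplus>\<^bsub>?H\<^esub> x \<odot>\<^bsub>?H\<^esub> \<eta>"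
      using H.diff_eq_zero_iff[OF c1 H.M.a_closed[OF c2]] by simp
    then have "(\<sigma> \<odot>\<^bsub>?H\<^esub> basis_vector S 0) 0 = (f \<odot>\<^bsub>?H\<^esub> \<gamma> \<oplus>\<^bsub>?H\<^esub> x \<odot>\<^bsub>?H\<^esub> \<eta>) 0" by simp
    then have "\<sigma> = f \<otimes> \<gamma> 0 \<oplus> x \<otimes> \<eta> 0" using \<sigma> by (simp add: basis_vector_def)
    moreover have "\<gamma> 0 \<in> carrier S" "\<eta> 0 \<in> carrier S" using \<gamma>(1) \<eta>(1) by (simp_all add: free_module_carrier_iff)
    ultimately show False using socle_notin by blast
  qed
  then have "carrier ?H = {\<zero>\<^bsub>?H\<^esub>}" by (auto simp: free_module_carrier_iff)
  moreover have "c \<in> \<beta> ` carrier ?H" unfolding b(2) using c by simp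
  ultimately show ?thesis using module_hom_zero[OF H.module_axioms G.module_axioms b(1)] by auto
qed

text \<open>Induction from the end of the resolution. The kernel of a minimal cover of
  \<open>K\<close> is a stable retract of the next syzygy and is deep, hence free by induction; then
  \<open>minimal_free_kernel_zero\<close> makes it zero and the cover an isomorphism. At the end the
  syzygy is zero, so \<open>K\<close> is a retract of a free module.\<close>

lemma free_syzygy:
  fixes P :: "nat \<Rightarrow> ('a, 'p) module" and s :: nat
  assumes res: "projective_resolution S M P d \<epsilon>" and len: "\<And>i. n < i \<Longrightarrow> carrier (P i) = {\<zero>\<^bsub>P i\<^esub>}"
    and K: "submodule K S (free_module S {..<s})" "deep (free_module S {..<s}) K"
      "stable_retract S (free_module S {..<s}\<lparr>carrier := K\<rparr>) (P j\<lparr>carrier := d j ` carrier (P (Suc j))\<rparr>)"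
  shows "\<exists>(t::nat) \<beta>. \<beta> \<in> module_hom S (free_module S {..<t}) (free_module S {..<s}) \<and>
    \<beta> ` carrier (free_module S {..<t}) = K \<and>
    (\<forall>c\<in>carrier (free_module S {..<t}). \<beta> c = \<zero>\<^bsub>free_module S {..<s}\<^esub> \<longrightarrow> c = \<zero>\<^bsub>free_module S {..<t}\<^esub>)"
  using K
proof (induction "n - j" arbitrary: j K s rule: less_induct)
  case (less j K s)
  note K = less.prems
  let ?F = "free_module S {..<s}"
  let ?K = "?F\<lparr>carrier := K\<rparr>" and ?Z = "P j\<lparr>carrier := d j ` carrier (P (Suc j))\<rparr>"
  have proj: "projective_module S (P i)" for i using res by (simp add: projective_resolution_def)
  then have mP: "module S (P i)" for i by (simp add: projective_module_def)
  have dh: "d i \<in> module_hom S (P (Suc i)) (P i)" for i using res by (simp add: projective_resolution_def)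
  have mF: "module S ?F" by (rule free_module_module[OF is_cring])
  interpret F: module S ?F by (rule mF)
  have mK: "module S ?K" by (rule submodule.submodule_is_module[OF K(1) mF])
  have mZ: "module S ?Z"
    by (rule submodule.submodule_is_module[OF image_submodule[OF mP mP dh module.carrier_is_submodule[OF mP]] mP])
  note L = noetherian_local_ringD[OF local]
  obtain t :: nat and g where g: "g \<in> {..<t} \<rightarrow> K"
    "linear_extension S ?F g ` carrier (free_module S {..<t}) = K"
    "\<And>c i. c \<in> carrier (free_module S {..<t}) \<Longrightarrow> linear_extension S ?F g c = \<zero>\<^bsub>?F\<^esub> \<Longrightarrow> c i \<in> \<nn>"
    by (rule minimal_generators[OF local mF noetherian_free_module[OF L(1,2)] K(1)], rule that, assumption, assumption, simp)
  let ?G = "free_module S {..<t}"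
  have mG: "module S ?G" by (rule free_module_module[OF is_cring])
  interpret G: module S ?G by (rule mG)
  define \<pi> where "\<pi> = linear_extension S ?F g"
  have gF: "g \<in> {..<t} \<rightarrow> carrier ?F" using g(1) F.submoduleE(1)[OF K(1)] by blast
  have \<pi>: "\<pi> \<in> module_hom S ?G ?F" unfolding \<pi>_def by (rule linear_extension_hom[OF mF gF])
  have im: "\<pi> ` carrier ?G = K" and min: "\<And>c i. c \<in> carrier ?G \<Longrightarrow> \<pi> c = \<zero>\<^bsub>?F\<^esub> \<Longrightarrow> c i \<in> \<nn>"
    unfolding \<pi>_def by (rule g(2), rule g(3))
  have \<pi>K: "\<pi> \<in> module_hom S ?G ?K"
  proof (rule module_hom_restrict_cod[OF \<pi>])
    show "\<pi> c \<in> K" if "c \<in> carrier ?G" for c unfolding im[symmetric] using that by (rule imageI)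
  qed
  have surj: "\<pi> ` carrier ?G = carrier ?K" using im by simp
  let ?K' = "{c \<in> carrier ?G. \<pi> c = \<zero>\<^bsub>?F\<^esub>}"
  have K': "submodule ?K' S ?G" using kernel_submodule[OF mG mF \<pi> F.zero_submodule] by simp
  have ker0: "c = \<zero>\<^bsub>?G\<^esub>" if c: "c \<in> carrier ?G" "\<pi> c = \<zero>\<^bsub>?F\<^esub>" for c
  proof (cases "j < n")
    case True
    have \<epsilon>Z: "d j \<in> module_hom S (P (Suc j)) ?Z" by (rule module_hom_restrict_cod[OF dh]) blast
    have kerd: "{c \<in> carrier (P (Suc j)). d j c = \<zero>\<^bsub>?Z\<^esub>} = d (Suc j) ` carrier (P (Suc (Suc j)))"
      using res by (simp add: projective_resolution_def a_kernel_def')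
    have "stable_retract S (?G\<lparr>carrier := ?K'\<rparr>) (P (Suc j)\<lparr>carrier := d (Suc j) ` carrier (P (Suc (Suc j)))\<rparr>)"
      using stable_retract_syzygy[OF mK mZ K(3) \<pi>K surj proj \<epsilon>Z] unfolding kerd by simp
    moreover have "deep ?G ?K'" by (rule deep_kernel[OF mF \<pi>]) (rule f_cancel)
    moreover have "n - Suc j < n - j" using True by simp
    ultimately obtain k :: nat and \<beta> where \<beta>: "\<beta> \<in> module_hom S (free_module S {..<k}) ?G"
      "\<beta> ` carrier (free_module S {..<k}) = ?K'"
      "\<forall>c\<in>carrier (free_module S {..<k}). \<beta> c = \<zero>\<^bsub>?G\<^esub> \<longrightarrow> c = \<zero>\<^bsub>free_module S {..<k}\<^esub>"
      using less.hyps[OF _ K', of "Suc j"] by blast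
    show ?thesis
    proof (rule minimal_free_kernel_zero[OF K(1,2) \<pi> im _ \<beta>(1,2) _ c])
      show "c i \<in> \<nn>" if "c \<in> carrier ?G" "\<pi> c = \<zero>\<^bsub>?F\<^esub>" for c i by (rule min[OF that])
      show "c = \<zero>\<^bsub>free_module S {..<k}\<^esub>"
        if "c \<in> carrier (free_module S {..<k})" "\<beta> c = \<zero>\<^bsub>?G\<^esub>" for c
        using \<beta>(3) that by simp
    qed
  next
    case False
    then have "carrier (P (Suc j)) = {\<zero>\<^bsub>P (Suc j)\<^esub>}" using len by simp
    then have Z0: "carrier ?Z = {\<zero>\<^bsub>?Z\<^esub>}" using module_hom_zero[OF mP mP dh] by simp
    interpret K: module S ?K by (rule mK)
    obtain u v k p q where r: "u \<in> module_hom S ?K ?Z" "v \<in> module_hom S ?Z ?K"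
      "p \<in> module_hom S ?K (free_module S {..<k::nat})" "q \<in> module_hom S (free_module S {..<k}) ?K"
      "\<forall>c\<in>carrier ?K. c = v (u c) \<oplus>\<^bsub>?K\<^esub> q (p c)"
      using K(3) unfolding stable_retract_def by blast
    have mk: "module S (free_module S {..<k})" by (rule free_module_module[OF is_cring])
    have qp: "q (p z) = z" if z: "z \<in> carrier ?K" for z
    proof -
      have "u z = \<zero>\<^bsub>?Z\<^esub>" using module_hom_closed[OF r(1) z] Z0 by blast
      then have "v (u z) = \<zero>\<^bsub>?K\<^esub>" using module_hom_zero[OF mZ mK r(2)] by simp
      moreover have "q (p z) \<in> carrier ?K" by (rule module_hom_closed[OF r(4) module_hom_closed[OF r(3) z]])
      ultimately have "v (u z) \<oplus>\<^bsub>?K\<^esub> q (p z) = q (p z)" using K.M.l_zero by metis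
      then show ?thesis using bspec[OF r(5) z] by simp
    qed
    have q\<pi>: "q v \<in> \<pi> ` carrier ?G" if "v \<in> carrier (free_module S {..<k})" for v
      unfolding surj by (rule module_hom_closed[OF r(4) that])
    obtain q' where q': "q' \<in> module_hom S (free_module S {..<k}) ?G"
      "\<And>c. c \<in> carrier (free_module S {..<k}) \<Longrightarrow> \<pi> (q' c) = q c"
      using free_lifting[OF mG mK r(4) \<pi>K q\<pi>] by blast
    have s: "(\<lambda>c. q' (p (\<pi> c))) \<in> module_hom S ?G ?G"
      by (rule module_hom_comp[OF module_hom_comp[OF \<pi>K r(3)] q'(1)])
    \<comment> \<open>\<open>p\<close> followed by \<open>q'\<close> splits the cover, so
      \<open>E\<close> maps into its kernel and has entries in \<open>\<nn>\<close> by minimality.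
      It fixes the kernel, which is therefore zero by Nakayama's lemma.\<close>
    define E where "E v = v \<ominus>\<^bsub>?G\<^esub> q' (p (\<pi> v))" for v
    have E: "E \<in> module_hom S ?G ?G" unfolding E_def by (rule module_hom_diff[OF mG mG module_hom_id s])
    have En: "E v i \<in> \<nn>" if v: "v \<in> carrier ?G" for v i
    proof (rule min[OF module_hom_closed[OF E v]])
      have \<pi>v: "\<pi> v \<in> carrier ?K" by (rule module_hom_closed[OF \<pi>K v])
      have "\<pi> (q' (p (\<pi> v))) = \<pi> v" using q'(2)[OF module_hom_closed[OF r(3) \<pi>v]] qp[OF \<pi>v] by simp
      then show "\<pi> (E v) = \<zero>\<^bsub>?F\<^esub>"
        unfolding E_def using module_hom_minus[OF mG mF \<pi> v module_hom_closed[OF s v]] module_hom_closed[OF \<pi> v]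
        by (simp add: F.M.minus_eq F.M.r_neg del: free_module_simps)
    qed
    have "q' (p (\<pi> c)) = \<zero>\<^bsub>?G\<^esub>"
      using module_hom_zero[OF mK mk r(3)] module_hom_zero[OF mk mG q'(1)] c(2) by simp
    then have "E c = c" unfolding E_def using c(1) free_module_minus[OF is_cring c(1) G.M.zero_closed]
      by (simp add: free_module_carrier_iff minus_eq)
    then have "c i \<ominus> E c i \<in> {\<zero>}" for i using c(1) by (simp add: free_module_carrier_iff minus_eq r_neg)
    then have "c i \<in> {\<zero>}" for i
      using vector_nakayama[OF local E En zeroideal c(1)] by blast
    then show ?thesis by auto
  qed
  show ?case using \<pi> im ker0 by blast
qed

end

section \<open>Hypersurface rings\<close>

lemma restrict_scalars_simps [simp]:
  "carrier (restrict_scalars \<phi> M) = carrier M" "\<zero>\<^bsub>restrict_scalars \<phi> M\<^esub> = \<zero>\<^bsub>M\<^esub>"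
  "add (restrict_scalars \<phi> M) = add M" "a \<odot>\<^bsub>restrict_scalars \<phi> M\<^esub> z = \<phi> a \<odot>\<^bsub>M\<^esub> z"
  by (simp_all add: restrict_scalars_def)

lemma restrict_scalars_module:
  assumes "cring S" "\<phi> \<in> ring_hom S R" "module R M"
  shows "module S (restrict_scalars \<phi> M)"
proof -
  interpret module R M by fact
  note h = ring_hom_closed[OF assms(2)] ring_hom_add[OF assms(2)] ring_hom_mult[OF assms(2)] ring_hom_one[OF assms(2)]
  show ?thesis
  proof (rule moduleI[OF assms(1)])
    show "abelian_group (restrict_scalars \<phi> M)"
    proof (rule abelian_groupI)
      fix z assume "z \<in> carrier (restrict_scalars \<phi> M)"
      then show "\<exists>w\<in>carrier (restrict_scalars \<phi> M). w \<oplus>\<^bsub>restrict_scalars \<phi> M\<^esub> z = \<zero>\<^bsub>restrict_scalars \<phi> M\<^esub>"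
        by (intro bexI[of _ "\<ominus>\<^bsub>M\<^esub> z"]) (simp_all add: M.l_neg)
    qed (simp_all add: M.a_ac)
  qed (simp_all add: h smult_l_distr smult_r_distr smult_assoc1)
qed

lemma (in module) submoduleI_smult:
  assumes "H \<subseteq> carrier M" "\<zero>\<^bsub>M\<^esub> \<in> H" "\<And>a b. a \<in> H \<Longrightarrow> b \<in> H \<Longrightarrow> a \<oplus>\<^bsub>M\<^esub> b \<in> H"
    "\<And>a z. a \<in> carrier R \<Longrightarrow> z \<in> H \<Longrightarrow> a \<odot>\<^bsub>M\<^esub> z \<in> H"
  shows "submodule H R M"
proof (rule submoduleI[OF assms(1,2) _ assms(3,4)])
  fix z assume z: "z \<in> H"
  then have "z \<in> carrier M" using assms(1) by blast
  then have "\<ominus>\<^bsub>M\<^esub> z = (\<ominus>\<^bsub>R\<^esub> \<one>\<^bsub>R\<^esub>) \<odot>\<^bsub>M\<^esub> z" by (simp add: smult_l_minus)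
  then show "\<ominus>\<^bsub>M\<^esub> z \<in> H" using assms(4)[OF _ z, of "\<ominus>\<^bsub>R\<^esub> \<one>\<^bsub>R\<^esub>"] by simp
qed

text \<open>\<open>is_free_module\<close> asks for a basis in the type of \<open>M\<close>; the
  images of the basis vectors serve. They are distinct because 1 is not 0, so sums can be reindexed
  between the two bases.\<close>

lemma free_from_bijection:
  fixes m :: nat
  assumes "module R M" "\<one>\<^bsub>R\<^esub> \<noteq> \<zero>\<^bsub>R\<^esub>" "h \<in> module_hom R (free_module R {..<m}) M"
    and surj: "h ` carrier (free_module R {..<m}) = carrier M"
    and inj: "\<And>v. v \<in> carrier (free_module R {..<m}) \<Longrightarrow> h v = \<zero>\<^bsub>M\<^esub> \<Longrightarrow> v = \<zero>\<^bsub>free_module R {..<m}\<^esub>"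
  shows "is_free_module R M"
proof -
  interpret module R M by fact
  let ?F = "free_module R {..<m}"
  interpret F: module R ?F by (rule free_module_module) (rule R.is_cring)
  define e where "e i = h (basis_vector R i)" for i :: nat
  have bv: "basis_vector R i \<in> carrier ?F" if "i < m" for i
    by (rule basis_vector_closed[OF R.is_cring]) (use that in simp)
  have ec: "e i \<in> carrier M" if "i < m" for i unfolding e_def by (rule module_hom_closed[OF assms(3) bv[OF that]])
  have einj: "inj_on e {..<m}"
  proof (rule inj_onI)
    fix i j assume ij: "i \<in> {..<m}" "j \<in> {..<m}" "e i = e j"
    then have b: "basis_vector R i \<in> carrier ?F" "basis_vector R j \<in> carrier ?F" using bv by simp_all
    have "h (basis_vector R i \<ominus>\<^bsub>?F\<^esub> basis_vector R j) = \<zero>\<^bsub>M\<^esub>"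
      using module_hom_minus[OF F.module_axioms assms(1,3) b] ij(3) module_hom_closed[OF assms(3) b(2)]
      by (simp add: e_def M.minus_eq M.r_neg)
    then have "basis_vector R i \<ominus>\<^bsub>?F\<^esub> basis_vector R j = \<zero>\<^bsub>?F\<^esub>" by (rule inj[OF F.M.minus_closed[OF b]])
    then have "basis_vector R i = (basis_vector R j :: nat \<Rightarrow> _)" using F.diff_eq_zero_iff[OF b] by simp
    then have "basis_vector R i i = basis_vector R j i" by simp
    then show "i = j" using assms(2) by (auto simp: basis_vector_def split: if_splits)
  qed
  let ?B = "e ` {..<m}"
  let ?G = "free_module R ?B"
  interpret G: module R ?G by (rule free_module_module) (rule R.is_cring)
  define L where "L = linear_extension R M (\<lambda>b. b)"
  have BM: "(\<lambda>b. b) \<in> ?B \<rightarrow> carrier M" using ec by auto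
  have L: "L \<in> module_hom R ?G M" unfolding L_def by (rule linear_extension_hom[OF assms(1) BM])
  have Linj: "w = \<zero>\<^bsub>?G\<^esub>" if w: "w \<in> carrier ?G" "L w = \<zero>\<^bsub>M\<^esub>" for w
  proof -
    have wc: "\<And>b. w b \<in> carrier R" "\<And>b. b \<notin> ?B \<Longrightarrow> w b = \<zero>\<^bsub>R\<^esub>" using w(1) by (auto simp: free_module_carrier_iff)
    define v where "v i = (if i < m then w (e i) else \<zero>\<^bsub>R\<^esub>)" for i
    have v: "v \<in> carrier ?F" using wc(1) by (simp add: v_def free_module_carrier_nat)
    have "L w = (\<Oplus>\<^bsub>M\<^esub>b\<in>?B. w b \<odot>\<^bsub>M\<^esub> b)"
      unfolding L_def by (rule linear_extension_eq[OF w(1) BM]) (use w(1) in \<open>auto simp: free_module_carrier_iff\<close>)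
    also have "\<dots> = (\<Oplus>\<^bsub>M\<^esub>i\<in>{..<m}. w (e i) \<odot>\<^bsub>M\<^esub> e i)"
      by (rule M.finsum_reindex[OF _ einj]) (use wc ec in auto)
    also have "\<dots> = (\<Oplus>\<^bsub>M\<^esub>i\<in>{..<m}. v i \<odot>\<^bsub>M\<^esub> e i)"
      by (rule M.finsum_cong') (use wc ec in \<open>auto simp: v_def\<close>)
    also have "\<dots> = linear_extension R M e v"
      by (rule finsum_linear_combination[OF v, symmetric]) (use ec in auto)
    also have "\<dots> = h v" unfolding e_def by (rule hom_eq_linear_extension[OF assms(1,3) v, symmetric])
    finally have v0: "v = \<zero>\<^bsub>?F\<^esub>" using inj[OF v] w(2) by simp
    have "w (e i) = \<zero>\<^bsub>R\<^esub>" if i: "i < m" for i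
    proof -
      have "v i = \<zero>\<^bsub>?F\<^esub> i" by (simp only: v0)
      then show ?thesis using i by (simp add: v_def)
    qed
    then have "w b = \<zero>\<^bsub>R\<^esub>" for b using wc(2)[of b] by (cases "b \<in> ?B") auto
    then show ?thesis by auto
  qed
  have Linj_on: "inj_on L (carrier ?G)"
  proof (rule inj_onI)
    fix w w' assume w: "w \<in> carrier ?G" "w' \<in> carrier ?G" "L w = L w'"
    have "L (w \<ominus>\<^bsub>?G\<^esub> w') = \<zero>\<^bsub>M\<^esub>"
      using module_hom_minus[OF G.module_axioms assms(1) L w(1,2)] w(3) module_hom_closed[OF L w(2)] by (simp add: M.minus_eq M.r_neg)
    then have "w \<ominus>\<^bsub>?G\<^esub> w' = \<zero>\<^bsub>?G\<^esub>" by (rule Linj[OF G.M.minus_closed[OF w(1,2)]])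
    then show "w = w'" using G.diff_eq_zero_iff[OF w(1,2)] by simp
  qed
  have Lsurj: "L ` carrier ?G = carrier M"
  proof
    show "L ` carrier ?G \<subseteq> carrier M" using module_hom_closed[OF L] by blast
    have sub: "submodule (L ` carrier ?G) R M" by (rule image_submodule[OF G.module_axioms assms(1) L G.carrier_is_submodule])
    show "carrier M \<subseteq> L ` carrier ?G"
    proof
      fix z assume "z \<in> carrier M"
      then obtain v where v: "z = h v" "v \<in> carrier ?F" unfolding surj[symmetric] by (rule imageE)
      have "h v = linear_extension R M e v" unfolding e_def by (rule hom_eq_linear_extension[OF assms(1,3) v(2)])
      also have "\<dots> \<in> L ` carrier ?G"
      proof (rule linear_extension_mem[OF sub v(2)])
        fix i assume i: "i \<in> {..<m}"
        have "basis_vector R (e i) \<in> carrier ?G" by (rule basis_vector_closed[OF R.is_cring]) (use i in simp)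
        moreover have "L (basis_vector R (e i)) = e i"
          unfolding L_def by (rule linear_extension_basis[OF assms(1)]) (use ec i in simp)
        ultimately have "e i \<in> L ` carrier ?G" by (metis imageI)
        moreover have "v i \<in> carrier R" using v(2) by (simp add: free_module_carrier_iff)
        ultimately show "v i \<odot>\<^bsub>M\<^esub> e i \<in> L ` carrier ?G" using submoduleE(4)[OF sub] by simp
      qed
      finally show "z \<in> L ` carrier ?G" using v(1) by simp
    qed
  qed
  let ?i = "inv_into (carrier ?G) L"
  have bij: "bij_betw L (carrier ?G) (carrier M)" using Linj_on Lsurj by (simp add: bij_betw_def)
  have ic: "?i z \<in> carrier ?G" "L (?i z) = z" if "z \<in> carrier M" for z
    using that inv_into_into[of z L "carrier ?G"] f_inv_into_f[of z L "carrier ?G"] Lsurj by simp_all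
  have iI: "?i (L w) = w" if "w \<in> carrier ?G" for w by (rule inv_into_f_f[OF Linj_on that])
  have "?i \<in> module_hom R M ?G"
  proof (rule module_homI)
    show "?i z \<in> carrier ?G" if "z \<in> carrier M" for z by (rule ic(1)[OF that])
    show "?i (z \<oplus>\<^bsub>M\<^esub> z') = ?i z \<oplus>\<^bsub>?G\<^esub> ?i z'" if "z \<in> carrier M" "z' \<in> carrier M" for z z'
      using iI[OF G.M.a_closed[OF ic(1)[OF that(1)] ic(1)[OF that(2)]]]
        module_hom_add[OF L ic(1)[OF that(1)] ic(1)[OF that(2)]] ic(2)[OF that(1)] ic(2)[OF that(2)] by simp
    show "?i (a \<odot>\<^bsub>M\<^esub> z) = a \<odot>\<^bsub>?G\<^esub> ?i z" if "a \<in> carrier R" "z \<in> carrier M" for a z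
      using iI[OF G.smult_closed[OF that(1) ic(1)[OF that(2)]]]
        module_hom_smult[OF L that(1) ic(1)[OF that(2)]] ic(2)[OF that(2)] by simp
  qed
  moreover have "bij_betw ?i (carrier M) (carrier ?G)" by (rule bij_betw_inv_into[OF bij])
  ultimately show ?thesis unfolding is_free_module_def module_isomorphic_def by blast
qed

section \<open>Matrices as linear maps\<close>

context cring
begin

lemma matrix_map_hom:
  assumes "\<And>i j. i < m \<Longrightarrow> j < m \<Longrightarrow> \<alpha> i j \<in> carrier R"
  shows "matrix_map R m \<alpha> \<in> module_hom R (free_module R {..<m}) (free_module R {..<m})"
proof (rule module_homI)
  fix v assume v: "v \<in> carrier (free_module R {..<m})"
  then have vc: "\<And>i. v i \<in> carrier R" by (simp add: free_module_carrier_iff)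
  show "matrix_map R m \<alpha> v \<in> carrier (free_module R {..<m})"
    using assms vc by (auto simp: matrix_map_def free_module_carrier_nat intro!: finsum_closed)
  show "matrix_map R m \<alpha> (a \<odot>\<^bsub>free_module R {..<m}\<^esub> v) = a \<odot>\<^bsub>free_module R {..<m}\<^esub> matrix_map R m \<alpha> v"
    if a: "a \<in> carrier R" for a
  proof
    fix i
    have "(\<Oplus>j\<in>{..<m}. \<alpha> i j \<otimes> (a \<otimes> v j)) = a \<otimes> (\<Oplus>j\<in>{..<m}. \<alpha> i j \<otimes> v j)" if i: "i < m"
    proof -
      have "(\<Oplus>j\<in>{..<m}. \<alpha> i j \<otimes> (a \<otimes> v j)) = (\<Oplus>j\<in>{..<m}. a \<otimes> (\<alpha> i j \<otimes> v j))"
        by (rule finsum_cong') (use assms i a vc in \<open>auto simp: m_lcomm\<close>)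
      then show ?thesis using finsum_rdistr[of "{..<m}" a "\<lambda>j. \<alpha> i j \<otimes> v j"] assms i a vc by auto
    qed
    then show "matrix_map R m \<alpha> (a \<odot>\<^bsub>free_module R {..<m}\<^esub> v) i = (a \<odot>\<^bsub>free_module R {..<m}\<^esub> matrix_map R m \<alpha> v) i"
      using a by (simp add: matrix_map_def)
  qed
  fix w assume "w \<in> carrier (free_module R {..<m})"
  then have wc: "\<And>i. w i \<in> carrier R" by (simp add: free_module_carrier_iff)
  show "matrix_map R m \<alpha> (v \<oplus>\<^bsub>free_module R {..<m}\<^esub> w) = matrix_map R m \<alpha> v \<oplus>\<^bsub>free_module R {..<m}\<^esub> matrix_map R m \<alpha> w"
  proof
    fix i
    have "(\<Oplus>j\<in>{..<m}. \<alpha> i j \<otimes> (v j \<oplus> w j)) = (\<Oplus>j\<in>{..<m}. \<alpha> i j \<otimes> v j) \<oplus> (\<Oplus>j\<in>{..<m}. \<alpha> i j \<otimes> w j)" if i: "i < m"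
    proof -
      have "(\<Oplus>j\<in>{..<m}. \<alpha> i j \<otimes> (v j \<oplus> w j)) = (\<Oplus>j\<in>{..<m}. \<alpha> i j \<otimes> v j \<oplus> \<alpha> i j \<otimes> w j)"
        by (rule finsum_cong') (use assms i vc wc in \<open>auto simp: r_distr\<close>)
      then show ?thesis using finsum_addf[of "\<lambda>j. \<alpha> i j \<otimes> v j" "{..<m}" "\<lambda>j. \<alpha> i j \<otimes> w j"] assms i vc wc by auto
    qed
    then show "matrix_map R m \<alpha> (v \<oplus>\<^bsub>free_module R {..<m}\<^esub> w) i = (matrix_map R m \<alpha> v \<oplus>\<^bsub>free_module R {..<m}\<^esub> matrix_map R m \<alpha> w) i"
      by (simp add: matrix_map_def)
  qed
qed

lemma matrix_map_basis:
  assumes "\<And>i j. i < m \<Longrightarrow> j < m \<Longrightarrow> \<alpha> i j \<in> carrier R" "i < m" "j < m"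
  shows "matrix_map R m \<alpha> (basis_vector R j) i = \<alpha> i j"
proof -
  have "(\<Oplus>k\<in>{..<m}. \<alpha> i k \<otimes> basis_vector R j k) = (\<Oplus>k\<in>{..<m}. if j = k then \<alpha> i k else \<zero>)"
    by (rule finsum_cong') (use assms in \<open>auto simp: basis_vector_def\<close>)
  also have "\<dots> = \<alpha> i j" by (rule finsum_singleton) (use assms in auto)
  finally show ?thesis using assms(2) by (simp add: matrix_map_def)
qed

lemma matrix_map_mult_scalar:
  assumes \<alpha>: "\<And>i j. i < m \<Longrightarrow> j < m \<Longrightarrow> \<alpha> i j \<in> carrier R" and \<beta>: "\<And>i j. i < m \<Longrightarrow> j < m \<Longrightarrow> \<beta> i j \<in> carrier R"
    and f: "f \<in> carrier R"
    and mult: "\<And>i j. i < m \<Longrightarrow> j < m \<Longrightarrow> (\<Oplus>k\<in>{..<m}. \<alpha> i k \<otimes> \<beta> k j) = (if i = j then f else \<zero>)"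
    and c: "c \<in> carrier (free_module R {..<m})"
  shows "matrix_map R m \<alpha> (matrix_map R m \<beta> c) = f \<odot>\<^bsub>free_module R {..<m}\<^esub> c"
proof (rule hom_eqI[OF free_module_module[OF is_cring] module_hom_comp[OF matrix_map_hom[OF \<beta>] matrix_map_hom[OF \<alpha>]]
      module.scaling_hom[OF free_module_module[OF is_cring] f] _ c])
  fix j assume "j \<in> {..<m}"
  then have j: "j < m" by simp
  show "matrix_map R m \<alpha> (matrix_map R m \<beta> (basis_vector R j)) = f \<odot>\<^bsub>free_module R {..<m}\<^esub> basis_vector R j"
  proof
    fix i
    show "matrix_map R m \<alpha> (matrix_map R m \<beta> (basis_vector R j)) i = (f \<odot>\<^bsub>free_module R {..<m}\<^esub> basis_vector R j) i"
    proof (cases "i < m")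
      case True
      have "(\<Oplus>k\<in>{..<m}. \<alpha> i k \<otimes> matrix_map R m \<beta> (basis_vector R j) k) = (\<Oplus>k\<in>{..<m}. \<alpha> i k \<otimes> \<beta> k j)"
        by (rule finsum_cong') (use \<alpha> \<beta> True j matrix_map_basis[of m \<beta> _ j] in auto)
      then show ?thesis using mult[OF True j] True f by (simp add: matrix_map_def[of R m \<alpha>] basis_vector_def)
    next
      case False
      then show ?thesis using j f by (auto simp: matrix_map_def[of R m \<alpha>] basis_vector_def)
    qed
  qed
qed

end

section \<open>Reduction modulo f\<close>

locale hypersurface =
  fixes S :: "'s ring" (structure) and \<nn> :: "'s set" and f :: 's
  assumes local: "noetherian_local_ring S \<nn>"
    and f: "f \<in> nonzerodivisors S" and fn: "f \<in> \<nn>"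
begin

lemmas L = noetherian_local_ringD[OF local]

sublocale cring S by (rule L(1))

abbreviation (input) "I \<equiv> PIdl f"
abbreviation (input) "R \<equiv> S Quot I"
abbreviation (input) "\<rho> \<equiv> \<lambda>s. I +> s"
abbreviation (input) "\<rho>v \<equiv> \<lambda>c i. I +> c i"

lemma fc: "f \<in> carrier S" using f by (simp add: nonzerodivisors_def)

lemma I: "ideal I S" by (rule cgenideal_ideal[OF fc])

lemma I_iff: "s \<in> I \<longleftrightarrow> (\<exists>c\<in>carrier S. s = f \<otimes> c)"
  using fc m_comm[OF fc] by (auto simp: cgenideal_def)

lemma rho_hom: "\<rho> \<in> ring_hom S R" by (rule ideal.rcos_ring_hom[OF I])

lemma R_cring: "cring R" by (rule ideal.quotient_is_cring[OF I is_cring])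

lemmas rho_closed = ring_hom_closed[OF rho_hom]
lemmas rho_simps = ring_hom_add[OF rho_hom] ring_hom_mult[OF rho_hom] ring_hom_one[OF rho_hom]

lemma rho_eq: "s \<in> carrier S \<Longrightarrow> t \<in> carrier S \<Longrightarrow> \<rho> s = \<rho> t \<longleftrightarrow> s \<ominus> t \<in> I"
  using quotient_eq_iff_same_a_r_cos[OF I] by simp

lemma rho_0: "\<rho> \<zero> = \<zero>\<^bsub>R\<^esub>"
  by (rule ring_hom_zero[OF rho_hom ring_axioms cring.axioms(1)[OF R_cring]])

lemma rho_zero_iff: "s \<in> carrier S \<Longrightarrow> \<rho> s = \<zero>\<^bsub>R\<^esub> \<longleftrightarrow> s \<in> I"
  using rho_eq[of s \<zero>] rho_0 by (simp add: minus_eq)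

lemma rho_surj:
  assumes "r \<in> carrier R"
  obtains s where "s \<in> carrier S" "r = \<rho> s"
  using assms by (auto simp: FactRing_def A_RCOSETS_def')

lemma self_S: "module S (self_module S)" by (rule self_module_module[OF is_cring])
lemma self_R: "module R (self_module R)" by (rule self_module_module[OF R_cring])
lemma free_S: "module S (free_module S B)" by (rule free_module_module[OF is_cring])
lemma free_R: "module R (free_module R B)" by (rule free_module_module[OF R_cring])

lemma restricted: "module R M \<Longrightarrow> module S (restrict_scalars \<rho> M)"
  by (rule restrict_scalars_module[OF is_cring rho_hom])

lemma reduction_hom: "\<rho>v \<in> module_hom S (free_module S {..<m::nat}) (restrict_scalars \<rho> (free_module R {..<m}))"
proof (rule module_homI)
  fix c assume c: "c \<in> carrier (free_module S {..<m})"
  then have cc: "\<And>i. c i \<in> carrier S" by (simp add: free_module_carrier_iff)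
  show "\<rho>v c \<in> carrier (restrict_scalars \<rho> (free_module R {..<m}))"
    using c rho_closed rho_0 by (simp add: free_module_carrier_nat)
  show "\<rho>v (a \<odot>\<^bsub>free_module S {..<m}\<^esub> c) = a \<odot>\<^bsub>restrict_scalars \<rho> (free_module R {..<m})\<^esub> \<rho>v c" if "a \<in> carrier S" for a
    using that cc by (simp add: rho_simps)
  fix d assume "d \<in> carrier (free_module S {..<m})"
  then have dc: "\<And>i. d i \<in> carrier S" by (simp add: free_module_carrier_iff)
  show "\<rho>v (c \<oplus>\<^bsub>free_module S {..<m}\<^esub> d) = \<rho>v c \<oplus>\<^bsub>restrict_scalars \<rho> (free_module R {..<m})\<^esub> \<rho>v d"
    using cc dc by (simp add: rho_simps)
qed

lemma reduction_closed: "c \<in> carrier (free_module S {..<m::nat}) \<Longrightarrow> \<rho>v c \<in> carrier (free_module R {..<m})"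
  using module_hom_closed[OF reduction_hom] by simp

lemma reduction_surj:
  assumes "v \<in> carrier (free_module R {..<m::nat})"
  obtains c where "c \<in> carrier (free_module S {..<m})" "v = \<rho>v c"
proof -
  have v: "\<And>i. v i \<in> carrier R" "\<And>i. i \<ge> m \<Longrightarrow> v i = \<zero>\<^bsub>R\<^esub>" using assms by (simp_all add: free_module_carrier_nat)
  have "\<forall>i. \<exists>s. s \<in> carrier S \<and> v i = \<rho> s" using rho_surj[OF v(1)] by metis
  then obtain s where s: "\<And>i. s i \<in> carrier S" "\<And>i. v i = \<rho> (s i)" by metis
  let ?c = "\<lambda>i. if i < m then s i else \<zero>"
  have "?c \<in> carrier (free_module S {..<m})" using s(1) by (simp add: free_module_carrier_nat)
  moreover have "v = \<rho>v ?c"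
  proof
    fix i show "v i = \<rho>v ?c i"
      using s(2)[of i] v(2)[of i] rho_0 by (cases "i < m") simp_all
  qed
  ultimately show thesis by (rule that)
qed

text \<open>A map over \<open>S\<close> into a module over \<open>R\<close> is determined by its
  values on the basis, and these define a map over \<open>R\<close> as well; no quotient of
  \<open>S^m\<close> by \<open>f\<close> is formed.\<close>

lemma hom_descends:
  assumes "module R M" "h \<in> module_hom S (free_module S {..<m::nat}) (restrict_scalars \<rho> M)"
  shows "\<exists>h'\<in>module_hom R (free_module R {..<m}) M. \<forall>c\<in>carrier (free_module S {..<m}). h' (\<rho>v c) = h c"
proof -
  have bs: "basis_vector S i \<in> carrier (free_module S {..<m})" if "i < m" for i
    by (rule basis_vector_closed[OF is_cring]) (use that in simp)
  have hb: "h (basis_vector S i) \<in> carrier M" if "i < m" for i using module_hom_closed[OF assms(2) bs[OF that]] by simp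
  let ?h = "linear_extension R M (\<lambda>i. h (basis_vector S i))"
  have h': "?h \<in> module_hom R (free_module R {..<m}) M" by (rule linear_extension_hom[OF assms(1)]) (use hb in auto)
  have h'': "?h \<in> module_hom S (restrict_scalars \<rho> (free_module R {..<m})) (restrict_scalars \<rho> M)"
    by (rule module_homI)
      (simp_all add: module_hom_closed[OF h'] module_hom_add[OF h'] module_hom_smult[OF h'] rho_closed del: free_module_simps)
  have "?h (\<rho>v c) = h c" if c: "c \<in> carrier (free_module S {..<m})" for c
  proof (rule hom_eqI[OF restricted[OF assms(1)] module_hom_comp[OF reduction_hom h''] assms(2) _ c])
    fix i assume i: "i \<in> {..<m}"
    have "\<rho>v (basis_vector S i) = basis_vector R i"
    proof
      fix q show "I +> basis_vector S i q = basis_vector R i q"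
        by (cases "q = i") (simp_all add: basis_vector_def rho_0 rho_simps(3))
    qed
    then show "?h (\<rho>v (basis_vector S i)) = h (basis_vector S i)"
      using linear_extension_basis[OF assms(1), of "\<lambda>i. h (basis_vector S i)" i] hb i by simp
  qed
  with h' show ?thesis by blast
qed

lemma f_cancel: "a \<in> carrier S \<Longrightarrow> b \<in> carrier S \<Longrightarrow> f \<otimes> a = f \<otimes> b \<Longrightarrow> a = b"
proof -
  assume ab: "a \<in> carrier S" "b \<in> carrier S" "f \<otimes> a = f \<otimes> b"
  have "f \<otimes> (a \<ominus> b) = f \<otimes> a \<ominus> f \<otimes> b" using ab fc by (simp add: minus_eq r_distr r_minus)
  then have "f \<otimes> (a \<ominus> b) = \<zero>" using ab fc by (simp add: minus_eq r_neg)
  then have "a \<ominus> b = \<zero>" using f ab(1,2) unfolding nonzerodivisors_def by blast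
  then show "a = b" using module.diff_eq_zero_iff[OF self_S, of a b] ab by (simp add: self_module_minus)
qed

section \<open>Matrix factorizations and their periodic complexes\<close>

text \<open>Eisenbud's argument for the dual complex: lift \<open>g\<close> to \<open>g1\<close>
  over \<open>S\<close>. Then \<open>g1 A = f h\<close>, so \<open>f g1 = g1 A B = f h B\<close>,
  and cancelling \<open>f\<close> gives \<open>g1 = h B\<close>. The statement can be applied with
  \<open>A\<close> and \<open>B\<close> exchanged, which covers both spots of the period.\<close>

lemma factorization_exact:
  fixes m :: nat
  assumes A: "A \<in> module_hom S (free_module S {..<m}) (free_module S {..<m})"
    and B: "B \<in> module_hom S (free_module S {..<m}) (free_module S {..<m})"
    and AB: "\<And>c. c \<in> carrier (free_module S {..<m}) \<Longrightarrow> A (B c) = f \<odot>\<^bsub>free_module S {..<m}\<^esub> c"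
    and g: "g \<in> module_hom R (free_module R {..<m}) (self_module R)"
    and gA: "\<And>c. c \<in> carrier (free_module S {..<m}) \<Longrightarrow> g (\<rho>v (A c)) = \<zero>\<^bsub>R\<^esub>"
  shows "\<exists>g'\<in>module_hom R (free_module R {..<m}) (self_module R). \<forall>c\<in>carrier (free_module S {..<m}). g (\<rho>v c) = g' (\<rho>v (B c))"
proof -
  let ?F = "free_module S {..<m}"
  have gS: "g \<in> module_hom S (restrict_scalars \<rho> (free_module R {..<m})) (restrict_scalars \<rho> (self_module R))"
    by (rule module_homI)
      (simp_all add: module_hom_closed[OF g, simplified] module_hom_add[OF g, simplified] module_hom_smult[OF g, simplified] rho_closed)
  have rS: "\<rho> \<in> module_hom S (self_module S) (restrict_scalars \<rho> (self_module R))"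
    by (rule module_homI) (simp_all add: rho_closed rho_simps)
  have gr: "(\<lambda>c. g (\<rho>v c)) \<in> module_hom S ?F (restrict_scalars \<rho> (self_module R))" by (rule module_hom_comp[OF reduction_hom gS])
  have img: "g (\<rho>v c) \<in> \<rho> ` carrier (self_module S)" if "c \<in> carrier ?F" for c
  proof -
    have "g (\<rho>v c) \<in> carrier R" using module_hom_closed[OF gr that] by simp
    then obtain s where "s \<in> carrier S" "g (\<rho>v c) = \<rho> s" by (rule rho_surj)
    then show ?thesis by simp
  qed
  obtain g1 where g1: "g1 \<in> module_hom S ?F (self_module S)" "\<And>c. c \<in> carrier ?F \<Longrightarrow> \<rho> (g1 c) = g (\<rho>v c)"
    using free_lifting[OF self_S restricted[OF self_R] gr rS img] by blast
  have g1c: "g1 c \<in> carrier S" if "c \<in> carrier ?F" for c using module_hom_closed[OF g1(1) that] by simp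
  have fm: "(\<lambda>s. f \<odot>\<^bsub>self_module S\<^esub> s) \<in> module_hom S (self_module S) (self_module S)"
    by (rule module.scaling_hom[OF self_S fc])
  have img2: "g1 (A c) \<in> (\<lambda>s. f \<odot>\<^bsub>self_module S\<^esub> s) ` carrier (self_module S)" if c: "c \<in> carrier ?F" for c
  proof -
    have Ac: "A c \<in> carrier ?F" by (rule module_hom_closed[OF A c])
    have "\<rho> (g1 (A c)) = \<zero>\<^bsub>R\<^esub>" using g1(2)[OF Ac] gA[OF c] by simp
    then have "g1 (A c) \<in> I" using rho_zero_iff[OF g1c[OF Ac]] by simp
    then show ?thesis using I_iff by auto
  qed
  obtain h where h: "h \<in> module_hom S ?F (self_module S)" "\<And>c. c \<in> carrier ?F \<Longrightarrow> f \<odot>\<^bsub>self_module S\<^esub> h c = g1 (A c)"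
    using free_lifting[OF self_S self_S module_hom_comp[OF A g1(1)] fm img2] by blast
  have hB: "g1 c = h (B c)" if c: "c \<in> carrier ?F" for c
  proof (rule f_cancel)
    have Bc: "B c \<in> carrier ?F" by (rule module_hom_closed[OF B c])
    show "g1 c \<in> carrier S" by (rule g1c[OF c])
    show "h (B c) \<in> carrier S" using module_hom_closed[OF h(1) Bc] by simp
    show "f \<otimes> g1 c = f \<otimes> h (B c)"
      using h(2)[OF Bc] AB[OF c] module_hom_smult[OF g1(1) fc c] by simp
  qed
  have "(\<lambda>c. \<rho> (h c)) \<in> module_hom S ?F (restrict_scalars \<rho> (self_module R))" by (rule module_hom_comp[OF h(1) rS])
  from hom_descends[OF self_R this] obtain g' where g': "g' \<in> module_hom R (free_module R {..<m}) (self_module R)"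
    "\<forall>c\<in>carrier ?F. g' (\<rho>v c) = \<rho> (h c)" by (rule bexE)
  have "g (\<rho>v c) = g' (\<rho>v (B c))" if c: "c \<in> carrier ?F" for c
    using g1(2)[OF c] hB[OF c] g'(2) module_hom_closed[OF B c] by simp
  with g'(1) show ?thesis by blast
qed

lemma factorization_splits:
  fixes m :: nat and M :: "('s set, 'm) module"
  assumes cm: "cohen_macaulay_local_ring R" "krull_dim R = 1"
    and M: "module R M" "finitely_generated_module R M" "has_rank R M"
    and nt: "\<not> has_torsion R (tensor_module R M (dual_module R M))"
    and A: "A \<in> module_hom S (free_module S {..<m}) (free_module S {..<m})"
    and B: "B \<in> module_hom S (free_module S {..<m}) (free_module S {..<m})"
    and AB: "\<And>c. c \<in> carrier (free_module S {..<m}) \<Longrightarrow> A (B c) = f \<odot>\<^bsub>free_module S {..<m}\<^esub> c"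
    and BA: "\<And>c. c \<in> carrier (free_module S {..<m}) \<Longrightarrow> B (A c) = f \<odot>\<^bsub>free_module S {..<m}\<^esub> c"
    and \<pi>: "\<pi> \<in> module_hom S (free_module S {..<m}) (restrict_scalars \<rho> M)"
      "\<pi> ` carrier (free_module S {..<m}) = carrier M"
      "\<And>c. c \<in> carrier (free_module S {..<m}) \<Longrightarrow> \<pi> c = \<zero>\<^bsub>M\<^esub> \<longleftrightarrow> c \<in> A ` carrier (free_module S {..<m})"
  shows "\<exists>C\<in>module_hom S (free_module S {..<m}) (free_module S {..<m}).
    \<exists>D\<in>module_hom S (free_module S {..<m}) (free_module S {..<m}).
      \<forall>c\<in>carrier (free_module S {..<m}). c = C (B c) \<oplus>\<^bsub>free_module S {..<m}\<^esub> A (D c)"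
proof -
  let ?F = "free_module S {..<m}" and ?G = "free_module R {..<m}"
  interpret F: module S ?F by (rule free_S)
  interpret M: module R M by (rule M(1))
  have lift: "\<exists>h'\<in>module_hom R ?G ?G. \<forall>c\<in>carrier ?F. h' (\<rho>v c) = \<rho>v (h c)" if "h \<in> module_hom S ?F ?F" for h
    by (rule hom_descends[OF free_R module_hom_comp[OF that reduction_hom]])
  obtain A' where A': "A' \<in> module_hom R ?G ?G" "\<forall>c\<in>carrier ?F. A' (\<rho>v c) = \<rho>v (A c)" using lift[OF A] by (rule bexE)
  obtain B' where B': "B' \<in> module_hom R ?G ?G" "\<forall>c\<in>carrier ?F. B' (\<rho>v c) = \<rho>v (B c)" using lift[OF B] by (rule bexE)
  obtain \<pi>' where \<pi>': "\<pi>' \<in> module_hom R ?G M" "\<forall>c\<in>carrier ?F. \<pi>' (\<rho>v c) = \<pi> c"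
    using hom_descends[OF M(1) \<pi>(1)] by (rule bexE)
  note Ac = module_hom_closed[OF A] and Bc = module_hom_closed[OF B]
  have A'e: "A' (\<rho>v c) = \<rho>v (A c)" and B'e: "B' (\<rho>v c) = \<rho>v (B c)" and \<pi>'e: "\<pi>' (\<rho>v c) = \<pi> c" if "c \<in> carrier ?F" for c
    using A'(2) B'(2) \<pi>'(2) that by blast+
  have per: "periodic_presentation R M m \<pi>' A' B'"
  proof (intro periodic_presentation.intro periodic_presentation_axioms.intro M(1) A'(1) B'(1) \<pi>'(1))
    show "\<pi>' ` carrier ?G = carrier M"
    proof
      show "\<pi>' ` carrier ?G \<subseteq> carrier M" using module_hom_closed[OF \<pi>'(1)] by blast
      show "carrier M \<subseteq> \<pi>' ` carrier ?G"
      proof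
        fix z assume "z \<in> carrier M"
        then obtain c where c: "z = \<pi> c" "c \<in> carrier ?F" unfolding \<pi>(2)[symmetric] by (rule imageE)
        then have "z = \<pi>' (\<rho>v c)" using \<pi>'e by simp
        then show "z \<in> \<pi>' ` carrier ?G" using reduction_closed[OF c(2)] by (rule image_eqI)
      qed
    qed
    fix a assume "a \<in> carrier ?G"
    then obtain c where c: "c \<in> carrier ?F" "a = \<rho>v c" by (rule reduction_surj)
    show "\<pi>' a = \<zero>\<^bsub>M\<^esub> \<longleftrightarrow> a \<in> A' ` carrier ?G"
    proof
      assume "\<pi>' a = \<zero>\<^bsub>M\<^esub>"
      then have "c \<in> A ` carrier ?F" using \<pi>(3)[OF c(1)] \<pi>'e[OF c(1)] c(2) by simp
      then obtain d where d: "c = A d" "d \<in> carrier ?F" by (rule imageE)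
      then have "a = A' (\<rho>v d)" using A'e c(2) by simp
      then show "a \<in> A' ` carrier ?G" using reduction_closed[OF d(2)] by (rule image_eqI)
    next
      assume "a \<in> A' ` carrier ?G"
      then obtain v where v: "a = A' v" "v \<in> carrier ?G" by (rule imageE)
      obtain d where d: "d \<in> carrier ?F" "v = \<rho>v d" by (rule reduction_surj[OF v(2)])
      have "a = \<rho>v (A d)" using v(1) A'e[OF d(1)] d(2) by simp
      then have "\<pi>' a = \<pi> (A d)" using \<pi>'e[OF Ac[OF d(1)]] by simp
      then show "\<pi>' a = \<zero>\<^bsub>M\<^esub>" using \<pi>(3)[OF Ac[OF d(1)]] d(1) by simp
    qed
    have "B' (A' a) = \<rho>v (f \<odot>\<^bsub>?F\<^esub> c)" using A'e[OF c(1)] B'e[OF Ac[OF c(1)]] BA[OF c(1)] c(2) by simp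
    also have "\<dots> = \<zero>\<^bsub>?G\<^esub>"
    proof -
      have "\<rho> (f \<otimes> c i) = \<zero>\<^bsub>R\<^esub>" for i
      proof -
        have "c i \<in> carrier S" using c(1) by (simp add: free_module_carrier_iff)
        then show ?thesis using rho_zero_iff[of "f \<otimes> c i"] I_iff fc by auto
      qed
      then show ?thesis by simp
    qed
    finally show "B' (A' a) = \<zero>\<^bsub>?G\<^esub>" .
  next
    fix g assume g: "g \<in> module_hom R ?G (self_module R)" and gA: "\<And>a. a \<in> carrier ?G \<Longrightarrow> g (A' a) = \<zero>\<^bsub>R\<^esub>"
    have "g (\<rho>v (A c)) = \<zero>\<^bsub>R\<^esub>" if "c \<in> carrier ?F" for c using gA[OF reduction_closed[OF that]] A'e[OF that] by simp
    from factorization_exact[OF A B AB g this] obtain g' where g': "g' \<in> module_hom R ?G (self_module R)"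
      "\<forall>c\<in>carrier ?F. g (\<rho>v c) = g' (\<rho>v (B c))" by blast
    have "g a = g' (B' a)" if a: "a \<in> carrier ?G" for a
    proof -
      obtain c where c: "c \<in> carrier ?F" "a = \<rho>v c" by (rule reduction_surj[OF a])
      then show ?thesis using g'(2) B'e by simp
    qed
    with g'(1) show "\<exists>g'\<in>module_hom R ?G (self_module R). \<forall>a\<in>carrier ?G. g a = g' (B' a)" by blast
  next
    fix g assume g: "g \<in> module_hom R ?G (self_module R)" and gB: "\<And>a. a \<in> carrier ?G \<Longrightarrow> g (B' a) = \<zero>\<^bsub>R\<^esub>"
    have "g (\<rho>v (B c)) = \<zero>\<^bsub>R\<^esub>" if "c \<in> carrier ?F" for c using gB[OF reduction_closed[OF that]] B'e[OF that] by simp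
    from factorization_exact[OF B A BA g this] obtain g' where g': "g' \<in> module_hom R ?G (self_module R)"
      "\<forall>c\<in>carrier ?F. g (\<rho>v c) = g' (\<rho>v (A c))" by blast
    have "g a = g' (A' a)" if a: "a \<in> carrier ?G" for a
    proof -
      obtain c where c: "c \<in> carrier ?F" "a = \<rho>v c" by (rule reduction_surj[OF a])
      then show ?thesis using g'(2) A'e by simp
    qed
    with g'(1) show "\<exists>g'\<in>module_hom R ?G (self_module R). \<forall>a\<in>carrier ?G. g a = g' (A' a)" by blast
  qed
  interpret P: periodic_presentation R M m \<pi>' A' B' by (rule per)
  obtain \<mm> x where x: "noetherian_local_ring R \<mm>" "x \<in> \<mm>" "x \<in> nonzerodivisors R"
    by (rule cohen_macaulay_nonzerodivisor[OF cm])
  obtain w where w: "w \<in> module_hom R ?G M" "\<And>a. a \<in> carrier ?G \<Longrightarrow> \<pi>' a = w (B' a)"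
    using P.cover_factors[OF x(1) cm(2) x(2,3) M(2,3) nt] by blast
  have wS: "w \<in> module_hom S (restrict_scalars \<rho> ?G) (restrict_scalars \<rho> M)"
    by (rule module_homI)
      (simp_all add: module_hom_closed[OF w(1)] module_hom_add[OF w(1)] module_hom_smult[OF w(1)] rho_closed del: free_module_simps)
  note mM = restricted[OF M(1)]
  have w0: "(\<lambda>c. w (\<rho>v c)) \<in> module_hom S ?F (restrict_scalars \<rho> M)" by (rule module_hom_comp[OF reduction_hom wS])
  have w0i: "w (\<rho>v c) \<in> \<pi> ` carrier ?F" if "c \<in> carrier ?F" for c
    unfolding \<pi>(2) using module_hom_closed[OF w0 that] by simp
  \<comment> \<open>\<open>C\<close> lifts \<open>w\<close>, so \<open>\<pi> C B = \<pi>\<close>;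
    then \<open>1 - C B\<close> maps into the kernel of \<open>\<pi>\<close>, which is the image of
    \<open>A\<close>, and lifts to \<open>D\<close>.\<close>
  obtain C where C: "C \<in> module_hom S ?F ?F" "\<And>c. c \<in> carrier ?F \<Longrightarrow> \<pi> (C c) = w (\<rho>v c)"
    using free_lifting[OF free_S mM w0 \<pi>(1) w0i] by blast
  have CB: "(\<lambda>c. C (B c)) \<in> module_hom S ?F ?F" by (rule module_hom_comp[OF B C(1)])
  have d: "(\<lambda>c. c \<ominus>\<^bsub>?F\<^esub> C (B c)) \<in> module_hom S ?F ?F" by (rule module_hom_diff[OF free_S free_S module_hom_id CB])
  have dA: "c \<ominus>\<^bsub>?F\<^esub> C (B c) \<in> A ` carrier ?F" if c: "c \<in> carrier ?F" for c
  proof -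
    have "\<pi> (C (B c)) = \<pi> c"
      using C(2)[OF Bc[OF c]] w(2)[OF reduction_closed[OF c]] \<pi>'e[OF c] B'e[OF c] by simp
    then have "\<pi> (c \<ominus>\<^bsub>?F\<^esub> C (B c)) = \<pi> c \<ominus>\<^bsub>restrict_scalars \<rho> M\<^esub> \<pi> c"
      using module_hom_minus[OF free_S mM \<pi>(1) c module_hom_closed[OF CB c]] by simp
    also have "\<dots> = \<zero>\<^bsub>M\<^esub>"
      using module.diff_eq_zero_iff[OF mM module_hom_closed[OF \<pi>(1) c] module_hom_closed[OF \<pi>(1) c]] by simp
    finally show ?thesis using \<pi>(3)[OF module_hom_closed[OF d c]] by simp
  qed
  obtain D where D: "D \<in> module_hom S ?F ?F" "\<And>c. c \<in> carrier ?F \<Longrightarrow> A (D c) = c \<ominus>\<^bsub>?F\<^esub> C (B c)"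
    using free_lifting[OF free_S free_S d A dA] by blast
  have "c = C (B c) \<oplus>\<^bsub>?F\<^esub> A (D c)" if c: "c \<in> carrier ?F" for c
    unfolding D(2)[OF c] by (rule F.eq_plus_diff[OF c module_hom_closed[OF CB c]])
  then show ?thesis using C(1) D(1) by blast
qed

section \<open>The base ring has depth two\<close>

lemma one_notin: "\<one> \<notin> \<nn>"
proof
  interpret n: ideal \<nn> S by (rule L)
  assume "\<one> \<in> \<nn>"
  then show False using n.one_imp_carrier primeideal.I_notcarr[OF L(5)] by simp
qed

text \<open>If the class of \<open>n\<close> were a unit, \<open>s n - 1\<close> would be a multiple
  of \<open>f\<close> for some \<open>s\<close>, and 1 would lie in \<open>\<nn>\<close>.\<close>

lemma rho_maximal:
  assumes "noetherian_local_ring R \<mm>" "n \<in> \<nn>"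
  shows "\<rho> n \<in> \<mm>"
proof (rule ccontr)
  interpret n: ideal \<nn> S by (rule L)
  interpret R: cring R by (rule R_cring)
  have n: "n \<in> carrier S" by (rule n.a_Hcarr[OF assms(2)])
  assume "\<rho> n \<notin> \<mm>"
  then obtain s' where s': "s' \<in> carrier R" "s' \<otimes>\<^bsub>R\<^esub> \<rho> n = \<one>\<^bsub>R\<^esub>"
    using local_ring_inverse[OF assms(1) rho_closed[OF n]] by blast
  obtain s where s: "s \<in> carrier S" "s' = \<rho> s" by (rule rho_surj[OF s'(1)])
  have "\<rho> (s \<otimes> n) = \<rho> \<one>" using s'(2) rho_simps(2)[OF s(1) n] rho_simps(3) s(2) by simp
  then have "s \<otimes> n \<ominus> \<one> \<in> I" using rho_eq[of "s \<otimes> n" \<one>] s(1) n by simp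
  then obtain c where c: "c \<in> carrier S" "s \<otimes> n \<ominus> \<one> = f \<otimes> c" using I_iff by blast
  have "\<one> = s \<otimes> n \<ominus> (s \<otimes> n \<ominus> \<one>)" using s(1) n by algebra
  also have "\<dots> = s \<otimes> n \<ominus> f \<otimes> c" by (simp only: c(2))
  also have "\<dots> \<in> \<nn>" unfolding minus_eq
    using n.I_l_closed[OF assms(2) s(1)] n.a_inv_closed[OF n.I_r_closed[OF fn c(1)]] by (rule n.a_closed)
  finally show False using one_notin by simp
qed

text \<open>Together with \<open>f\<close>, a lift \<open>x\<close> of a regular element
  \<open>y\<close> of \<open>R\<close> gives a regular sequence, and \<open>S / (f, x)\<close> is
  \<open>R / (y)\<close>. Its socle is nonzero by the dimension-one argument for
  \<open>R\<close>.\<close>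

lemma depth_two:
  assumes "noetherian_local_ring R \<mm>" "krull_dim R = 1" "y \<in> \<mm>" "y \<in> nonzerodivisors R"
  obtains x \<sigma> :: 's where "x \<in> carrier S" "\<rho> x = y" "depth_two_local_ring S \<nn> f x \<sigma>"
proof -
  note LR = noetherian_local_ringD[OF assms(1)]
  interpret R: cring R by (rule R_cring)
  interpret m: ideal \<mm> R by (rule LR)
  interpret n: ideal \<nn> S by (rule L)
  have y: "y \<in> carrier R" by (rule m.a_Hcarr[OF assms(3)])
  obtain x where x: "x \<in> carrier S" "y = \<rho> x" by (rule rho_surj[OF y])
  \<comment> \<open>The ideal generated by \<open>y\<close>, as a submodule of \<open>R\<close>; the
    unit element is the element outside it that starts the search for a socle element.\<close>
  define W where "W = (\<lambda>r. r \<otimes>\<^bsub>R\<^esub> y) ` carrier R"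
  have W: "submodule W R (self_module R)"
    using module.ideal_multiples_submodule[OF self_R R.oneideal, of y] y unfolding W_def by simp
  have "\<one>\<^bsub>R\<^esub> \<notin> W"
  proof
    assume "\<one>\<^bsub>R\<^esub> \<in> W"
    then obtain r where "\<one>\<^bsub>R\<^esub> = r \<otimes>\<^bsub>R\<^esub> y" "r \<in> carrier R" unfolding W_def by (rule imageE)
    then have "\<one>\<^bsub>R\<^esub> \<in> \<mm>" using m.I_l_closed[OF assms(3)] by simp
    then show False using m.one_imp_carrier primeideal.I_notcarr[OF LR(5)] by simp
  qed
  then have one: "\<one>\<^bsub>R\<^esub> \<in> carrier (self_module R) - W" by simp
  have "\<exists>g\<in>carrier (self_module R) - W. \<forall>r\<in>\<mm>. r \<odot>\<^bsub>self_module R\<^esub> g \<in> W"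
  proof (rule socle_mod_nonzerodivisor[OF assms(1,2,4) self_R W one])
    fix v assume "v \<in> carrier (self_module R)"
    then show "y \<odot>\<^bsub>self_module R\<^esub> v \<in> W" using R.m_comm[OF y] by (auto simp: W_def)
  qed
  then obtain g where g: "g \<in> carrier R" "g \<notin> W" "\<And>r. r \<in> \<mm> \<Longrightarrow> r \<otimes>\<^bsub>R\<^esub> g \<in> W" by auto
  obtain \<sigma> where \<sigma>: "\<sigma> \<in> carrier S" "g = \<rho> \<sigma>" by (rule rho_surj[OF g(1)])
  have rf: "\<rho> (f \<otimes> a) = \<zero>\<^bsub>R\<^esub>" if "a \<in> carrier S" for a
    using that rho_zero_iff[of "f \<otimes> a"] I_iff fc by auto
  have "depth_two_local_ring S \<nn> f x \<sigma>"
  proof (unfold_locales, rule local, rule f, rule x, rule \<sigma>)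
    fix s t assume st: "s \<in> carrier S" "t \<in> carrier S" "x \<otimes> s = f \<otimes> t"
    then have "y \<otimes>\<^bsub>R\<^esub> \<rho> s = \<zero>\<^bsub>R\<^esub>" using rf[OF st(2)] rho_simps(2)[OF x(1) st(1)] x(2) by simp
    then have "\<rho> s = \<zero>\<^bsub>R\<^esub>" using assms(4) rho_closed[OF st(1)] unfolding nonzerodivisors_def by blast
    then show "\<exists>c\<in>carrier S. s = f \<otimes> c" using rho_zero_iff[OF st(1)] I_iff by simp
  next
    fix a b assume ab: "a \<in> carrier S" "b \<in> carrier S"
    show "\<sigma> \<noteq> f \<otimes> a \<oplus> x \<otimes> b"
    proof
      assume "\<sigma> = f \<otimes> a \<oplus> x \<otimes> b"
      then have "g = \<rho> (f \<otimes> a) \<oplus>\<^bsub>R\<^esub> \<rho> (x \<otimes> b)" using rho_simps(1)[of "f \<otimes> a" "x \<otimes> b"] ab fc x \<sigma>(2) by simp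
      then have "g = \<rho> b \<otimes>\<^bsub>R\<^esub> y"
        using rf[OF ab(1)] rho_simps(2)[OF x(1) ab(2)] R.m_comm[OF y rho_closed[OF ab(2)]] x(2) y rho_closed[OF ab(2)]
        by (metis R.l_zero R.m_closed)
      then show False using g(2) rho_closed[OF ab(2)] unfolding W_def by blast
    qed
  next
    fix n assume nn: "n \<in> \<nn>"
    have n: "n \<in> carrier S" by (rule n.a_Hcarr[OF nn])
    have "\<rho> n \<otimes>\<^bsub>R\<^esub> g \<in> W" by (rule g(3)[OF rho_maximal[OF assms(1) nn]])
    then obtain r' where r': "\<rho> n \<otimes>\<^bsub>R\<^esub> g = r' \<otimes>\<^bsub>R\<^esub> y" "r' \<in> carrier R" unfolding W_def by (rule imageE)
    obtain r where r: "r \<in> carrier S" "r' = \<rho> r" by (rule rho_surj[OF r'(2)])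
    have "\<rho> (n \<otimes> \<sigma>) = \<rho> (r \<otimes> x)" using r'(1) \<sigma>(2) r(2) x(2) rho_simps(2)[OF n \<sigma>(1)] rho_simps(2)[OF r(1) x(1)] by simp
    then have "n \<otimes> \<sigma> \<ominus> r \<otimes> x \<in> I" using rho_eq[of "n \<otimes> \<sigma>" "r \<otimes> x"] n \<sigma>(1) r(1) x(1) by simp
    then obtain a where a: "a \<in> carrier S" "n \<otimes> \<sigma> \<ominus> r \<otimes> x = f \<otimes> a" using I_iff by blast
    have "\<sigma> \<otimes> n = (n \<otimes> \<sigma> \<ominus> r \<otimes> x) \<oplus> x \<otimes> r" using n \<sigma>(1) r(1) x(1) by algebra
    then have "\<sigma> \<otimes> n = f \<otimes> a \<oplus> x \<otimes> r" by (simp only: a(2))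
    with a(1) r(1) show "\<exists>a\<in>carrier S. \<exists>b\<in>carrier S. \<sigma> \<otimes> n = f \<otimes> a \<oplus> x \<otimes> b" by blast
  qed
  with x show thesis by (intro that) simp_all
qed

lemma submodule_restrict_scalars:
  assumes "module R M"
  shows "submodule K S (restrict_scalars \<rho> M) \<longleftrightarrow> submodule K R M"
proof
  interpret M: module R M by fact
  interpret N: module S "restrict_scalars \<rho> M" by (rule restricted[OF assms])
  {
    assume K: "submodule K S (restrict_scalars \<rho> M)"
    show "submodule K R M"
    proof (rule M.submoduleI_smult)
      show "K \<subseteq> carrier M" using N.submoduleE(1)[OF K] by simp
      show "\<zero>\<^bsub>M\<^esub> \<in> K" using N.submodule_zero[OF K] by simp
      show "a \<oplus>\<^bsub>M\<^esub> b \<in> K" if "a \<in> K" "b \<in> K" for a b using N.submoduleE(5)[OF K that] by simp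
      show "a \<odot>\<^bsub>M\<^esub> z \<in> K" if "a \<in> carrier R" "z \<in> K" for a z
      proof -
        obtain s where "s \<in> carrier S" "a = \<rho> s" by (rule rho_surj[OF \<open>a \<in> carrier R\<close>])
        then show ?thesis using N.submoduleE(4)[OF K _ \<open>z \<in> K\<close>, of s] by simp
      qed
    qed
  next
    assume K: "submodule K R M"
    show "submodule K S (restrict_scalars \<rho> M)"
    proof (rule N.submoduleI_smult)
      show "K \<subseteq> carrier (restrict_scalars \<rho> M)" using M.submoduleE(1)[OF K] by simp
      show "\<zero>\<^bsub>restrict_scalars \<rho> M\<^esub> \<in> K" using M.submodule_zero[OF K] by simp
      show "a \<oplus>\<^bsub>restrict_scalars \<rho> M\<^esub> b \<in> K" if "a \<in> K" "b \<in> K" for a b using M.submoduleE(5)[OF K that] by simp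
      show "a \<odot>\<^bsub>restrict_scalars \<rho> M\<^esub> z \<in> K" if "a \<in> carrier S" "z \<in> K" for a z
        using M.submoduleE(4)[OF K rho_closed[OF that(1)] that(2)] by simp
    qed
  }
qed

lemma noetherian_restrict_scalars:
  assumes "module R M" "noetherian_module R M"
  shows "noetherian_module S (restrict_scalars \<rho> M)"
  using assms(2) submodule_restrict_scalars[OF assms(1)]
  by (simp add: noetherian_module_def submodule_generated_def)

lemma f_kills: "module R M \<Longrightarrow> z \<in> carrier M \<Longrightarrow> f \<odot>\<^bsub>restrict_scalars \<rho> M\<^esub> z = \<zero>\<^bsub>M\<^esub>"
proof -
  assume M: "module R M" and z: "z \<in> carrier M"
  interpret M: module R M by (rule M)
  have "f = f \<otimes> \<one>" using fc by simp
  then have "\<rho> f = \<zero>\<^bsub>R\<^esub>" using rho_zero_iff[OF fc] I_iff by blast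
  then show ?thesis using z by simp
qed

section \<open>Torsion-free modules of finite projective dimension\<close>

text \<open>The kernel of a minimal cover is free with basis map \<open>\<beta>\<close>. Since
  \<open>f\<close> kills \<open>M\<close>, multiplication by \<open>f\<close> factors as
  \<open>\<beta> B\<close>, and injectivity of \<open>\<beta>\<close> gives
  \<open>B \<beta> = f\<close> as well. The two equations bound the ranks in both directions, so the
  matrices are square.\<close>

lemma finite_proj_dim_factorization:
  fixes M :: "('s set, 'm) module" and \<sigma> :: 's
  assumes M: "module R M" "noetherian_module R M"
    and dt: "depth_two_local_ring S \<nn> f x \<sigma>"
    and reg: "\<forall>z\<in>carrier M. \<rho> x \<odot>\<^bsub>M\<^esub> z = \<zero>\<^bsub>M\<^esub> \<longrightarrow> z = \<zero>\<^bsub>M\<^esub>"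
    and pd: "proj_dim S (restrict_scalars \<rho> M) < \<infinity>"
  shows "\<exists>(m::nat) \<pi> A B. \<pi> \<in> module_hom S (free_module S {..<m}) (restrict_scalars \<rho> M) \<and>
    \<pi> ` carrier (free_module S {..<m}) = carrier M \<and>
    (\<forall>c\<in>carrier (free_module S {..<m}). \<pi> c = \<zero>\<^bsub>M\<^esub> \<longleftrightarrow> c \<in> A ` carrier (free_module S {..<m})) \<and>
    (\<forall>c\<in>carrier (free_module S {..<m}). \<forall>i. \<pi> c = \<zero>\<^bsub>M\<^esub> \<longrightarrow> c i \<in> \<nn>) \<and>
    A \<in> module_hom S (free_module S {..<m}) (free_module S {..<m}) \<and>
    B \<in> module_hom S (free_module S {..<m}) (free_module S {..<m}) \<and>
    (\<forall>c\<in>carrier (free_module S {..<m}). A (B c) = f \<odot>\<^bsub>free_module S {..<m}\<^esub> c) \<and>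
    (\<forall>c\<in>carrier (free_module S {..<m}). B (A c) = f \<odot>\<^bsub>free_module S {..<m}\<^esub> c)"
proof -
  interpret D: depth_two_local_ring S \<nn> f x \<sigma> by (rule dt)
  let ?N = "restrict_scalars \<rho> M"
  interpret M: module R M by (rule M(1))
  have mN: "module S ?N" by (rule restricted[OF M(1)])
  interpret N: module S ?N by (rule mN)
  obtain m :: nat and g where g: "g \<in> {..<m} \<rightarrow> carrier ?N"
    "linear_extension S ?N g ` carrier (free_module S {..<m}) = carrier ?N"
    "\<And>c i. c \<in> carrier (free_module S {..<m}) \<Longrightarrow> linear_extension S ?N g c = \<zero>\<^bsub>?N\<^esub> \<Longrightarrow> c i \<in> \<nn>"
    by (rule minimal_generators[OF local mN noetherian_restrict_scalars[OF M] N.carrier_is_submodule], rule that, assumption, assumption, simp)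
  let ?F = "free_module S {..<m}"
  have mF: "module S ?F" by (rule free_S)
  interpret F: module S ?F by (rule mF)
  define \<pi> where "\<pi> = linear_extension S ?N g"
  have \<pi>: "\<pi> \<in> module_hom S ?F ?N" unfolding \<pi>_def by (rule linear_extension_hom[OF mN g(1)])
  have surj: "\<pi> ` carrier ?F = carrier ?N" unfolding \<pi>_def by (rule g(2))
  have min: "\<And>c i. c \<in> carrier ?F \<Longrightarrow> \<pi> c = \<zero>\<^bsub>?N\<^esub> \<Longrightarrow> c i \<in> \<nn>" unfolding \<pi>_def by (rule g(3))
  define K where "K = {c \<in> carrier ?F. \<pi> c = \<zero>\<^bsub>?N\<^esub>}"
  have K: "submodule K S ?F" using kernel_submodule[OF mF mN \<pi> N.zero_submodule] by (simp add: K_def)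
  have deep: "D.deep ?F K" unfolding K_def
  proof (rule D.deep_kernel[OF mN \<pi>])
    fix z assume "z \<in> carrier ?N" "x \<odot>\<^bsub>?N\<^esub> z = \<zero>\<^bsub>?N\<^esub>"
    then show "z = \<zero>\<^bsub>?N\<^esub>" using reg by simp
  qed
  \<comment> \<open>The infimum over the empty set is infinite, so a finite value comes from an
    actual resolution of finite length.\<close>
  have "{enat n | n. \<exists>(P :: nat \<Rightarrow> ('s, 'm + nat \<Rightarrow> 's) module) d \<epsilon>.
       projective_resolution S ?N P d \<epsilon> \<and> (\<forall>i>n. carrier (P i) = {\<zero>\<^bsub>P i\<^esub>})} \<noteq> {}"
  proof
    assume e: "{enat n | n. \<exists>(P :: nat \<Rightarrow> ('s, 'm + nat \<Rightarrow> 's) module) d \<epsilon>.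
       projective_resolution S ?N P d \<epsilon> \<and> (\<forall>i>n. carrier (P i) = {\<zero>\<^bsub>P i\<^esub>})} = {}"
    have "proj_dim S ?N = \<infinity>" unfolding proj_dim_def e by (simp add: top_enat_def)
    then show False using pd by simp
  qed
  then obtain n and P :: "nat \<Rightarrow> ('s, 'm + nat \<Rightarrow> 's) module" and d \<epsilon> where
    res: "projective_resolution S ?N P d \<epsilon>" and len: "\<And>i. n < i \<Longrightarrow> carrier (P i) = {\<zero>\<^bsub>P i\<^esub>}"
    by blast
  have P0: "projective_module S (P 0)" "\<epsilon> \<in> module_hom S (P 0) ?N" "\<epsilon> ` carrier (P 0) = carrier ?N"
    "{c \<in> carrier (P 0). \<epsilon> c = \<zero>\<^bsub>?N\<^esub>} = d 0 ` carrier (P (Suc 0))"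
    using res by (simp_all add: projective_resolution_def a_kernel_def')
  have "stable_retract S (?F\<lparr>carrier := K\<rparr>) (P 0\<lparr>carrier := d 0 ` carrier (P (Suc 0))\<rparr>)"
    using stable_retract_syzygy[OF mN mN stable_retract_refl[OF mN] \<pi> surj P0(1-3)] unfolding P0(4) K_def .
  from D.free_syzygy[OF res len K deep this] obtain k :: nat and \<beta> where
    \<beta>: "\<beta> \<in> module_hom S (free_module S {..<k}) ?F" "\<beta> ` carrier (free_module S {..<k}) = K"
      "\<forall>c\<in>carrier (free_module S {..<k}). \<beta> c = \<zero>\<^bsub>?F\<^esub> \<longrightarrow> c = \<zero>\<^bsub>free_module S {..<k}\<^esub>" by blast
  let ?G = "free_module S {..<k}"
  have mG: "module S ?G" by (rule free_S)
  interpret G: module S ?G by (rule mG)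
  have fK: "f \<odot>\<^bsub>?F\<^esub> c \<in> \<beta> ` carrier ?G" if c: "c \<in> carrier ?F" for c
  proof -
    have "\<pi> (f \<odot>\<^bsub>?F\<^esub> c) = \<zero>\<^bsub>?N\<^esub>"
      using module_hom_smult[OF \<pi> fc c] f_kills[OF M(1), of "\<pi> c"] module_hom_closed[OF \<pi> c] by simp
    then show ?thesis unfolding \<beta>(2) K_def using F.smult_closed[OF fc c] by simp
  qed
  obtain B where B: "B \<in> module_hom S ?F ?G" "\<And>c. c \<in> carrier ?F \<Longrightarrow> \<beta> (B c) = f \<odot>\<^bsub>?F\<^esub> c"
    using free_lifting[OF mG mF F.scaling_hom[OF fc] \<beta>(1) fK] by blast
  have BA: "B (\<beta> c) = f \<odot>\<^bsub>?G\<^esub> c" if c: "c \<in> carrier ?G" for c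
  proof -
    have b: "\<beta> c \<in> carrier ?F" by (rule module_hom_closed[OF \<beta>(1) c])
    have c1: "B (\<beta> c) \<in> carrier ?G" by (rule module_hom_closed[OF B(1) b])
    have c2: "f \<odot>\<^bsub>?G\<^esub> c \<in> carrier ?G" by (rule G.smult_closed[OF fc c])
    have "\<beta> (B (\<beta> c)) = \<beta> (f \<odot>\<^bsub>?G\<^esub> c)" using B(2)[OF b] module_hom_smult[OF \<beta>(1) fc c] by (simp del: free_module_simps)
    then have "\<beta> (B (\<beta> c) \<ominus>\<^bsub>?G\<^esub> f \<odot>\<^bsub>?G\<^esub> c) = \<zero>\<^bsub>?F\<^esub>"
      using module_hom_minus[OF mG mF \<beta>(1) c1 c2] module_hom_closed[OF \<beta>(1) c2]
      by (simp add: F.M.minus_eq F.M.r_neg del: free_module_simps)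
    then have "B (\<beta> c) \<ominus>\<^bsub>?G\<^esub> f \<odot>\<^bsub>?G\<^esub> c = \<zero>\<^bsub>?G\<^esub>" using \<beta>(3) G.M.minus_closed[OF c1 c2] by blast
    then show ?thesis using G.diff_eq_zero_iff[OF c1 c2] by simp
  qed
  have 10: "\<one> \<noteq> \<zero>"
  proof
    interpret n: ideal \<nn> S by (rule L)
    assume "\<one> = \<zero>"
    then show False using one_notin n.zero_closed by simp
  qed
  have "m \<le> k" by (rule square_matrix[OF is_cring L(2) 10 f \<beta>(1) B(1) B(2)])
  moreover have "k \<le> m" by (rule square_matrix[OF is_cring L(2) 10 f B(1) \<beta>(1) BA])
  ultimately have km: "k = m" by simp
  show ?thesis
  proof (intro exI conjI)
    show "\<pi> \<in> module_hom S ?F ?N" by (rule \<pi>)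
    show "\<pi> ` carrier ?F = carrier M" using surj by simp
    show "\<forall>c\<in>carrier ?F. \<pi> c = \<zero>\<^bsub>M\<^esub> \<longleftrightarrow> c \<in> \<beta> ` carrier ?F"
      using \<beta>(2) unfolding km by (simp add: K_def)
    show "\<forall>c\<in>carrier ?F. \<forall>i. \<pi> c = \<zero>\<^bsub>M\<^esub> \<longrightarrow> c i \<in> \<nn>" using min by simp
    show "\<beta> \<in> module_hom S ?F ?F" using \<beta>(1) unfolding km .
    show "B \<in> module_hom S ?F ?F" using B(1) unfolding km .
    show "\<forall>c\<in>carrier ?F. \<beta> (B c) = f \<odot>\<^bsub>?F\<^esub> c" using B(2) by blast
    show "\<forall>c\<in>carrier ?F. B (\<beta> c) = f \<odot>\<^bsub>?F\<^esub> c" using BA unfolding km by blast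
  qed
qed

lemma finite_proj_dim_has_torsion:
  fixes M :: "('s set, 'm) module"
  assumes cm: "cohen_macaulay_local_ring R" "krull_dim R = 1"
    and M: "module R M" "finitely_generated_module R M" "has_rank R M"
    and nf: "\<not> is_free_module R M" and tf: "torsion_free R M"
    and pd: "proj_dim S (restrict_scalars \<rho> M) < \<infinity>"
  shows "has_torsion R (tensor_module R M (dual_module R M))"
proof (rule ccontr)
  assume nt: "\<not> has_torsion R (tensor_module R M (dual_module R M))"
  interpret M: module R M by (rule M(1))
  interpret n: ideal \<nn> S by (rule L)
  obtain \<mm> y where y: "noetherian_local_ring R \<mm>" "y \<in> \<mm>" "y \<in> nonzerodivisors R"
    by (rule cohen_macaulay_nonzerodivisor[OF cm])
  note LR = noetherian_local_ringD[OF y(1)]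
  obtain x \<sigma> where x: "x \<in> carrier S" "\<rho> x = y" "depth_two_local_ring S \<nn> f x \<sigma>"
    by (rule depth_two[OF y(1) cm(2) y(2,3)])
  have reg: "\<forall>z\<in>carrier M. \<rho> x \<odot>\<^bsub>M\<^esub> z = \<zero>\<^bsub>M\<^esub> \<longrightarrow> z = \<zero>\<^bsub>M\<^esub>"
  proof (intro ballI impI)
    fix z assume z: "z \<in> carrier M" "\<rho> x \<odot>\<^bsub>M\<^esub> z = \<zero>\<^bsub>M\<^esub>"
    have "z \<in> torsion_submodule R M"
      by (rule killed_by_nonzerodivisor_torsion[OF M(1) y(3) z(1)]) (use z(2) x(2) in simp)
    then show "z = \<zero>\<^bsub>M\<^esub>" using tf by (simp add: torsion_free_def)
  qed
  obtain m :: nat and \<pi> A B where H: "\<pi> \<in> module_hom S (free_module S {..<m}) (restrict_scalars \<rho> M) \<and>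
    \<pi> ` carrier (free_module S {..<m}) = carrier M \<and>
    (\<forall>c\<in>carrier (free_module S {..<m}). \<pi> c = \<zero>\<^bsub>M\<^esub> \<longleftrightarrow> c \<in> A ` carrier (free_module S {..<m})) \<and>
    (\<forall>c\<in>carrier (free_module S {..<m}). \<forall>i. \<pi> c = \<zero>\<^bsub>M\<^esub> \<longrightarrow> c i \<in> \<nn>) \<and>
    A \<in> module_hom S (free_module S {..<m}) (free_module S {..<m}) \<and>
    B \<in> module_hom S (free_module S {..<m}) (free_module S {..<m}) \<and>
    (\<forall>c\<in>carrier (free_module S {..<m}). A (B c) = f \<odot>\<^bsub>free_module S {..<m}\<^esub> c) \<and>
    (\<forall>c\<in>carrier (free_module S {..<m}). B (A c) = f \<odot>\<^bsub>free_module S {..<m}\<^esub> c)"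
    using finite_proj_dim_factorization[OF M(1) noetherian_finitely_generated[OF LR(1,2) M(1,2)] x(3) reg pd]
    by (elim exE) (rule that, assumption)
  note H = H[THEN conjunct1] H[THEN conjunct2, THEN conjunct1] H[THEN conjunct2, THEN conjunct2, THEN conjunct1, THEN bspec]
    H[THEN conjunct2, THEN conjunct2, THEN conjunct2, THEN conjunct1, THEN bspec, THEN spec, THEN mp]
    H[THEN conjunct2, THEN conjunct2, THEN conjunct2, THEN conjunct2]
  note \<pi> = H(1-4) and A = H(5)[THEN conjunct1] and B = H(5)[THEN conjunct2, THEN conjunct1]
    and AB = H(5)[THEN conjunct2, THEN conjunct2, THEN conjunct1, THEN bspec]
    and BA = H(5)[THEN conjunct2, THEN conjunct2, THEN conjunct2, THEN bspec]
  let ?F = "free_module S {..<m}" and ?G = "free_module R {..<m}"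
  have mF: "module S ?F" by (rule free_S)
  interpret F: module S ?F by (rule mF)
  obtain C D where C: "C \<in> module_hom S ?F ?F" and D: "D \<in> module_hom S ?F ?F"
    and CD: "\<And>c. c \<in> carrier ?F \<Longrightarrow> c = C (B c) \<oplus>\<^bsub>?F\<^esub> A (D c)"
    using factorization_splits[OF cm M nt A B AB BA \<pi>(1-3)] by blast
  note Ac = module_hom_closed[OF A]
  \<comment> \<open>Nakayama's lemma for the vector \<open>A d\<close>, the map \<open>A D\<close>
    and the ideal \<open>(f)\<close>. The entries of \<open>A D\<close> are in \<open>\<nn>\<close>
    because the image of \<open>A\<close> consists of relations of a minimal cover.\<close>
  have AI: "A d i \<in> I" if d: "d \<in> carrier ?F" for d i
  proof (rule vector_nakayama[OF local module_hom_comp[OF D A] _ I Ac[OF d]])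
    fix v i assume v: "v \<in> carrier ?F"
    have "A (D v) \<in> A ` carrier ?F" using module_hom_closed[OF D v] by (rule imageI)
    then show "A (D v) i \<in> \<nn>" using \<pi>(3,4)[OF module_hom_closed[OF A module_hom_closed[OF D v]]] by blast
  next
    fix i
    let ?c = "A d"
    have Cd: "C d \<in> carrier ?F" by (rule module_hom_closed[OF C d])
    have ADc: "A (D ?c) \<in> carrier ?F" by (rule Ac[OF module_hom_closed[OF D Ac[OF d]]])
    have "C (B ?c) = f \<odot>\<^bsub>?F\<^esub> C d" using BA[OF d] module_hom_smult[OF C fc d] by simp
    then have "?c = f \<odot>\<^bsub>?F\<^esub> C d \<oplus>\<^bsub>?F\<^esub> A (D ?c)" using CD[OF Ac[OF d]] by simp
    then have "?c i = (f \<odot>\<^bsub>?F\<^esub> C d \<oplus>\<^bsub>?F\<^esub> A (D ?c)) i" by (rule fun_cong)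
    then have e: "?c i = f \<otimes> C d i \<oplus> A (D ?c) i" by simp
    have cc: "C d i \<in> carrier S" "A (D ?c) i \<in> carrier S" using Cd ADc by (simp_all add: free_module_carrier_iff)
    have "?c i \<ominus> A (D ?c) i = f \<otimes> C d i" unfolding e using cc fc by algebra
    then show "?c i \<ominus> A (D ?c) i \<in> I" using I_iff cc(1) by blast
  qed
  obtain h where h: "h \<in> module_hom R ?G M" "\<forall>c\<in>carrier ?F. h (\<rho>v c) = \<pi> c"
    using hom_descends[OF M(1) \<pi>(1)] by (rule bexE)
  have "is_free_module R M"
  \<comment> \<open>The columns of \<open>A\<close> vanish over \<open>R\<close>, so the reduced
    cover has kernel zero.\<close>
  proof (rule free_from_bijection[OF M(1) _ h(1)])
    interpret m: ideal \<mm> R by (rule LR)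
    show "\<one>\<^bsub>R\<^esub> \<noteq> \<zero>\<^bsub>R\<^esub>"
      using m.zero_closed m.one_imp_carrier primeideal.I_notcarr[OF LR(5)] by metis
    show "h ` carrier ?G = carrier M"
    proof
      show "h ` carrier ?G \<subseteq> carrier M" using module_hom_closed[OF h(1)] by blast
      show "carrier M \<subseteq> h ` carrier ?G"
      proof
        fix z assume "z \<in> carrier M"
        then obtain c where c: "z = \<pi> c" "c \<in> carrier ?F" unfolding \<pi>(2)[symmetric] by (rule imageE)
        then have "z = h (\<rho>v c)" using h(2) by simp
        then show "z \<in> h ` carrier ?G" using reduction_closed[OF c(2)] by (rule image_eqI)
      qed
    qed
    fix v assume v: "v \<in> carrier ?G" "h v = \<zero>\<^bsub>M\<^esub>"
    obtain c where c: "c \<in> carrier ?F" "v = \<rho>v c" by (rule reduction_surj[OF v(1)])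
    then have "c \<in> A ` carrier ?F" using v(2) h(2) \<pi>(3)[OF c(1)] by simp
    then obtain d where d: "c = A d" "d \<in> carrier ?F" by (rule imageE)
    have "\<rho> (c i) = \<zero>\<^bsub>R\<^esub>" for i
      using rho_zero_iff[of "c i"] AI[OF d(2), of i] c(1) d(1) by (simp add: free_module_carrier_iff)
    then show "v = \<zero>\<^bsub>?G\<^esub>" unfolding c(2) by simp
  qed
  with nf show False by simp
qed

section \<open>Reduced matrix factorizations\<close>

lemma vectors_submodule:
  assumes "ideal J S"
  shows "submodule {w \<in> carrier (free_module S {..<m::nat}). \<forall>i. w i \<in> J} S (free_module S {..<m})"
proof -
  interpret J: ideal J S by fact
  interpret F: module S "free_module S {..<m}" by (rule free_S)
  show ?thesis
    by (rule F.submoduleI_smult) (auto simp: free_module_carrier_nat J.I_l_closed)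
qed

text \<open>Each product of a coordinate of \<open>v\<close> with an entry of \<open>h\<close> needs
  just one factor in \<open>J\<close>. Both cases occur: for \<open>C B\<close> the vector has its
  entries in the ideal, for \<open>A D\<close> the matrix has.\<close>

lemma hom_into_vectors:
  fixes m :: nat
  assumes "ideal J S" and h: "h \<in> module_hom S (free_module S {..<m}) (free_module S {..<m})"
    and v: "v \<in> carrier (free_module S {..<m})"
    and vJ: "\<And>j i. j < m \<Longrightarrow> i < m \<Longrightarrow> v j \<in> J \<or> h (basis_vector S j) i \<in> J"
  shows "h v i \<in> J"
proof -
  interpret J: ideal J S by fact
  let ?F = "free_module S {..<m}" and ?H = "{w \<in> carrier (free_module S {..<m}). \<forall>i. w i \<in> J}"
  interpret F: module S ?F by (rule free_S)
  have "linear_extension S ?F (\<lambda>j. h (basis_vector S j)) v \<in> ?H"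
  proof (rule F.linear_extension_mem[OF vectors_submodule[OF assms(1)] v])
    fix j assume "j \<in> {..<m}"
    then have j: "j < m" and "j \<in> {..<m}" by simp_all
    have hj: "h (basis_vector S j) \<in> carrier ?F"
      by (rule module_hom_closed[OF h basis_vector_closed[OF is_cring]]) (use j in simp)
    have vj: "v j \<in> carrier S" using v by (simp add: free_module_carrier_iff)
    have "v j \<otimes> h (basis_vector S j) i \<in> J" for i
    proof (cases "i < m")
      case True
      have "h (basis_vector S j) i \<in> carrier S" using hj by (simp add: free_module_carrier_iff)
      then show ?thesis using vJ[OF j True] vj J.I_l_closed J.I_r_closed by blast
    next
      case False
      then have "h (basis_vector S j) i = \<zero>" using hj by (simp add: free_module_carrier_nat)
      then show ?thesis using vj by simp
    qed
    then show "v j \<odot>\<^bsub>?F\<^esub> h (basis_vector S j) \<in> ?H" using F.smult_closed[OF vj hj] by simp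
  qed
  then show ?thesis using hom_eq_linear_extension[OF free_S h v] by simp
qed

lemma reduced_factorization_has_torsion:
  fixes M :: "('s set, 'm) module"
  assumes cm: "cohen_macaulay_local_ring R" "krull_dim R = 1"
    and M: "module R M" "finitely_generated_module R M" "has_rank R M"
    and mf: "reduced_matrix_factorization S \<nn> f m \<alpha> \<beta>"
    and iso: "module_isomorphic R M (descend_scalars (matrix_cokernel S m \<alpha>))"
  shows "has_torsion R (tensor_module R M (dual_module R M))"
proof (rule ccontr)
  assume nt: "\<not> has_torsion R (tensor_module R M (dual_module R M))"
  have m: "0 < m" and \<alpha>: "\<And>i j. i < m \<Longrightarrow> j < m \<Longrightarrow> \<alpha> i j \<in> carrier S" and \<beta>: "\<And>i j. i < m \<Longrightarrow> j < m \<Longrightarrow> \<beta> i j \<in> carrier S"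
    and \<alpha>\<beta>: "\<And>i j. i < m \<Longrightarrow> j < m \<Longrightarrow> (\<Oplus>k\<in>{..<m}. \<alpha> i k \<otimes> \<beta> k j) = (if i = j then f else \<zero>)"
    and \<beta>\<alpha>: "\<And>i j. i < m \<Longrightarrow> j < m \<Longrightarrow> (\<Oplus>k\<in>{..<m}. \<beta> i k \<otimes> \<alpha> k j) = (if i = j then f else \<zero>)"
    and n: "\<And>i j. i < m \<Longrightarrow> j < m \<Longrightarrow> \<alpha> i j \<in> \<nn>" "\<And>i j. i < m \<Longrightarrow> j < m \<Longrightarrow> \<beta> i j \<in> \<nn>"
    using mf unfolding reduced_matrix_factorization_def matrix_factorization_def by simp_all
  let ?F = "free_module S {..<m}"
  interpret F: module S ?F by (rule free_S)
  interpret M: module R M by (rule M(1))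
  interpret n: ideal \<nn> S by (rule L)
  define A B where "A = matrix_map S m \<alpha>" and "B = matrix_map S m \<beta>"
  have A: "A \<in> module_hom S ?F ?F" and B: "B \<in> module_hom S ?F ?F"
    unfolding A_def B_def by (rule matrix_map_hom[OF \<alpha>], assumption+, rule matrix_map_hom[OF \<beta>])
  have AB: "A (B c) = f \<odot>\<^bsub>?F\<^esub> c" and BA: "B (A c) = f \<odot>\<^bsub>?F\<^esub> c" if "c \<in> carrier ?F" for c
    unfolding A_def B_def using matrix_map_mult_scalar[OF \<alpha> \<beta> fc \<alpha>\<beta> that] matrix_map_mult_scalar[OF \<beta> \<alpha> fc \<beta>\<alpha> that] by simp_all
  define K where "K = A ` carrier ?F"
  have K: "submodule K S ?F" unfolding K_def by (rule image_submodule[OF F.module_axioms F.module_axioms A F.carrier_is_submodule])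
  let ?Q = "quotient_module ?F K"
  interpret Q: module S ?Q by (rule F.quotient_module_module[OF K])
  define q where "q c = K +>\<^bsub>?F\<^esub> c" for c
  have q: "q \<in> module_hom S ?F ?Q" unfolding q_def by (rule F.quotient_hom[OF K])
  have q0: "q c = \<zero>\<^bsub>?Q\<^esub> \<longleftrightarrow> c \<in> K" if "c \<in> carrier ?F" for c
    unfolding q_def quotient_module_simps(2) by (rule F.coset_zero[OF K that])
  \<comment> \<open>The cokernel of \<open>A\<close> is killed by \<open>f\<close>, as
    \<open>f c = A (B c)\<close> for every vector \<open>c\<close>.\<close>
  have fq: "(f \<otimes> a) \<odot>\<^bsub>?Q\<^esub> q c = \<zero>\<^bsub>?Q\<^esub>" if a: "a \<in> carrier S" and c: "c \<in> carrier ?F" for a c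
  proof -
    have ac: "a \<odot>\<^bsub>?F\<^esub> c \<in> carrier ?F" by (rule F.smult_closed[OF a c])
    have "f \<odot>\<^bsub>?F\<^esub> (a \<odot>\<^bsub>?F\<^esub> c) \<in> K" unfolding K_def AB[OF ac, symmetric] using module_hom_closed[OF B ac] by (rule imageI)
    then have "q (f \<odot>\<^bsub>?F\<^esub> (a \<odot>\<^bsub>?F\<^esub> c)) = \<zero>\<^bsub>?Q\<^esub>" using q0[OF F.smult_closed[OF fc ac]] by simp
    then show ?thesis
      using module_hom_smult[OF q fc ac] module_hom_smult[OF q a c] Q.smult_assoc1[OF fc a module_hom_closed[OF q c]] by simp
  qed
  \<comment> \<open>All elements of a coset of \<open>(f)\<close> act alike on the cokernel, so the
    image in \<open>descend_scalars\<close> is a singleton and \<open>the_elem\<close> returns the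
    expected product.\<close>
  have desc: "\<rho> s \<odot>\<^bsub>descend_scalars ?Q\<^esub> q c = s \<odot>\<^bsub>?Q\<^esub> q c" if s: "s \<in> carrier S" and c: "c \<in> carrier ?F" for s c
  proof -
    note qc = module_hom_closed[OF q c]
    have e: "t \<odot>\<^bsub>?Q\<^esub> q c = s \<odot>\<^bsub>?Q\<^esub> q c" if "t \<in> I +> s" for t
    proof -
      from that obtain a where a: "a \<in> carrier S" "t = f \<otimes> a \<oplus> s" using I_iff by (auto simp: a_r_coset_def')
      then show ?thesis using fq[OF a(1) c] Q.smult_l_distr[OF m_closed[OF fc a(1)] s qc] Q.smult_closed[OF s qc] by simp
    qed
    have "\<zero> \<in> I" by (rule additive_subgroup.zero_closed[OF ideal.axioms(1)[OF I]])
    then have "s \<in> I +> s" using s by (auto simp: a_r_coset_def' intro!: bexI[of _ \<zero>])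
    then have "(\<lambda>t. t \<odot>\<^bsub>?Q\<^esub> q c) ` (I +> s) = {s \<odot>\<^bsub>?Q\<^esub> q c}" using e by blast
    then show ?thesis by (simp add: descend_scalars_def)
  qed
  have coker: "matrix_cokernel S m \<alpha> = ?Q" by (simp add: matrix_cokernel_def K_def A_def)
  have dsimps: "carrier (descend_scalars ?Q) = carrier ?Q" "add (descend_scalars ?Q) = add ?Q" by (simp_all add: descend_scalars_def)
  obtain h where h: "h \<in> module_hom R M (descend_scalars ?Q)" "bij_betw h (carrier M) (carrier ?Q)"
    using iso unfolding coker module_isomorphic_def dsimps by blast
  note hadd = module_hom_add[OF h(1), unfolded dsimps]
  have hinj: "inj_on h (carrier M)" and him: "h ` carrier M = carrier ?Q" using h(2) by (simp_all add: bij_betw_def)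
  \<comment> \<open>The projection to the cokernel followed by the inverse of the isomorphism.
    Linearity is checked through injectivity of \<open>h\<close>, without module laws for the
    descended cokernel.\<close>
  define \<pi> where "\<pi> c = inv_into (carrier M) h (q c)" for c
  have \<pi>c: "\<pi> c \<in> carrier M" and h\<pi>: "h (\<pi> c) = q c" if "c \<in> carrier ?F" for c
  proof -
    have "q c \<in> h ` carrier M" unfolding him by (rule module_hom_closed[OF q that])
    then show "\<pi> c \<in> carrier M" "h (\<pi> c) = q c" unfolding \<pi>_def by (rule inv_into_into, rule f_inv_into_f)
  qed
  have \<pi>I: "z = \<pi> c" if "z \<in> carrier M" "c \<in> carrier ?F" "h z = q c" for z c
    using inj_onD[OF hinj _ that(1) \<pi>c[OF that(2)]] h\<pi>[OF that(2)] that(3) by simp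
  have \<pi>: "\<pi> \<in> module_hom S ?F (restrict_scalars \<rho> M)"
  proof (rule module_homI)
    fix c assume c: "c \<in> carrier ?F"
    then show "\<pi> c \<in> carrier (restrict_scalars \<rho> M)" using \<pi>c by simp
    show "\<pi> (s \<odot>\<^bsub>?F\<^esub> c) = s \<odot>\<^bsub>restrict_scalars \<rho> M\<^esub> \<pi> c" if s: "s \<in> carrier S" for s
    proof -
      have "h (\<rho> s \<odot>\<^bsub>M\<^esub> \<pi> c) = q (s \<odot>\<^bsub>?F\<^esub> c)"
        using module_hom_smult[OF h(1) rho_closed[OF s] \<pi>c[OF c]] h\<pi>[OF c] desc[OF s c] module_hom_smult[OF q s c] by simp
      then show ?thesis
        using \<pi>I[OF M.smult_closed[OF rho_closed[OF s] \<pi>c[OF c]] F.smult_closed[OF s c]] by simp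
    qed
    fix d assume d: "d \<in> carrier ?F"
    have "h (\<pi> c \<oplus>\<^bsub>M\<^esub> \<pi> d) = q (c \<oplus>\<^bsub>?F\<^esub> d)"
      using hadd[OF \<pi>c[OF c] \<pi>c[OF d]] h\<pi>[OF c] h\<pi>[OF d] module_hom_add[OF q c d] by simp
    then show "\<pi> (c \<oplus>\<^bsub>?F\<^esub> d) = \<pi> c \<oplus>\<^bsub>restrict_scalars \<rho> M\<^esub> \<pi> d"
      using \<pi>I[OF M.a_closed[OF \<pi>c[OF c] \<pi>c[OF d]] F.M.a_closed[OF c d]] by simp
  qed
  have surj: "\<pi> ` carrier ?F = carrier M"
  proof
    show "\<pi> ` carrier ?F \<subseteq> carrier M" using \<pi>c by blast
    show "carrier M \<subseteq> \<pi> ` carrier ?F"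
    proof
      fix z assume z: "z \<in> carrier M"
      then have "h z \<in> carrier ?Q" unfolding him[symmetric] by (rule imageI)
      then obtain c where c: "c \<in> carrier ?F" "h z = q c" unfolding q_def by (rule quotient_module_carrierE)
      show "z \<in> \<pi> ` carrier ?F" using \<pi>I[OF z c] c(1) by (rule image_eqI)
    qed
  qed
  have \<pi>0: "\<pi> c = \<zero>\<^bsub>M\<^esub> \<longleftrightarrow> c \<in> A ` carrier ?F" if c: "c \<in> carrier ?F" for c
  proof -
    have "\<pi> \<zero>\<^bsub>?F\<^esub> = \<zero>\<^bsub>M\<^esub>" using module_hom_zero[OF F.module_axioms restricted[OF M(1)] \<pi>] by simp
    then have "h \<zero>\<^bsub>M\<^esub> = \<zero>\<^bsub>?Q\<^esub>"
      using h\<pi>[OF F.M.zero_closed] module_hom_zero[OF F.module_axioms Q.module_axioms q] by metis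
    then have "\<pi> c = \<zero>\<^bsub>M\<^esub> \<longleftrightarrow> q c = \<zero>\<^bsub>?Q\<^esub>" using h\<pi>[OF c] \<pi>I[OF M.zero_closed c] by metis
    then show ?thesis using q0[OF c] by (simp add: K_def)
  qed
  obtain C D where C: "C \<in> module_hom S ?F ?F" and D: "D \<in> module_hom S ?F ?F"
    and CD: "\<And>c. c \<in> carrier ?F \<Longrightarrow> c = C (B c) \<oplus>\<^bsub>?F\<^esub> A (D c)"
    using factorization_splits[OF cm M nt A B AB BA \<pi> surj \<pi>0] by blast
  \<comment> \<open>There is a basis vector since \<open>m\<close> is positive; coordinate 0 of
    \<open>1 = C B + A D\<close> applied to it puts 1 into \<open>\<nn>\<close>.\<close>
  let ?e = "basis_vector S (0::nat)"
  have e: "?e \<in> carrier ?F" by (rule basis_vector_closed[OF is_cring]) (use m in simp)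
  have Bn: "B ?e j \<in> \<nn>" if "j < m" for j
    unfolding B_def using matrix_map_basis[of m \<beta> j 0] \<beta> that m n(2) by simp
  have 1: "C (B ?e) 0 \<in> \<nn>"
    by (rule hom_into_vectors[OF n.ideal_axioms C module_hom_closed[OF B e]]) (use Bn in blast)
  have An: "A (basis_vector S j) i \<in> \<nn>" if "j < m" "i < m" for i j
    unfolding A_def using matrix_map_basis[of m \<alpha> i j] \<alpha> that n(1) by simp
  have 2: "A (D ?e) 0 \<in> \<nn>"
    by (rule hom_into_vectors[OF n.ideal_axioms A module_hom_closed[OF D e]]) (use An in blast)
  have "?e 0 = (C (B ?e) \<oplus>\<^bsub>?F\<^esub> A (D ?e)) 0" by (rule fun_cong[OF CD[OF e]])
  then have "\<one> = C (B ?e) 0 \<oplus> A (D ?e) 0" by (simp add: basis_vector_def)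
  then show False using n.a_closed[OF 1 2] one_notin by simp
qed

end

theorem corollary1p4:
  fixes S :: "'s ring" and \<nn> :: "'s set" and f :: 's
    and R :: "'s set ring" and M :: "('s set, 'm) module"
  assumes "noetherian_local_ring S \<nn>"
    and "f \<in> \<nn> \<cdot>\<^bsub>S\<^esub> \<nn>"
    and "f \<in> nonzerodivisors S"
    and "R = S Quot (PIdl\<^bsub>S\<^esub> f)"
    and "cohen_macaulay_local_ring R"
    and "krull_dim R = 1"
    and "module R M"
    and "finitely_generated_module R M"
    and "has_rank R M"
  shows "(\<not> is_free_module R M \<and> torsion_free R M \<and>
            proj_dim S (restrict_scalars (\<lambda>s. PIdl\<^bsub>S\<^esub> f +>\<^bsub>S\<^esub> s) M) < \<infinity>
          \<longrightarrow> has_torsion R (tensor_module R M (dual_module R M))) \<and>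
         (\<forall>m \<alpha> \<beta>. reduced_matrix_factorization S \<nn> f m \<alpha> \<beta> \<and>
            module_isomorphic R M (descend_scalars (matrix_cokernel S m \<alpha>))
          \<longrightarrow> has_torsion R (tensor_module R M (dual_module R M)))"
proof -
  interpret S: cring S by (rule noetherian_local_ringD[OF assms(1)])
  have "f \<in> \<nn>"
    using S.ideal_prod_inter[of \<nn> \<nn>] noetherian_local_ringD(4)[OF assms(1)] assms(2) by blast
  then interpret hypersurface S \<nn> f by unfold_locales (use assms in auto)
  show ?thesis
    using finite_proj_dim_has_torsion[of M] reduced_factorization_has_torsion[of M] assms(5-9) unfolding assms(4) by blast
qed

end
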